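(* Let $X_1,\dots,X_m$ be a family of locally Lipschitz vector fields in an open and connected domain $\Omega\subset\mathbb{R}^n$, linearly independent at every point of $\Omega$, such that for every compact set $K\subset\Omega$ $$\inf_{p\in K}\ \inf_{i\in\{1,\dots,m\}}|X_i(p)|>0.$$ Assume also that any two points in $\Omega$ can be connected by a horizontal curve. Then for $k\ge 1$, any measurable set $E\subset\mathbb{R}^k$ and any Lipschitz mapping $f:E\to(\Omega,d_{cc})$ the following conditions are equivalent: (1) $\mathcal{H}^k_{d_{cc}}(f(E))=0$ in $(\Omega,d_{cc})$; (2) $\mathcal{H}^k(f(E))=0$ with respect to the Euclidean metric in $\Omega$; (3) $\operatorname{rank}(\operatorname{ap}Df)<k$ a.e. in $E$.
   Context: For $p\in\Omega$ and $v=\sum_{i=1}^m a_iX_i(p)\in\operatorname{span}\{X_1(p),\dots,X_m(p)\}$ put $|v|_H=\big(\sum_{i=1}^m a_i^2\big)^{1/2}$. An absolutely continuous curve $\gamma:[a,b]\to\Omega$ is horizontal if there are measurable functions $a_i(t)$, $a\le t\le b$, $i=1,\dots,m$, such that $\gamma'(t)=\sum_{i=1}^m a_i(t)X_i(\gamma(t))$ for almost all $t\in[a,b]$. Its horizontal length is $\ell_H(\gamma)=\int_a^b|\gamma'(t)|_H\,dt$. The Carnot–Carathéodory distance $d_{cc}(x,y)$ of $x,y\in\Omega$ is the infimum of horizontal lengths of horizontal curves connecting $x$ and $y$; since any two points can be connected by a horizontal curve, $(\Omega,d_{cc})$ is a metric space. $\mathcal{H}^k_{d_{cc}}$ is the $k$-dimensional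 Hausdorff measure with respect to $d_{cc}$, and $\mathcal{H}^k$ the one with respect to the Euclidean metric. In (3), $f$ is regarded as a mapping from $E\subset\mathbb{R}^k$ into $\mathbb{R}^n$ with the Euclidean metric, and $\operatorname{ap}Df$ is the approximate derivative of this mapping: a measurable function $h:E\to\mathbb{R}$ is approximately differentiable at $x\in E$ if there are a measurable set $E_x\subset E$ and a linear function $L:\mathbb{R}^k\to\mathbb{R}$ such that $x$ is a density point of $E_x$ and $\lim_{E_x\ni y\to x}\frac{h(y)-h(x)-L(y-x)}{|y-x|}=0$; the unique such $L$ is $\operatorname{ap}Dh(x)$, and for maps into $\mathbb{R}^n$ this is understood componentwise. (The approximate derivative of $f$ exists a.e. in $E$.) *)

theory Defs
  imports "HOL-Analysis.Analysis"
begin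

section \<open>Families of vector fields\<close>

text \<open>
  A family of vector fields \<open>X\<^sub>1, \<dots>, X\<^sub>m\<close> is a function \<open>X :: nat \<Rightarrow> real ^ 'n \<Rightarrow> real ^ 'n\<close> of which
  only the indices in \<open>{1..m}\<close> and the points of the domain are used.
\<close>

definition locally_lipschitz_on :: "'a::metric_space set \<Rightarrow> ('a \<Rightarrow> 'b::metric_space) \<Rightarrow> bool" where
  "locally_lipschitz_on S g \<longleftrightarrow> (\<forall>p\<in>S. \<exists>r>0. \<exists>L. L-lipschitz_on (ball p r \<inter> S) g)"

definition lin_indep_family :: "nat \<Rightarrow> (nat \<Rightarrow> 'a::real_vector) \<Rightarrow> bool" where
  "lin_indep_family m v \<longleftrightarrow>
    (\<forall>c :: nat \<Rightarrow> real. (\<Sum>i=1..m. c i *\<^sub>R v i) = 0 \<longrightarrow> (\<forall>i\<in>{1..m}. c i = 0))"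

text \<open>
  The norm \<open>|v|\<^sub>H\<close> of a horizontal vector \<open>v\<close> at \<open>p\<close>. The coefficients are unique when the fields
  are linearly independent at \<open>p\<close>; for \<open>v\<close> outside the span the value is unspecified.
\<close>

definition horizontal_norm ::
  "nat \<Rightarrow> (nat \<Rightarrow> real ^ 'n \<Rightarrow> real ^ 'n) \<Rightarrow> real ^ 'n \<Rightarrow> real ^ 'n \<Rightarrow> real" where
  "horizontal_norm m X p v =
    (THE r. \<exists>c. v = (\<Sum>i=1..m. c i *\<^sub>R X i p) \<and> r = sqrt (\<Sum>i=1..m. (c i)\<^sup>2))"


section \<open>Horizontal curves and the Carnot-Caratheodory distance\<close>

definition abs_continuous_curve :: "real \<Rightarrow> real \<Rightarrow> (real \<Rightarrow> 'a::metric_space) \<Rightarrow> bool" where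
  "abs_continuous_curve a b \<gamma> \<longleftrightarrow>
    (\<forall>\<epsilon>>0. \<exists>\<delta>>0. \<forall>I :: (real \<times> real) set.
       finite I \<and> (\<forall>(u, v)\<in>I. a \<le> u \<and> u \<le> v \<and> v \<le> b) \<and>
       disjoint_family_on (\<lambda>(u, v). {u<..<v}) I \<and> (\<Sum>(u, v)\<in>I. v - u) < \<delta>
       \<longrightarrow> (\<Sum>(u, v)\<in>I. dist (\<gamma> u) (\<gamma> v)) < \<epsilon>)"

definition horizontal_curve ::
  "(real ^ 'n) set \<Rightarrow> nat \<Rightarrow> (nat \<Rightarrow> real ^ 'n \<Rightarrow> real ^ 'n) \<Rightarrow>
   real \<Rightarrow> real \<Rightarrow> (real \<Rightarrow> real ^ 'n) \<Rightarrow> bool" where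
  "horizontal_curve \<Omega> m X a b \<gamma> \<longleftrightarrow>
    a \<le> b \<and> \<gamma> ` {a..b} \<subseteq> \<Omega> \<and> abs_continuous_curve a b \<gamma> \<and>
    (\<exists>c :: nat \<Rightarrow> real \<Rightarrow> real.
       (\<forall>i\<in>{1..m}. c i \<in> borel_measurable (lebesgue_on {a..b})) \<and>
       (AE t in lebesgue_on {a..b}.
          (\<gamma> has_vector_derivative (\<Sum>i=1..m. c i t *\<^sub>R X i (\<gamma> t))) (at t within {a..b})))"

text \<open>
  Lengths and distances take values in \<^typ>\<open>ennreal\<close>, so that no integrability or
  nonemptiness side condition is hidden in a default value.
\<close>

definition horizontal_length ::
  "nat \<Rightarrow> (nat \<Rightarrow> real ^ 'n \<Rightarrow> real ^ 'n) \<Rightarrow> real \<Rightarrow> real \<Rightarrow> (real \<Rightarrow> real ^ 'n) \<Rightarrow> ennreal" where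
  "horizontal_length m X a b \<gamma> =
    (\<integral>\<^sup>+ t. ennreal (horizontal_norm m X (\<gamma> t) (vector_derivative \<gamma> (at t within {a..b})))
       \<partial>lebesgue_on {a..b})"

definition cc_dist ::
  "(real ^ 'n) set \<Rightarrow> nat \<Rightarrow> (nat \<Rightarrow> real ^ 'n \<Rightarrow> real ^ 'n) \<Rightarrow> real ^ 'n \<Rightarrow> real ^ 'n \<Rightarrow> ennreal" where
  "cc_dist \<Omega> m X x y =
    Inf {horizontal_length m X a b \<gamma> | a b \<gamma>. horizontal_curve \<Omega> m X a b \<gamma> \<and> \<gamma> a = x \<and> \<gamma> b = y}"


section \<open>Hausdorff measure\<close>

definition ediameter :: "('a \<Rightarrow> 'a \<Rightarrow> ennreal) \<Rightarrow> 'a set \<Rightarrow> ennreal" where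
  "ediameter d S = (SUP x\<in>S. SUP y\<in>S. d x y)"

text \<open>
  Hausdorff (outer) measure of a subset \<open>A\<close> of a space \<open>M\<close> with distance \<open>d\<close>, for an integer
  dimension \<open>k \<ge> 1\<close> (for \<open>k = 0\<close> empty covering sets would be counted), normalized so that it
  agrees with Lebesgue measure in \<open>k\<close>-dimensional Euclidean space.
\<close>

definition hausdorff_premeasure ::
  "'a set \<Rightarrow> ('a \<Rightarrow> 'a \<Rightarrow> ennreal) \<Rightarrow> nat \<Rightarrow> real \<Rightarrow> 'a set \<Rightarrow> ennreal" where
  "hausdorff_premeasure M d k \<delta> A =
    Inf {(\<Sum>i. ennreal (unit_ball_vol (real k)) * (ediameter d (C i) / 2) ^ k) | C :: nat \<Rightarrow> 'a set.
           A \<subseteq> (\<Union>i. C i) \<and> (\<forall>i. C i \<subseteq> M \<and> ediameter d (C i) \<le> ennreal \<delta>)}"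

definition hausdorff_measure ::
  "'a set \<Rightarrow> ('a \<Rightarrow> 'a \<Rightarrow> ennreal) \<Rightarrow> nat \<Rightarrow> 'a set \<Rightarrow> ennreal" where
  "hausdorff_measure M d k A = (SUP \<delta>\<in>{0<..}. hausdorff_premeasure M d k \<delta> A)"


section \<open>Approximate derivatives\<close>

definition density_point :: "'a::euclidean_space set \<Rightarrow> 'a \<Rightarrow> bool" where
  "density_point S x \<longleftrightarrow>
    ((\<lambda>r. measure lebesgue (S \<inter> ball x r) / measure lebesgue (ball x r)) \<longlongrightarrow> 1) (at_right 0)"

definition has_ap_derivative ::
  "('a::euclidean_space \<Rightarrow> real) \<Rightarrow> ('a \<Rightarrow> real) \<Rightarrow> 'a set \<Rightarrow> 'a \<Rightarrow> bool" where
  "has_ap_derivative h L E x \<longleftrightarrow>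
    x \<in> E \<and> linear L \<and>
    (\<exists>S. S \<in> sets lebesgue \<and> S \<subseteq> E \<and> density_point S x \<and>
       ((\<lambda>y. (h y - h x - L (y - x)) / norm (y - x)) \<longlongrightarrow> 0) (at x within S))"

definition ap_differentiable :: "('a::euclidean_space \<Rightarrow> real ^ 'n) \<Rightarrow> 'a set \<Rightarrow> 'a \<Rightarrow> bool" where
  "ap_differentiable f E x \<longleftrightarrow> (\<forall>j. \<exists>L. has_ap_derivative (\<lambda>y. f y $ j) L E x)"

definition ap_D :: "('a::euclidean_space \<Rightarrow> real ^ 'n) \<Rightarrow> 'a set \<Rightarrow> 'a \<Rightarrow> 'a \<Rightarrow> real ^ 'n" where
  "ap_D f E x = (\<lambda>v. \<chi> j. (THE L. has_ap_derivative (\<lambda>y. f y $ j) L E x) v)"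

end

theory Submission
  imports Defs
begin

text \<open>
  Near a point of \<open>\<Omega>\<close> the Euclidean length of a horizontal vector is comparable to its horizontal
  norm. The bound of the former by the latter makes \<open>d\<^sub>c\<^sub>c\<close> locally dominate a multiple of the Euclidean
  distance, so (1) implies (2), and \<open>f\<close> is locally Lipschitz for the Euclidean metric. By Rademacher's
  theorem \<open>f\<close> is then differentiable almost everywhere relative to \<open>E\<close>, and where the derivative is
  injective \<open>f\<close> is bi-Lipschitz on countably many pieces, so (2) implies (3).

  For (3) implies (1) let the derivative have a kernel at almost every point. On a line parallel to a
  unit vector \<open>v\<close> the map \<open>f\<close> is a \<open>d\<^sub>c\<^sub>c\<close>-Lipschitz curve defined on a closed set; filling the gaps by almost
  shortest curves makes it a Lipschitz curve on an interval, and such a curve is horizontal. Its speed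
  is comparable to its Euclidean speed, so at almost all points where \<open>f\<close> moves slowly along \<open>v\<close> in the
  Euclidean metric it also moves slowly in \<open>d\<^sub>c\<^sub>c\<close>. Small cubes around density points of the set of such
  points can be cut into thin tubes in direction \<open>v\<close> whose images have small diameter, and this
  yields coverings of the image with arbitrarily small sums.
\<close>

section \<open>Density points and Rademacher's theorem\<close>

text \<open>The obstacle is (3) implies (1). In general \<open>d_cc\<close> is not bounded by a
  multiple of the Euclidean distance, so a Euclidean derivative vanishing along \<open>v\<close> at
  one point says nothing about \<open>d_cc\<close> there, and Sard-type arguments do not transfer.
  What transfers is speed: along horizontal curves the two speeds are comparable almost everywhere,
  and \<open>d_cc\<close> is bounded by the integral of the horizontal one. Slowness is therefore
  regained only at almost every point, in integrated form, with density points keeping the fast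
  remainder small. The kernel direction varies with the point, so it is replaced by one from a
  countable dense set, along which the derivative is merely small. A rate \<open>1/n\<close> is
  fixed first: a cube of side \<open>h\<close> is then covered by about \<open>n^(k-1)\<close>
  images of diameter about \<open>h/n\<close>, and the sum of their \<open>k\<close>-th powers is
  about \<open>h^k/n\<close>; only at the end does \<open>n\<close> tend to infinity. Measurability
  shapes the statements: coefficients of the derivative of a curve are found as limits of Borel
  functions, and conditions quantified over a continuum are stated at countably many scales, to make
  Fubini's theorem applicable to the exceptional sets.\<close>

lemma content_ball_split:
  fixes A :: "'a::euclidean_space set"
  assumes "A \<in> sets lebesgue"
  shows "measure lebesgue (ball x r) = measure lebesgue (A \<inter> ball x r) + measure lebesgue (ball x r - A)"
proof -
  have "ball x r \<inter> A \<in> lmeasurable"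
    using assms by (simp add: fmeasurable_Int_fmeasurable)
  then have "measure lebesgue (ball x r - ball x r \<inter> A) = measure lebesgue (ball x r) - measure lebesgue (ball x r \<inter> A)"
    by (intro measurable_measure_Diff) auto
  moreover have "ball x r - ball x r \<inter> A = ball x r - A"
    by auto
  ultimately show ?thesis
    by (simp add: Int_commute)
qed

text \<open>Vitali's covering argument. Each point of the set has a ball inside an open
  \<open>V\<close> around \<open>A\<close> in which the complement of \<open>A\<close> fills more
  than the fraction \<open>q\<close>. Disjoint balls among these have total volume at most
  \<open>1/q\<close> times the measure of \<open>V - A\<close>, their fivefold dilations cover the
  set, and \<open>V - A\<close> can be made arbitrarily small.\<close>

lemma negligible_low_density:
  fixes A :: "'a::euclidean_space set"
  assumes A: "A \<in> sets lebesgue" and "0 < q"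
  shows "negligible {x\<in>A. \<forall>d>0. \<exists>r. 0 < r \<and> r < d \<and>
           q * measure lebesgue (ball x r) < measure lebesgue (ball x r - A)}"
proof -
  let ?\<mu> = "measure lebesgue :: 'a set \<Rightarrow> real"
  define S where "S = {x\<in>A. \<forall>d>0. \<exists>r. 0 < r \<and> r < d \<and> q * ?\<mu> (ball x r) < ?\<mu> (ball x r - A)}"
  have SA: "S \<subseteq> A" and SD: "\<And>x d. x \<in> S \<Longrightarrow> 0 < d \<Longrightarrow> \<exists>r. 0 < r \<and> r < d \<and> q * ?\<mu> (ball x r) < ?\<mu> (ball x r - A)"
    by (auto simp: S_def)
  have "\<exists>T. S \<subseteq> T \<and> T \<in> lmeasurable \<and> ?\<mu> T \<le> e" if "0 < e" for e
  proof -
  \<comment> \<open>Dilating a ball by 5 costs \<open>5 ^ DIM('a)\<close>; passing from a ball to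
    its part outside \<open>A\<close> costs \<open>1 / q\<close>.\<close>
  define c where "c = 5 ^ DIM('a) / q"
  have c: "0 < c" using \<open>0 < q\<close> by (simp add: c_def)
  obtain V where V: "open V" "A \<subseteq> V" "V - A \<in> lmeasurable" "emeasure lebesgue (V - A) < ennreal (e / c)"
    by (rule sets_lebesgue_outer_open[OF A, of "e / c"]) (use \<open>0 < e\<close> c in auto)
  then have mV: "?\<mu> (V - A) \<le> e / c"
    using \<open>0 < e\<close> c by (simp add: emeasure_eq_measure2 ennreal_less_iff)
  define K where "K = {(x, r). x \<in> S \<and> 0 < r \<and> r < 1 \<and> ball x r \<subseteq> V \<and> q * ?\<mu> (ball x r) < ?\<mu> (ball x r - A)}"
  have "S \<subseteq> (\<Union>i\<in>K. ball (fst i) (snd i))"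
  proof
    fix x assume x: "x \<in> S"
    then have "x \<in> V"
      using V SA by auto
    then obtain d where d: "0 < d" "ball x d \<subseteq> V"
      using V openE by blast
    then obtain r where r: "0 < r" "r < min d 1" "q * ?\<mu> (ball x r) < ?\<mu> (ball x r - A)"
      using SD[OF x, of "min d 1"] by auto
    have "ball x r \<subseteq> V"
      using r(2) d(2) subset_ball[of r d x] by auto
    then have "(x, r) \<in> K"
      using x r by (simp add: K_def)
    then show "x \<in> (\<Union>i\<in>K. ball (fst i) (snd i))"
      using r by force
  qed
  then obtain C where C: "countable C" "C \<subseteq> K"
     "pairwise (\<lambda>i j. disjnt (ball (fst i) (snd i)) (ball (fst j) (snd j))) C"
     "S \<subseteq> (\<Union>i\<in>C. ball (fst i) (5 * snd i))"
  proof (rule Vitali_covering_lemma_balls[where S=S and K=K and a=fst and r=snd and B=1])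
    show "0 < snd i \<and> snd i \<le> 1" if "i \<in> K" for i
      using that by (auto simp: K_def)
  qed assumption
  have le: "?\<mu> (\<Union>i\<in>I. ball (fst i) (5 * snd i)) \<le> e" if I: "I \<subseteq> C" "finite I" for I
  proof -
    have "?\<mu> (\<Union>i\<in>I. ball (fst i) (5 * snd i)) \<le> (\<Sum>i\<in>I. ?\<mu> (ball (fst i) (5 * snd i)))"
      using I by (intro measure_UNION_le) auto
    also have "\<dots> \<le> (\<Sum>i\<in>I. c * ?\<mu> (ball (fst i) (snd i) \<inter> (V - A)))"
    proof (rule sum_mono)
      fix i assume "i \<in> I"
      then have i: "i \<in> K" using I C by auto
      have "ball (fst i) (snd i) \<inter> (V - A) = ball (fst i) (snd i) - A"
        using i by (auto simp: K_def)
      then have "q * ?\<mu> (ball (fst i) (snd i)) \<le> ?\<mu> (ball (fst i) (snd i) \<inter> (V - A))"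
        using i by (auto simp: K_def)
      moreover have "?\<mu> (ball (fst i) (5 * snd i)) = 5 ^ DIM('a) * ?\<mu> (ball (fst i) (snd i))"
        using i content_ball_conv_unit_ball[of "5 * snd i" "fst i"] content_ball_conv_unit_ball[of "snd i" "fst i"]
        by (auto simp: K_def power_mult_distrib)
      ultimately show "?\<mu> (ball (fst i) (5 * snd i)) \<le> c * ?\<mu> (ball (fst i) (snd i) \<inter> (V - A))"
        using \<open>0 < q\<close> by (simp add: c_def field_simps)
    qed
    also have "\<dots> = c * ?\<mu> (\<Union>i\<in>I. ball (fst i) (snd i) \<inter> (V - A))"
    proof -
      have "pairwise (\<lambda>i j. disjnt (ball (fst i) (snd i) \<inter> (V - A)) (ball (fst j) (snd j) \<inter> (V - A))) I"
        using C(3) I(1) unfolding pairwise_def disjnt_def by blast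
      then have "?\<mu> (\<Union>i\<in>I. ball (fst i) (snd i) \<inter> (V - A)) = (\<Sum>i\<in>I. ?\<mu> (ball (fst i) (snd i) \<inter> (V - A)))"
        using I V(3) by (intro measure_UNION') (auto intro: fmeasurable.Int)
      then show ?thesis by (simp add: sum_distrib_left)
    qed
    also have "\<dots> \<le> c * ?\<mu> (V - A)"
      using c V(3) I by (intro mult_left_mono measure_mono_fmeasurable) (auto intro!: sets.finite_UN)
    also have "\<dots> \<le> e"
      using mV c by (simp add: field_simps)
    finally show ?thesis .
  qed
  show ?thesis
  proof (intro exI conjI)
    show "S \<subseteq> (\<Union>i\<in>C. ball (fst i) (5 * snd i))" by (rule C(4))
    show "(\<Union>i\<in>C. ball (fst i) (5 * snd i)) \<in> lmeasurable"
      by (rule fmeasurable_UN_bound[OF C(1) _ le]) auto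
    show "?\<mu> (\<Union>i\<in>C. ball (fst i) (5 * snd i)) \<le> e"
      by (rule measure_UN_bound[OF C(1) _ le]) auto
  qed
qed
  then show ?thesis
    unfolding negligible_outer_le S_def[symmetric] by blast
qed

lemma density_pointI:
  fixes A :: "'a::euclidean_space set"
  assumes A: "A \<in> sets lebesgue"
    and lim: "\<And>q. 0 < q \<Longrightarrow> \<exists>d>0. \<forall>r. 0 < r \<longrightarrow> r < d \<longrightarrow>
               measure lebesgue (ball x r - A) \<le> q * measure lebesgue (ball x r)"
  shows "density_point A x"
  unfolding density_point_def
proof (rule tendstoI)
  fix e :: real assume "0 < e"
  then obtain d where d: "d > 0" "\<And>r. 0 < r \<Longrightarrow> r < d \<Longrightarrow>
      measure lebesgue (ball x r - A) \<le> e/2 * measure lebesgue (ball x r)"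
    using lim[of "e/2"] by auto
  show "\<forall>\<^sub>F r in at_right 0. dist (measure lebesgue (A \<inter> ball x r) / measure lebesgue (ball x r)) 1 < e"
    unfolding eventually_at_right_field
  proof (intro exI[of _ d] conjI allI impI)
    fix r assume r: "0 < r" "r < d"
    have pos: "0 < measure lebesgue (ball x r)"
      using r content_ball_pos[of r x] by simp
    have "dist (measure lebesgue (A \<inter> ball x r) / measure lebesgue (ball x r)) 1
        = measure lebesgue (ball x r - A) / measure lebesgue (ball x r)"
      using pos by (simp add: dist_real_def content_ball_split[OF A, of x r] divide_simps)
    also have "\<dots> \<le> e/2"
      using d(2)[OF r] pos by (simp add: field_simps)
    finally show "dist (measure lebesgue (A \<inter> ball x r) / measure lebesgue (ball x r)) 1 < e"
      using \<open>0 < e\<close> by simp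
  qed (use d in auto)
qed

text \<open>Lebesgue's density theorem. Failure of density at \<open>x\<close> is failure for some
  \<open>q\<close> of the form \<open>1 / Suc n\<close>, so countably many sets of low density
  suffice.\<close>

theorem negligible_not_density_point:
  fixes A :: "'a::euclidean_space set"
  assumes A: "A \<in> sets lebesgue"
  shows "negligible {x\<in>A. \<not> density_point A x}"
proof (rule negligible_subset)
  let ?N = "\<lambda>q. {x\<in>A. \<forall>d>0. \<exists>r. 0 < r \<and> r < d \<and>
           q * measure lebesgue (ball x r) < measure lebesgue (ball x r - A)}"
  show "negligible (\<Union>n. ?N (inverse (real (Suc n))))"
    using negligible_low_density[OF A] by (intro negligible_Union_nat) auto
  show "{x\<in>A. \<not> density_point A x} \<subseteq> (\<Union>n. ?N (inverse (real (Suc n))))"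
  proof safe
    fix x assume "x \<in> A" "\<not> density_point A x"
    then obtain q where q: "q > 0" "\<not> (\<exists>d>0. \<forall>r. 0 < r \<longrightarrow> r < d \<longrightarrow>
               measure lebesgue (ball x r - A) \<le> q * measure lebesgue (ball x r))"
      using density_pointI[OF A] by blast
    obtain n where n: "inverse (real (Suc n)) < q"
      using reals_Archimedean[OF q(1)] by blast
    have "x \<in> ?N (inverse (real (Suc n)))"
    proof (intro CollectI conjI allI impI)
      fix d :: real assume "d > 0"
      with q(2) obtain r where "0 < r" "r < d" "q * measure lebesgue (ball x r) < measure lebesgue (ball x r - A)"
        by (meson not_le)
      moreover have "inverse (real (Suc n)) * measure lebesgue (ball x r) \<le> q * measure lebesgue (ball x r)"
        using n by (intro mult_right_mono) auto
      ultimately show "\<exists>r. 0 < r \<and> r < d \<and> inverse (real (Suc n)) * measure lebesgue (ball x r) < measure lebesgue (ball x r - A)"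
        by (intro exI[of _ r]) linarith
    qed (use \<open>x \<in> A\<close> in auto)
    then show "x \<in> (\<Union>n. ?N (inverse (real (Suc n))))" by blast
  qed
qed

lemma density_pointD:
  fixes A :: "'a::euclidean_space set"
  assumes A: "A \<in> sets lebesgue" and x: "density_point A x" and "0 < q"
  obtains d where "d > 0" "\<And>r. 0 < r \<Longrightarrow> r < d \<Longrightarrow>
               measure lebesgue (ball x r - A) \<le> q * measure lebesgue (ball x r)"
proof -
  have "\<forall>\<^sub>F r in at_right 0. dist (measure lebesgue (A \<inter> ball x r) / measure lebesgue (ball x r)) 1 < q"
    using x \<open>0 < q\<close> unfolding density_point_def by (rule tendstoD)
  then obtain d where d: "d > 0" "\<And>r. 0 < r \<Longrightarrow> r < d \<Longrightarrow>
     dist (measure lebesgue (A \<inter> ball x r) / measure lebesgue (ball x r)) 1 < q"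
    unfolding eventually_at_right_field by auto
  show thesis
  proof (rule that[OF d(1)])
    fix r assume r: "0 < r" "r < d"
    have pos: "0 < measure lebesgue (ball x r)"
      using r content_ball_pos[of r x] by simp
    have "1 - measure lebesgue (A \<inter> ball x r) / measure lebesgue (ball x r) < q"
      using d(2)[OF r] by (simp add: dist_real_def)
    then have "measure lebesgue (ball x r) - measure lebesgue (A \<inter> ball x r) < q * measure lebesgue (ball x r)"
      using pos by (simp add: field_simps)
    then show "measure lebesgue (ball x r - A) \<le> q * measure lebesgue (ball x r)"
      using content_ball_split[OF A, of x r] by linarith
  qed
qed

text \<open>The form in which density is mostly used: a point \<open>y\<close> near \<open>x\<close>
  may be replaced by a point of \<open>A\<close> at an error small relative to
  \<open>dist y x\<close>. Otherwise a ball around \<open>y\<close> would be a hole in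
  \<open>A\<close> too large for a density point.\<close>

lemma density_point_near:
  fixes A :: "'a::euclidean_space set"
  assumes A: "A \<in> sets lebesgue" and x: "density_point A x" and "0 < \<eta>" "\<eta> \<le> 1"
  obtains d where "d > 0" "\<And>y. dist y x < d \<Longrightarrow> y \<noteq> x \<Longrightarrow> \<exists>z\<in>A. dist z y < \<eta> * dist y x"
proof -
  let ?\<mu> = "measure lebesgue :: 'a set \<Rightarrow> real"
  \<comment> \<open>Half of the volume ratio between the hole of radius \<open>\<eta> * ?r\<close>
    around \<open>y\<close> and the surrounding \<open>ball x (2 * ?r)\<close>, so that the hole
    cannot fit.\<close>
  define q where "q = (\<eta> / 2) ^ DIM('a) / 2"
  have "q > 0" using assms by (simp add: q_def)
  then obtain d where d: "d > 0" "\<And>r. 0 < r \<Longrightarrow> r < d \<Longrightarrow> ?\<mu> (ball x r - A) \<le> q * ?\<mu> (ball x r)"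
    by (rule density_pointD[OF A x]) (blast intro: that)
  show thesis
  proof (rule that[of "d/2"])
    fix y assume y: "dist y x < d / 2" "y \<noteq> x"
    let ?r = "dist y x"
    have r: "0 < ?r" using y by simp
    show "\<exists>z\<in>A. dist z y < \<eta> * dist y x"
    proof (rule ccontr)
      assume "\<not> ?thesis"
      then have sub: "ball y (\<eta> * ?r) \<subseteq> ball x (2 * ?r) - A"
      proof (intro subsetI DiffI)
        fix z assume z: "z \<in> ball y (\<eta> * ?r)"
        have "\<eta> * ?r \<le> 1 * ?r" using \<open>\<eta> \<le> 1\<close> by (intro mult_right_mono) auto
        then have "dist x z < 2 * ?r"
          using z dist_triangle[of x z y] by (simp add: dist_commute)
        then show "z \<in> ball x (2 * ?r)" by simp
      qed (auto simp: dist_commute)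
      have "?\<mu> (ball y (\<eta> * ?r)) \<le> ?\<mu> (ball x (2 * ?r) - A)"
        using sub A by (intro measure_mono_fmeasurable) (auto intro: fmeasurable_Diff)
      also have "\<dots> \<le> q * ?\<mu> (ball x (2 * ?r))"
        using d(2)[of "2 * ?r"] y by auto
      finally have "(\<eta> * ?r) ^ DIM('a) * ?\<mu> (ball (0::'a) 1) \<le> q * ((2 * ?r) ^ DIM('a) * ?\<mu> (ball (0::'a) 1))"
        using content_ball_conv_unit_ball[of "\<eta> * ?r" y] content_ball_conv_unit_ball[of "2 * ?r" x] assms(3)
        by simp
      then have "(\<eta> * ?r) ^ DIM('a) \<le> q * (2 * ?r) ^ DIM('a)"
        using content_ball_pos[of 1 "0::'a"] by (simp add: mult.assoc[symmetric])
      also have "\<dots> = (\<eta> * ?r) ^ DIM('a) / 2"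
        by (simp add: q_def power_mult_distrib power_divide)
      finally have "(\<eta> * ?r) ^ DIM('a) \<le> 0" by simp
      moreover have "0 < (\<eta> * ?r) ^ DIM('a)"
        using r assms(3) by (intro zero_less_power mult_pos_pos)
      ultimately show False by linarith
    qed
  qed (use d in auto)
qed

section \<open>Reduction to lines and Rademacher's theorem\<close>

text \<open>Fubini's theorem without coordinates adapted to \<open>v\<close>: the indicator of
  \<open>x + t v\<close> lying in the set is integrated over all \<open>x\<close> and over
  \<open>t\<close> in \<open>{0..1}\<close>. Integrating in \<open>t\<close> first gives 0 by
  hypothesis; integrating in \<open>x\<close> first gives the measure of the set, by translation
  invariance.\<close>

lemma negligible_if_negligible_on_lines:
  fixes N :: "'a::euclidean_space set" and v :: 'a
  assumes N: "N \<in> sets lebesgue" and lines: "\<And>x. negligible {t::real. x + t *\<^sub>R v \<in> N}"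
  shows "negligible N"
proof -
  \<comment> \<open>A Borel set carrying \<open>N\<close> up to a null set; the indicator has to be
    jointly Borel measurable in \<open>x\<close> and \<open>t\<close>.\<close>
  obtain B N' where B: "B \<in> sets borel" "negligible N'" "B \<union> N' = N"
    using sets_lebesgue_almost_borel[OF N] by metis
  note B(1)[measurable]
  have line0: "(\<integral>\<^sup>+t. indicator {0..1::real} t * indicator B (x + t *\<^sub>R v) \<partial>lborel) = 0" for x
  proof -
    have "{t::real. x + t *\<^sub>R v \<in> B} \<in> sets borel"
      by measurable
    moreover have "negligible {t::real. x + t *\<^sub>R v \<in> B}"
      by (rule negligible_subset[OF lines[of x]]) (use B in auto)
    ultimately have "{t::real. x + t *\<^sub>R v \<in> B} \<in> null_sets lborel"
      by (simp add: negligible_iff_null_sets null_sets_completion_iff)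
    then have "AE t in lborel. x + t *\<^sub>R v \<notin> B"
      by (simp add: AE_not_in[of "{t. x + t *\<^sub>R v \<in> B}", simplified])
    then have "AE t in lborel. indicator {0..1::real} t * indicator B (x + t *\<^sub>R v) = (0::ennreal)"
      by eventually_elim simp
    then show ?thesis
      by (subst nn_integral_0_iff_AE) auto
  qed
  have "0 = (\<integral>\<^sup>+x. (\<integral>\<^sup>+t. indicator {0..1::real} t * indicator B (x + t *\<^sub>R v) \<partial>lborel) \<partial>(lborel :: 'a measure))"
    by (simp add: line0)
  also have "\<dots> = (\<integral>\<^sup>+t. (\<integral>\<^sup>+x. indicator {0..1::real} t * indicator B (x + t *\<^sub>R v) \<partial>(lborel :: 'a measure)) \<partial>lborel)"
    by (rule lborel_pair.Fubini'[symmetric]) measurable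
  also have "\<dots> = (\<integral>\<^sup>+t. indicator {0..1::real} t * emeasure lborel B \<partial>lborel)"
  proof (rule nn_integral_cong)
    fix t :: real
    have "(\<integral>\<^sup>+x. indicator B (x + t *\<^sub>R v) \<partial>(lborel :: 'a measure))
        = (\<integral>\<^sup>+x. indicator B x \<partial>(distr lborel borel ((+) (t *\<^sub>R v))))"
      by (subst nn_integral_distr) (auto simp: add.commute)
    also have "\<dots> = emeasure lborel B"
      by (simp add: lborel_distr_plus)
    finally show "(\<integral>\<^sup>+x. indicator {0..1::real} t * indicator B (x + t *\<^sub>R v) \<partial>(lborel :: 'a measure))
        = indicator {0..1::real} t * emeasure lborel B"
      by (subst nn_integral_cmult) auto
  qed
  also have "\<dots> = emeasure lborel B"
    by (subst nn_integral_multc) auto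
  finally have "B \<in> null_sets lborel"
    by auto
  then have "negligible B"
    by (simp add: negligible_iff_null_sets null_sets_completionI)
  with B show ?thesis by (metis negligible_Un)
qed

text \<open>The values of \<open>h\<close> are cut into slabs of height \<open>1 / Suc n\<close>.
  Almost every point is a density point of each slab set containing it: on this set \<open>h\<close>
  is within \<open>e / 2\<close> of \<open>h x\<close>, and the rest of a short interval has small
  measure while \<open>h\<close> is bounded.\<close>

lemma lebesgue_differentiation_bounded:
  fixes h :: "real \<Rightarrow> real"
  assumes [measurable]: "h \<in> borel_measurable borel" and bd: "\<And>x. \<bar>h x\<bar> \<le> M"
  shows "negligible {x. \<not> (\<forall>e>0. \<exists>d>0. \<forall>a b. a \<le> x \<longrightarrow> x \<le> b \<longrightarrow> a < b \<longrightarrow> b - a < d \<longrightarrow>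
            (\<integral>\<^sup>+y. ennreal \<bar>h y - h x\<bar> * indicator {a..b} y \<partial>lborel) \<le> ennreal (e * (b - a)))}"
proof -
  have M: "M \<ge> 0" using bd[of 0] by simp
  define H where "H n j = {y. real_of_int j \<le> real (Suc n) * h y \<and> real (Suc n) * h y < real_of_int j + 1}" for n :: nat and j :: int
  have H[measurable]: "H n j \<in> sets borel" for n j
    unfolding H_def by measurable
  have Hl: "H n j \<in> sets lebesgue" for n j
    using H[of n j] by simp
  have neg: "negligible (\<Union>n. \<Union>j. {x \<in> H n j. \<not> density_point (H n j) x})"
    by (intro negligible_countable_Union) (auto intro!: negligible_not_density_point Hl negligible_countable_Union)
  show ?thesis
  proof (rule negligible_subset[OF neg], rule subsetI, rule ccontr)
    fix x
    assume bad: "x \<in> {x. \<not> (\<forall>e>0. \<exists>d>0. \<forall>a b. a \<le> x \<longrightarrow> x \<le> b \<longrightarrow> a < b \<longrightarrow> b - a < d \<longrightarrow>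
            (\<integral>\<^sup>+y. ennreal \<bar>h y - h x\<bar> * indicator {a..b} y \<partial>lborel) \<le> ennreal (e * (b - a)))}"
      and notin: "x \<notin> (\<Union>n. \<Union>j. {x \<in> H n j. \<not> density_point (H n j) x})"
    have "\<exists>d>0. \<forall>a b. a \<le> x \<longrightarrow> x \<le> b \<longrightarrow> a < b \<longrightarrow> b - a < d \<longrightarrow>
            (\<integral>\<^sup>+y. ennreal \<bar>h y - h x\<bar> * indicator {a..b} y \<partial>lborel) \<le> ennreal (e * (b - a))" if "e > 0" for e
    proof -
      obtain n where n: "inverse (real (Suc n)) < e / 2"
        using reals_Archimedean[of "e/2"] \<open>e > 0\<close> by auto
      define j where "j = \<lfloor>real (Suc n) * h x\<rfloor>"
      have xH: "x \<in> H n j"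
        unfolding H_def j_def by (auto simp del: of_nat_Suc)
      then have dens: "density_point (H n j) x"
        using notin by blast
      have close: "\<bar>h y - h x\<bar> \<le> e / 2" if "y \<in> H n j" for y
      proof -
        have "\<bar>real (Suc n) * h y - real (Suc n) * h x\<bar> \<le> 1"
          using that xH unfolding H_def by (auto simp del: of_nat_Suc)
        then have "real (Suc n) * \<bar>h y - h x\<bar> \<le> 1"
          by (simp add: abs_mult right_diff_distrib[symmetric] del: of_nat_Suc)
        then have "\<bar>h y - h x\<bar> \<le> inverse (real (Suc n))"
          by (simp add: field_simps del: of_nat_Suc)
        with n show ?thesis by linarith
      qed
      \<comment> \<open>The interval lies in a ball of length \<open>4 * (b - a)\<close> and
        \<open>h\<close> varies by at most \<open>2 * M\<close>, so the part outside the slab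
        contributes at most \<open>2 * M * q * 4 * (b - a)\<close>, which is at most
        \<open>e / 2 * (b - a)\<close>.\<close>
      define q where "q = e / (16 * (M + 1))"
      have "q > 0" using \<open>e > 0\<close> M by (simp add: q_def)
      obtain d where d: "d > 0" "\<And>r. 0 < r \<Longrightarrow> r < d \<Longrightarrow>
               measure lebesgue (ball x r - H n j) \<le> q * measure lebesgue (ball x r)"
        using density_pointD[OF Hl dens \<open>q > 0\<close>] by blast
      show ?thesis
      proof (intro exI[of _ "d/2"] conjI allI impI)
        fix a b assume ab: "a \<le> x" "x \<le> b" "a < b" "b - a < d / 2"
        let ?r = "2 * (b - a)"
        define B where "B = ball x ?r - H n j"
        have B[measurable]: "B \<in> sets borel" by (simp add: B_def)
        have fin: "emeasure lborel B = ennreal (measure lebesgue B)"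
        proof -
          have "B \<in> lmeasurable"
            using Hl unfolding B_def by (intro fmeasurable_Diff) auto
          then have "emeasure lebesgue B = ennreal (measure lebesgue B)"
            by (rule emeasure_eq_measure2)
          then show ?thesis by simp
        qed
        have "measure lebesgue B \<le> q * measure lebesgue (ball x ?r)"
          using ab unfolding B_def by (intro d(2)) auto
        also have "measure lebesgue (ball x ?r) = 4 * (b - a)"
          using ab by (simp add: ball_eq_greaterThanLessThan)
        finally have mB: "measure lebesgue B \<le> q * (4 * (b - a))" .
        have "(\<integral>\<^sup>+y. ennreal \<bar>h y - h x\<bar> * indicator {a..b} y \<partial>lborel)
           \<le> (\<integral>\<^sup>+y. ennreal (e/2) * indicator {a..b} y + ennreal (2 * M) * indicator B y \<partial>lborel)"
        proof (rule nn_integral_mono)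
          fix y
          show "ennreal \<bar>h y - h x\<bar> * indicator {a..b} y
             \<le> ennreal (e/2) * indicator {a..b} y + ennreal (2 * M) * indicator B y"
          proof (cases "y \<in> {a..b}")
            case True
            show ?thesis
            proof (cases "y \<in> H n j")
              case True
              with close[OF True] show ?thesis
                by (auto simp: indicator_def B_def intro: ennreal_leI)
            next
              case False
              have "y \<in> ball x ?r" using ab \<open>y \<in> {a..b}\<close> by (auto simp: dist_real_def)
              moreover have "\<bar>h y - h x\<bar> \<le> 2 * M" using bd[of y] bd[of x] by linarith
              then have "ennreal \<bar>h y - h x\<bar> \<le> ennreal (2 * M)" by (rule ennreal_leI)
              then have "ennreal \<bar>h y - h x\<bar> \<le> ennreal (e/2) + ennreal (2 * M)"
                by (rule order_trans) simp
              ultimately show ?thesis using False \<open>y \<in> {a..b}\<close> by (simp add: B_def)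
            qed
          qed simp
        qed
        also have "\<dots> = ennreal (e/2) * ennreal (b - a) + ennreal (2 * M) * ennreal (measure lebesgue B)"
          using ab by (subst nn_integral_add) (auto simp: nn_integral_cmult_indicator fin)
        also have "\<dots> = ennreal (e/2 * (b - a) + 2 * M * measure lebesgue B)"
          using ab M \<open>e > 0\<close> by (simp add: ennreal_mult[symmetric] ennreal_plus[symmetric] del: ennreal_plus)
        also have "\<dots> \<le> ennreal (e * (b - a))"
        proof (rule ennreal_leI)
          have "2 * M * measure lebesgue B \<le> 2 * M * (q * (4 * (b - a)))"
            using mB M by (intro mult_left_mono) auto
          also have "\<dots> = (M / (M + 1)) * (e / 2 * (b - a))"
            using M by (simp add: q_def field_simps)
          also have "\<dots> \<le> 1 * (e / 2 * (b - a))"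
            using M ab \<open>e > 0\<close> by (intro mult_right_mono) auto
          finally show "e/2 * (b - a) + 2 * M * measure lebesgue B \<le> e * (b - a)"
            by (simp add: field_simps)
        qed
        finally show "(\<integral>\<^sup>+y. ennreal \<bar>h y - h x\<bar> * indicator {a..b} y \<partial>lborel) \<le> ennreal (e * (b - a))" .
      qed (use d in auto)
    qed
    then show False using bad by blast
  qed
qed

text \<open>The Lebesgue measure of the image under the increasing function \<open>f x + (L + 1) * x\<close> has a bounded density,
  to which Lebesgue's differentiation theorem applies.\<close>

theorem lipschitz_real_ae_differentiable:
  fixes f :: "real \<Rightarrow> real"
  assumes lip: "L-lipschitz_on UNIV f"
  shows "negligible {x. \<not> f differentiable (at x)}"
proof -
  have L: "L \<ge> 0" using lip by (rule lipschitz_on_nonneg)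
  \<comment> \<open>The slope \<open>L + 1\<close> rather than \<open>L\<close> makes
    \<open>g\<close> expanding and not only increasing, so that its inverse \<open>k\<close> is
    1-Lipschitz.\<close>
  define g where "g x = f x + (L + 1) * x" for x
  define M where "M = 2 * L + 1"
  have M: "M > 0" using L by (simp add: M_def)
  have fl: "\<bar>f y - f x\<bar> \<le> L * \<bar>y - x\<bar>" for x y
    using lipschitz_onD[OF lip, of y x] by (simp add: dist_real_def)
  have glow: "y - x \<le> g y - g x" if "x \<le> y" for x y
    using fl[of y x] that by (simp add: g_def algebra_simps abs_if split: if_splits)
  have gup: "g y - g x \<le> M * (y - x)" if "x \<le> y" for x y
    using fl[of y x] that by (simp add: g_def M_def algebra_simps abs_if split: if_splits)
  have gle: "g x \<le> g y \<longleftrightarrow> x \<le> y" for x y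
    using glow[of x y] glow[of y x] by linarith
  have contg: "continuous_on UNIV g"
    unfolding g_def using lipschitz_on_continuous_on[OF lip] by (intro continuous_intros)
  have "\<exists>x. g x = z" for z
  proof -
    define c where "c = \<bar>z - g 0\<bar>"
    have "g (- c) \<le> z" "z \<le> g c" "- c \<le> c"
      using glow[of "-c" 0] glow[of 0 c] by (auto simp: c_def)
    then show ?thesis
      using IVT'[of g "-c" z c] continuous_on_subset[OF contg] by blast
  qed
  then have surj: "surj g" by (metis surjI)
  have inj: "inj g"
    using gle by (metis injI order_antisym order_refl)
  define k where "k = inv g"
  have gk[simp]: "g (k z) = z" and kg[simp]: "k (g x) = x" for x z
    using surj inj by (auto simp: k_def surj_f_inv_f inv_f_f)
  have klip: "\<bar>k y - k x\<bar> \<le> \<bar>y - x\<bar>" for x y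
    using glow[of "k x" "k y"] glow[of "k y" "k x"] by simp linarith
  have "1-lipschitz_on UNIV k"
    by (rule lipschitz_onI) (auto simp: dist_real_def klip)
  then have "continuous_on UNIV k" by (rule lipschitz_on_continuous_on)
  then have [measurable]: "k \<in> borel_measurable borel"
    by (rule borel_measurable_continuous_onI)
  have vim: "k -` A = g ` A" for A
    by (metis (no_types, lifting) gk kg image_iff subsetI subset_antisym vimageE vimageI)
  \<comment> \<open>The push-forward under the inverse gives a set the Lebesgue measure of its image
    under \<open>g\<close>. It is absolutely continuous because the Lipschitz map \<open>g\<close>
    preserves null sets.\<close>
  define \<mu> where "\<mu> = distr lborel borel k"
  have em: "emeasure \<mu> {a..b} = ennreal (g b - g a)" if "a \<le> b" for a b
  proof -
    have "k -` {a..b} = {g a..g b}"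
      using gle[of a "k z" for z] gle[of "k z" b for z] by auto
    then show ?thesis
      using that gle by (simp add: \<mu>_def emeasure_distr)
  qed
  have "absolutely_continuous lborel \<mu>"
    unfolding absolutely_continuous_def
  proof
    fix A :: "real set" assume A: "A \<in> null_sets lborel"
    then have "negligible A"
      by (simp add: negligible_iff_null_sets null_sets_completionI)
    then have "negligible (g ` A)"
    proof (rule negligible_locally_Lipschitz_image[rotated])
      fix x assume "x \<in> A"
      have "norm (g y - g x) \<le> M * norm (y - x)" for y
        using gup[of x y] gup[of y x] gle[of x y] gle[of y x] by (cases "x \<le> y") auto
      then show "\<exists>T B. open T \<and> x \<in> T \<and> (\<forall>y\<in>A \<inter> T. norm (g y - g x) \<le> B * norm (y - x))"
        by (intro exI[of _ UNIV] exI[of _ M]) auto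
    qed simp
    moreover have "k -` A \<in> sets borel"
      using A measurable_sets[of k borel borel A] by auto
    ultimately have "emeasure lborel (k -` A) = 0"
      by (simp add: vim negligible_iff_null_sets null_sets_completion_iff null_sets_def)
    then show "A \<in> null_sets \<mu>"
      using A by (auto simp: \<mu>_def null_sets_def emeasure_distr)
  qed
  moreover have "sets \<mu> = sets lborel" by (simp add: \<mu>_def)
  ultimately obtain h where h[measurable]: "h \<in> borel_measurable borel" and dens: "density lborel h = \<mu>"
    using sigma_finite_measure.Radon_Nikodym[OF lborel.sigma_finite_measure_axioms, of \<mu>] by auto
  have hI: "(\<integral>\<^sup>+x. h x * indicator {a..b} x \<partial>lborel) = ennreal (g b - g a)" if "a \<le> b" for a b
    using em[OF that] unfolding dens[symmetric] by (simp add: emeasure_density)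
  \<comment> \<open>The Radon-Nikodym density is determined only up to null sets and may take the
    value infinity. At a density point of \<open>Bad\<close> its mean over short intervals would
    exceed the slope bound \<open>M\<close> of \<open>g\<close>, so \<open>Bad\<close> is
    null.\<close>
  define Bad where "Bad = {x. ennreal (M + 1) \<le> h x}"
  have Bad[measurable]: "Bad \<in> sets borel"
    unfolding Bad_def by measurable
  have negBad: "negligible Bad"
  proof (rule negligible_subset[OF negligible_not_density_point[of Bad]])
    show "Bad \<in> sets lebesgue" using Bad by simp
    show "Bad \<subseteq> {x \<in> Bad. \<not> density_point Bad x}"
    proof safe
      fix x assume "density_point Bad x"
      \<comment> \<open>Chosen so that \<open>(M + 1) * (1 - q) = M + 1/2\<close>, still above
        \<open>M\<close>.\<close>
      define q where "q = 1 / (2 * (M + 1))"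
      have "q > 0" using M by (simp add: q_def)
      have Badl: "Bad \<in> sets lebesgue" using Bad by simp
      obtain d where d: "d > 0" "\<And>r. 0 < r \<Longrightarrow> r < d \<Longrightarrow>
               measure lebesgue (ball x r - Bad) \<le> q * measure lebesgue (ball x r)"
        using density_pointD[OF Badl \<open>density_point Bad x\<close> \<open>q > 0\<close>] by blast
      define r where "r = d / 2"
      have r: "0 < r" "r < d" using d by (auto simp: r_def)
      have mb: "measure lebesgue (ball x r) = 2 * r"
        using r by (simp add: ball_eq_greaterThanLessThan)
      have "Bad \<inter> ball x r \<in> lmeasurable"
        using Badl by (intro fmeasurable_Int_fmeasurable[of "ball x r" _ Bad, unfolded Int_commute[of "ball x r"]]) auto
      then have e1: "emeasure lborel (Bad \<inter> ball x r) = ennreal (measure lebesgue (Bad \<inter> ball x r))"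
        using emeasure_eq_measure2[of "Bad \<inter> ball x r" lebesgue] by simp
      have "ennreal ((M + 1) * measure lebesgue (Bad \<inter> ball x r))
          = (\<integral>\<^sup>+x'. ennreal (M + 1) * indicator (Bad \<inter> ball x r) x' \<partial>lborel)"
        using M by (simp add: nn_integral_cmult_indicator e1 ennreal_mult)
      also have "\<dots> \<le> (\<integral>\<^sup>+x'. h x' * indicator {x - r..x + r} x' \<partial>lborel)"
        by (intro nn_integral_mono) (auto simp: indicator_def Bad_def dist_real_def)
      also have "\<dots> = ennreal (g (x + r) - g (x - r))"
        using r by (intro hI) auto
      also have "\<dots> \<le> ennreal (M * (2 * r))"
        using gup[of "x - r" "x + r"] r by (intro ennreal_leI) auto
      finally have "(M + 1) * measure lebesgue (Bad \<inter> ball x r) \<le> M * (2 * r)"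
        using M r by (subst (asm) ennreal_le_iff) auto
      moreover have "measure lebesgue (Bad \<inter> ball x r) \<ge> (1 - q) * (2 * r)"
        using d(2)[OF r] content_ball_split[OF Badl, of x r] mb by (simp add: algebra_simps)
      then have "(M + 1) * ((1 - q) * (2 * r)) \<le> (M + 1) * measure lebesgue (Bad \<inter> ball x r)"
        using M by (intro mult_left_mono) auto
      ultimately have "(M + 1) * ((1 - q) * (2 * r)) \<le> M * (2 * r)" by linarith
      moreover have "(M + 1) * ((1 - q) * (2 * r)) = (M + 1/2) * (2 * r)"
        using M by (simp add: q_def field_simps)
      ultimately show False using r by (simp add: algebra_simps)
    qed
  qed
  \<comment> \<open>A real-valued version bounded everywhere, as
    \<open>lebesgue_differentiation_bounded\<close> requires; it agrees with \<open>h\<close> off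
    \<open>Bad\<close>.\<close>
  define hr where "hr x = enn2real (min (h x) (ennreal (M + 1)))" for x
  have hrm[measurable]: "hr \<in> borel_measurable borel" unfolding hr_def by measurable
  have minlt: "min (h x) (ennreal (M + 1)) < top" for x
    by (simp add: min_less_iff_disj)
  have hrb: "\<bar>hr x\<bar> \<le> M + 1" and hr0: "0 \<le> hr x" for x
    using M minlt[of x] by (auto simp: hr_def intro!: enn2real_leI)
  have "AE x in lborel. x \<notin> Bad"
    using negBad Bad by (intro AE_not_in) (simp add: negligible_iff_null_sets null_sets_completion_iff)
  then have "AE x in lborel. h x = ennreal (hr x)"
    by eventually_elim (use minlt in \<open>auto simp: Bad_def hr_def min_def\<close>)
  then have hrI: "(\<integral>\<^sup>+x. ennreal (hr x) * indicator {a..b} x \<partial>lborel) = ennreal (g b - g a)" if "a \<le> b" for a b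
    unfolding hI[OF that, symmetric] by (intro nn_integral_cong_AE) auto
  note neg = lebesgue_differentiation_bounded[OF hrm hrb]
  show ?thesis
  proof (rule negligible_subset[OF neg], rule subsetI, rule ccontr)
    fix x assume "x \<in> {x. \<not> f differentiable at x}"
      and "x \<notin> {x. \<not> (\<forall>e>0. \<exists>d>0. \<forall>a b. a \<le> x \<longrightarrow> x \<le> b \<longrightarrow> a < b \<longrightarrow> b - a < d \<longrightarrow>
            (\<integral>\<^sup>+y. ennreal \<bar>hr y - hr x\<bar> * indicator {a..b} y \<partial>lborel) \<le> ennreal (e * (b - a)))}"
    then have nd: "\<not> f differentiable at x" and
      ld: "\<And>e. e > 0 \<Longrightarrow> \<exists>d>0. \<forall>a b. a \<le> x \<longrightarrow> x \<le> b \<longrightarrow> a < b \<longrightarrow> b - a < d \<longrightarrow>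
            (\<integral>\<^sup>+y. ennreal \<bar>hr y - hr x\<bar> * indicator {a..b} y \<partial>lborel) \<le> ennreal (e * (b - a))"
      by blast+
    have key: "\<bar>g b - g a - hr x * (b - a)\<bar> \<le> e * (b - a)"
      if ab: "a \<le> x" "x \<le> b" "a < b" and "e > 0"
        and le: "(\<integral>\<^sup>+y. ennreal \<bar>hr y - hr x\<bar> * indicator {a..b} y \<partial>lborel) \<le> ennreal (e * (b - a))" for a b e
    proof -
      have gab: "0 \<le> g b - g a" using gle ab by simp
      have c: "(\<integral>\<^sup>+y. ennreal (hr x) * indicator {a..b} y \<partial>lborel) = ennreal (hr x * (b - a))"
        using ab hr0 by (simp add: nn_integral_cmult_indicator ennreal_mult)
      have "ennreal (g b - g a) = (\<integral>\<^sup>+y. ennreal (hr y) * indicator {a..b} y \<partial>lborel)"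
        using hrI ab by simp
      also have "\<dots> \<le> (\<integral>\<^sup>+y. ennreal (hr x) * indicator {a..b} y + ennreal \<bar>hr y - hr x\<bar> * indicator {a..b} y \<partial>lborel)"
        using hr0 by (intro nn_integral_mono) (auto simp: indicator_def ennreal_plus[symmetric] simp del: ennreal_plus intro!: ennreal_leI)
      also have "\<dots> = ennreal (hr x * (b - a)) + (\<integral>\<^sup>+y. ennreal \<bar>hr y - hr x\<bar> * indicator {a..b} y \<partial>lborel)"
        by (subst nn_integral_add) (auto simp: c)
      also have "\<dots> \<le> ennreal (hr x * (b - a)) + ennreal (e * (b - a))"
        using le by (intro add_left_mono)
      finally have 1: "g b - g a \<le> hr x * (b - a) + e * (b - a)"
        using ab \<open>e > 0\<close> hr0[of x] by (simp add: ennreal_plus[symmetric] del: ennreal_plus)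
      have "ennreal (hr x * (b - a)) = (\<integral>\<^sup>+y. ennreal (hr x) * indicator {a..b} y \<partial>lborel)"
        using c by simp
      also have "\<dots> \<le> (\<integral>\<^sup>+y. ennreal (hr y) * indicator {a..b} y + ennreal \<bar>hr y - hr x\<bar> * indicator {a..b} y \<partial>lborel)"
        using hr0 by (intro nn_integral_mono) (auto simp: indicator_def ennreal_plus[symmetric] simp del: ennreal_plus intro!: ennreal_leI)
      also have "\<dots> = ennreal (g b - g a) + (\<integral>\<^sup>+y. ennreal \<bar>hr y - hr x\<bar> * indicator {a..b} y \<partial>lborel)"
        using ab by (subst nn_integral_add) (auto simp: hrI)
      also have "\<dots> \<le> ennreal (g b - g a) + ennreal (e * (b - a))"
        using le by (intro add_left_mono)
      finally have 2: "hr x * (b - a) \<le> g b - g a + e * (b - a)"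
        using ab \<open>e > 0\<close> gab by (simp add: ennreal_plus[symmetric] del: ennreal_plus)
      from 1 2 show ?thesis by linarith
    qed
    have "(g has_derivative (\<lambda>y. hr x * y)) (at x)"
      unfolding has_derivative_at_alt
    proof (intro conjI allI impI)
      show "bounded_linear ((*) (hr x))" by (rule bounded_linear_mult_right)
      fix e :: real assume "e > 0"
      from ld[OF this] obtain d where d: "d > 0" "\<And>a b. a \<le> x \<Longrightarrow> x \<le> b \<Longrightarrow> a < b \<Longrightarrow> b - a < d \<Longrightarrow>
            (\<integral>\<^sup>+y. ennreal \<bar>hr y - hr x\<bar> * indicator {a..b} y \<partial>lborel) \<le> ennreal (e * (b - a))"
        by blast
      have "norm (g y - g x - hr x * (y - x)) \<le> e * norm (y - x)" if "norm (y - x) < d" for y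
      proof -
        consider "y = x" | "x < y" | "y < x" by linarith
        then show ?thesis
        proof cases
          case 2
          then show ?thesis
            using key[of x y e] d(2)[of x y] that \<open>e > 0\<close> by auto
        next
          case 3
          then have "\<bar>g x - g y - hr x * (x - y)\<bar> \<le> e * (x - y)"
            using key[of y x e] d(2)[of y x] that \<open>e > 0\<close> by auto
          moreover have "g y - g x - hr x * (y - x) = - (g x - g y - hr x * (x - y))"
            by (simp add: algebra_simps)
          ultimately show ?thesis using 3 by simp
        qed simp
      qed
      then show "\<exists>d>0. \<forall>y. norm (y - x) < d \<longrightarrow> norm (g y - g x - hr x * (y - x)) \<le> e * norm (y - x)"
        using d by blast
    qed
    then have "g differentiable at x" by (auto simp: differentiable_def)
    then have "(\<lambda>y. g y - (L + 1) * y) differentiable at x"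
      by (intro derivative_intros)
    then have "f differentiable at x" by (simp add: g_def)
    with nd show False by simp
  qed
qed

text \<open>On each line parallel to \<open>v\<close> the restriction of \<open>F\<close> is
  differentiable almost everywhere. Rational slopes and scales \<open>1 / Suc m\<close> are used in
  order that the exceptional set be Borel: for fixed \<open>m\<close> and \<open>r\<close> the
  condition is closed.\<close>

lemma negligible_no_near_slope:
  fixes F :: "'a::euclidean_space \<Rightarrow> real" and v :: 'a
  assumes lip: "L-lipschitz_on UNIV F" and "e > 0"
  shows "negligible {x. \<not> (\<exists>m::nat. \<exists>r\<in>\<rat>. \<forall>t. \<bar>t\<bar> \<le> inverse (real (Suc m)) \<longrightarrow>
            \<bar>F (x + t *\<^sub>R v) - F x - t * r\<bar> \<le> e * \<bar>t\<bar>)}" (is "negligible ?N")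
proof (rule negligible_if_negligible_on_lines[where v=v])
  have cont: "continuous_on UNIV F" using lip by (rule lipschitz_on_continuous_on)
  have cont': "continuous_on UNIV (\<lambda>x. F (x + c))" for c
    by (rule continuous_on_compose2[OF cont]) (auto intro!: continuous_intros)
  have cl: "closed {x. \<forall>t. \<bar>t\<bar> \<le> d \<longrightarrow> \<bar>F (x + t *\<^sub>R v) - F x - t * r\<bar> \<le> e * \<bar>t\<bar>}" for d r
    by (intro closed_Collect_all closed_Collect_imp open_Collect_const closed_Collect_le continuous_intros cont cont')
  have "{x. \<exists>m::nat. \<exists>r\<in>\<rat>. \<forall>t. \<bar>t\<bar> \<le> inverse (real (Suc m)) \<longrightarrow> \<bar>F (x + t *\<^sub>R v) - F x - t * r\<bar> \<le> e * \<bar>t\<bar>}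
      = (\<Union>m::nat. \<Union>r\<in>\<rat>. {x. \<forall>t. \<bar>t\<bar> \<le> inverse (real (Suc m)) \<longrightarrow> \<bar>F (x + t *\<^sub>R v) - F x - t * r\<bar> \<le> e * \<bar>t\<bar>})"
    by blast
  also have "\<dots> \<in> sets borel"
    by (intro sets.countable_UN'' countable_rat countableI_type borel_closed cl)
  finally have "- {x. \<exists>m::nat. \<exists>r\<in>\<rat>. \<forall>t. \<bar>t\<bar> \<le> inverse (real (Suc m)) \<longrightarrow>
            \<bar>F (x + t *\<^sub>R v) - F x - t * r\<bar> \<le> e * \<bar>t\<bar>} \<in> sets borel"
    by (rule borel_comp)
  then have "?N \<in> sets borel" by (subst Collect_neg_eq)
  then show "?N \<in> sets lebesgue" by simp
next
  fix x
  have "(L * norm v)-lipschitz_on UNIV (\<lambda>t. F (x + t *\<^sub>R v))"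
  proof (rule lipschitz_onI)
    fix s t :: real
    have "dist (F (x + s *\<^sub>R v)) (F (x + t *\<^sub>R v)) \<le> L * dist (x + s *\<^sub>R v) (x + t *\<^sub>R v)"
      by (rule lipschitz_onD[OF lip]) auto
    also have "dist (x + s *\<^sub>R v) (x + t *\<^sub>R v) = norm v * dist s t"
      by (simp add: dist_norm scaleR_left_diff_distrib[symmetric])
    finally show "dist (F (x + s *\<^sub>R v)) (F (x + t *\<^sub>R v)) \<le> L * norm v * dist s t"
      by (simp add: mult.assoc)
  qed (use lipschitz_on_nonneg[OF lip] in auto)
  then have "negligible {t. \<not> (\<lambda>t. F (x + t *\<^sub>R v)) differentiable at t}"
    by (rule lipschitz_real_ae_differentiable)
  then show "negligible {t. x + t *\<^sub>R v \<in> ?N}"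
  proof (rule negligible_subset, intro subsetI CollectI notI)
    fix t assume t: "t \<in> {t. x + t *\<^sub>R v \<in> ?N}"
      and "(\<lambda>t. F (x + t *\<^sub>R v)) differentiable at t"
    then obtain D where "((\<lambda>t. F (x + t *\<^sub>R v)) has_real_derivative D) (at t)"
      using real_differentiableE by blast
    then have "((\<lambda>t. F (x + t *\<^sub>R v)) has_derivative (\<lambda>h. D * h)) (at t)"
      by (simp add: has_field_derivative_def)
    then obtain d where d: "d > 0" "\<And>s. norm (s - t) < d \<Longrightarrow>
        norm (F (x + s *\<^sub>R v) - F (x + t *\<^sub>R v) - D * (s - t)) \<le> e/2 * norm (s - t)"
      unfolding has_derivative_at_alt using \<open>e > 0\<close> half_gt_zero by metis
    obtain m where m: "inverse (real (Suc m)) < d" using reals_Archimedean[OF d(1)] by blast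
    obtain r where r: "r \<in> \<rat>" "D - e/2 < r" "r < D + e/2"
      using Rats_dense_in_real[of "D - e/2" "D + e/2"] \<open>e > 0\<close> by auto
    have "\<bar>F (x + t *\<^sub>R v + s *\<^sub>R v) - F (x + t *\<^sub>R v) - s * r\<bar> \<le> e * \<bar>s\<bar>"
      if s: "\<bar>s\<bar> \<le> inverse (real (Suc m))" for s
    proof -
      have 1: "\<bar>F (x + t *\<^sub>R v + s *\<^sub>R v) - F (x + t *\<^sub>R v) - D * s\<bar> \<le> e/2 * \<bar>s\<bar>"
        using d(2)[of "t + s"] s m by (simp add: scaleR_left_distrib add.assoc)
      have "\<bar>D * s - s * r\<bar> = \<bar>D - r\<bar> * \<bar>s\<bar>"
        by (simp add: abs_mult[symmetric] algebra_simps)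
      also have "\<bar>D - r\<bar> * \<bar>s\<bar> \<le> e/2 * \<bar>s\<bar>"
        by (rule mult_right_mono) (use r in linarith, simp)
      finally show ?thesis using 1 by argo
    qed
    then have "x + t *\<^sub>R v \<notin> ?N" using r(1) by blast
    with t show False by blast
  qed
qed

text \<open>The way from \<open>x\<close> to \<open>x + h\<close> follows the coordinate axes. A
  corner need not lie in \<open>A\<close>, but some point of \<open>A\<close> is within
  \<open>e * DIM('a) * norm h\<close> of it, and there the slope estimate holds with the uniform
  scale \<open>d0\<close>; moving both ends of the step back to the corner costs
  \<open>2 * L\<close> times this distance.\<close>

lemma telescoping_at_density_point:
  fixes F :: "'a::euclidean_space \<Rightarrow> real" and q :: "'a \<Rightarrow> real" and L :: real
  assumes lip: "L-lipschitz_on UNIV F" and A: "A \<in> sets lebesgue" "x \<in> A" "density_point A x"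
    and e: "0 < e" "e \<le> 1" and "0 < d0"
    and slope: "\<And>z i t. z \<in> A \<Longrightarrow> i \<in> Basis \<Longrightarrow> \<bar>t\<bar> \<le> d0 \<Longrightarrow> \<bar>F (z + t *\<^sub>R i) - F z - t * q i\<bar> \<le> e * \<bar>t\<bar>"
  obtains d where "d > 0" "\<And>h. norm h < d \<Longrightarrow>
     \<bar>F (x + h) - F x - (\<Sum>i\<in>Basis. (h \<bullet> i) * q i)\<bar> \<le> DIM('a) * (1 + 2 * L * DIM('a)) * e * norm h"
proof -
  have L: "L \<ge> 0" using lip by (rule lipschitz_on_nonneg)
  obtain d1 where d1: "d1 > 0" "\<And>y. dist y x < d1 \<Longrightarrow> y \<noteq> x \<Longrightarrow> \<exists>z\<in>A. dist z y < e * dist y x"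
    using density_point_near[OF A(1,3) e] by blast
  \<comment> \<open>Coordinate steps must not exceed \<open>d0\<close>, and corners, at distance at
    most \<open>DIM('a) * norm h\<close> from \<open>x\<close>, must be within the range
    \<open>d1\<close> of the density estimate.\<close>
  define d where "d = min d0 (d1 / DIM('a))"
  show thesis
  proof (rule that[of d])
    fix h :: 'a assume h: "norm h < d"
    have step: "\<bar>F (x + (\<Sum>i\<in>J. (h \<bullet> i) *\<^sub>R i)) - F x - (\<Sum>i\<in>J. (h \<bullet> i) * q i)\<bar>
        \<le> card J * ((1 + 2 * L * DIM('a)) * e * norm h)" if "finite J" "J \<subseteq> Basis" for J
      using that
    proof (induction J rule: finite_induct)
      case (insert i J)
      let ?y = "x + (\<Sum>i\<in>J. (h \<bullet> i) *\<^sub>R i)"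
      have "norm (\<Sum>i\<in>J. (h \<bullet> i) *\<^sub>R i) \<le> (\<Sum>i\<in>J. norm h)"
        using insert.prems by (intro sum_norm_le) (auto simp: Basis_le_norm subset_iff)
      also have "\<dots> \<le> DIM('a) * norm h"
        using insert.prems by (auto intro!: mult_right_mono card_mono)
      finally have ny: "dist ?y x \<le> DIM('a) * norm h"
        by (simp add: dist_norm)
      also have "\<dots> < d1"
        using h by (simp add: d_def field_simps)
      finally have "dist ?y x < d1" .
      then obtain z where z: "z \<in> A" "dist z ?y \<le> e * dist ?y x"
        using d1(2)[of ?y] A(2) by (cases "?y = x") (auto intro: less_imp_le)
      have zy: "dist z ?y \<le> e * (DIM('a) * norm h)"
        using z(2) ny e by (meson less_imp_le mult_left_mono order_trans)
      have a: "\<bar>F (?y + c) - F (z + c)\<bar> \<le> L * (e * (DIM('a) * norm h))" for c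
      proof -
        have "\<bar>F (?y + c) - F (z + c)\<bar> \<le> L * dist (?y + c) (z + c)"
          using lipschitz_onD[OF lip, of "?y + c" "z + c"] by (simp add: dist_real_def)
        also have "\<dots> \<le> L * (e * (DIM('a) * norm h))"
          using zy L by (intro mult_left_mono) (auto simp: dist_commute)
        finally show ?thesis .
      qed
      have "i \<in> Basis" using insert by auto
      have "\<bar>F (z + (h \<bullet> i) *\<^sub>R i) - F z - (h \<bullet> i) * q i\<bar> \<le> e * \<bar>h \<bullet> i\<bar>"
        using z(1) \<open>i \<in> Basis\<close> h Basis_le_norm[OF \<open>i \<in> Basis\<close>, of h] by (intro slope) (auto simp: d_def)
      also have "\<dots> \<le> e * norm h"
        using Basis_le_norm[OF \<open>i \<in> Basis\<close>, of h] e by (intro mult_left_mono) auto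
      finally have b: "\<bar>F (z + (h \<bullet> i) *\<^sub>R i) - F z - (h \<bullet> i) * q i\<bar> \<le> e * norm h" .
      have eq: "x + (\<Sum>i\<in>insert i J. (h \<bullet> i) *\<^sub>R i) = ?y + (h \<bullet> i) *\<^sub>R i"
        using insert by (simp add: algebra_simps)
      have IH: "\<bar>F ?y - F x - (\<Sum>i\<in>J. (h \<bullet> i) * q i)\<bar> \<le> card J * ((1 + 2 * L * DIM('a)) * e * norm h)"
        using insert by auto
      have "\<bar>F (?y + (h \<bullet> i) *\<^sub>R i) - F ?y - (h \<bullet> i) * q i\<bar> \<le> e * norm h + 2 * (L * (e * (DIM('a) * norm h)))"
        using a[of 0] a[of "(h \<bullet> i) *\<^sub>R i"] b by (simp add: abs_le_iff)
      also have "\<dots> = (1 + 2 * L * DIM('a)) * e * norm h" by (simp add: algebra_simps)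
      finally show ?case
        unfolding eq using IH insert by (simp add: algebra_simps abs_le_iff)
    qed simp
    have "(\<Sum>i\<in>Basis. (h \<bullet> i) *\<^sub>R i) = h" by (rule euclidean_representation)
    with step[of Basis] show "\<bar>F (x + h) - F x - (\<Sum>i\<in>Basis. (h \<bullet> i) * q i)\<bar> \<le> DIM('a) * (1 + 2 * L * DIM('a)) * e * norm h"
      by (simp add: mult.assoc)
  qed (use d1 \<open>0 < d0\<close> in \<open>auto simp: d_def\<close>)
qed

text \<open>Almost everywhere the axis slopes exist up to \<open>1 / Suc n\<close>, at a scale and
  with rational slopes depending on the point. The sets \<open>A n m q\<close> on which scale and
  slopes are uniform are countably many, so almost every point is a density point of all those
  containing it; there axis slopes yield a full linear approximation.\<close>

theorem rademacher_real:
  fixes F :: "'a::euclidean_space \<Rightarrow> real"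
  assumes lip: "L-lipschitz_on UNIV F"
  shows "negligible {x. \<not> F differentiable (at x)}"
proof -
  have L: "L \<ge> 0" using lip by (rule lipschitz_on_nonneg)
  have cont: "continuous_on UNIV F" using lip by (rule lipschitz_on_continuous_on)
  have cont': "continuous_on UNIV (\<lambda>x. F (x + c))" for c
    by (rule continuous_on_compose2[OF cont]) (auto intro!: continuous_intros)
  define A where "A n m q = {x. \<forall>i\<in>Basis. \<forall>t. \<bar>t\<bar> \<le> inverse (real (Suc m)) \<longrightarrow>
            \<bar>F (x + t *\<^sub>R i) - F x - t * q i\<bar> \<le> inverse (real (Suc n)) * \<bar>t\<bar>}" for n m :: nat and q :: "'a \<Rightarrow> real"
  have AD: "\<bar>F (z + t *\<^sub>R i) - F z - t * q i\<bar> \<le> inverse (real (Suc n)) * \<bar>t\<bar>"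
    if "z \<in> A n m q" "i \<in> Basis" "\<bar>t\<bar> \<le> inverse (real (Suc m))" for z t i n m q
    using that unfolding A_def by blast
  have "closed (A n m q)" for n m q
    unfolding A_def Ball_def
    by (intro closed_Collect_all closed_Collect_imp open_Collect_const closed_Collect_le continuous_intros cont cont')
  then have Al: "A n m q \<in> sets lebesgue" for n m q by simp
  \<comment> \<open>Slope vectors are taken extensional on \<open>Basis\<close>, which keeps the
    family countable.\<close>
  define Q where "Q = (PiE Basis (\<lambda>_. \<rat>) :: ('a \<Rightarrow> real) set)"
  have Q: "countable Q" unfolding Q_def by (intro countable_PiE) (auto simp: countable_rat)
  define N1 where "N1 n i = {x. \<not> (\<exists>m::nat. \<exists>r\<in>\<rat>. \<forall>t. \<bar>t\<bar> \<le> inverse (real (Suc m)) \<longrightarrow>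
            \<bar>F (x + t *\<^sub>R i) - F x - t * r\<bar> \<le> inverse (real (Suc n)) * \<bar>t\<bar>)}" for n :: nat and i :: 'a
  define N where "N = (\<Union>n. \<Union>i\<in>Basis. N1 n i) \<union> (\<Union>n. \<Union>m. \<Union>q\<in>Q. {x\<in>A n m q. \<not> density_point (A n m q) x})"
  have "negligible (N1 n i)" for n i
    unfolding N1_def by (rule negligible_no_near_slope[OF lip]) simp
  then have negN: "negligible N"
    unfolding N_def
    by (intro negligible_Un negligible_countable_Union countable_image countableI_type countable_finite finite_Basis)
      (auto intro!: negligible_not_density_point Al negligible_countable_Union countable_image Q simp: countable_finite)
  show ?thesis
  proof (rule negligible_subset[OF negN], intro subsetI, rule ccontr)
    fix x assume nd: "x \<in> {x. \<not> F differentiable at x}" and x: "x \<notin> N"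
    have xN1: "x \<notin> N1 n i" if "i \<in> Basis" for n i
      using x that by (auto simp: N_def)
    have xd: "density_point (A n m q) x" if "q \<in> Q" "x \<in> A n m q" for n m q
      using x that by (auto simp: N_def)
    have "\<exists>m q. q \<in> Q \<and> x \<in> A n m q" for n
    proof -
      have "\<exists>m::nat. \<exists>r\<in>\<rat>. \<forall>t. \<bar>t\<bar> \<le> inverse (real (Suc m)) \<longrightarrow>
            \<bar>F (x + t *\<^sub>R i) - F x - t * r\<bar> \<le> inverse (real (Suc n)) * \<bar>t\<bar>" if "i \<in> Basis" for i
        using xN1[OF that, of n] by (simp add: N1_def)
      then obtain m r where mr: "\<And>i. i \<in> Basis \<Longrightarrow> r i \<in> \<rat>"
        "\<And>i t. i \<in> Basis \<Longrightarrow> \<bar>t\<bar> \<le> inverse (real (Suc (m i))) \<Longrightarrow>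
            \<bar>F (x + t *\<^sub>R i) - F x - t * r i\<bar> \<le> inverse (real (Suc n)) * \<bar>t\<bar>"
        by metis
      have "x \<in> A n (Max (m ` Basis)) (restrict r Basis)"
        unfolding A_def
      proof (intro CollectI ballI allI impI)
        fix i :: 'a and t :: real assume i: "i \<in> Basis" and t: "\<bar>t\<bar> \<le> inverse (real (Suc (Max (m ` Basis))))"
        have "m i \<le> Max (m ` Basis)" using i by simp
        then have "inverse (real (Suc (Max (m ` Basis)))) \<le> inverse (real (Suc (m i)))"
          by (intro le_imp_inverse_le) auto
        with t have "\<bar>t\<bar> \<le> inverse (real (Suc (m i)))" by (rule order_trans)
        with mr(2)[OF i, of t] i show "\<bar>F (x + t *\<^sub>R i) - F x - t * restrict r Basis i\<bar> \<le> inverse (real (Suc n)) * \<bar>t\<bar>"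
          by simp
      qed
      moreover have "restrict r Basis \<in> Q" using mr(1) by (auto simp: Q_def)
      ultimately show ?thesis by blast
    qed
    then obtain m q where mq: "\<And>n. q n \<in> Q" "\<And>n. x \<in> A n (m n) (q n)" by metis
    then have dens: "density_point (A n (m n) (q n)) x" for n
      by (intro xd)
    \<comment> \<open>Slopes of two accuracies describe the same increment over a common step
      \<open>t\<close>, hence differ by at most the sum of the accuracies. So \<open>q n i\<close>
      is Cauchy in \<open>n\<close>, and its limit is the partial derivative.\<close>
    have qq: "\<bar>q n i - q k i\<bar> \<le> inverse (real (Suc n)) + inverse (real (Suc k))" if "i \<in> Basis" for n k i
    proof -
      define t where "t = min (inverse (real (Suc (m n)))) (inverse (real (Suc (m k))))"
      have t: "t > 0" by (simp add: t_def)
      have "\<bar>F (x + t *\<^sub>R i) - F x - t * q n i\<bar> \<le> inverse (real (Suc n)) * \<bar>t\<bar>"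
        using t by (intro AD[OF mq(2) that]) (simp add: t_def del: of_nat_Suc)
      moreover have "\<bar>F (x + t *\<^sub>R i) - F x - t * q k i\<bar> \<le> inverse (real (Suc k)) * \<bar>t\<bar>"
        using t by (intro AD[OF mq(2) that]) (simp add: t_def del: of_nat_Suc)
      ultimately have "\<bar>t * q n i - t * q k i\<bar> \<le> inverse (real (Suc n)) * \<bar>t\<bar> + inverse (real (Suc k)) * \<bar>t\<bar>"
        by linarith
      then have "t * \<bar>q n i - q k i\<bar> \<le> t * (inverse (real (Suc n)) + inverse (real (Suc k)))"
        using t by (simp add: abs_mult right_diff_distrib[symmetric] distrib_left mult.commute)
      then show ?thesis using t by simp
    qed
    have "\<exists>D. \<forall>n. \<bar>q n i - D\<bar> \<le> inverse (real (Suc n))" if i: "i \<in> Basis" for i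
    proof -
      have lim0: "(\<lambda>k. inverse (real (Suc k))) \<longlonglongrightarrow> 0" by (rule LIMSEQ_inverse_real_of_nat)
      have "Cauchy (\<lambda>n. q n i)"
      proof (rule metric_CauchyI)
        fix e :: real assume "e > 0"
        then obtain K where K: "inverse (real (Suc K)) < e / 2"
          using reals_Archimedean[of "e/2"] by auto
        have "dist (q a i) (q b i) < e" if "a \<ge> K" "b \<ge> K" for a b
        proof -
          have "inverse (real (Suc a)) \<le> inverse (real (Suc K))" "inverse (real (Suc b)) \<le> inverse (real (Suc K))"
            using that by (auto intro!: le_imp_inverse_le)
          then show ?thesis using qq[OF i, of a b] K unfolding dist_real_def by linarith
        qed
        then show "\<exists>M. \<forall>a\<ge>M. \<forall>b\<ge>M. dist (q a i) (q b i) < e" by blast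
      qed
      then obtain D where D: "(\<lambda>k. q k i) \<longlonglongrightarrow> D"
        using real_Cauchy_convergent convergent_def by blast
      have "\<bar>q n i - D\<bar> \<le> inverse (real (Suc n)) + 0" for n
      proof (rule LIMSEQ_le)
        show "(\<lambda>k. \<bar>q n i - q k i\<bar>) \<longlonglongrightarrow> \<bar>q n i - D\<bar>"
          by (intro tendsto_intros D)
        show "(\<lambda>k. inverse (real (Suc n)) + inverse (real (Suc k))) \<longlonglongrightarrow> inverse (real (Suc n)) + 0"
          by (intro tendsto_add tendsto_const lim0)
      qed (use qq[OF i] in blast)
      then have "\<bar>q n i - D\<bar> \<le> inverse (real (Suc n))" for n by simp
      then show ?thesis by blast
    qed
    then obtain D where D: "\<And>n i. i \<in> Basis \<Longrightarrow> \<bar>q n i - D i\<bar> \<le> inverse (real (Suc n))" by metis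
    \<comment> \<open>The first summand is the telescoping error, the second the error of replacing
      the rational slopes \<open>q n\<close> by their limits \<open>D\<close>.\<close>
    define C where "C = real DIM('a) * (1 + 2 * L * DIM('a)) + DIM('a)"
    have C: "C > 0" using L by (simp add: C_def add_nonneg_pos)
    have "(F has_derivative (\<lambda>h. \<Sum>i\<in>Basis. (h \<bullet> i) * D i)) (at x)"
      unfolding has_derivative_at_alt
    proof (intro conjI allI impI)
      show "bounded_linear (\<lambda>h. \<Sum>i\<in>Basis. (h \<bullet> i) * D i)"
        by (intro bounded_linear_sum bounded_linear_compose[OF bounded_linear_mult_left] bounded_linear_inner_left)
      fix e :: real assume "e > 0"
      obtain n where n: "inverse (real (Suc n)) < e / C"
        using reals_Archimedean[of "e / C"] \<open>e > 0\<close> C by auto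
      let ?\<eta> = "inverse (real (Suc n))"
      have e1: "0 < ?\<eta>" "?\<eta> \<le> 1" by (auto simp: inverse_le_1_iff)
      obtain d where d: "d > 0" "\<And>h. norm h < d \<Longrightarrow>
     \<bar>F (x + h) - F x - (\<Sum>i\<in>Basis. (h \<bullet> i) * q n i)\<bar> \<le> DIM('a) * (1 + 2 * L * DIM('a)) * ?\<eta> * norm h"
      proof (rule telescoping_at_density_point[OF lip Al mq(2) dens e1, of "inverse (real (Suc (m n)))" n])
        show "\<bar>F (z + t *\<^sub>R i) - F z - t * q n i\<bar> \<le> ?\<eta> * \<bar>t\<bar>"
          if "z \<in> A n (m n) (q n)" "i \<in> Basis" "\<bar>t\<bar> \<le> inverse (real (Suc (m n)))" for z i t
          using that by (intro AD)
      qed (simp, blast intro: that)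
      have "norm (F y - F x - (\<Sum>i\<in>Basis. ((y - x) \<bullet> i) * D i)) \<le> e * norm (y - x)" if y: "norm (y - x) < d" for y
      proof -
        let ?h = "y - x"
        have "\<bar>(\<Sum>i\<in>Basis. (?h \<bullet> i) * q n i) - (\<Sum>i\<in>Basis. (?h \<bullet> i) * D i)\<bar>
            = \<bar>\<Sum>i\<in>Basis. (?h \<bullet> i) * (q n i - D i)\<bar>"
          by (simp add: sum_subtractf right_diff_distrib)
        also have "\<dots> \<le> (\<Sum>i\<in>(Basis::'a set). norm ?h * ?\<eta>)"
          using D Basis_le_norm by (intro order_trans[OF sum_abs] sum_mono) (auto simp: abs_mult intro!: mult_mono)
        also have "\<dots> = DIM('a) * ?\<eta> * norm ?h" by simp
        finally have 1: "\<bar>(\<Sum>i\<in>Basis. (?h \<bullet> i) * q n i) - (\<Sum>i\<in>Basis. (?h \<bullet> i) * D i)\<bar> \<le> DIM('a) * ?\<eta> * norm ?h" .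
        have "\<bar>F y - F x - (\<Sum>i\<in>Basis. (?h \<bullet> i) * D i)\<bar> \<le> DIM('a) * (1 + 2 * L * DIM('a)) * ?\<eta> * norm ?h + DIM('a) * ?\<eta> * norm ?h"
          using d(2)[OF y] 1 by simp
        also have "\<dots> = (C * ?\<eta>) * norm ?h" by (simp add: C_def algebra_simps)
        also have "\<dots> \<le> e * norm ?h"
          using n C by (intro mult_right_mono) (auto simp: field_simps)
        finally show ?thesis by simp
      qed
      then show "\<exists>d>0. \<forall>y. norm (y - x) < d \<longrightarrow>
          norm (F y - F x - (\<Sum>i\<in>Basis. ((y - x) \<bullet> i) * D i)) \<le> e * norm (y - x)"
        using d by blast
    qed
    then show False using nd by (auto simp: differentiable_def)
  qed
qed

text \<open>McShane's formula \<open>F x = inf (f e + L |x - e|)\<close>.\<close>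

lemma lipschitz_on_extend_real:
  fixes f :: "'a::metric_space \<Rightarrow> real"
  assumes lip: "L-lipschitz_on E f"
  obtains F where "L-lipschitz_on UNIV F" "\<And>x. x \<in> E \<Longrightarrow> F x = f x"
proof (cases "E = {}")
  case True
  show thesis
    by (rule that[of "\<lambda>_. 0"]) (use True lipschitz_on_nonneg[OF lip] in \<open>auto intro!: lipschitz_onI\<close>)
next
  case False
  have L: "L \<ge> 0" using lip by (rule lipschitz_on_nonneg)
  define F where "F x = (INF e\<in>E. f e + L * dist x e)" for x
  have lo: "f a - L * dist x a \<le> f e + L * dist x e" if "a \<in> E" "e \<in> E" for a e x
  proof -
    have "f a - f e \<le> L * dist a e"
      using lipschitz_onD[OF lip that] by (simp add: dist_real_def abs_le_iff)
    also have "\<dots> \<le> L * (dist x a + dist x e)"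
      using L dist_triangle3[of a e x] by (intro mult_left_mono) auto
    finally show ?thesis by (simp add: algebra_simps)
  qed
  have bdd: "bdd_below ((\<lambda>e. f e + L * dist x e) ` E)" for x
    using False lo by (metis (mono_tags, lifting) bdd_belowI2 ex_in_conv)
  show thesis
  proof (rule that[of F])
    have le: "F x \<le> F y + L * dist x y" for x y
    proof -
      have "F x - L * dist x y \<le> f e + L * dist y e" if "e \<in> E" for e
      proof -
        have "F x \<le> f e + L * dist x e"
          unfolding F_def by (rule cINF_lower[OF bdd that])
        also have "\<dots> \<le> f e + L * (dist x y + dist y e)"
          using L by (intro add_left_mono mult_left_mono dist_triangle)
        finally show ?thesis by (simp add: algebra_simps)
      qed
      then have "F x - L * dist x y \<le> F y"
        unfolding F_def[of y] using False by (intro cINF_greatest) auto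
      then show ?thesis by simp
    qed
    show "L-lipschitz_on UNIV F"
    proof (rule lipschitz_onI)
      show "dist (F x) (F y) \<le> L * dist x y" for x y
        using le[of x y] le[of y x] by (simp add: dist_real_def dist_commute abs_le_iff)
    qed (rule L)
    fix x assume x: "x \<in> E"
    show "F x = f x"
    proof (rule antisym)
      show "F x \<le> f x" unfolding F_def using cINF_lower[OF bdd x, of x] by simp
      show "f x \<le> F x" unfolding F_def using False lo[OF x, of _ x] by (intro cINF_greatest) auto
    qed
  qed
qed

text \<open>Each coordinate is extended to the whole space with the same Lipschitz constant, and the
  extension is differentiable almost everywhere. The derivative is taken within \<open>E\<close>
  because \<open>f\<close> is controlled only there; it may fail to be unique.\<close>

theorem rademacher_within:
  fixes f :: "'a::euclidean_space \<Rightarrow> 'b::euclidean_space"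
  assumes lip: "L-lipschitz_on E f"
  shows "negligible {x\<in>E. \<not> (\<exists>D. (f has_derivative D) (at x within E))}"
proof -
  have "\<exists>F. L-lipschitz_on UNIV F \<and> (\<forall>x\<in>E. F x = f x \<bullet> b)" if "b \<in> Basis" for b
  proof -
    have "L-lipschitz_on E (\<lambda>x. f x \<bullet> b)"
    proof (rule lipschitz_onI)
      fix x y assume "x \<in> E" "y \<in> E"
      have "dist (f x \<bullet> b) (f y \<bullet> b) \<le> dist (f x) (f y)"
        using Basis_le_norm[OF that, of "f x - f y"] by (simp add: dist_norm inner_diff_left)
      also have "\<dots> \<le> L * dist x y" by (rule lipschitz_onD[OF lip]) fact+
      finally show "dist (f x \<bullet> b) (f y \<bullet> b) \<le> L * dist x y" .
    qed (rule lipschitz_on_nonneg[OF lip])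
    then obtain F where "L-lipschitz_on UNIV F" "\<And>x. x \<in> E \<Longrightarrow> F x = f x \<bullet> b"
      by (rule lipschitz_on_extend_real) blast
    then show ?thesis by blast
  qed
  then obtain F where F: "\<And>b. b \<in> Basis \<Longrightarrow> L-lipschitz_on UNIV (F b)" "\<And>b x. b \<in> Basis \<Longrightarrow> x \<in> E \<Longrightarrow> F b x = f x \<bullet> b"
    by metis
  have neg: "negligible (\<Union>b\<in>Basis. {x. \<not> F b differentiable (at x)})"
    by (intro negligible_Union) (auto intro: rademacher_real F)
  show ?thesis
  proof (rule negligible_subset[OF neg], intro subsetI, rule ccontr)
    fix x assume x: "x \<in> {x \<in> E. \<not> (\<exists>D. (f has_derivative D) (at x within E))}"
      and "x \<notin> (\<Union>b\<in>Basis. {x. \<not> F b differentiable (at x)})"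
    then have "\<exists>D. (F b has_derivative D) (at x within E)" if "b \<in> Basis" for b
      using that differentiable_at_withinI unfolding differentiable_def by blast
    then obtain D where "\<And>b. b \<in> Basis \<Longrightarrow> (F b has_derivative D b) (at x within E)" by metis
    then have "((\<lambda>x. \<Sum>b\<in>Basis. F b x *\<^sub>R b) has_derivative (\<lambda>h. \<Sum>b\<in>Basis. D b h *\<^sub>R b)) (at x within E)"
      by (intro has_derivative_sum has_derivative_scaleR_left)
    then have "(f has_derivative (\<lambda>h. \<Sum>b\<in>Basis. D b h *\<^sub>R b)) (at x within E)"
      by (rule has_derivative_transform[rotated 2]) (use x F(2) in \<open>auto simp: euclidean_representation\<close>)
    with x show False by blast
  qed
qed

section \<open>Hausdorff content\<close>

text \<open>Unlike in the premeasures, the covering sets may have any diameter; this gives the same null sets.\<close>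

definition hausdorff_content :: "('a \<Rightarrow> 'a \<Rightarrow> ennreal) \<Rightarrow> nat \<Rightarrow> 'a set \<Rightarrow> ennreal" where
  "hausdorff_content d k = outer_measure UNIV (\<lambda>C. ediameter d C ^ k)"

lemma ediameter_leI: "(\<And>x y. x \<in> A \<Longrightarrow> y \<in> A \<Longrightarrow> d x y \<le> c) \<Longrightarrow> ediameter d A \<le> c"
  by (auto simp: ediameter_def intro!: SUP_least)

lemma ediameter_upper: "x \<in> A \<Longrightarrow> y \<in> A \<Longrightarrow> d x y \<le> ediameter d A"
  unfolding ediameter_def by (rule SUP_upper2, assumption, rule SUP_upper)

lemma ediameter_mono: "A \<subseteq> B \<Longrightarrow> ediameter d A \<le> ediameter d B"
  by (rule ediameter_leI) (auto intro: ediameter_upper)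

lemma ediameter_empty[simp]: "ediameter d {} = 0"
  by (simp add: ediameter_def bot_ennreal)

context
  fixes k :: nat and d :: "'a \<Rightarrow> 'a \<Rightarrow> ennreal"
  assumes k: "k \<ge> 1"
begin

text \<open>With all subsets as the ring, the abstract outer measure construction applies to
  \<open>ediameter d C ^ k\<close>, which is monotone but not additive.\<close>

lemma ring_UNIV: "ring_of_sets UNIV (UNIV :: 'a set set)"
  using sigma_algebra_Pow[of "UNIV :: 'a set"]
  by (intro algebra.axioms(1) sigma_algebra.axioms(1)) simp

lemma positive_diam: "positive UNIV (\<lambda>C. ediameter d C ^ k)"
  using k by (simp add: positive_def)

lemma increasing_diam: "increasing UNIV (\<lambda>C. ediameter d C ^ k)"
  by (auto simp: increasing_def intro!: power_mono ediameter_mono)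

lemma hausdorff_content_le:
  assumes "A \<subseteq> (\<Union>i::nat. C i)"
  shows "hausdorff_content d k A \<le> (\<Sum>i. ediameter d (C i) ^ k)"
  unfolding hausdorff_content_def
  by (rule ring_of_sets.outer_measure_le[OF ring_UNIV positive_diam increasing_diam _ assms]) simp

lemma hausdorff_content_approx:
  assumes "hausdorff_content d k A < e"
  obtains C :: "nat \<Rightarrow> 'a set" where "A \<subseteq> (\<Union>i. C i)" "(\<Sum>i. ediameter d (C i) ^ k) < e"
  using ring_of_sets.outer_measure_close[OF ring_UNIV assms[unfolded hausdorff_content_def]] that by blast

lemma hausdorff_content_mono: "A \<subseteq> B \<Longrightarrow> hausdorff_content d k A \<le> hausdorff_content d k B"
  using ring_of_sets.increasing_outer_measure[OF ring_UNIV, of "\<lambda>C. ediameter d C ^ k"]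
  unfolding hausdorff_content_def by (simp add: increasing_def)

lemma hausdorff_content_empty: "hausdorff_content d k {} = 0"
  unfolding hausdorff_content_def by (rule outer_measure_empty[OF positive_diam]) simp

lemma hausdorff_content_UN_le:
  "hausdorff_content d k (\<Union>n::nat. A n) \<le> (\<Sum>n. hausdorff_content d k (A n))"
proof -
  have "countably_subadditive UNIV (hausdorff_content d k)"
    using ring_of_sets.countably_subadditive_outer_measure[OF ring_UNIV positive_diam increasing_diam]
    by (simp add: hausdorff_content_def)
  then have "hausdorff_content d k (\<Union>n. disjointed A n) \<le> (\<Sum>n. hausdorff_content d k (disjointed A n))"
    using disjoint_family_disjointed[of A] by (auto simp only: countably_subadditive_def)
  also have "\<dots> \<le> (\<Sum>n. hausdorff_content d k (A n))"
    by (intro suminf_le hausdorff_content_mono disjointed_subset) auto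
  finally show ?thesis by (simp add: UN_disjointed_eq)
qed

lemma hausdorff_content_UN_null:
  assumes "\<And>n::nat. hausdorff_content d k (A n) = 0"
  shows "hausdorff_content d k (\<Union>n. A n) = 0"
  using hausdorff_content_UN_le[of A] assms by simp

lemma hausdorff_content_finite_UN_le:
  assumes I: "finite I" and le: "\<And>i. i \<in> I \<Longrightarrow> hausdorff_content d k (A i) \<le> c"
  shows "hausdorff_content d k (\<Union>i\<in>I. A i) \<le> of_nat (card I) * c"
proof -
  obtain e where e: "bij_betw e {..<card I} I"
    using ex_bij_betw_nat_finite[OF I] atLeast0LessThan by metis
  define B where "B n = (if n < card I then A (e n) else {})" for n
  have "(\<Union>i\<in>I. A i) = (\<Union>n. B n)"
    using bij_betw_imp_surj_on[OF e] by (auto simp: B_def split: if_splits) (metis image_iff lessThan_iff)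
  then have "hausdorff_content d k (\<Union>i\<in>I. A i) \<le> (\<Sum>n. hausdorff_content d k (B n))"
    using hausdorff_content_UN_le[of B] by simp
  also have "\<dots> = (\<Sum>n<card I. hausdorff_content d k (B n))"
    by (rule suminf_finite) (auto simp: B_def hausdorff_content_empty)
  also have "\<dots> \<le> (\<Sum>n<card I. c)"
    using bij_betw_apply[OF e] by (intro sum_mono) (auto simp: B_def intro!: le)
  finally show ?thesis by simp
qed

lemma hausdorff_content_le_diam: "hausdorff_content d k A \<le> ediameter d A ^ k"
proof -
  have "hausdorff_content d k A \<le> (\<Sum>i::nat. ediameter d (if i = 0 then A else {}) ^ k)"
    by (rule hausdorff_content_le) auto
  also have "\<dots> = (\<Sum>i\<in>{0::nat}. ediameter d (if i = 0 then A else {}) ^ k)"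
    by (rule suminf_finite) (use k in auto)
  finally show ?thesis by simp
qed

text \<open>The premeasures differ from the content by the factor
  \<open>unit_ball_vol k / 2 ^ k\<close> and by the restriction to small diameters. For null sets
  the restriction costs nothing: if the sum of the \<open>k\<close>-th powers is small, so is every
  summand. Intersecting with \<open>A\<close> puts the covering sets inside
  \<open>M\<close>.\<close>

lemma hausdorff_measure_eq_0_iff:
  assumes A: "A \<subseteq> M"
  shows "hausdorff_measure M d k A = 0 \<longleftrightarrow> hausdorff_content d k A = 0"
proof
  let ?c = "ennreal (unit_ball_vol (real k)) * ennreal (1/2) ^ k"
  have c: "?c = ennreal (unit_ball_vol (real k) * (1/2) ^ k)"
    by (subst ennreal_power, simp, rule ennreal_mult[symmetric]) simp_all
  have cpos: "unit_ball_vol (real k) * (1/2) ^ k > 0" by simp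
  have vol_ne0: "unit_ball_vol (real k) \<noteq> 0"
    using unit_ball_vol_pos[of "real k"] by linarith
  have half: "t / 2 = ennreal (1/2) * t" for t :: ennreal
    by (simp add: divide_ennreal_def mult.commute ennreal_divide_numeral[symmetric]
        inverse_eq_divide flip: ennreal_numeral ennreal_1)
  have scale: "(\<Sum>i. ennreal (unit_ball_vol (real k)) * (ediameter d (C i) / 2) ^ k)
        = ?c * (\<Sum>i. ediameter d (C i) ^ k)" for C :: "nat \<Rightarrow> 'a set"
    unfolding half power_mult_distrib mult.assoc[symmetric] by simp
  show "hausdorff_content d k A = 0" if "hausdorff_measure M d k A = 0"
  proof -
    have "hausdorff_premeasure M d k 1 A \<le> hausdorff_measure M d k A"
      unfolding hausdorff_measure_def by (rule SUP_upper) simp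
    then have p0: "hausdorff_premeasure M d k 1 A = 0" using that by simp
    have "hausdorff_content d k A \<le> ennreal e" if "e > 0" for e
    proof -
      have "hausdorff_premeasure M d k 1 A < ?c * ennreal e"
        using p0 cpos \<open>e > 0\<close> unfolding c by (simp add: ennreal_mult[symmetric] ennreal_zero_less_mult_iff)
      then obtain C where C: "A \<subseteq> (\<Union>i. C i)" "?c * (\<Sum>i. ediameter d (C i) ^ k) < ?c * ennreal e"
        unfolding hausdorff_premeasure_def Inf_less_iff scale by blast
      have "(\<Sum>i. ediameter d (C i) ^ k) \<le> ennreal e"
      proof (rule ccontr)
        assume "\<not> ?thesis"
        then have "?c * ennreal e \<le> ?c * (\<Sum>i. ediameter d (C i) ^ k)" by (intro mult_left_mono) auto
        with C(2) show False by simp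
      qed
      with hausdorff_content_le[OF C(1)] show ?thesis by (rule order_trans)
    qed
    have "hausdorff_content d k A \<le> 0"
      by (rule ennreal_le_epsilon) (use \<open>\<And>e. 0 < e \<Longrightarrow> hausdorff_content d k A \<le> ennreal e\<close> in simp)
    then show ?thesis by simp
  qed
  show "hausdorff_measure M d k A = 0" if h0: "hausdorff_content d k A = 0"
  proof -
    have pre: "hausdorff_premeasure M d k \<delta> A \<le> ennreal e" if "\<delta> > 0" "e > 0" for \<delta> e
    proof -
      \<comment> \<open>The first bound forces every diameter to be at most \<open>\<delta>\<close>,
        with the factor 1/2 making the contradiction strict; the second absorbs the normalizing
        factor.\<close>
      define e' where "e' = min ((\<delta>/2) ^ k) (e / (unit_ball_vol (real k) * (1/2) ^ k))"
      have e': "e' > 0" using that cpos by (simp add: e'_def)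
      then obtain C where C: "A \<subseteq> (\<Union>i::nat. C i)" "(\<Sum>i. ediameter d (C i) ^ k) < ennreal e'"
        using hausdorff_content_approx[of A "ennreal e'"] h0 by auto
      define C' where "C' i = C i \<inter> A" for i
      have C'le: "ediameter d (C' i) ^ k \<le> ediameter d (C i) ^ k" for i
        by (auto simp: C'_def intro!: power_mono ediameter_mono)
      have "(\<Sum>i. ediameter d (C' i) ^ k) \<le> (\<Sum>i. ediameter d (C i) ^ k)"
        by (intro suminf_le C'le) auto
      then have s: "(\<Sum>i. ediameter d (C' i) ^ k) \<le> ennreal e'" using C(2) by simp
      have diam: "ediameter d (C' i) \<le> ennreal \<delta>" for i
      proof (rule ccontr)
        assume "\<not> ?thesis"
        then have "ennreal \<delta> < ediameter d (C' i)" by simp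
        then have "ennreal \<delta> ^ k \<le> ediameter d (C' i) ^ k"
          by (intro power_mono) auto
        also have "\<dots> \<le> (\<Sum>i. ediameter d (C' i) ^ k)"
          using sum_le_suminf[of "\<lambda>i. ediameter d (C' i) ^ k" "{i}"] by simp
        also have "\<dots> \<le> ennreal e'" by (rule s)
        also have "\<dots> \<le> ennreal ((\<delta>/2) ^ k)"
          by (rule ennreal_leI) (simp add: e'_def)
        finally have "\<delta> ^ k \<le> (\<delta>/2) ^ k"
          using that by (simp add: ennreal_power)
        moreover have "(\<delta>/2) ^ k < \<delta> ^ k"
          using that k by (intro power_strict_mono) auto
        ultimately show False by simp
      qed
      have "hausdorff_premeasure M d k \<delta> A \<le> (\<Sum>i. ennreal (unit_ball_vol (real k)) * (ediameter d (C' i) / 2) ^ k)"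
        unfolding hausdorff_premeasure_def
      proof (rule Inf_lower, intro CollectI exI conjI allI)
        show "A \<subseteq> (\<Union>i. C' i)" using C(1) by (auto simp: C'_def)
        show "C' i \<subseteq> M" for i using A by (auto simp: C'_def)
      qed (use diam in simp_all)
      also have "\<dots> \<le> ?c * ennreal e'"
        unfolding scale by (intro mult_left_mono s) simp
      also have "\<dots> \<le> ?c * ennreal (e / (unit_ball_vol (real k) * (1/2) ^ k))"
        by (intro mult_left_mono ennreal_leI) (auto simp: e'_def)
      also have "\<dots> = ennreal e"
        unfolding c using that cpos by (simp add: vol_ne0 ennreal_mult[symmetric] del: power_one_over)
      finally show ?thesis .
    qed
    have "hausdorff_premeasure M d k \<delta> A \<le> 0" if "\<delta> > 0" for \<delta>
      by (rule ennreal_le_epsilon) (use pre[OF that] in simp)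
    then have "hausdorff_measure M d k A \<le> 0"
      unfolding hausdorff_measure_def by (intro SUP_least) auto
    then show ?thesis by simp
  qed
qed

end

section \<open>Estimating set functions by dyadic cubes\<close>

text \<open>The covering lemma of gauge integration supplies non-overlapping dyadic cubes, each
  inside the gauge neighbourhood of a point of \<open>S\<close> that it contains. Kept inside an
  open \<open>T\<close> barely larger than \<open>S\<close>, their volumes add up to at most that of
  \<open>T\<close>. Below, \<open>\<phi>\<close> is the Hausdorff content of an image, once for null
  sets and once for the tube estimate.\<close>

lemma cube_covering_le:
  fixes \<phi> :: "'a::euclidean_space set \<Rightarrow> ennreal"
  assumes sub: "\<And>A :: nat \<Rightarrow> 'a set. \<phi> (\<Union>n. A n) \<le> (\<Sum>n. \<phi> (A n))"
    and mono: "\<And>A B. A \<subseteq> B \<Longrightarrow> \<phi> A \<le> \<phi> B" and emp: "\<phi> {} = 0"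
    and S: "S \<in> sets lebesgue" "bounded S" and \<kappa>: "0 \<le> \<kappa>"
    and loc: "\<And>x. x \<in> S \<Longrightarrow> \<exists>r>0. \<forall>u v h. 0 < h \<longrightarrow> (\<forall>i\<in>Basis. v \<bullet> i - u \<bullet> i = h) \<longrightarrow> x \<in> cbox u v \<longrightarrow>
                 cbox u v \<subseteq> ball x r \<longrightarrow> \<phi> (cbox u v) \<le> ennreal (\<kappa> * h ^ DIM('a))"
  shows "\<phi> S \<le> ennreal \<kappa> * emeasure lebesgue S"
proof (rule ennreal_le_epsilon)
  fix e :: real assume "e > 0"
  define e' where "e' = e / (\<kappa> + 1)"
  have e': "e' > 0" using \<open>e > 0\<close> \<kappa> by (simp add: e'_def)
  obtain T where T: "open T" "S \<subseteq> T" "T - S \<in> lmeasurable" "emeasure lebesgue (T - S) < ennreal e'"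
    by (rule sets_lebesgue_outer_open[OF S(1) e'])
  from loc obtain r where r: "\<And>x. x \<in> S \<Longrightarrow> r x > 0"
    "\<And>x u v h. x \<in> S \<Longrightarrow> 0 < h \<Longrightarrow> (\<forall>i\<in>Basis. v \<bullet> i - u \<bullet> i = h) \<Longrightarrow> x \<in> cbox u v \<Longrightarrow>
                 cbox u v \<subseteq> ball x (r x) \<Longrightarrow> \<phi> (cbox u v) \<le> ennreal (\<kappa> * h ^ DIM('a))"
    by metis
  \<comment> \<open>On \<open>S\<close> the neighbourhood encodes both demands on a cube: smallness
    for \<open>loc\<close> and inclusion in \<open>T\<close>. Off \<open>S\<close> a gauge still
    needs a value, but cubes are tagged only by points of \<open>S\<close>.\<close>
  define g where "g x = (if x \<in> S then ball x (r x) \<inter> T else ball x 1)" for x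
  have g: "gauge g" using r(1) T(1,2) by (auto simp: gauge_def g_def)
  obtain B where B: "B > 0" "\<And>x. x \<in> S \<Longrightarrow> norm x \<le> B"
    using S(2) by (auto simp: bounded_pos)
  \<comment> \<open>Starting from a cube makes all dyadic parts cubes, with side
    \<open>2 * B / 2 ^ m\<close>.\<close>
  define b where "b = B *\<^sub>R (One :: 'a)"
  have bi: "b \<bullet> i = B" if "i \<in> Basis" for i using that by (simp add: b_def)
  have Sb: "S \<subseteq> cbox (- b) b"
  proof
    fix x assume "x \<in> S"
    then have "\<bar>x \<bullet> i\<bar> \<le> B" if "i \<in> Basis" for i
      using B(2)[of x] Basis_le_norm[OF that, of x] by linarith
    then show "x \<in> cbox (- b) b" by (force simp: mem_box bi abs_le_iff)
  qed
  have ne: "box (- b) b \<noteq> {}" using B(1) by (simp add: box_ne_empty bi)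
  obtain D where D: "countable D" "\<Union>D \<subseteq> cbox (- b) b"
    "\<And>K. K \<in> D \<Longrightarrow> interior K \<noteq> {} \<and> (\<exists>c d. K = cbox c d)"
    "pairwise (\<lambda>A B. interior A \<inter> interior B = {}) D"
    "\<And>K. K \<in> D \<Longrightarrow> \<exists>x \<in> S \<inter> K. K \<subseteq> g x"
    "\<And>u v. cbox u v \<in> D \<Longrightarrow> \<exists>n. \<forall>i \<in> Basis. v \<bullet> i - u \<bullet> i = (b \<bullet> i - (- b) \<bullet> i) / 2^n"
    "S \<subseteq> \<Union>D"
    by (rule covering_lemma[OF Sb ne g]) (rule that; assumption)
  define K where "K n = (if n \<in> to_nat_on D ` D then from_nat_into D n else {})" for n
  have KD: "K n \<in> D \<or> K n = {}" for n
    by (auto simp: K_def D(1))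
  have Dsub: "\<Union>D \<subseteq> (\<Union>n. K n)"
  proof
    fix x assume "x \<in> \<Union>D"
    then obtain J where J: "J \<in> D" "x \<in> J" by blast
    then have "x \<in> K (to_nat_on D J)" by (simp add: K_def D(1))
    then show "x \<in> (\<Union>n. K n)" by blast
  qed
  have disj: "disjoint_family (\<lambda>n. interior (K n))"
    unfolding disjoint_family_on_def
  proof (intro ballI impI)
    fix m n :: nat assume "m \<noteq> n"
    show "interior (K m) \<inter> interior (K n) = {}"
    proof (cases "m \<in> to_nat_on D ` D \<and> n \<in> to_nat_on D ` D")
      case True
      then have "K m \<in> D" "K n \<in> D" "K m \<noteq> K n"
        using \<open>m \<noteq> n\<close> D(1) by (auto simp: K_def)
      then show ?thesis using D(4) by (auto simp: pairwise_def)
    qed (auto simp: K_def)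
  qed
  have le: "\<phi> (K n) \<le> ennreal \<kappa> * emeasure lebesgue (interior (K n))" for n
  proof (cases "K n = {}")
    case False
    then have KnD: "K n \<in> D" using KD by blast
    then obtain u v where uv: "K n = cbox u v" using D(3) by blast
    obtain m where m: "\<And>i. i \<in> Basis \<Longrightarrow> v \<bullet> i - u \<bullet> i = (b \<bullet> i - (- b) \<bullet> i) / 2^m"
      using D(6)[of u v] KnD uv by auto
    define h where "h = 2 * B / 2 ^ m"
    have h: "h > 0" "\<forall>i\<in>Basis. v \<bullet> i - u \<bullet> i = h" using m B(1) by (auto simp: h_def bi)
    obtain x where x: "x \<in> S" "x \<in> K n" "K n \<subseteq> g x" using D(5)[OF KnD] by blast
    have "\<phi> (cbox u v) \<le> ennreal (\<kappa> * h ^ DIM('a))"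
      using x uv by (intro r(2)[OF x(1) h]) (auto simp: g_def)
    also have "\<dots> = ennreal \<kappa> * ennreal (h ^ DIM('a))"
      using \<kappa> h by (simp add: ennreal_mult)
    also have "ennreal (h ^ DIM('a)) = emeasure lborel (box u v)"
    proof -
      have "(\<Prod>i\<in>Basis. (v - u) \<bullet> i) = (\<Prod>i\<in>(Basis::'a set). h)"
        using h by (intro prod.cong) (auto simp: inner_diff_left)
      moreover have "u \<bullet> i \<le> v \<bullet> i" if "i \<in> Basis" for i using h that by (metis diff_ge_0_iff_ge less_imp_le)
      ultimately show ?thesis by (simp add: emeasure_lborel_box)
    qed
    finally show ?thesis by (simp add: uv interior_cbox)
  qed (simp add: emp)
  have "\<phi> S \<le> \<phi> (\<Union>n. K n)" using D(7) Dsub by (intro mono) auto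
  also have "\<dots> \<le> (\<Sum>n. \<phi> (K n))" by (rule sub)
  also have "\<dots> \<le> (\<Sum>n. ennreal \<kappa> * emeasure lebesgue (interior (K n)))"
    by (intro suminf_le le) auto
  also have "\<dots> = ennreal \<kappa> * (\<Sum>n. emeasure lebesgue (interior (K n)))" by simp
  also have "(\<Sum>n. emeasure lebesgue (interior (K n))) = emeasure lebesgue (\<Union>n. interior (K n))"
    by (rule suminf_emeasure[OF _ disj]) auto
  also have "\<dots> \<le> emeasure lebesgue T"
  proof (rule emeasure_mono)
    show "(\<Union>n. interior (K n)) \<subseteq> T"
    proof (rule UN_least)
      fix n
      have "K n \<subseteq> T"
        using KD[of n] D(5)[of "K n"] by (fastforce simp: g_def)
      then show "interior (K n) \<subseteq> T" using interior_subset by blast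
    qed
  qed (use T in simp)
  also have "emeasure lebesgue T \<le> emeasure lebesgue S + emeasure lebesgue (T - S)"
    using emeasure_subadditive[of S lebesgue "T - S"] S(1) T by (simp add: Un_absorb1 fmeasurableD)
  also have "\<dots> \<le> emeasure lebesgue S + ennreal e'"
    using T(4) by (intro add_left_mono less_imp_le)
  finally have "\<phi> S \<le> ennreal \<kappa> * emeasure lebesgue S + ennreal \<kappa> * ennreal e'"
    by (simp add: distrib_left mult_left_mono)
  also have "ennreal \<kappa> * ennreal e' \<le> ennreal e"
    using \<kappa> \<open>e > 0\<close> by (simp add: e'_def ennreal_mult[symmetric] field_simps ennreal_leI)
  finally show "\<phi> S \<le> ennreal \<kappa> * emeasure lebesgue S + ennreal e"
    by (simp add: add_left_mono)
qed

section \<open>Approximate derivatives of Lipschitz maps\<close>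

abbreviation edist :: "'a::metric_space \<Rightarrow> 'a \<Rightarrow> ennreal" where
  "edist \<equiv> \<lambda>x y. ennreal (dist x y)"

text \<open>The difference \<open>M\<close> of the two derivatives is \<open>o(norm (z - x))\<close>
  at \<open>z - x\<close> for \<open>z\<close> in \<open>E\<close>. Near \<open>x + t u\<close>
  there is such a \<open>z\<close>, for any direction \<open>u\<close>, because \<open>x\<close> is
  a density point; so \<open>M u\<close> is arbitrarily small. This gives the definite description
  in \<open>ap_D\<close> its meaning.\<close>

lemma has_derivative_within_unique_at_density_point:
  fixes f :: "'a::euclidean_space \<Rightarrow> 'b::real_normed_vector"
  assumes E: "E \<in> sets lebesgue" and x: "density_point E x"
    and D: "(f has_derivative D1) (at x within E)" "(f has_derivative D2) (at x within E)"
  shows "D1 = D2"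
proof -
  define M where "M v = D1 v - D2 v" for v
  have der: "((\<lambda>y. 0) has_derivative M) (at x within E)"
    using has_derivative_diff[OF D] by (simp add: M_def[abs_def])
  then have M: "bounded_linear M" by (rule has_derivative_bounded_linear)
  then have lin: "linear M" by (rule bounded_linear.linear)
  obtain B where B: "B > 0" "\<And>v. norm (M v) \<le> norm v * B"
    using bounded_linear.pos_bounded[OF M] by blast
  have le: "norm (M u) \<le> e" if "e > 0" for u e
  proof (cases "u = 0")
    case False
    then have u: "norm u > 0" by simp
    \<comment> \<open>Since \<open>norm (z - x)\<close> will be at most
      \<open>2 * t * norm u\<close>, this spends half of the budget \<open>t * e\<close>;
      \<open>\<eta>\<close> spends the other half through the bound \<open>B\<close> for
      \<open>M\<close>.\<close>
    define \<epsilon> where "\<epsilon> = e / (4 * norm u)"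
    have "\<epsilon> > 0" using \<open>e > 0\<close> u by (simp add: \<epsilon>_def)
    then obtain d where d: "d > 0" "\<And>y. y \<in> E \<Longrightarrow> norm (y - x) < d \<Longrightarrow> norm (M (y - x)) \<le> \<epsilon> * norm (y - x)"
      using der unfolding has_derivative_within_alt by (auto simp: norm_minus_commute)
    define \<eta> where "\<eta> = min 1 (e / (2 * B * norm u))"
    have \<eta>: "0 < \<eta>" "\<eta> \<le> 1" using \<open>e > 0\<close> u B by (auto simp: \<eta>_def)
    obtain d' where d': "d' > 0" "\<And>y. dist y x < d' \<Longrightarrow> y \<noteq> x \<Longrightarrow> \<exists>z\<in>E. dist z y < \<eta> * dist y x"
      using density_point_near[OF E x \<eta>] by blast
    define t where "t = min d d' / (4 * norm u)"
    have t: "t > 0" using d(1) d'(1) u by (simp add: t_def)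
    have tu: "t * norm u \<le> d / 4" "t * norm u \<le> d' / 4" using u by (auto simp: t_def)
    define y where "y = x + t *\<^sub>R u"
    have yx: "dist y x = t * norm u" using t by (simp add: y_def dist_norm)
    obtain z where z: "z \<in> E" "dist z y < \<eta> * dist y x"
      using d'(2)[of y] tu d'(1) t u yx by (force simp: y_def)
    have "\<eta> * dist y x \<le> 1 * dist y x" using \<eta> by (intro mult_right_mono) auto
    then have zx: "norm (z - x) \<le> 2 * (t * norm u)"
      using z(2) dist_triangle[of z x y] yx by (simp add: dist_norm)
    have "norm (M (z - x)) \<le> \<epsilon> * norm (z - x)"
      using zx tu d(1) by (intro d(2) z) linarith
    also have "\<dots> \<le> \<epsilon> * (2 * (t * norm u))" using zx \<open>\<epsilon> > 0\<close> by (intro mult_left_mono) auto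
    also have "\<dots> = t * (e / 2)" using u by (simp add: \<epsilon>_def)
    finally have 1: "norm (M (z - x)) \<le> t * (e / 2)" .
    have "norm (M (y - z)) \<le> norm (y - z) * B" by (rule B)
    also have "\<dots> \<le> (\<eta> * (t * norm u)) * B"
      using z(2) B yx by (intro mult_right_mono) (auto simp: dist_norm norm_minus_commute)
    also have "\<dots> \<le> (e / (2 * B * norm u) * (t * norm u)) * B"
      using B t by (intro mult_right_mono) (auto simp: \<eta>_def)
    also have "\<dots> = t * (e / 2)" using u B by simp
    finally have 2: "norm (M (y - z)) \<le> t * (e / 2)" .
    have "t * norm (M u) = norm (M (t *\<^sub>R u))"
      using t by (simp add: linear_scale[OF lin])
    also have "t *\<^sub>R u = (z - x) + (y - z)" by (simp add: y_def)
    also have "norm (M \<dots>) \<le> norm (M (z - x)) + norm (M (y - z))"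
      by (simp only: linear_add[OF lin] norm_triangle_ineq)
    also have "\<dots> \<le> t * e" using 1 2 by simp
    finally show ?thesis using t by simp
  qed (use that linear_0[OF lin] in simp)
  have "M u = 0" for u
    using le[of "norm (M u) / 2" u] by (cases "M u = 0") auto
  then show ?thesis by (auto simp: M_def)
qed

text \<open>A limit along a set \<open>S\<close> of density 1 becomes a limit within
  \<open>E\<close>: a point \<open>z\<close> of \<open>S\<close> near \<open>y\<close> replaces
  \<open>y\<close>, at a cost controlled by the Lipschitz constant of \<open>h\<close> and the bound
  \<open>B\<close> of \<open>D\<close>.\<close>

lemma has_derivative_within_density_extend:
  fixes h :: "'a::euclidean_space \<Rightarrow> real"
  assumes S: "S \<in> sets lebesgue" "S \<subseteq> E" "density_point S x" and x: "x \<in> E"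
    and lip: "L-lipschitz_on (E \<inter> ball x \<rho>) h" and "\<rho> > 0" and D: "linear D"
    and lim: "((\<lambda>y. (h y - h x - D (y - x)) / norm (y - x)) \<longlongrightarrow> 0) (at x within S)"
  shows "(h has_derivative D) (at x within E)"
  unfolding has_derivative_within_alt
proof (intro conjI allI impI)
  show bl: "bounded_linear D" using D by (simp add: linear_conv_bounded_linear)
  have L: "L \<ge> 0" using lip by (rule lipschitz_on_nonneg)
  obtain B where B: "B > 0" "\<And>v. norm (D v) \<le> norm v * B"
    using bounded_linear.pos_bounded[OF bl] by blast
  fix e :: real assume "e > 0"
  have "\<forall>\<^sub>F z in at x within S. dist ((h z - h x - D (z - x)) / norm (z - x)) 0 < e / 4"
    by (rule tendstoD[OF lim]) (use \<open>e > 0\<close> in simp)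
  then obtain d where d: "d > 0" "\<And>z. z \<in> S \<Longrightarrow> z \<noteq> x \<Longrightarrow> dist z x < d \<Longrightarrow> \<bar>(h z - h x - D (z - x)) / norm (z - x)\<bar> < e / 4"
    unfolding eventually_at dist_real_def diff_0_right by blast
  \<comment> \<open>The bound \<open>1/2\<close> keeps \<open>z\<close> different from
    \<open>x\<close>, where the quotient is not controlled; the other one makes
    \<open>(L + B) * \<eta>\<close> at most \<open>e / 2\<close>.\<close>
  define \<eta> where "\<eta> = min (1/2) (e / (2 * (L + B)))"
  have "\<eta> \<le> 1/2" unfolding \<eta>_def by (rule min.cobounded1)
  moreover have "0 < \<eta>" using \<open>e > 0\<close> L B by (simp add: \<eta>_def)
  ultimately have \<eta>: "0 < \<eta>" "\<eta> \<le> 1" "\<eta> \<le> 1/2" by simp_all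
  have \<eta>2: "(L + B) * \<eta> \<le> e / 2"
  proof -
    have "(L + B) * \<eta> \<le> (L + B) * (e / (2 * (L + B)))"
      using L B by (intro mult_left_mono) (auto simp: \<eta>_def)
    also have "\<dots> = e / 2" using L B by (simp add: field_simps)
    finally show ?thesis .
  qed
  obtain d' where d': "d' > 0" "\<And>y. dist y x < d' \<Longrightarrow> y \<noteq> x \<Longrightarrow> \<exists>z\<in>S. dist z y < \<eta> * dist y x"
    using density_point_near[OF S(1,3) \<eta>(1,2)] by blast
  show "\<exists>d>0. \<forall>y\<in>E. norm (y - x) < d \<longrightarrow> norm (h y - h x - D (y - x)) \<le> e * norm (y - x)"
  proof (intro exI[of _ "min (min d d') \<rho> / 2"] conjI ballI impI)
    fix y assume y: "y \<in> E" "norm (y - x) < min (min d d') \<rho> / 2"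
    show "norm (h y - h x - D (y - x)) \<le> e * norm (y - x)"
    proof (cases "y = x")
      case True then show ?thesis using linear_0[OF D] by simp
    next
      case False
      let ?r = "norm (y - x)"
      have r: "?r > 0" "?r < d / 2" "?r < d' / 2" "?r < \<rho> / 2" using False y(2) by auto
      obtain z where z: "z \<in> S" "dist z y < \<eta> * dist y x"
        using d'(2)[of y] False r d'(1) by (auto simp: dist_norm)
      have "\<eta> * ?r \<le> 1/2 * ?r" using \<eta> by (intro mult_right_mono) auto
      moreover have "norm (z - y) < \<eta> * ?r" using z(2) by (simp add: dist_norm)
      ultimately have zy: "norm (z - y) < ?r" "norm (z - y) \<le> \<eta> * ?r" using r(1) by linarith+
      have zx: "norm (z - x) \<le> 2 * ?r" "z \<noteq> x"
        using zy norm_triangle_ineq[of "z - y" "y - x"] by (auto simp: norm_minus_commute)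
      have "\<bar>(h z - h x - D (z - x)) / norm (z - x)\<bar> < e / 4"
        using zx r by (intro d(2) z) (auto simp: dist_norm)
      then have "\<bar>h z - h x - D (z - x)\<bar> \<le> e / 4 * norm (z - x)"
        using zx(2) by (simp add: field_simps)
      also have "\<dots> \<le> e / 4 * (2 * ?r)" using zx \<open>e > 0\<close> by (intro mult_left_mono) auto
      finally have 1: "\<bar>h z - h x - D (z - x)\<bar> \<le> e / 2 * ?r" by simp
      have "dist x y = ?r" "dist x z = norm (z - x)"
        by (simp_all add: dist_norm norm_minus_commute)
      then have "dist x y < \<rho>" "dist x z < \<rho>"
        using zx(1) r by linarith+
      then have "\<bar>h y - h z\<bar> \<le> L * dist y z"
        using lipschitz_onD[OF lip, of y z] y(1) z(1) S(2) by (auto simp: dist_real_def)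
      also have "\<dots> \<le> L * (\<eta> * ?r)" using L zy by (intro mult_left_mono) (auto simp: dist_norm norm_minus_commute)
      finally have 2: "\<bar>h y - h z\<bar> \<le> L * (\<eta> * ?r)" .
      have "\<bar>D (z - y)\<bar> \<le> norm (z - y) * B" using B(2)[of "z - y"] by simp
      also have "\<dots> \<le> (\<eta> * ?r) * B" using B zy by (intro mult_right_mono) auto
      finally have 3: "\<bar>D (z - y)\<bar> \<le> (\<eta> * ?r) * B" .
      have "D (z - x) = D (z - y) + D (y - x)"
        using linear_add[OF D, of "z - y" "y - x"] by simp
      then have "\<bar>h y - h x - D (y - x)\<bar> \<le> e / 2 * ?r + L * (\<eta> * ?r) + (\<eta> * ?r) * B"
        using 1 2 3 by linarith
      also have "\<dots> = e / 2 * ?r + ((L + B) * \<eta>) * ?r" by (simp add: algebra_simps)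
      also have "\<dots> \<le> e / 2 * ?r + e / 2 * ?r"
        using \<eta>2 by (intro add_left_mono mult_right_mono) auto
      finally show ?thesis by simp
    qed
  qed (use d d' \<open>\<rho> > 0\<close> in auto)
qed

lemma has_ap_derivativeI:
  assumes "E \<in> sets lebesgue" "x \<in> E" "density_point E x" "(h has_derivative D) (at x within E)"
  shows "has_ap_derivative h D E x"
  unfolding has_ap_derivative_def
proof (intro conjI exI[of _ E])
  show "linear D" using assms(4) has_derivative_linear by blast
  show "((\<lambda>y. (h y - h x - D (y - x)) / norm (y - x)) \<longlongrightarrow> 0) (at x within E)"
    using assms(4) unfolding has_derivative_within
    by (auto elim!: Lim_transform_eventually simp: eventually_at_filter divide_inverse algebra_simps)
qed (use assms in auto)

context
  fixes f :: "'a::euclidean_space \<Rightarrow> real ^ 'n" and E :: "'a set" and L \<rho> :: real and x :: 'a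
  assumes E: "E \<in> sets lebesgue" and x: "x \<in> E" "density_point E x"
    and lip: "L-lipschitz_on (E \<inter> ball x \<rho>) f" and \<rho>: "\<rho> > 0"
begin

lemma lipschitz_component: "L-lipschitz_on (E \<inter> ball x \<rho>) (\<lambda>y. f y $ j)"
proof (rule lipschitz_onI)
  fix y z assume "y \<in> E \<inter> ball x \<rho>" "z \<in> E \<inter> ball x \<rho>"
  then have "dist (f y) (f z) \<le> L * dist y z" by (rule lipschitz_onD[OF lip])
  then show "dist (f y $ j) (f z $ j) \<le> L * dist y z"
    using dist_vec_nth_le[of "f y" j "f z"] by linarith
qed (rule lipschitz_on_nonneg[OF lip])

text \<open>At such density points the approximate derivative is just a derivative within
  \<open>E\<close>, one direction with \<open>E\<close> itself as the set of density 1. Condition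
  (3) is handled in this form from here on.\<close>

lemma has_ap_derivative_iff:
  "has_ap_derivative (\<lambda>y. f y $ j) D E x \<longleftrightarrow> ((\<lambda>y. f y $ j) has_derivative D) (at x within E)"
  using has_ap_derivativeI[OF E x] has_derivative_within_density_extend[OF _ _ _ x(1) lipschitz_component \<rho>]
  unfolding has_ap_derivative_def by blast

lemma has_derivative_vec_iff:
  "(f has_derivative D) (at x within E) \<longleftrightarrow> (\<forall>j. ((\<lambda>y. f y $ j) has_derivative (\<lambda>v. D v $ j)) (at x within E))"
  unfolding has_derivative_componentwise_within[of f] Basis_vec_def
  by (auto simp: inner_axis)

lemma ap_differentiable_iff: "ap_differentiable f E x \<longleftrightarrow> (\<exists>D. (f has_derivative D) (at x within E))"
proof
  assume "ap_differentiable f E x"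
  then have "\<forall>j. \<exists>D. ((\<lambda>y. f y $ j) has_derivative D) (at x within E)"
    unfolding ap_differentiable_def has_ap_derivative_iff .
  then obtain D where "\<And>j. ((\<lambda>y. f y $ j) has_derivative D j) (at x within E)" by metis
  then have "(f has_derivative (\<lambda>v. \<chi> j. D j v)) (at x within E)"
    unfolding has_derivative_vec_iff by simp
  then show "\<exists>D. (f has_derivative D) (at x within E)" by blast
next
  assume "\<exists>D. (f has_derivative D) (at x within E)"
  then show "ap_differentiable f E x"
    unfolding ap_differentiable_def has_ap_derivative_iff has_derivative_vec_iff by blast
qed

lemma ap_D_eq:
  assumes "(f has_derivative D) (at x within E)"
  shows "ap_D f E x = D"
proof -
  have "(THE L. has_ap_derivative (\<lambda>y. f y $ j) L E x) = (\<lambda>v. D v $ j)" for j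
    unfolding has_ap_derivative_iff
  proof (rule the_equality)
    show *: "((\<lambda>y. f y $ j) has_derivative (\<lambda>v. D v $ j)) (at x within E)"
      using assms unfolding has_derivative_vec_iff by blast
    show "L = (\<lambda>v. D v $ j)" if "((\<lambda>y. f y $ j) has_derivative L) (at x within E)" for L
      using has_derivative_within_unique_at_density_point[OF E x(2) that *] .
  qed
  then show ?thesis unfolding ap_D_def by (simp add: vec_eq_iff fun_eq_iff)
qed

end

section \<open>Points of full rank\<close>

text \<open>The inverse map is \<open>c\<close>-Lipschitz, so a covering of the image pulls back to
  a covering of \<open>W\<close> by balls whose radii are \<open>c\<close> times the diameters, with
  total volume as small as desired.\<close>

lemma negligible_if_image_hausdorff_null:
  fixes f :: "'a::euclidean_space \<Rightarrow> 'b::metric_space"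
  assumes c: "c > 0" and lo: "\<And>x y. x \<in> W \<Longrightarrow> y \<in> W \<Longrightarrow> dist x y \<le> c * dist (f x) (f y)"
    and null: "hausdorff_content edist DIM('a) (f ` W) = 0"
  shows "negligible W"
  unfolding negligible_outer_le
proof (intro allI impI)
  fix e :: real assume "e > 0"
  let ?k = "DIM('a)"
  let ?\<omega> = "measure lebesgue (ball (0::'a) 1)"
  have \<omega>: "?\<omega> > 0" using content_ball_pos[of 1 "0::'a"] by simp
  have k1: "?k \<ge> 1" by (simp add: DIM_ge_Suc0)
  define e' where "e' = e / ((2 * c) ^ ?k * ?\<omega>)"
  have e': "e' > 0" using \<open>e > 0\<close> c \<omega> by (simp add: e'_def)
  obtain C where C: "f ` W \<subseteq> (\<Union>i::nat. C i)" "(\<Sum>i. ediameter edist (C i) ^ ?k) < ennreal e'"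
    using hausdorff_content_approx[OF k1, of edist "f ` W" "ennreal e'"] null e' by auto
  define r where "r i = enn2real (ediameter edist (C i))" for i
  have fin: "ediameter edist (C i) = ennreal (r i)" for i
  proof -
    have "ediameter edist (C i) ^ ?k \<le> (\<Sum>i. ediameter edist (C i) ^ ?k)"
      using sum_le_suminf[of "\<lambda>i. ediameter edist (C i) ^ ?k" "{i}"] by simp
    also have "\<dots> < top" using C(2) ennreal_less_top by (rule order.strict_trans)
    finally have "ediameter edist (C i) \<noteq> top" using k1 by (auto simp: power_eq_top_ennreal)
    then show ?thesis by (simp add: r_def less_top)
  qed
  have r0: "0 \<le> r i" for i by (simp add: r_def)
  \<comment> \<open>Centred at any point of \<open>W\<close> mapped into \<open>C i\<close>. Closed
    balls, since the diameter \<open>r i\<close> may be 0.\<close>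
  define B where "B i = (if W \<inter> f -` C i = {} then {} else cball (SOME x. x \<in> W \<inter> f -` C i) (c * r i))" for i
  have Bm: "B i \<in> lmeasurable" for i by (simp add: B_def)
  have mB: "emeasure lebesgue (B i) \<le> ennreal (c ^ ?k * ?\<omega> * r i ^ ?k)" for i
  proof (cases "W \<inter> f -` C i = {}")
    case False
    let ?x = "SOME x. x \<in> W \<inter> f -` C i"
    have "emeasure lebesgue (B i) = ennreal (measure lebesgue (B i))"
      using emeasure_eq_measure2[OF Bm[of i]] .
    also have "measure lebesgue (B i) = (c * r i) ^ ?k * ?\<omega>"
      using False content_ball_conv_unit_ball[of "c * r i" ?x] c r0[of i]
      by (simp add: B_def content_cball_conv_ball)
    finally show ?thesis by (simp add: power_mult_distrib ac_simps)
  qed (simp add: B_def)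
  have sub: "W \<subseteq> (\<Union>i. B i)"
  proof
    fix x assume x: "x \<in> W"
    then obtain i where i: "f x \<in> C i" using C(1) by blast
    then have ne: "x \<in> W \<inter> f -` C i" using x by simp
    let ?x = "SOME x. x \<in> W \<inter> f -` C i"
    have sx: "?x \<in> W \<inter> f -` C i" using ne by (rule someI)
    have "ennreal (dist (f ?x) (f x)) \<le> ennreal (r i)"
      unfolding fin[symmetric] using sx i by (intro ediameter_upper) auto
    then have "dist (f ?x) (f x) \<le> r i" using r0 by (simp add: ennreal_le_iff)
    then have "dist ?x x \<le> c * r i"
      using lo[of ?x x] sx x c by (meson IntD1 less_imp_le mult_left_mono order_trans)
    then have "x \<in> B i" using ne by (auto simp: B_def)
    then show "x \<in> (\<Union>i. B i)" by blast
  qed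
  have "emeasure lebesgue (\<Union>i. B i) \<le> (\<Sum>i. emeasure lebesgue (B i))"
    using Bm by (intro emeasure_subadditive_countably) auto
  also have "\<dots> \<le> (\<Sum>i. ennreal (c ^ ?k * ?\<omega>) * ediameter edist (C i) ^ ?k)"
    using mB r0 c \<omega> by (intro suminf_le) (auto simp: fin ennreal_power ennreal_mult[symmetric])
  also have "\<dots> = ennreal (c ^ ?k * ?\<omega>) * (\<Sum>i. ediameter edist (C i) ^ ?k)" by simp
  also have "\<dots> \<le> ennreal (c ^ ?k * ?\<omega>) * ennreal e'"
    using C(2) by (intro mult_left_mono) auto
  also have "\<dots> = ennreal (c ^ ?k * ?\<omega> * e')" using c \<omega> e' by (simp add: ennreal_mult)
  also have "\<dots> \<le> ennreal e"
    using c \<omega> \<open>e > 0\<close> by (intro ennreal_leI) (simp add: e'_def field_simps power_mult_distrib)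
  finally have em: "emeasure lebesgue (\<Union>i. B i) \<le> ennreal e" .
  have lm: "(\<Union>i. B i) \<in> lmeasurable"
    using em Bm by (intro fmeasurableI) (auto simp: le_less_trans[OF _ ennreal_less_top])
  show "\<exists>T. W \<subseteq> T \<and> T \<in> lmeasurable \<and> measure lebesgue T \<le> e"
    using sub lm em \<open>e > 0\<close> by (intro exI[of _ "\<Union>i. B i"]) (simp add: emeasure_eq_measure2)
qed

text \<open>An injective derivative is bounded below, so each such point lies in some
  \<open>W j\<close>, where \<open>f\<close> shrinks distances at most by the factor
  \<open>Suc j\<close> at scales below \<open>1 / Suc j\<close>. Within a ball of half that radius
  this holds for any two points of \<open>W j\<close>, and the previous lemma applies.\<close>

lemma negligible_full_rank_points:
  fixes f :: "'a::euclidean_space \<Rightarrow> 'b::euclidean_space"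
  assumes null: "hausdorff_content edist DIM('a) (f ` E) = 0"
  shows "negligible {x\<in>E. \<exists>D. (f has_derivative D) (at x within E) \<and> inj D}"
proof -
  define W where "W j = {x\<in>E. \<forall>y\<in>E. dist x y < inverse (real (Suc j)) \<longrightarrow> dist x y \<le> real (Suc j) * dist (f x) (f y)}" for j
  have "negligible (W j)" for j
    unfolding locally_negligible_alt[of "W j"]
  proof
    fix x assume x: "x \<in> W j"
    let ?U = "W j \<inter> ball x (inverse (real (Suc j)) / 2)"
    have "negligible ?U"
    proof (rule negligible_if_image_hausdorff_null)
      show "hausdorff_content edist DIM('a) (f ` ?U) = 0"
        using hausdorff_content_mono[of "DIM('a)" "f ` ?U" "f ` E" edist] null
        by (force simp: W_def DIM_ge_Suc0)
      show "real (Suc j) > 0" by simp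
      show "dist y z \<le> real (Suc j) * dist (f y) (f z)" if "y \<in> ?U" "z \<in> ?U" for y z
      proof -
        have "dist y z < inverse (real (Suc j))"
          using that dist_triangle3[of y z x] by simp
        then show ?thesis using that by (simp add: W_def)
      qed
    qed
    then show "\<exists>U. openin (top_of_set (W j)) U \<and> x \<in> U \<and> negligible U"
      using x by (intro exI[of _ ?U]) (auto simp: openin_open_Int)
  qed
  then have neg: "negligible (\<Union>j. W j)" by (rule negligible_Union_nat)
  show ?thesis
  proof (rule negligible_subset[OF neg], clarify)
    fix x D assume x: "x \<in> E" and D: "(f has_derivative D) (at x within E)" "inj D"
    obtain B where B: "B > 0" "\<And>v. B * norm v \<le> norm (D v)"
      using linear_inj_bounded_below_pos[OF has_derivative_linear[OF D(1)] D(2)] by blast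
    obtain d where d: "d > 0" "\<And>y. y \<in> E \<Longrightarrow> norm (y - x) < d \<Longrightarrow> norm (f y - f x - D (y - x)) \<le> B / 2 * norm (y - x)"
      using D(1) B(1) unfolding has_derivative_within_alt by (meson half_gt_zero)
    obtain j where j: "inverse (real (Suc j)) < min d (B / 2)"
      using reals_Archimedean[of "min d (B / 2)"] d(1) B(1) by auto
    have "x \<in> W j"
      unfolding W_def
    proof (intro CollectI conjI ballI impI)
      fix y assume y: "y \<in> E" "dist x y < inverse (real (Suc j))"
      have "norm (f y - f x - D (y - x)) \<le> B / 2 * norm (y - x)"
        using y j by (intro d(2)) (auto simp: dist_norm norm_minus_commute)
      moreover have "norm (D (y - x)) \<le> norm (f y - f x) + norm (f y - f x - D (y - x))"
        using norm_triangle_ineq4[of "f y - f x" "f y - f x - D (y - x)"] by simp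
      ultimately have "B / 2 * norm (y - x) \<le> norm (f y - f x)"
        using B(2)[of "y - x"] by (simp add: field_simps)
      moreover have "inverse (real (Suc j)) * norm (y - x) \<le> B / 2 * norm (y - x)"
        using j by (intro mult_right_mono) auto
      ultimately have "inverse (real (Suc j)) * norm (y - x) \<le> norm (f y - f x)" by linarith
      then show "dist x y \<le> real (Suc j) * dist (f x) (f y)"
        by (simp add: dist_norm norm_minus_commute field_simps del: of_nat_Suc)
    qed (rule x)
    then show "x \<in> (\<Union>j. W j)" by blast
  qed
qed

section \<open>Absolutely continuous and horizontal curves\<close>

text \<open>Absolute continuity with curried premises, so that its body can be used as a rule
  through \<open>rule_format\<close>.\<close>

lemma abs_continuous_curveD:
  assumes "abs_continuous_curve a b \<gamma>" "e > 0"
  shows "\<exists>d>0. \<forall>I. finite I \<longrightarrow> (\<forall>u v. (u, v) \<in> I \<longrightarrow> a \<le> u \<and> u \<le> v \<and> v \<le> b) \<longrightarrow>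
       disjoint_family_on (\<lambda>(u, v). {u<..<v}) I \<longrightarrow> (\<Sum>(u, v)\<in>I. v - u) < d \<longrightarrow> (\<Sum>(u, v)\<in>I. dist (\<gamma> u) (\<gamma> v)) < e"
proof -
  from assms obtain d where d: "d > 0" "\<forall>I. finite I \<and> (\<forall>(u, v)\<in>I. a \<le> u \<and> u \<le> v \<and> v \<le> b) \<and>
       disjoint_family_on (\<lambda>(u, v). {u<..<v}) I \<and> (\<Sum>(u, v)\<in>I. v - u) < d \<longrightarrow> (\<Sum>(u, v)\<in>I. dist (\<gamma> u) (\<gamma> v)) < e"
    unfolding abs_continuous_curve_def by (elim allE[of _ e] impE) auto
  show ?thesis
  proof (intro exI[of _ d] conjI allI impI)
    fix I :: "(real \<times> real) set"
    assume "finite I" "\<forall>u v. (u, v) \<in> I \<longrightarrow> a \<le> u \<and> u \<le> v \<and> v \<le> b"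
       "disjoint_family_on (\<lambda>(u, v). {u<..<v}) I" "(\<Sum>(u, v)\<in>I. v - u) < d"
    then show "(\<Sum>(u, v)\<in>I. dist (\<gamma> u) (\<gamma> v)) < e"
      by (intro d(2)[rule_format] conjI ballI) auto
  qed (rule d)
qed

lemma abs_continuous_curveI:
  assumes "\<And>e. e > 0 \<Longrightarrow> \<exists>d>0. \<forall>I. finite I \<longrightarrow> (\<forall>u v. (u, v) \<in> I \<longrightarrow> a \<le> u \<and> u \<le> v \<and> v \<le> b) \<longrightarrow>
       disjoint_family_on (\<lambda>(u, v). {u<..<v}) I \<longrightarrow> (\<Sum>(u, v)\<in>I. v - u) < d \<longrightarrow> (\<Sum>(u, v)\<in>I. dist (\<gamma> u) (\<gamma> v)) < e"
  shows "abs_continuous_curve a b \<gamma>"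
  unfolding abs_continuous_curve_def
proof (intro allI impI)
  fix e :: real assume "e > 0"
  from assms[OF this] obtain d where d: "d > 0" "\<forall>I. finite I \<longrightarrow> (\<forall>u v. (u, v) \<in> I \<longrightarrow> a \<le> u \<and> u \<le> v \<and> v \<le> b) \<longrightarrow>
       disjoint_family_on (\<lambda>(u, v). {u<..<v}) I \<longrightarrow> (\<Sum>(u, v)\<in>I. v - u) < d \<longrightarrow> (\<Sum>(u, v)\<in>I. dist (\<gamma> u) (\<gamma> v)) < e"
    by (elim exE conjE)
  show "\<exists>\<delta>>0. \<forall>I. finite I \<and> (\<forall>(u, v)\<in>I. a \<le> u \<and> u \<le> v \<and> v \<le> b) \<and>
       disjoint_family_on (\<lambda>(u, v). {u<..<v}) I \<and> (\<Sum>(u, v)\<in>I. v - u) < \<delta> \<longrightarrow> (\<Sum>(u, v)\<in>I. dist (\<gamma> u) (\<gamma> v)) < e"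
  proof (intro exI[of _ d] conjI allI impI)
    fix I :: "(real \<times> real) set"
    assume "finite I \<and> (\<forall>(u, v)\<in>I. a \<le> u \<and> u \<le> v \<and> v \<le> b) \<and>
       disjoint_family_on (\<lambda>(u, v). {u<..<v}) I \<and> (\<Sum>(u, v)\<in>I. v - u) < d"
    then show "(\<Sum>(u, v)\<in>I. dist (\<gamma> u) (\<gamma> v)) < e"
      by (intro d(2)[rule_format]) auto
  qed (rule d)
qed

lemma abs_continuous_curve_subinterval:
  assumes "abs_continuous_curve a b \<gamma>" "a \<le> s" "t \<le> b"
  shows "abs_continuous_curve s t \<gamma>"
proof (rule abs_continuous_curveI)
  fix e :: real assume "e > 0"
  obtain d where d: "d > 0" "\<forall>I. finite I \<longrightarrow> (\<forall>u v. (u, v) \<in> I \<longrightarrow> a \<le> u \<and> u \<le> v \<and> v \<le> b) \<longrightarrow>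
       disjoint_family_on (\<lambda>(u, v). {u<..<v}) I \<longrightarrow> (\<Sum>(u, v)\<in>I. v - u) < d \<longrightarrow> (\<Sum>(u, v)\<in>I. dist (\<gamma> u) (\<gamma> v)) < e"
    using abs_continuous_curveD[OF assms(1) \<open>e > 0\<close>] by blast
  have "(\<Sum>(u, v)\<in>I. dist (\<gamma> u) (\<gamma> v)) < e"
    if "finite I" "\<forall>u v. (u, v) \<in> I \<longrightarrow> s \<le> u \<and> u \<le> v \<and> v \<le> t"
       "disjoint_family_on (\<lambda>(u, v). {u<..<v}) I" "(\<Sum>(u, v)\<in>I. v - u) < d" for I
    using that assms(2,3) by (intro d(2)[rule_format]) force+
  then show "\<exists>d>0. \<forall>I. finite I \<longrightarrow> (\<forall>u v. (u, v) \<in> I \<longrightarrow> s \<le> u \<and> u \<le> v \<and> v \<le> t) \<longrightarrow>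
       disjoint_family_on (\<lambda>(u, v). {u<..<v}) I \<longrightarrow> (\<Sum>(u, v)\<in>I. v - u) < d \<longrightarrow> (\<Sum>(u, v)\<in>I. dist (\<gamma> u) (\<gamma> v)) < e"
    using d(1) by (intro exI[of _ d] conjI allI impI)
qed

text \<open>Used with two frozen halves for joined curves, and with a constant second curve for
  linear images.\<close>

lemma abs_continuous_curve_dominated:
  assumes "abs_continuous_curve a b \<gamma>1" "abs_continuous_curve a b \<gamma>2"
    and le: "\<And>u v. a \<le> u \<Longrightarrow> u \<le> v \<Longrightarrow> v \<le> b \<Longrightarrow> dist (\<gamma> u) (\<gamma> v) \<le> dist (\<gamma>1 u) (\<gamma>1 v) + dist (\<gamma>2 u) (\<gamma>2 v)"
  shows "abs_continuous_curve a b \<gamma>"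
proof (rule abs_continuous_curveI)
  fix e :: real assume "e > 0"
  then have e2: "e / 2 > 0" by simp
  obtain d1 where d1: "d1 > 0" "\<forall>I. finite I \<longrightarrow> (\<forall>u v. (u, v) \<in> I \<longrightarrow> a \<le> u \<and> u \<le> v \<and> v \<le> b) \<longrightarrow>
       disjoint_family_on (\<lambda>(u, v). {u<..<v}) I \<longrightarrow> (\<Sum>(u, v)\<in>I. v - u) < d1 \<longrightarrow> (\<Sum>(u, v)\<in>I. dist (\<gamma>1 u) (\<gamma>1 v)) < e / 2"
    using abs_continuous_curveD[OF assms(1) e2] by blast
  obtain d2 where d2: "d2 > 0" "\<forall>I. finite I \<longrightarrow> (\<forall>u v. (u, v) \<in> I \<longrightarrow> a \<le> u \<and> u \<le> v \<and> v \<le> b) \<longrightarrow>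
       disjoint_family_on (\<lambda>(u, v). {u<..<v}) I \<longrightarrow> (\<Sum>(u, v)\<in>I. v - u) < d2 \<longrightarrow> (\<Sum>(u, v)\<in>I. dist (\<gamma>2 u) (\<gamma>2 v)) < e / 2"
    using abs_continuous_curveD[OF assms(2) e2] by blast
  have "(\<Sum>(u, v)\<in>I. dist (\<gamma> u) (\<gamma> v)) < e"
    if I: "finite I" "\<forall>u v. (u, v) \<in> I \<longrightarrow> a \<le> u \<and> u \<le> v \<and> v \<le> b"
       "disjoint_family_on (\<lambda>(u, v). {u<..<v}) I" "(\<Sum>(u, v)\<in>I. v - u) < min d1 d2" for I
  proof -
    have "(\<Sum>(u, v)\<in>I. dist (\<gamma> u) (\<gamma> v)) \<le> (\<Sum>(u, v)\<in>I. dist (\<gamma>1 u) (\<gamma>1 v) + dist (\<gamma>2 u) (\<gamma>2 v))"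
      using I(2) le by (intro sum_mono) auto
    also have "\<dots> = (\<Sum>(u, v)\<in>I. dist (\<gamma>1 u) (\<gamma>1 v)) + (\<Sum>(u, v)\<in>I. dist (\<gamma>2 u) (\<gamma>2 v))"
      by (simp add: sum.distrib case_prod_unfold)
    also have "\<dots> < e / 2 + e / 2"
      using I by (intro add_strict_mono d1(2)[rule_format] d2(2)[rule_format]) auto
    finally show ?thesis by simp
  qed
  then show "\<exists>d>0. \<forall>I. finite I \<longrightarrow> (\<forall>u v. (u, v) \<in> I \<longrightarrow> a \<le> u \<and> u \<le> v \<and> v \<le> b) \<longrightarrow>
       disjoint_family_on (\<lambda>(u, v). {u<..<v}) I \<longrightarrow> (\<Sum>(u, v)\<in>I. v - u) < d \<longrightarrow> (\<Sum>(u, v)\<in>I. dist (\<gamma> u) (\<gamma> v)) < e"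
    using d1(1) d2(1) by (intro exI[of _ "min d1 d2"] conjI allI impI) auto
qed

lemma abs_continuous_curve_lipschitz:
  fixes \<gamma> :: "real \<Rightarrow> 'a::metric_space"
  assumes lip: "\<And>u v. a \<le> u \<Longrightarrow> u \<le> v \<Longrightarrow> v \<le> b \<Longrightarrow> dist (\<gamma> u) (\<gamma> v) \<le> L * (v - u)" and L: "L \<ge> 0"
  shows "abs_continuous_curve a b \<gamma>"
proof (rule abs_continuous_curveI)
  fix e :: real assume "e > 0"
  have "(\<Sum>(u, v)\<in>I. dist (\<gamma> u) (\<gamma> v)) < e"
    if I: "finite I" "\<forall>u v. (u, v) \<in> I \<longrightarrow> a \<le> u \<and> u \<le> v \<and> v \<le> b"
       "disjoint_family_on (\<lambda>(u, v). {u<..<v}) I" "(\<Sum>(u, v)\<in>I. v - u) < e / (L + 1)" for I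
  proof -
    have "(\<Sum>(u, v)\<in>I. dist (\<gamma> u) (\<gamma> v)) \<le> (\<Sum>(u, v)\<in>I. L * (v - u))"
      using I lip by (intro sum_mono) auto
    also have "\<dots> = L * (\<Sum>(u, v)\<in>I. v - u)"
      by (simp add: sum_distrib_left case_prod_unfold)
    also have "\<dots> \<le> L * (e / (L + 1))"
      using I L by (intro mult_left_mono) auto
    also have "\<dots> < e" using L \<open>e > 0\<close> by (simp add: field_simps)
    finally show ?thesis .
  qed
  then show "\<exists>d>0. \<forall>I. finite I \<longrightarrow> (\<forall>u v. (u, v) \<in> I \<longrightarrow> a \<le> u \<and> u \<le> v \<and> v \<le> b) \<longrightarrow>
       disjoint_family_on (\<lambda>(u, v). {u<..<v}) I \<longrightarrow> (\<Sum>(u, v)\<in>I. v - u) < d \<longrightarrow> (\<Sum>(u, v)\<in>I. dist (\<gamma> u) (\<gamma> v)) < e"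
    using L \<open>e > 0\<close> by (intro exI[of _ "e / (L + 1)"] conjI allI impI) auto
qed

text \<open>A monotone 1-Lipschitz map sends non-overlapping intervals to non-overlapping intervals
  of no greater total length. Translation, reversal and the truncations \<open>min t b\<close>,
  \<open>max t b\<close> are of this kind.\<close>

lemma abs_continuous_curve_compose:
  fixes \<phi> :: "real \<Rightarrow> real"
  assumes AC: "abs_continuous_curve a b \<gamma>"
    and monotone: "(\<forall>u v. u \<le> v \<longrightarrow> \<phi> u \<le> \<phi> v) \<or> (\<forall>u v. u \<le> v \<longrightarrow> \<phi> v \<le> \<phi> u)"
    and lip: "\<And>u v. \<bar>\<phi> v - \<phi> u\<bar> \<le> \<bar>v - u\<bar>" and into: "\<And>t. a' \<le> t \<Longrightarrow> t \<le> b' \<Longrightarrow> a \<le> \<phi> t \<and> \<phi> t \<le> b"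
  shows "abs_continuous_curve a' b' (\<lambda>t. \<gamma> (\<phi> t))"
proof (rule abs_continuous_curveI)
  fix e :: real assume e: "e > 0"
  obtain d where d: "d > 0" "\<forall>I. finite I \<longrightarrow> (\<forall>u v. (u, v) \<in> I \<longrightarrow> a \<le> u \<and> u \<le> v \<and> v \<le> b) \<longrightarrow>
       disjoint_family_on (\<lambda>(u, v). {u<..<v}) I \<longrightarrow> (\<Sum>(u, v)\<in>I. v - u) < d \<longrightarrow> (\<Sum>(u, v)\<in>I. dist (\<gamma> u) (\<gamma> v)) < e"
    using abs_continuous_curveD[OF AC e] by blast
  \<comment> \<open>The image interval with ordered endpoints, also for decreasing
    \<open>\<phi>\<close>.\<close>
  define g where "g = (\<lambda>(u, v). (min (\<phi> u) (\<phi> v), max (\<phi> u) (\<phi> v)))"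
  have "(\<Sum>(u, v)\<in>I. dist (\<gamma> (\<phi> u)) (\<gamma> (\<phi> v))) < e"
    if fin: "finite I" and I': "\<forall>u v. (u, v) \<in> I \<longrightarrow> a' \<le> u \<and> u \<le> v \<and> v \<le> b'"
      and disj: "disjoint_family_on (\<lambda>(u, v). {u<..<v}) I" and small: "(\<Sum>(u, v)\<in>I. v - u) < d" for I
  proof -
    have I: "\<And>u v. (u, v) \<in> I \<Longrightarrow> a' \<le> u \<and> u \<le> v \<and> v \<le> b'" using I' by blast
    have gdisj: "{fst (g p)<..<snd (g p)} \<inter> {fst (g q)<..<snd (g q)} = {}" if pq: "p \<in> I" "q \<in> I" "p \<noteq> q" for p q
    proof -
      obtain u v u' v' where p: "p = (u, v)" and q: "q = (u', v')" by (cases p, cases q) auto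
      have le: "u \<le> v" "u' \<le> v'" using I pq p q by auto
      have dis: "{u<..<v} \<inter> {u'<..<v'} = {}"
        using disj pq p q unfolding disjoint_family_on_def by fastforce
      have "v \<le> u' \<or> v' \<le> u \<or> u = v \<or> u' = v'"
      proof (rule ccontr)
        assume "\<not> ?thesis"
        then have "max u u' < min v v'" using le by auto
        then obtain w where "max u u' < w" "w < min v v'" using dense by blast
        then have "w \<in> {u<..<v} \<inter> {u'<..<v'}" by auto
        with dis show False by simp
      qed
      then show ?thesis
        using monotone
      proof (elim disjE)
        assume m: "\<forall>u v. u \<le> v \<longrightarrow> \<phi> u \<le> \<phi> v" and "v \<le> u'"
        then have "\<phi> u \<le> \<phi> v" "\<phi> v \<le> \<phi> u'" "\<phi> u' \<le> \<phi> v'" using le by auto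
        then show ?thesis by (auto simp: g_def p q)
      next
        assume m: "\<forall>u v. u \<le> v \<longrightarrow> \<phi> u \<le> \<phi> v" and "v' \<le> u"
        then have "\<phi> u \<le> \<phi> v" "\<phi> v' \<le> \<phi> u" "\<phi> u' \<le> \<phi> v'" using le by auto
        then show ?thesis by (auto simp: g_def p q)
      next
        assume m: "\<forall>u v. u \<le> v \<longrightarrow> \<phi> v \<le> \<phi> u" and "v \<le> u'"
        then have "\<phi> v \<le> \<phi> u" "\<phi> u' \<le> \<phi> v" "\<phi> v' \<le> \<phi> u'" using le by auto
        then show ?thesis by (auto simp: g_def p q)
      next
        assume m: "\<forall>u v. u \<le> v \<longrightarrow> \<phi> v \<le> \<phi> u" and "v' \<le> u"
        then have "\<phi> v \<le> \<phi> u" "\<phi> u \<le> \<phi> v'" "\<phi> v' \<le> \<phi> u'" using le by auto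
        then show ?thesis by (auto simp: g_def p q)
      qed (auto simp: g_def p q)
    qed
    \<comment> \<open>Different intervals may collapse to the same degenerate one, so
      \<open>g\<close> need not be injective on \<open>I\<close>; such intervals contribute
      0.\<close>
    have sum_g: "sum F (g ` I) = sum (F \<circ> g) I" if "\<And>u. F (u, u) = 0" for F :: "real \<times> real \<Rightarrow> real"
    proof (rule sum.reindex_nontrivial[OF fin])
      fix p q assume pq: "p \<in> I" "q \<in> I" "p \<noteq> q" "g p = g q"
      have "fst (g p) \<le> snd (g p)" by (auto simp: g_def split: prod.splits)
      moreover have "{fst (g p)<..<snd (g p)} = {}" using gdisj[OF pq(1-3)] pq(4) by simp
      ultimately have "fst (g p) = snd (g p)" using greaterThanLessThan_empty_iff[of "fst (g p)" "snd (g p)"] by auto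
      then have "g p = (fst (g p), fst (g p))" by (metis prod.collapse)
      then show "F (g p) = 0" using that by metis
    qed
    have "(\<Sum>(u, v)\<in>g ` I. dist (\<gamma> u) (\<gamma> v)) < e"
    proof (rule d(2)[rule_format])
      show "finite (g ` I)" using fin by simp
      fix u' v' assume "(u', v') \<in> g ` I"
      then obtain u v where uv: "(u, v) \<in> I" "(u', v') = (min (\<phi> u) (\<phi> v), max (\<phi> u) (\<phi> v))"
        by (auto simp: g_def)
      have "a \<le> \<phi> u \<and> \<phi> u \<le> b" "a \<le> \<phi> v \<and> \<phi> v \<le> b" using I[OF uv(1)] into by auto
      then show "a \<le> u' \<and> u' \<le> v' \<and> v' \<le> b" using uv(2) by auto
    next
      show "disjoint_family_on (\<lambda>(u, v). {u<..<v}) (g ` I)"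
        unfolding disjoint_family_on_def
      proof (intro ballI impI)
        fix p q assume "p \<in> g ` I" "q \<in> g ` I" "p \<noteq> q"
        then obtain p' q' where "p' \<in> I" "q' \<in> I" "p' \<noteq> q'" "p = g p'" "q = g q'" by blast
        then show "(case p of (u, v) \<Rightarrow> {u<..<v}) \<inter> (case q of (u, v) \<Rightarrow> {u<..<v}) = {}"
          using gdisj by (simp add: case_prod_unfold)
      qed
      have "(\<Sum>(u, v)\<in>g ` I. v - u) = (\<Sum>p\<in>I. snd (g p) - fst (g p))"
        using sum_g[of "\<lambda>(u, v). v - u"] by (simp add: case_prod_unfold)
      also have "\<dots> \<le> (\<Sum>(u, v)\<in>I. v - u)"
      proof (rule sum_mono)
        fix p assume "p \<in> I"
        then obtain u v where p: "p = (u, v)" "u \<le> v" using I by (cases p) auto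
        then show "snd (g p) - fst (g p) \<le> (case p of (u, v) \<Rightarrow> v - u)"
          using lip[of v u] by (auto simp: g_def)
      qed
      finally show "(\<Sum>(u, v)\<in>g ` I. v - u) < d" using small by simp
    qed
    also have "(\<Sum>(u, v)\<in>g ` I. dist (\<gamma> u) (\<gamma> v)) = (\<Sum>(u, v)\<in>I. dist (\<gamma> (\<phi> u)) (\<gamma> (\<phi> v)))"
      using sum_g[of "\<lambda>(u, v). dist (\<gamma> u) (\<gamma> v)"]
      by (auto simp: case_prod_unfold g_def min_def max_def dist_commute intro!: sum.cong)
    finally show ?thesis .
  qed
  then show "\<exists>d>0. \<forall>I. finite I \<longrightarrow> (\<forall>u v. (u, v) \<in> I \<longrightarrow> a' \<le> u \<and> u \<le> v \<and> v \<le> b') \<longrightarrow>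
       disjoint_family_on (\<lambda>(u, v). {u<..<v}) I \<longrightarrow> (\<Sum>(u, v)\<in>I. v - u) < d \<longrightarrow> (\<Sum>(u, v)\<in>I. dist (\<gamma> (\<phi> u)) (\<gamma> (\<phi> v))) < e"
    using d(1) by (intro exI[of _ d] conjI allI impI)
qed

text \<open>The intervals of a fine tagged division are split by their tags: where the derivative exists
  the increments are compared with the integral of \<open>g\<close>, and the others lie in an open set
  of small measure, where absolute continuity applies.\<close>

lemma abs_continuous_curve_norm_diff_le:
  fixes \<gamma> :: "real \<Rightarrow> 'a::real_normed_vector"
  assumes AC: "abs_continuous_curve a b \<gamma>" and ab: "a \<le> b" and N: "negligible N"
    and der: "\<And>t. a < t \<Longrightarrow> t < b \<Longrightarrow> t \<notin> N \<Longrightarrow> (\<gamma> has_vector_derivative \<gamma>' t) (at t)"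
    and le: "\<And>t. a < t \<Longrightarrow> t < b \<Longrightarrow> t \<notin> N \<Longrightarrow> norm (\<gamma>' t) \<le> g t" and g0: "\<And>t. 0 \<le> g t"
    and int: "(g has_integral J) {a..b}"
  shows "norm (\<gamma> b - \<gamma> a) \<le> J"
proof (rule field_le_epsilon)
  fix e0 :: real assume "e0 > 0"
  \<comment> \<open>Three errors are to come: \<open>e\<close> for the tags in \<open>N'\<close>,
    \<open>e\<close> for the Riemann sum of \<open>g\<close>, and \<open>e * (b - a)\<close> for the
    linear approximations.\<close>
  define e where "e = e0 / (2 + (b - a))"
  have e: "e > 0" using \<open>e0 > 0\<close> ab by (simp add: e_def)
  obtain d where d: "d > 0" "\<forall>I. finite I \<longrightarrow> (\<forall>u v. (u, v) \<in> I \<longrightarrow> a \<le> u \<and> u \<le> v \<and> v \<le> b) \<longrightarrow>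
       disjoint_family_on (\<lambda>(u, v). {u<..<v}) I \<longrightarrow> (\<Sum>(u, v)\<in>I. v - u) < d \<longrightarrow> (\<Sum>(u, v)\<in>I. dist (\<gamma> u) (\<gamma> v)) < e"
    using abs_continuous_curveD[OF AC e] by blast
  \<comment> \<open>The derivative is given only inside the interval, so the endpoints join the
    exceptional set.\<close>
  define N' where "N' = N \<union> {a, b}"
  have negN': "negligible N'" unfolding N'_def using N by (intro negligible_Un) auto
  have "N' \<in> sets lebesgue" using negN' by (rule negligible_imp_sets)
  then obtain U where U: "open U" "N' \<subseteq> U" "U - N' \<in> lmeasurable" "emeasure lebesgue (U - N') < ennreal d"
    by (rule sets_lebesgue_outer_open[OF _ d(1)])
  have U_eq: "U = (U - N') \<union> N'" using U(2) by blast
  have Ulm: "U \<in> lmeasurable"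
    using fmeasurable.Un[OF U(3) negligible_imp_measurable[OF negN']] U_eq by simp
  have "measure lebesgue U = measure lebesgue (U - N')"
    using measure_negligible_symdiff[of "U - N'" U] U(3) negN' by (auto intro: negligible_subset)
  then have mU: "measure lebesgue U < d"
    using U(3,4) d(1) by (simp add: emeasure_eq_measure2 ennreal_less_iff)
  have "\<exists>\<gamma>1. gauge \<gamma>1 \<and> (\<forall>p. p tagged_division_of {a..b} \<and> \<gamma>1 fine p \<longrightarrow>
      norm ((\<Sum>(x, k)\<in>p. measure lborel k *\<^sub>R g x) - J) < e)"
    by (rule int[unfolded has_integral_real, THEN spec, THEN mp, OF e])
  then obtain \<gamma>1 where \<gamma>1: "gauge \<gamma>1" "\<forall>p. p tagged_division_of {a..b} \<and> \<gamma>1 fine p \<longrightarrow>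
      norm ((\<Sum>(x, k)\<in>p. measure lborel k *\<^sub>R g x) - J) < e"
    by (elim exE conjE)
  have "\<exists>r>0. \<forall>y. norm (y - t) < r \<longrightarrow> norm (\<gamma> y - \<gamma> t - (y - t) *\<^sub>R \<gamma>' t) \<le> e * norm (y - t)"
    if "a < t" "t < b" "t \<notin> N" for t
    using der[OF that] e unfolding has_vector_derivative_def has_derivative_at_alt by blast
  then obtain r where r: "\<And>t. a < t \<Longrightarrow> t < b \<Longrightarrow> t \<notin> N \<Longrightarrow> r t > 0"
    "\<And>t y. a < t \<Longrightarrow> t < b \<Longrightarrow> t \<notin> N \<Longrightarrow> norm (y - t) < r t \<Longrightarrow> norm (\<gamma> y - \<gamma> t - (y - t) *\<^sub>R \<gamma>' t) \<le> e * norm (y - t)"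
    by metis
  define \<gamma>2 where "\<gamma>2 t = \<gamma>1 t \<inter> (if t \<in> N' then U else if a < t \<and> t < b then ball t (r t) else UNIV)" for t
  have "gauge \<gamma>2"
    using \<gamma>1(1) U(1,2) r(1) by (auto simp: gauge_def \<gamma>2_def N'_def)
  then obtain p where p: "p tagged_division_of {a..b}" "\<gamma>2 fine p"
    by (rule fine_division_exists_real)
  note fin = tagged_division_ofD(1)[OF p(1)]
  have "\<gamma>1 fine p" using p(2) unfolding fine_def \<gamma>2_def by blast
  then have Rs: "(\<Sum>(x, k)\<in>p. measure lborel k *\<^sub>R g x) < J + e"
    using \<gamma>1(2)[rule_format, of p] p(1) by (auto simp: abs_less_iff)
  have K: "\<exists>u v. K = {u..v} \<and> u \<le> v \<and> u \<le> x \<and> x \<le> v \<and> a \<le> u \<and> v \<le> b \<and> K \<subseteq> \<gamma>2 x" if xKp: "(x, K) \<in> p" for x K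
  proof -
    obtain u v where "K = cbox u v" using tagged_division_ofD(4)[OF p(1) xKp] by blast
    moreover have "x \<in> K" "K \<subseteq> {a..b}" using tagged_division_ofD(2,3)[OF p(1) that] by auto
    moreover have "K \<subseteq> \<gamma>2 x" using p(2) that by (auto simp: fine_def)
    ultimately show ?thesis by (intro exI[of _ u] exI[of _ v]) auto
  qed
  define p1 where "p1 = {(x, K) \<in> p. x \<in> N'}"
  define p2 where "p2 = {(x, K) \<in> p. x \<notin> N'}"
  have pp: "p = p1 \<union> p2" "p1 \<inter> p2 = {}" "finite p1" "finite p2" "p1 \<subseteq> p" "p2 \<subseteq> p"
    using fin by (auto simp: p1_def p2_def intro: finite_subset[OF _ fin])
  have "\<gamma> b - \<gamma> a = (\<Sum>(x, K)\<in>p. \<gamma> (Sup K) - \<gamma> (Inf K))"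
    using additive_tagged_division_1[OF ab p(1), of \<gamma>] by simp
  also have "norm \<dots> \<le> (\<Sum>(x, K)\<in>p. norm (\<gamma> (Sup K) - \<gamma> (Inf K)))"
    using norm_sum[of "\<lambda>(x, K). \<gamma> (Sup K) - \<gamma> (Inf K)" p] by (simp add: case_prod_unfold)
  also have "\<dots> = (\<Sum>(x, K)\<in>p1. norm (\<gamma> (Sup K) - \<gamma> (Inf K))) + (\<Sum>(x, K)\<in>p2. norm (\<gamma> (Sup K) - \<gamma> (Inf K)))"
    using pp by (simp add: sum.union_disjoint)
  also have "(\<Sum>(x, K)\<in>p2. norm (\<gamma> (Sup K) - \<gamma> (Inf K))) \<le> (\<Sum>(x, K)\<in>p2. measure lborel K *\<^sub>R g x + e * measure lborel K)"
  proof (rule sum_mono)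
    fix q assume q: "q \<in> p2"
    obtain x K' where qx: "q = (x, K')" by (cases q)
    have xK: "(x, K') \<in> p" "x \<notin> N'" using q qx by (auto simp: p2_def)
    obtain u v where uv: "K' = {u..v}" "u \<le> v" "u \<le> x" "x \<le> v" "a \<le> u" "v \<le> b" "K' \<subseteq> \<gamma>2 x"
      using K[OF xK(1)] by blast
    have x: "a < x" "x < b" "x \<notin> N" using xK(2) uv by (auto simp: N'_def)
    have "u \<in> ball x (r x)" "v \<in> ball x (r x)"
      using uv xK(2) x by (auto simp: \<gamma>2_def subset_iff)
    then have "norm (\<gamma> u - \<gamma> x - (u - x) *\<^sub>R \<gamma>' x) \<le> e * norm (u - x)"
      "norm (\<gamma> v - \<gamma> x - (v - x) *\<^sub>R \<gamma>' x) \<le> e * norm (v - x)"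
      using r(2)[OF x, of u] r(2)[OF x, of v] by (auto simp: dist_real_def abs_minus_commute)
    then have "norm ((\<gamma> v - \<gamma> x - (v - x) *\<^sub>R \<gamma>' x) - (\<gamma> u - \<gamma> x - (u - x) *\<^sub>R \<gamma>' x)) \<le> e * (v - u)"
      using uv norm_triangle_ineq4[of "\<gamma> v - \<gamma> x - (v - x) *\<^sub>R \<gamma>' x" "\<gamma> u - \<gamma> x - (u - x) *\<^sub>R \<gamma>' x"]
      by (simp add: algebra_simps)
    moreover have "\<gamma> v - \<gamma> u = ((\<gamma> v - \<gamma> x - (v - x) *\<^sub>R \<gamma>' x) - (\<gamma> u - \<gamma> x - (u - x) *\<^sub>R \<gamma>' x)) + (v - u) *\<^sub>R \<gamma>' x"
      by (simp add: algebra_simps)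
    ultimately have "norm (\<gamma> v - \<gamma> u) \<le> e * (v - u) + norm ((v - u) *\<^sub>R \<gamma>' x)"
      by (metis (no_types, lifting) add_mono_thms_linordered_semiring(3) norm_triangle_le order_refl add_right_mono norm_triangle_ineq order_trans)
    also have "norm ((v - u) *\<^sub>R \<gamma>' x) \<le> (v - u) * g x"
      using le[OF x] uv(2) by (simp add: mult_left_mono)
    finally have "norm (\<gamma> v - \<gamma> u) \<le> (v - u) * g x + e * (v - u)" by simp
    then show "(case q of (x, K) \<Rightarrow> norm (\<gamma> (Sup K) - \<gamma> (Inf K))) \<le> (case q of (x, K) \<Rightarrow> measure lborel K *\<^sub>R g x + e * measure lborel K)"
      using uv(1,2) qx by simp
  qed
  also have "(\<Sum>(x, K)\<in>p2. measure lborel K *\<^sub>R g x + e * measure lborel K) \<le> (\<Sum>(x, K)\<in>p. measure lborel K *\<^sub>R g x + e * measure lborel K)"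
    using pp fin g0 e by (intro sum_mono2) auto
  also have "\<dots> = (\<Sum>(x, K)\<in>p. measure lborel K *\<^sub>R g x) + e * (\<Sum>(x, K)\<in>p. measure lborel K)"
    by (simp add: sum.distrib sum_distrib_left case_prod_unfold)
  also have "(\<Sum>(x, K)\<in>p. measure lborel K) = b - a"
    using additive_content_tagged_division[of p a b] p(1) ab by simp
  also have "(\<Sum>(x, K)\<in>p1. norm (\<gamma> (Sup K) - \<gamma> (Inf K))) \<le> e"
  proof -
    define G where "G = (\<lambda>(x::real, K::real set). (Inf K, Sup K))"
    have Gd: "{Inf K<..<Sup K} \<inter> {Inf K'<..<Sup K'} = {}" if xKp: "(x, K) \<in> p" "(x', K') \<in> p" "(x, K) \<noteq> (x', K')" for x K x' K'
    proof -
      obtain u v where "K = {u..v}" "u \<le> v" using K[OF xKp(1)] by blast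
      moreover obtain u' v' where "K' = {u'..v'}" "u' \<le> v'" using K[OF xKp(2)] by blast
      moreover have "interior K \<inter> interior K' = {}"
        using tagged_division_ofD(5)[OF p(1) that] by simp
      ultimately show ?thesis by simp
    qed
    have sum_G: "sum F (G ` p1) = sum (F \<circ> G) p1" if "\<And>u. F (u, u) = 0" for F :: "real \<times> real \<Rightarrow> real"
    proof (rule sum.reindex_nontrivial[OF pp(3)])
      fix q q' assume q: "q \<in> p1" "q' \<in> p1" "q \<noteq> q'" "G q = G q'"
      obtain x K' x' K'' where qq: "q = (x, K')" "q' = (x', K'')" by (cases q, cases q') auto
      obtain u v where uv: "K' = {u..v}" "u \<le> v" using K[of x K'] q(1) qq pp(5) by blast
      have "{Inf K'<..<Sup K'} = {}"
        using Gd[of x K' x' K''] q qq pp(5) by (auto simp: G_def)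
      then have "u = v" using uv by auto
      then show "F (G q) = 0" using that uv by (simp add: G_def qq)
    qed
    have mem: "\<exists>x K. (x, K) \<in> p1 \<and> q = (Inf K, Sup K)" if "q \<in> G ` p1" for q
      using that by (auto simp: G_def)
    have disj: "disjoint_family_on (\<lambda>(u, v). {u<..<v}) (G ` p1)"
      unfolding disjoint_family_on_def
    proof (intro ballI impI)
      fix q q' assume q: "q \<in> G ` p1" "q' \<in> G ` p1" "q \<noteq> q'"
      obtain x K where x: "(x, K) \<in> p1" "q = (Inf K, Sup K)" using mem[OF q(1)] by blast
      obtain x' K' where x': "(x', K') \<in> p1" "q' = (Inf K', Sup K')" using mem[OF q(2)] by blast
      show "(case q of (u, v) \<Rightarrow> {u<..<v}) \<inter> (case q' of (u, v) \<Rightarrow> {u<..<v}) = {}"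
        using Gd[of x K x' K'] x x' q(3) pp(5) by auto
    qed
    have GI: "a \<le> u \<and> u \<le> v \<and> v \<le> b \<and> {u<..<v} \<subseteq> U" if q: "(u, v) \<in> G ` p1" for u v
    proof -
      obtain x K' where x: "(x, K') \<in> p1" "(u, v) = (Inf K', Sup K')" using mem[OF q] by blast
      obtain u' v' where uv: "K' = {u'..v'}" "u' \<le> v'" "a \<le> u'" "v' \<le> b" "K' \<subseteq> \<gamma>2 x"
        using K[of x K'] x(1) pp(5) by blast
      have "\<gamma>2 x \<subseteq> U" using x(1) by (auto simp: p1_def \<gamma>2_def)
      then have "{u'<..<v'} \<subseteq> U" using uv(1,5) by fastforce
      then show ?thesis using x(2) uv by simp
    qed
    have "(\<Sum>(u, v)\<in>G ` p1. v - u) = (\<Sum>q\<in>G ` p1. measure lebesgue (case q of (u, v) \<Rightarrow> {u<..<v}))"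
      using GI by (intro sum.cong) auto
    also have "\<dots> = measure lebesgue (\<Union>q\<in>G ` p1. case q of (u, v) \<Rightarrow> {u<..<v})"
    proof (rule measure_UNION'[symmetric])
      show "pairwise (\<lambda>q q'. disjnt (case q of (u, v) \<Rightarrow> {u<..<v}) (case q' of (u, v) \<Rightarrow> {u<..<v})) (G ` p1)"
        using disj unfolding pairwise_def disjnt_def disjoint_family_on_def by blast
    qed (use pp(3) in auto)
    also have "\<dots> \<le> measure lebesgue U"
    proof (rule measure_mono_fmeasurable[OF _ _ Ulm])
      show "(\<Union>q\<in>G ` p1. case q of (u, v) \<Rightarrow> {u<..<v}) \<subseteq> U"
      proof (rule UN_least)
        fix q assume "q \<in> G ` p1"
        then show "(case q of (u, v) \<Rightarrow> {u<..<v}) \<subseteq> U" using GI by (cases q) blast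
      qed
      show "(\<Union>q\<in>G ` p1. case q of (u, v) \<Rightarrow> {u<..<v}) \<in> sets lebesgue"
        using pp(3) by (intro sets.finite_UN) (auto simp: case_prod_unfold)
    qed
    also have "\<dots> < d" by (rule mU)
    finally have "(\<Sum>(u, v)\<in>G ` p1. dist (\<gamma> u) (\<gamma> v)) < e"
      using pp(3) GI disj by (intro d(2)[rule_format]) auto
    also have "(\<Sum>(u, v)\<in>G ` p1. dist (\<gamma> u) (\<gamma> v)) = (\<Sum>(x, K)\<in>p1. norm (\<gamma> (Sup K) - \<gamma> (Inf K)))"
      using sum_G[of "\<lambda>(u, v). dist (\<gamma> u) (\<gamma> v)"]
      by (simp add: case_prod_unfold G_def dist_norm norm_minus_commute)
    finally show ?thesis by simp
  qed
  finally have "norm (\<gamma> b - \<gamma> a) \<le> e + (J + e + e * (b - a))" using Rs by simp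
  also have "\<dots> = J + e * (2 + (b - a))"
    by (simp add: algebra_simps)
  also have "\<dots> = J + e0"
    using ab by (simp add: e_def)
  finally show "norm (\<gamma> b - \<gamma> a) \<le> J + e0" .
qed

section \<open>Curves with explicit coefficients\<close>

definition speed :: "nat \<Rightarrow> (nat \<Rightarrow> real \<Rightarrow> real) \<Rightarrow> real \<Rightarrow> real" where
  "speed m c t = sqrt (\<Sum>i=1..m. (c i t)\<^sup>2)"

text \<open>A horizontal curve with its coefficients exhibited. They are measurable on the whole
  line, and derivatives are two-sided on the open interval, so that restriction, reparametrization
  and joining need no change of measure or filter.\<close>

definition controlled_curve ::
  "(real ^ 'n) set \<Rightarrow> nat \<Rightarrow> (nat \<Rightarrow> real ^ 'n \<Rightarrow> real ^ 'n) \<Rightarrow>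
   real \<Rightarrow> real \<Rightarrow> (real \<Rightarrow> real ^ 'n) \<Rightarrow> (nat \<Rightarrow> real \<Rightarrow> real) \<Rightarrow> bool" where
  "controlled_curve \<Omega> m X a b \<gamma> c \<longleftrightarrow>
    a \<le> b \<and> \<gamma> ` {a..b} \<subseteq> \<Omega> \<and> abs_continuous_curve a b \<gamma> \<and>
    (\<forall>i\<in>{1..m}. c i \<in> borel_measurable lebesgue) \<and>
    negligible {t\<in>{a<..<b}. \<not> (\<gamma> has_vector_derivative (\<Sum>i=1..m. c i t *\<^sub>R X i (\<gamma> t))) (at t)}"

text \<open>Bypasses the definite description in \<open>horizontal_norm\<close>; the two lengths
  agree where the fields are independent.\<close>

definition control_length :: "nat \<Rightarrow> real \<Rightarrow> real \<Rightarrow> (nat \<Rightarrow> real \<Rightarrow> real) \<Rightarrow> ennreal" where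
  "control_length m a b c = (\<integral>\<^sup>+t. ennreal (speed m c t) * indicator {a..b} t \<partial>lebesgue)"

lemma speed_nonneg[simp]: "0 \<le> speed m c t"
  by (simp add: speed_def sum_nonneg)

lemma speed_measurable[measurable (raw)]:
  assumes "\<forall>i\<in>{1..m}. c i \<in> borel_measurable M"
  shows "speed m c \<in> borel_measurable M"
proof -
  have [measurable]: "c i \<in> borel_measurable M" if "i \<in> {1..m}" for i using assms that by blast
  have "(\<lambda>t. sqrt (\<Sum>i=1..m. (c i t)\<^sup>2)) \<in> borel_measurable M" by measurable
  then show ?thesis by (simp add: speed_def[abs_def])
qed

lemma speed_indicator_measurable:
  assumes "\<forall>i\<in>{1..m}. c i \<in> borel_measurable lebesgue"
  shows "(\<lambda>t. ennreal (speed m c t) * indicator {a..b} t) \<in> borel_measurable lebesgue"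
proof -
  have [measurable]: "speed m c \<in> borel_measurable lebesgue" "{a..b} \<in> sets lebesgue"
    using speed_measurable[OF assms] by auto
  show ?thesis by measurable
qed

lemma horizontal_norm_eq:
  assumes ind: "lin_indep_family m (\<lambda>i. X i p)"
  shows "horizontal_norm m X p (\<Sum>i=1..m. c i *\<^sub>R X i p) = sqrt (\<Sum>i=1..m. (c i)\<^sup>2)"
  unfolding horizontal_norm_def
proof (rule the_equality)
  show "\<exists>c'. (\<Sum>i=1..m. c i *\<^sub>R X i p) = (\<Sum>i=1..m. c' i *\<^sub>R X i p) \<and> sqrt (\<Sum>i=1..m. (c i)\<^sup>2) = sqrt (\<Sum>i=1..m. (c' i)\<^sup>2)"
    by blast
next
  fix r assume "\<exists>c'. (\<Sum>i=1..m. c i *\<^sub>R X i p) = (\<Sum>i=1..m. c' i *\<^sub>R X i p) \<and> r = sqrt (\<Sum>i=1..m. (c' i)\<^sup>2)"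
  then obtain c' where c': "(\<Sum>i=1..m. c i *\<^sub>R X i p) = (\<Sum>i=1..m. c' i *\<^sub>R X i p)" "r = sqrt (\<Sum>i=1..m. (c' i)\<^sup>2)"
    by blast
  have "(\<Sum>i=1..m. (c i - c' i) *\<^sub>R X i p) = 0"
    using c'(1) by (simp add: scaleR_left_diff_distrib sum_subtractf)
  then have "\<forall>i\<in>{1..m}. c i - c' i = 0"
    using ind unfolding lin_indep_family_def by (elim allE[of _ "\<lambda>i. c i - c' i"]) simp
  then have "(\<Sum>i=1..m. (c i)\<^sup>2) = (\<Sum>i=1..m. (c' i)\<^sup>2)"
    by (intro sum.cong) auto
  then show "r = sqrt (\<Sum>i=1..m. (c i)\<^sup>2)" using c'(2) by simp
qed

lemma AE_lebesgue_on_Icc_iff: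
  "(AE t in lebesgue_on {a..b::real}. P t) \<longleftrightarrow> negligible {t\<in>{a<..<b}. \<not> P t}"
proof -
  have "(AE t in lebesgue_on {a..b}. P t) \<longleftrightarrow> (AE t in lebesgue. t \<in> {a..b} \<longrightarrow> P t)"
    by (rule AE_restrict_space_iff) simp
  also have "\<dots> \<longleftrightarrow> negligible {t. \<not> (t \<in> {a..b} \<longrightarrow> P t)}"
    unfolding eventually_ae_filter_negligible by (auto intro: negligible_subset)
  also have "\<dots> \<longleftrightarrow> negligible {t\<in>{a<..<b}. \<not> P t}"
  proof
    assume n: "negligible {t\<in>{a<..<b}. \<not> P t}"
    have "negligible ({t\<in>{a<..<b}. \<not> P t} \<union> {a, b})"
      using n by (intro negligible_Un) auto
    then show "negligible {t. \<not> (t \<in> {a..b} \<longrightarrow> P t)}"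
      by (rule negligible_subset) auto
  qed (auto elim: negligible_subset)
  finally show ?thesis .
qed

lemma controlled_curve_imp_horizontal:
  assumes ind: "\<And>p. p \<in> \<Omega> \<Longrightarrow> lin_indep_family m (\<lambda>i. X i p)"
    and cc: "controlled_curve \<Omega> m X a b \<gamma> c"
  shows "horizontal_curve \<Omega> m X a b \<gamma>" and "horizontal_length m X a b \<gamma> = control_length m a b c"
proof -
  let ?P = "\<lambda>t. (\<gamma> has_vector_derivative (\<Sum>i=1..m. c i t *\<^sub>R X i (\<gamma> t))) (at t within {a..b})"
  have "{t\<in>{a<..<b}. \<not> ?P t} \<subseteq> {t\<in>{a<..<b}. \<not> (\<gamma> has_vector_derivative (\<Sum>i=1..m. c i t *\<^sub>R X i (\<gamma> t))) (at t)}"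
    by (auto intro: has_vector_derivative_at_within)
  then have AE: "AE t in lebesgue_on {a..b}. ?P t"
    unfolding AE_lebesgue_on_Icc_iff using cc negligible_subset by (auto simp: controlled_curve_def)
  show "horizontal_curve \<Omega> m X a b \<gamma>"
    unfolding horizontal_curve_def using cc AE
    by (auto simp: controlled_curve_def intro!: exI[of _ c] measurable_restrict_space1)
  have "{t\<in>{a<..<b}. \<not> horizontal_norm m X (\<gamma> t) (vector_derivative \<gamma> (at t within {a..b})) = speed m c t}
      \<subseteq> {t\<in>{a<..<b}. \<not> (\<gamma> has_vector_derivative (\<Sum>i=1..m. c i t *\<^sub>R X i (\<gamma> t))) (at t)}"
  proof safe
    fix t assume t: "t \<in> {a<..<b}" and d: "(\<gamma> has_vector_derivative (\<Sum>i=1..m. c i t *\<^sub>R X i (\<gamma> t))) (at t)"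
      and n: "horizontal_norm m X (\<gamma> t) (vector_derivative \<gamma> (at t within {a..b})) \<noteq> speed m c t"
    have "at t within {a..b} = at t" using t by (intro at_within_Icc_at) auto
    then have "vector_derivative \<gamma> (at t within {a..b}) = (\<Sum>i=1..m. c i t *\<^sub>R X i (\<gamma> t))"
      using d vector_derivative_at by simp
    moreover have "\<gamma> t \<in> \<Omega>" using cc t by (auto simp: controlled_curve_def)
    moreover from ind[OF this] have "horizontal_norm m X (\<gamma> t) (\<Sum>i=1..m. c i t *\<^sub>R X i (\<gamma> t)) = speed m c t"
      unfolding speed_def by (intro horizontal_norm_eq)
    ultimately show False
      using n by simp
  qed
  then have AE2: "AE t in lebesgue_on {a..b}. horizontal_norm m X (\<gamma> t) (vector_derivative \<gamma> (at t within {a..b})) = speed m c t"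
    unfolding AE_lebesgue_on_Icc_iff using cc negligible_subset by (auto simp: controlled_curve_def)
  have "horizontal_length m X a b \<gamma> = (\<integral>\<^sup>+ t. ennreal (speed m c t) \<partial>lebesgue_on {a..b})"
    unfolding horizontal_length_def by (intro nn_integral_cong_AE) (use AE2 in eventually_elim, simp)
  then show "horizontal_length m X a b \<gamma> = control_length m a b c"
    by (simp add: control_length_def nn_integral_restrict_space)
qed

lemma horizontal_curve_imp_controlled:
  assumes "horizontal_curve \<Omega> m X a b \<gamma>"
  obtains c where "controlled_curve \<Omega> m X a b \<gamma> c"
proof -
  obtain c where c: "\<forall>i\<in>{1..m}. c i \<in> borel_measurable (lebesgue_on {a..b})"
    "AE t in lebesgue_on {a..b}. (\<gamma> has_vector_derivative (\<Sum>i=1..m. c i t *\<^sub>R X i (\<gamma> t))) (at t within {a..b})"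
    using assms unfolding horizontal_curve_def by blast
  \<comment> \<open>Extension by 0 makes the coefficients measurable on the whole line.\<close>
  define c' where "c' i t = indicator {a..b} t *\<^sub>R c i t" for i t
  have "c' i \<in> borel_measurable lebesgue" if "i \<in> {1..m}" for i
    using c(1) that unfolding c'_def by (subst borel_measurable_restrict_space_iff[symmetric]) auto
  moreover have "{t\<in>{a<..<b}. \<not> (\<gamma> has_vector_derivative (\<Sum>i=1..m. c' i t *\<^sub>R X i (\<gamma> t))) (at t)}
     \<subseteq> {t\<in>{a<..<b}. \<not> (\<gamma> has_vector_derivative (\<Sum>i=1..m. c i t *\<^sub>R X i (\<gamma> t))) (at t within {a..b})}"
  proof safe
    fix t assume t: "t \<in> {a<..<b}" and n: "\<not> (\<gamma> has_vector_derivative (\<Sum>i=1..m. c' i t *\<^sub>R X i (\<gamma> t))) (at t)"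
      and d: "(\<gamma> has_vector_derivative (\<Sum>i=1..m. c i t *\<^sub>R X i (\<gamma> t))) (at t within {a..b})"
    have "at t within {a..b} = at t" using t by (intro at_within_Icc_at) auto
    with n d t show False by (simp add: c'_def)
  qed
  ultimately have "controlled_curve \<Omega> m X a b \<gamma> c'"
    using assms c(2) negligible_subset unfolding AE_lebesgue_on_Icc_iff horizontal_curve_def controlled_curve_def by blast
  then show thesis by (rule that)
qed

lemma controlled_curve_subinterval:
  assumes "controlled_curve \<Omega> m X a b \<gamma> c" "a \<le> s" "s \<le> t" "t \<le> b"
  shows "controlled_curve \<Omega> m X s t \<gamma> c"
proof -
  have "\<gamma> ` {s..t} \<subseteq> \<Omega>"
    using assms by (auto simp: controlled_curve_def)
  moreover have "{u\<in>{s<..<t}. \<not> (\<gamma> has_vector_derivative (\<Sum>i=1..m. c i u *\<^sub>R X i (\<gamma> u))) (at u)}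
    \<subseteq> {u\<in>{a<..<b}. \<not> (\<gamma> has_vector_derivative (\<Sum>i=1..m. c i u *\<^sub>R X i (\<gamma> u))) (at u)}"
    using assms by auto
  ultimately show ?thesis
    using assms negligible_subset abs_continuous_curve_subinterval[of a b \<gamma> s t]
    unfolding controlled_curve_def by blast
qed

text \<open>Translation (\<open>\<sigma> = 1\<close>) serves the triangle inequality, reversal
  (\<open>\<sigma> = -1\<close>) symmetry. The equivalences in the hypotheses match the intervals
  regardless of orientation.\<close>

lemma controlled_curve_reparam:
  assumes cc: "controlled_curve \<Omega> m X a b \<gamma> c" and \<sigma>: "\<sigma> = 1 \<or> \<sigma> = -1"
    and ab: "a' \<le> b'" "\<And>t. a \<le> s + \<sigma> * t \<and> s + \<sigma> * t \<le> b \<longleftrightarrow> a' \<le> t \<and> t \<le> b'"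
    "\<And>t. a < s + \<sigma> * t \<and> s + \<sigma> * t < b \<longleftrightarrow> a' < t \<and> t < b'"
  shows "controlled_curve \<Omega> m X a' b' (\<lambda>t. \<gamma> (s + \<sigma> * t)) (\<lambda>i t. \<sigma> * c i (s + \<sigma> * t))"
    and "control_length m a' b' (\<lambda>i t. \<sigma> * c i (s + \<sigma> * t)) = control_length m a b c"
proof -
  have \<sigma>2: "\<sigma> * \<sigma> = 1" "\<sigma> \<noteq> 0" "\<bar>\<sigma>\<bar> = 1" using \<sigma> by auto
  let ?\<phi> = "\<lambda>t. s + \<sigma> * t"
  have inv: "?\<phi> (\<sigma> * (t - s)) = t" "\<sigma> * (?\<phi> t - s) = t" for t
    using \<sigma> by (auto simp: algebra_simps)
  note c = cc[unfolded controlled_curve_def]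
  let ?N = "{t\<in>{a<..<b}. \<not> (\<gamma> has_vector_derivative (\<Sum>i=1..m. c i t *\<^sub>R X i (\<gamma> t))) (at t)}"
  have AC: "abs_continuous_curve a' b' (\<lambda>t. \<gamma> (?\<phi> t))"
  proof (rule abs_continuous_curve_compose[where a=a and b=b])
    show "abs_continuous_curve a b \<gamma>" using c by blast
    show "(\<forall>u v. u \<le> v \<longrightarrow> ?\<phi> u \<le> ?\<phi> v) \<or> (\<forall>u v. u \<le> v \<longrightarrow> ?\<phi> v \<le> ?\<phi> u)" using \<sigma> by auto
    show "\<bar>?\<phi> v - ?\<phi> u\<bar> \<le> \<bar>v - u\<bar>" for u v using \<sigma> by auto
  qed (use ab in auto)
  have "negligible ((\<lambda>t. \<sigma> * (t - s)) ` ?N)"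
  proof (rule negligible_locally_Lipschitz_image)
    show "negligible ?N" using c by blast
    show "\<exists>T B. open T \<and> x \<in> T \<and> (\<forall>y\<in>?N \<inter> T. norm (\<sigma> * (y - s) - \<sigma> * (x - s)) \<le> B * norm (y - x))" for x
      using \<sigma> by (intro exI[of _ UNIV] exI[of _ 1]) auto
  qed simp
  then have neg: "negligible {t\<in>{a'<..<b'}. \<not> ((\<lambda>t. \<gamma> (?\<phi> t)) has_vector_derivative (\<Sum>i=1..m. (\<sigma> * c i (?\<phi> t)) *\<^sub>R X i (\<gamma> (?\<phi> t)))) (at t)}"
  proof (rule negligible_subset, intro subsetI)
    fix t assume t: "t \<in> {t\<in>{a'<..<b'}. \<not> ((\<lambda>t. \<gamma> (?\<phi> t)) has_vector_derivative (\<Sum>i=1..m. (\<sigma> * c i (?\<phi> t)) *\<^sub>R X i (\<gamma> (?\<phi> t)))) (at t)}"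
    have "?\<phi> t \<in> ?N"
    proof (rule ccontr)
      assume "?\<phi> t \<notin> ?N"
      then have d: "(\<gamma> has_vector_derivative (\<Sum>i=1..m. c i (?\<phi> t) *\<^sub>R X i (\<gamma> (?\<phi> t)))) (at (?\<phi> t))"
        using t ab(3) by auto
      have "(?\<phi> has_vector_derivative \<sigma>) (at t)"
        by (auto intro!: derivative_eq_intros simp: has_real_derivative_iff_has_vector_derivative[symmetric])
      from vector_diff_chain_at[OF this d]
      have "((\<lambda>t. \<gamma> (?\<phi> t)) has_vector_derivative \<sigma> *\<^sub>R (\<Sum>i=1..m. c i (?\<phi> t) *\<^sub>R X i (\<gamma> (?\<phi> t)))) (at t)"
        by (simp add: o_def)
      then show False using t by (simp add: scaleR_sum_right)
    qed
    then show "t \<in> (\<lambda>t. \<sigma> * (t - s)) ` ?N"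
      using inv(2)[of t] by (metis (no_types, lifting) image_eqI)
  qed
  have cm: "c i \<in> borel_measurable lebesgue" if "i \<in> {1..m}" for i using c that by blast
  have "(\<lambda>t. \<sigma> * c i (?\<phi> t)) \<in> borel_measurable lebesgue" if "i \<in> {1..m}" for i
    using borel_measurable_affine[OF cm[OF that] \<sigma>2(2), of s] by simp
  moreover have "(\<lambda>t. \<gamma> (?\<phi> t)) ` {a'..b'} \<subseteq> \<Omega>"
    using c ab(2) by auto
  ultimately show "controlled_curve \<Omega> m X a' b' (\<lambda>t. \<gamma> (?\<phi> t)) (\<lambda>i t. \<sigma> * c i (?\<phi> t))"
    unfolding controlled_curve_def using ab(1) AC neg by blast
  have sp: "speed m (\<lambda>i t. \<sigma> * c i (?\<phi> t)) t = speed m c (?\<phi> t)" for t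
    using \<sigma> by (auto simp: speed_def power_mult_distrib)
  have ind: "indicator {a'..b'} t = (indicator {a..b} (?\<phi> t) :: ennreal)" for t
    using ab(2)[of t] by (auto simp: indicator_def)
  define F where "F t = ennreal (speed m c t) * indicator {a..b} t" for t
  have Fm: "F \<in> borel_measurable lebesgue"
    unfolding F_def using cm by (intro speed_indicator_measurable) blast
  have "(\<integral>\<^sup>+t. F t \<partial>lebesgue) = (\<integral>\<^sup>+t. F (?\<phi> t) \<partial>lebesgue)"
    using nn_integral_real_affine_lebesgue[OF Fm \<sigma>2(2), of s] \<sigma>2(3) by simp
  then show "control_length m a' b' (\<lambda>i t. \<sigma> * c i (?\<phi> t)) = control_length m a b c"
    by (simp add: control_length_def sp ind F_def)
qed

text \<open>Absolute continuity comes from the curves \<open>\<gamma>1 (min t b)\<close> and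
  \<open>\<gamma>2 (max t b)\<close>, frozen after and before the junction, whose increments
  together dominate those of the joined curve.\<close>

lemma controlled_curve_join:
  assumes 1: "controlled_curve \<Omega> m X a b \<gamma>1 c1" and 2: "controlled_curve \<Omega> m X b d \<gamma>2 c2" and eq: "\<gamma>1 b = \<gamma>2 b"
  shows "controlled_curve \<Omega> m X a d (\<lambda>t. if t \<le> b then \<gamma>1 t else \<gamma>2 t) (\<lambda>i t. if t \<le> b then c1 i t else c2 i t)"
    and "control_length m a d (\<lambda>i t. if t \<le> b then c1 i t else c2 i t) \<le> control_length m a b c1 + control_length m b d c2"
proof -
  note c1 = 1[unfolded controlled_curve_def] and c2 = 2[unfolded controlled_curve_def]
  let ?\<gamma> = "\<lambda>t. if t \<le> b then \<gamma>1 t else \<gamma>2 t" and ?c = "\<lambda>i t. if t \<le> b then c1 i t else c2 i t"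
  have ab: "a \<le> b" "b \<le> d" using c1 c2 by auto
  have AC: "abs_continuous_curve a d ?\<gamma>"
  proof (rule abs_continuous_curve_dominated)
    show "abs_continuous_curve a d (\<lambda>t. \<gamma>1 (min t b))"
      by (rule abs_continuous_curve_compose[where a=a and b=b]) (use c1 ab in auto)
    show "abs_continuous_curve a d (\<lambda>t. \<gamma>2 (max t b))"
      by (rule abs_continuous_curve_compose[where a=b and b=d]) (use c2 ab in auto)
    fix u v assume "a \<le> u" "u \<le> v" "v \<le> d"
    then show "dist (?\<gamma> u) (?\<gamma> v) \<le> dist (\<gamma>1 (min u b)) (\<gamma>1 (min v b)) + dist (\<gamma>2 (max u b)) (\<gamma>2 (max v b))"
      using dist_triangle[of "\<gamma>1 u" "\<gamma>2 v" "\<gamma>1 b"] eq by (auto simp: min_def max_def)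
  qed
  let ?N1 = "{t\<in>{a<..<b}. \<not> (\<gamma>1 has_vector_derivative (\<Sum>i=1..m. c1 i t *\<^sub>R X i (\<gamma>1 t))) (at t)}"
  let ?N2 = "{t\<in>{b<..<d}. \<not> (\<gamma>2 has_vector_derivative (\<Sum>i=1..m. c2 i t *\<^sub>R X i (\<gamma>2 t))) (at t)}"
  have "negligible (?N1 \<union> ?N2 \<union> {b})" using c1 c2 by (intro negligible_Un) auto
  then have neg: "negligible {t\<in>{a<..<d}. \<not> (?\<gamma> has_vector_derivative (\<Sum>i=1..m. ?c i t *\<^sub>R X i (?\<gamma> t))) (at t)}"
  proof (rule negligible_subset, intro subsetI)
    fix t assume t: "t \<in> {t\<in>{a<..<d}. \<not> (?\<gamma> has_vector_derivative (\<Sum>i=1..m. ?c i t *\<^sub>R X i (?\<gamma> t))) (at t)}"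
    consider "t < b" | "t = b" | "t > b" by linarith
    then show "t \<in> ?N1 \<union> ?N2 \<union> {b}"
    proof cases
      case 1
      have "(?\<gamma> has_vector_derivative D) (at t)" if "(\<gamma>1 has_vector_derivative D) (at t)" for D
        by (rule has_vector_derivative_transform_within_open[OF that, of "{..<b}"]) (use 1 in auto)
      then show ?thesis using 1 t by auto
    next
      case 3
      have "(?\<gamma> has_vector_derivative D) (at t)" if "(\<gamma>2 has_vector_derivative D) (at t)" for D
        by (rule has_vector_derivative_transform_within_open[OF that, of "{b<..}"]) (use 3 in auto)
      then show ?thesis using 3 t by auto
    qed auto
  qed
  have cm: "c1 i \<in> borel_measurable lebesgue" "c2 i \<in> borel_measurable lebesgue" if "i \<in> {1..m}" for i
    using c1 c2 that by blast+
  have "{t. t \<le> b} \<in> sets lebesgue" by simp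
  then have "?c i \<in> borel_measurable lebesgue" if "i \<in> {1..m}" for i
    using cm[OF that] by (intro measurable_If) auto
  moreover have "?\<gamma> ` {a..d} \<subseteq> \<Omega>" using c1 c2 by (auto simp: image_subset_iff)
  ultimately show "controlled_curve \<Omega> m X a d ?\<gamma> ?c"
    unfolding controlled_curve_def using ab AC neg by auto
  have "control_length m a d ?c \<le> (\<integral>\<^sup>+t. ennreal (speed m c1 t) * indicator {a..b} t + ennreal (speed m c2 t) * indicator {b..d} t \<partial>lebesgue)"
    unfolding control_length_def by (intro nn_integral_mono) (auto simp: indicator_def speed_def)
  also have "\<dots> = control_length m a b c1 + control_length m b d c2"
    unfolding control_length_def using cm by (intro nn_integral_add speed_indicator_measurable) blast+
  finally show "control_length m a d ?c \<le> control_length m a b c1 + control_length m b d c2" .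
qed

text \<open>Integration of a velocity bound. Two choices of \<open>T\<close> occur: the identity,
  with \<open>B\<close> the local bound \<open>M\<close> of the fields, and the inner product with a
  vector normal to the fields at a point, with a small \<open>B\<close>.\<close>

lemma control_length_norm_diff_le:
  fixes T :: "real ^ 'n \<Rightarrow> 'a::real_normed_vector"
  assumes cc: "controlled_curve \<Omega> m X a b \<gamma> c" and T: "bounded_linear T" "\<And>v. norm (T v) \<le> norm v" and B: "B > 0"
    and le: "\<And>t. a < t \<Longrightarrow> t < b \<Longrightarrow> norm (T (\<Sum>i=1..m. c i t *\<^sub>R X i (\<gamma> t))) \<le> B * speed m c t"
  shows "ennreal (norm (T (\<gamma> b) - T (\<gamma> a))) \<le> ennreal B * control_length m a b c"
proof (cases "control_length m a b c = top")
  case True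
  then show ?thesis using B by (simp add: ennreal_mult_top)
next
  case False
  note c = cc[unfolded controlled_curve_def]
  then obtain l where l: "control_length m a b c = ennreal l" "l \<ge> 0" using False by (cases "control_length m a b c") auto
  have [measurable]: "speed m c \<in> borel_measurable lebesgue" using c by (intro speed_measurable) blast
  have "((\<lambda>t. speed m c t * indicator {a..b} t) has_integral l) UNIV"
  proof (subst has_integral_iff_nn_integral_lebesgue)
    have "(\<lambda>t. speed m c t * indicator {a..b} t) \<in> borel_measurable lebesgue"
      by (intro borel_measurable_times borel_measurable_indicator) auto
    moreover have "(\<integral>\<^sup>+t. ennreal (speed m c t * indicator {a..b} t) \<partial>lebesgue) = ennreal l"
      unfolding l(1)[symmetric] control_length_def by (intro nn_integral_cong) (auto simp: indicator_def)
    ultimately show "(\<lambda>t. speed m c t * indicator {a..b} t) \<in> borel_measurable lebesgue \<and>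
       (\<integral>\<^sup>+t. ennreal (speed m c t * indicator {a..b} t) \<partial>lebesgue) = ennreal l \<and> 0 \<le> l" using l by simp
  qed simp
  moreover have "(\<lambda>t. speed m c t * indicator {a..b} t) = (\<lambda>t. if t \<in> {a..b} then speed m c t else 0)"
    by (auto simp: indicator_def)
  ultimately have "(speed m c has_integral l) {a..b}"
    by (simp only: has_integral_restrict_UNIV)
  then have int: "((\<lambda>t. B * speed m c t) has_integral (B * l)) {a..b}"
    by (rule has_integral_mult_right)
  have lin: "linear T" using T(1) by (rule bounded_linear.linear)
  have "norm (T (\<gamma> b) - T (\<gamma> a)) \<le> B * l"
  proof (rule abs_continuous_curve_norm_diff_le[OF _ _ _ _ _ _ int])
    show "abs_continuous_curve a b (\<lambda>t. T (\<gamma> t))"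
    proof (rule abs_continuous_curve_dominated)
      show "abs_continuous_curve a b \<gamma>" using c by blast
      show "abs_continuous_curve a b (\<lambda>t. 0 :: real)" by (rule abs_continuous_curve_lipschitz[of _ _ _ 0]) auto
      show "dist (T (\<gamma> u)) (T (\<gamma> v)) \<le> dist (\<gamma> u) (\<gamma> v) + dist (0::real) 0" for u v
        using T(2)[of "\<gamma> u - \<gamma> v"] by (simp add: dist_norm linear_diff[OF lin])
    qed
    show "negligible {t\<in>{a<..<b}. \<not> (\<gamma> has_vector_derivative (\<Sum>i=1..m. c i t *\<^sub>R X i (\<gamma> t))) (at t)}"
      using c by blast
    show "((\<lambda>t. T (\<gamma> t)) has_vector_derivative T (\<Sum>i=1..m. c i t *\<^sub>R X i (\<gamma> t))) (at t)"
      if "a < t" "t < b" "t \<notin> {t\<in>{a<..<b}. \<not> (\<gamma> has_vector_derivative (\<Sum>i=1..m. c i t *\<^sub>R X i (\<gamma> t))) (at t)}" for t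
      using that by (intro bounded_linear.has_vector_derivative[OF T(1)]) auto
  qed (use c le B in auto)
  then show ?thesis using l B by (simp add: ennreal_mult[symmetric] ennreal_leI)
qed

section \<open>Metric properties of \<open>cc_dist\<close>\<close>

context
  fixes \<Omega> :: "(real ^ 'n) set" and m :: nat and X :: "nat \<Rightarrow> real ^ 'n \<Rightarrow> real ^ 'n"
  assumes ind: "\<And>p. p \<in> \<Omega> \<Longrightarrow> lin_indep_family m (\<lambda>i. X i p)"
begin

lemma cc_dist_le_control_length:
  assumes "controlled_curve \<Omega> m X a b \<gamma> c"
  shows "cc_dist \<Omega> m X (\<gamma> a) (\<gamma> b) \<le> control_length m a b c"
proof -
  have "horizontal_curve \<Omega> m X a b \<gamma>"
    by (rule controlled_curve_imp_horizontal(1)[OF ind assms])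
  then have "cc_dist \<Omega> m X (\<gamma> a) (\<gamma> b) \<le> horizontal_length m X a b \<gamma>"
    unfolding cc_dist_def by (intro Inf_lower) blast
  also have "\<dots> = control_length m a b c"
    by (rule controlled_curve_imp_horizontal(2)[OF ind assms])
  finally show ?thesis .
qed

lemma cc_dist_lessE:
  assumes "cc_dist \<Omega> m X x y < e"
  obtains a b \<gamma> c where "controlled_curve \<Omega> m X a b \<gamma> c" "\<gamma> a = x" "\<gamma> b = y" "control_length m a b c < e"
proof -
  obtain a b \<gamma> where *: "horizontal_curve \<Omega> m X a b \<gamma>" "\<gamma> a = x" "\<gamma> b = y" "horizontal_length m X a b \<gamma> < e"
    using assms unfolding cc_dist_def Inf_less_iff by blast
  obtain c where c: "controlled_curve \<Omega> m X a b \<gamma> c"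
    using horizontal_curve_imp_controlled[OF *(1)] .
  have "horizontal_length m X a b \<gamma> = control_length m a b c"
    by (rule controlled_curve_imp_horizontal(2)[OF ind c])
  with * show thesis using that[OF c] by simp
qed

lemma cc_dist_refl:
  assumes "x \<in> \<Omega>"
  shows "cc_dist \<Omega> m X x x = 0"
proof -
  have "controlled_curve \<Omega> m X 0 0 (\<lambda>_. x) (\<lambda>_ _. 0)"
    using assms by (auto simp: controlled_curve_def intro!: abs_continuous_curve_lipschitz[of _ _ _ 0])
  from cc_dist_le_control_length[OF this] show ?thesis
    by (simp add: control_length_def speed_def)
qed

lemma cc_dist_sym_le: "cc_dist \<Omega> m X y x \<le> cc_dist \<Omega> m X x y"
proof (rule ccontr)
  assume "\<not> ?thesis"
  then have "cc_dist \<Omega> m X x y < cc_dist \<Omega> m X y x" by simp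
  then obtain a b \<gamma> c where c: "controlled_curve \<Omega> m X a b \<gamma> c" "\<gamma> a = x" "\<gamma> b = y"
    "control_length m a b c < cc_dist \<Omega> m X y x"
    by (rule cc_dist_lessE)
  have "a \<le> b" using c by (auto simp: controlled_curve_def)
  note r = controlled_curve_reparam[OF c(1), of "-1" "-b" "-a" 0]
  have "cc_dist \<Omega> m X (\<gamma> (0 + - 1 * - b)) (\<gamma> (0 + - 1 * - a)) \<le> control_length m (-b) (-a) (\<lambda>i t. - 1 * c i (0 + - 1 * t))"
    using \<open>a \<le> b\<close> by (intro cc_dist_le_control_length r(1)) auto
  also have "\<dots> = control_length m a b c"
    using \<open>a \<le> b\<close> by (intro r(2)) auto
  finally show False using c by simp
qed

lemma cc_dist_sym: "cc_dist \<Omega> m X x y = cc_dist \<Omega> m X y x"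
  by (intro antisym cc_dist_sym_le)

lemma cc_dist_triangle: "cc_dist \<Omega> m X x z \<le> cc_dist \<Omega> m X x y + cc_dist \<Omega> m X y z"
proof (rule ennreal_le_epsilon)
  fix e :: real assume fin: "cc_dist \<Omega> m X x y + cc_dist \<Omega> m X y z < top" and "e > 0"
  have lt: "u < u + ennreal (e/2)" if ut: "u < top" for u
  proof -
    obtain r where "u = ennreal r" "r \<ge> 0" using ut by (cases u) auto
    then show ?thesis using \<open>e > 0\<close> by (simp add: ennreal_plus[symmetric] ennreal_less_iff del: ennreal_plus)
  qed
  have "cc_dist \<Omega> m X x y < cc_dist \<Omega> m X x y + ennreal (e/2)" using fin by (intro lt) auto
  then obtain a b \<gamma> c where c: "controlled_curve \<Omega> m X a b \<gamma> c" "\<gamma> a = x" "\<gamma> b = y"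
    "control_length m a b c < cc_dist \<Omega> m X x y + ennreal (e/2)"
    by (rule cc_dist_lessE)
  have "cc_dist \<Omega> m X y z < cc_dist \<Omega> m X y z + ennreal (e/2)" using fin by (intro lt) auto
  then obtain a' b' \<gamma>' c' where c': "controlled_curve \<Omega> m X a' b' \<gamma>' c'" "\<gamma>' a' = y" "\<gamma>' b' = z"
    "control_length m a' b' c' < cc_dist \<Omega> m X y z + ennreal (e/2)"
    by (rule cc_dist_lessE)
  have "a' \<le> b'" "a \<le> b" using c(1) c'(1) by (auto simp: controlled_curve_def)
  define s where "s = a' - b"
  have r: "controlled_curve \<Omega> m X b (b' - s) (\<lambda>t. \<gamma>' (s + 1 * t)) (\<lambda>i t. 1 * c' i (s + 1 * t))"
    "control_length m b (b' - s) (\<lambda>i t. 1 * c' i (s + 1 * t)) = control_length m a' b' c'"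
    using \<open>a' \<le> b'\<close> by (intro controlled_curve_reparam[OF c'(1)]; auto simp: s_def)+
  have "\<gamma> b = \<gamma>' (s + 1 * b)" using c c' by (simp add: s_def)
  note j = controlled_curve_join[OF c(1) r(1) this]
  from cc_dist_le_control_length[OF j(1)] have "cc_dist \<Omega> m X (\<gamma> a) (if b' - s \<le> b then \<gamma> (b' - s) else \<gamma>' (s + 1 * (b' - s)))
     \<le> control_length m a b c + control_length m a' b' c'"
    using j(2) r(2) \<open>a \<le> b\<close> by (auto intro: order_trans)
  moreover have "(if b' - s \<le> b then \<gamma> (b' - s) else \<gamma>' (s + 1 * (b' - s))) = z"
    using c c' \<open>a' \<le> b'\<close> by (auto simp: s_def)
  ultimately have "cc_dist \<Omega> m X x z \<le> control_length m a b c + control_length m a' b' c'"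
    using c(2) by simp
  also have "\<dots> \<le> (cc_dist \<Omega> m X x y + ennreal (e/2)) + (cc_dist \<Omega> m X y z + ennreal (e/2))"
    using c(4) c'(4) by (intro add_mono less_imp_le)
  also have "\<dots> = cc_dist \<Omega> m X x y + cc_dist \<Omega> m X y z + (ennreal (e/2) + ennreal (e/2))"
    by (simp add: add.assoc add.left_commute)
  also have "ennreal (e/2) + ennreal (e/2) = ennreal e"
    using \<open>e > 0\<close> by (simp add: ennreal_plus[symmetric] del: ennreal_plus)
  finally show "cc_dist \<Omega> m X x z \<le> cc_dist \<Omega> m X x y + cc_dist \<Omega> m X y z + ennreal e" .
qed

end

lemma abs_continuous_curve_continuous:
  assumes "abs_continuous_curve a b \<gamma>"
  shows "continuous_on {a..b} \<gamma>"
  unfolding continuous_on_iff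
proof (intro ballI allI impI)
  fix x and e :: real assume x: "x \<in> {a..b}" and e: "0 < e"
  obtain d where d: "d > 0" "\<forall>I. finite I \<longrightarrow> (\<forall>u v. (u, v) \<in> I \<longrightarrow> a \<le> u \<and> u \<le> v \<and> v \<le> b) \<longrightarrow>
       disjoint_family_on (\<lambda>(u, v). {u<..<v}) I \<longrightarrow> (\<Sum>(u, v)\<in>I. v - u) < d \<longrightarrow> (\<Sum>(u, v)\<in>I. dist (\<gamma> u) (\<gamma> v)) < e"
    using abs_continuous_curveD[OF assms e] by blast
  have "dist (\<gamma> y) (\<gamma> x) < e" if y: "y \<in> {a..b}" "dist y x < d" for y
  proof -
    have "(\<Sum>(u, v)\<in>{(min x y, max x y)}. dist (\<gamma> u) (\<gamma> v)) < e"
    proof (rule d(2)[rule_format])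
      show "a \<le> u \<and> u \<le> v \<and> v \<le> b" if "(u, v) \<in> {(min x y, max x y)}" for u v
        using that x y by auto
      show "(\<Sum>(u, v)\<in>{(min x y, max x y)}. v - u) < d"
        using y by (auto simp: dist_real_def)
    qed (simp_all add: disjoint_family_on_def)
    then show ?thesis by (cases "x \<le> y") (simp_all add: dist_commute)
  qed
  then show "\<exists>d>0. \<forall>y\<in>{a..b}. dist y x < d \<longrightarrow> dist (\<gamma> y) (\<gamma> x) < e"
    using d(1) by blast
qed

lemma abs_le_l2norm:
  fixes c :: "nat \<Rightarrow> real"
  assumes "i \<in> {1..m}"
  shows "\<bar>c i\<bar> \<le> sqrt (\<Sum>i=1..m. (c i)\<^sup>2)"
proof -
  have "(c i)\<^sup>2 \<le> (\<Sum>i=1..m. (c i)\<^sup>2)" using assms by (intro member_le_sum) auto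
  then show ?thesis using real_le_rsqrt real_sqrt_abs by (metis real_sqrt_le_iff)
qed

lemma l2norm_le_sum: "sqrt (\<Sum>i=1..m. (c i)\<^sup>2) \<le> (\<Sum>i=1..m. \<bar>c i :: real\<bar>)"
  using L2_set_le_sum_abs[of c "{1..m}"] by (simp add: L2_set_def)

lemma norm_sum_scaleR_le:
  fixes v :: "nat \<Rightarrow> 'a::real_normed_vector"
  shows "norm (\<Sum>i=1..m. c i *\<^sub>R v i) \<le> (\<Sum>i=1..m. norm (v i)) * sqrt (\<Sum>i=1..m. (c i)\<^sup>2)"
proof -
  have "norm (\<Sum>i=1..m. c i *\<^sub>R v i) \<le> (\<Sum>i=1..m. norm (v i) * sqrt (\<Sum>i=1..m. (c i)\<^sup>2))"
  proof (rule sum_norm_le)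
    fix i assume "i \<in> {1..m}"
    then have "norm (v i) * \<bar>c i\<bar> \<le> norm (v i) * sqrt (\<Sum>i=1..m. (c i)\<^sup>2)"
      by (intro mult_left_mono abs_le_l2norm) auto
    then show "norm (c i *\<^sub>R v i) \<le> norm (v i) * sqrt (\<Sum>i=1..m. (c i)\<^sup>2)"
      by (simp add: mult.commute)
  qed
  then show ?thesis by (simp add: sum_distrib_right)
qed

text \<open>Functionals dual to the fields at one point are what later recovers coefficients of
  horizontal vectors near it. Since \<open>lin_indep_family\<close> speaks of indexed vectors and
  \<open>independent\<close> of sets, injectivity is needed for the translation.\<close>

lemma lin_indep_family_dual:
  fixes v :: "nat \<Rightarrow> 'a::euclidean_space"
  assumes ind: "lin_indep_family m v"
  shows "inj_on v {1..m}"
    and "\<exists>G. \<forall>j\<in>{1..m}. linear (G j) \<and> (\<forall>i\<in>{1..m}. G j (v i) = (if i = j then 1 else 0 :: real))"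
proof -
  show inj: "inj_on v {1..m}"
  proof (rule inj_onI, rule ccontr)
    fix i j assume ij: "i \<in> {1..m}" "j \<in> {1..m}" "v i = v j" "i \<noteq> j"
    define c where "c k = (if k = i then 1 else if k = j then -1 else 0 :: real)" for k
    have "(\<Sum>k=1..m. c k *\<^sub>R v k) = (\<Sum>k\<in>{i, j}. c k *\<^sub>R v k)"
      using ij by (intro sum.mono_neutral_right) (auto simp: c_def)
    also have "\<dots> = 0" using ij by (simp add: c_def)
    finally have "\<forall>k\<in>{1..m}. c k = 0" using ind unfolding lin_indep_family_def by blast
    then have "c i = 0" using ij(1) by blast
    then show False by (simp add: c_def)
  qed
  have "independent (v ` {1..m})"
  proof
    assume "dependent (v ` {1..m})"
    then obtain u where u: "\<exists>x\<in>v ` {1..m}. u x \<noteq> 0" "(\<Sum>x\<in>v ` {1..m}. u x *\<^sub>R x) = 0"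
      using dependent_finite[of "v ` {1..m}"] by auto
    have "(\<Sum>k=1..m. u (v k) *\<^sub>R v k) = 0"
      using u(2) unfolding sum.reindex[OF inj] by (simp add: o_def)
    then have "\<forall>k\<in>{1..m}. u (v k) = 0"
      using ind unfolding lin_indep_family_def by (elim allE[of _ "\<lambda>k. u (v k)"]) simp
    then show False using u(1) by auto
  qed
  then have "\<exists>g. linear g \<and> (\<forall>x\<in>v ` {1..m}. g x = (if x = v j then 1 else 0 :: real))" for j
    by (rule linear_independent_extend)
  then obtain G where G: "\<And>j. linear (G j)" "\<And>j x. x \<in> v ` {1..m} \<Longrightarrow> G j x = (if x = v j then 1 else 0 :: real)"
    by metis
  then show "\<exists>G. \<forall>j\<in>{1..m}. linear (G j) \<and> (\<forall>i\<in>{1..m}. G j (v i) = (if i = j then 1 else 0 :: real))"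
  proof (intro exI[of _ G] ballI conjI)
    fix i j assume "i \<in> {1..m}" "j \<in> {1..m}"
    then show "G j (v i) = (if i = j then 1 else 0)"
      using G(2)[of "v i" j] inj_on_eq_iff[OF inj, of i j] by simp
  qed (rule G(1))
qed

section \<open>Comparison with the Euclidean metric near a point\<close>

text \<open>The functionals \<open>G j\<close> are constructed as dual to the fields at the centre
  and stay fixed while the fields vary with \<open>q\<close>. With entries within
  \<open>1 / (2 * m)\<close>, the matrix of the \<open>G j (X i q)\<close> differs from the identity
  by at most 1/2 in the sum norm, which makes coefficients recoverable throughout the ball.\<close>

locale cc_chart =
  fixes \<Omega> :: "(real ^ 'n) set" and m :: nat and X :: "nat \<Rightarrow> real ^ 'n \<Rightarrow> real ^ 'n"
    and p :: "real ^ 'n" and R M \<mu> :: real and G :: "nat \<Rightarrow> real ^ 'n \<Rightarrow> real"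
  assumes ind: "\<And>q. q \<in> \<Omega> \<Longrightarrow> lin_indep_family m (\<lambda>i. X i q)"
    and R: "R > 0" "cball p R \<subseteq> \<Omega>" and M: "M > 0" and mu: "\<mu> > 0"
    and cont: "\<And>i. i \<in> {1..m} \<Longrightarrow> continuous_on (cball p R) (X i)"
    and upper: "\<And>q c. q \<in> cball p R \<Longrightarrow> norm (\<Sum>i=1..m. c i *\<^sub>R X i q) \<le> M * sqrt (\<Sum>i=1..m. (c i)\<^sup>2)"
    and lower: "\<And>q c. q \<in> cball p R \<Longrightarrow> \<mu> * sqrt (\<Sum>i=1..m. (c i)\<^sup>2) \<le> norm (\<Sum>i=1..m. c i *\<^sub>R X i q)"
    and G: "\<And>j. j \<in> {1..m} \<Longrightarrow> linear (G j)"
    and GX: "\<And>i j q. i \<in> {1..m} \<Longrightarrow> j \<in> {1..m} \<Longrightarrow> q \<in> cball p R \<Longrightarrow>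
       \<bar>(if i = j then 1 else 0) - G j (X i q)\<bar> \<le> 1 / (2 * real m)"

text \<open>The lower bound is the substance: \<open>G j\<close> applied to a combination of the
  fields near \<open>p\<close> returns \<open>c j\<close> up to an error, and all errors together
  are at most half of the sum of the \<open>\<bar>c j\<bar>\<close>, which can be absorbed.\<close>

lemma ex_cc_chart:
  fixes X :: "nat \<Rightarrow> real ^ 'n \<Rightarrow> real ^ 'n"
  assumes "open \<Omega>" and lip: "\<And>i. i \<in> {1..m} \<Longrightarrow> locally_lipschitz_on \<Omega> (X i)"
    and ind: "\<And>q. q \<in> \<Omega> \<Longrightarrow> lin_indep_family m (\<lambda>i. X i q)" and p: "p \<in> \<Omega>"
  shows "\<exists>R M \<mu> G. cc_chart \<Omega> m X p R M \<mu> G"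
proof -
  have contO: "continuous_on \<Omega> (X i)" if i: "i \<in> {1..m}" for i
    unfolding continuous_on_eq_continuous_at[OF \<open>open \<Omega>\<close>]
  proof
    fix q assume q: "q \<in> \<Omega>"
    obtain r L where r: "r > 0" "L-lipschitz_on (ball q r \<inter> \<Omega>) (X i)"
      using lip[OF i] q unfolding locally_lipschitz_on_def by blast
    have "continuous_on (ball q r \<inter> \<Omega>) (X i)" using r(2) by (rule lipschitz_on_continuous_on)
    then show "isCont (X i) q"
      using r(1) q \<open>open \<Omega>\<close> by (subst (asm) continuous_on_eq_continuous_at) auto
  qed
  obtain G where G: "\<And>j. j \<in> {1..m} \<Longrightarrow> linear (G j)"
    "\<And>i j. i \<in> {1..m} \<Longrightarrow> j \<in> {1..m} \<Longrightarrow> G j (X i p) = (if i = j then 1 else 0 :: real)"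
    using lin_indep_family_dual(2)[OF ind[OF p]] by metis
  have "\<exists>k>0. \<forall>v. \<bar>G j v\<bar> \<le> norm v * k" if "j \<in> {1..m}" for j
    using bounded_linear.pos_bounded[of "G j"] G(1)[OF that] by (auto simp: linear_conv_bounded_linear)
  then obtain k where k: "\<And>j. j \<in> {1..m} \<Longrightarrow> k j > 0" "\<And>j v. j \<in> {1..m} \<Longrightarrow> \<bar>G j v\<bar> \<le> norm v * k j" by metis
  define K where "K = (\<Sum>j=1..m. k j) + 1"
  have "0 \<le> (\<Sum>j=1..m. k j)" by (rule sum_nonneg) (use k(1) less_imp_le in blast)
  then have K: "K > 0" by (simp add: K_def)
  have GK: "\<bar>G j v\<bar> \<le> K * norm v" if "j \<in> {1..m}" for j v
  proof -
    have "k j \<le> (\<Sum>j=1..m. k j)" using that k(1) by (intro member_le_sum) (auto intro: less_imp_le)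
    then have "norm v * k j \<le> norm v * K" by (intro mult_left_mono) (auto simp: K_def)
    with k(2)[OF that, of v] show ?thesis by (simp add: mult.commute)
  qed
  \<comment> \<open>\<open>K * \<eta>\<close> has to be at most \<open>1 / (2 * m)\<close>; with
    \<open>Suc m\<close> the quotient is positive also for \<open>m = 0\<close>.\<close>
  define \<eta> where "\<eta> = 1 / (2 * real (Suc m) * K)"
  have \<eta>: "\<eta> > 0" using K by (simp add: \<eta>_def)
  have "\<exists>r>0. \<forall>q. dist q p < r \<longrightarrow> dist (X i q) (X i p) < \<eta>" if "i \<in> {1..m}" for i
  proof -
    have "isCont (X i) p" using contO[OF that] \<open>open \<Omega>\<close> p continuous_on_eq_continuous_at by blast
    then show ?thesis using \<eta> unfolding continuous_at_eps_delta by blast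
  qed
  then obtain r where r: "\<And>i. i \<in> {1..m} \<Longrightarrow> r i > 0"
    "\<And>i q. i \<in> {1..m} \<Longrightarrow> dist q p < r i \<Longrightarrow> dist (X i q) (X i p) < \<eta>" by metis
  obtain R0 where R0: "R0 > 0" "cball p R0 \<subseteq> \<Omega>"
    using \<open>open \<Omega>\<close> p open_contains_cball by blast
  define R where "R = Min (insert R0 (r ` {1..m})) / 2"
  have R: "R > 0" using R0(1) r(1) by (simp add: R_def Min_gr_iff)
  have "Min (insert R0 (r ` {1..m})) \<le> R0" by (rule Min_le) auto
  then have RR0: "R \<le> R0" using R unfolding R_def by linarith
  have Rr: "R < r i" if "i \<in> {1..m}" for i
  proof -
    have "Min (insert R0 (r ` {1..m})) \<le> r i" by (rule Min_le) (use that in auto)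
    then show ?thesis using R unfolding R_def by linarith
  qed
  have close: "norm (X i q - X i p) \<le> \<eta>" if "i \<in> {1..m}" "q \<in> cball p R" for i q
    using r(2)[OF that(1), of q] Rr[OF that(1)] that(2) by (force simp: dist_norm norm_minus_commute)
  have GX: "\<bar>(if i = j then 1 else 0) - G j (X i q)\<bar> \<le> 1 / (2 * real m)"
    if i: "i \<in> {1..m}" and j: "j \<in> {1..m}" and q: "q \<in> cball p R" for i j q
  proof -
    have "(if i = j then 1 else 0) - G j (X i q) = G j (X i p - X i q)"
      using G(2)[OF i j] linear_diff[OF G(1)[OF j]] by simp
    also have "\<bar>\<dots>\<bar> \<le> K * norm (X i p - X i q)" by (rule GK[OF j])
    also have "\<dots> \<le> K * \<eta>" using close[OF i q] K by (simp add: norm_minus_commute)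
    also have "\<dots> = 1 / (2 * real (Suc m))" using K by (simp add: \<eta>_def)
    also have "\<dots> \<le> 1 / (2 * real m)" using i by (intro divide_left_mono) auto
    finally show ?thesis .
  qed
  define M where "M = (\<Sum>i=1..m. norm (X i p) + \<eta>) + 1"
  have M: "M > 0" using \<eta> by (simp add: M_def sum_nonneg add_nonneg_pos)
  \<comment> \<open>The reciprocal of the bound \<open>2 * m * K\<close> found below for the
    coefficients, with 1 added because \<open>m\<close> may be 0.\<close>
  define \<mu> where "\<mu> = 1 / (2 * real m * K + 1)"
  have mu: "\<mu> > 0" using K by (simp add: \<mu>_def add_nonneg_pos)
  have upper: "norm (\<Sum>i=1..m. c i *\<^sub>R X i q) \<le> M * sqrt (\<Sum>i=1..m. (c i)\<^sup>2)" if q: "q \<in> cball p R" for q c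
  proof -
    have "(\<Sum>i=1..m. norm (X i q)) \<le> (\<Sum>i=1..m. norm (X i p) + \<eta>)"
    proof (rule sum_mono)
      fix i assume "i \<in> {1..m}"
      then show "norm (X i q) \<le> norm (X i p) + \<eta>"
        using close[of i q] q norm_triangle_sub[of "X i q" "X i p"] by simp
    qed
    then have "(\<Sum>i=1..m. norm (X i q)) * sqrt (\<Sum>i=1..m. (c i)\<^sup>2) \<le> M * sqrt (\<Sum>i=1..m. (c i)\<^sup>2)"
      by (intro mult_right_mono) (auto simp: M_def sum_nonneg)
    with norm_sum_scaleR_le[where c=c and v="\<lambda>i. X i q" and m=m] show ?thesis by linarith
  qed
  have lower: "\<mu> * sqrt (\<Sum>i=1..m. (c i)\<^sup>2) \<le> norm (\<Sum>i=1..m. c i *\<^sub>R X i q)" if q: "q \<in> cball p R" for q c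
  proof -
    let ?v = "\<Sum>i=1..m. c i *\<^sub>R X i q" and ?s = "\<Sum>i=1..m. \<bar>c i\<bar>"
    have cj: "\<bar>c j\<bar> \<le> K * norm ?v + ?s / (2 * real m)" if j: "j \<in> {1..m}" for j
    proof -
      have "G j ?v = (\<Sum>i=1..m. c i * G j (X i q))"
        by (simp add: linear_sum[OF G(1)[OF j]] linear_scale[OF G(1)[OF j]])
      moreover have "c j = (\<Sum>i=1..m. c i * (if i = j then 1 else 0))"
        using j by (simp add: if_distrib sum.delta cong: if_cong)
      ultimately have "c j = G j ?v + (\<Sum>i=1..m. c i * ((if i = j then 1 else 0) - G j (X i q)))"
        by (simp add: right_diff_distrib sum_subtractf)
      also have "\<bar>\<dots>\<bar> \<le> \<bar>G j ?v\<bar> + (\<Sum>i=1..m. \<bar>c i\<bar> * (1 / (2 * real m)))"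
      proof (intro order_trans[OF abs_triangle_ineq] add_mono order_refl order_trans[OF sum_abs] sum_mono)
        fix i assume i: "i \<in> {1..m}"
        show "\<bar>c i * ((if i = j then 1 else 0) - G j (X i q))\<bar> \<le> \<bar>c i\<bar> * (1 / (2 * real m))"
          unfolding abs_mult by (intro mult_left_mono GX i j q) simp
      qed
      also have "\<dots> \<le> K * norm ?v + ?s / (2 * real m)"
        using GK[OF j, of ?v] by (simp add: sum_divide_distrib)
      finally show ?thesis .
    qed
    \<comment> \<open>Summing over \<open>j\<close> leaves \<open>?s / 2\<close> on the right, which
      moves to the left.\<close>
    have "?s \<le> (\<Sum>j=1..m. K * norm ?v + ?s / (2 * real m))" by (intro sum_mono cj)
    also have "\<dots> \<le> real m * (K * norm ?v) + ?s / 2"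
      by (cases "m = 0") (auto simp: distrib_left)
    finally have "?s \<le> 2 * real m * K * norm ?v" by (simp add: algebra_simps)
    with l2norm_le_sum[of c m] have "sqrt (\<Sum>i=1..m. (c i)\<^sup>2) \<le> 2 * real m * K * norm ?v" by linarith
    also have "\<dots> \<le> (2 * real m * K + 1) * norm ?v" by (intro mult_right_mono) auto
    finally have "sqrt (\<Sum>i=1..m. (c i)\<^sup>2) \<le> (2 * real m * K + 1) * norm ?v" .
    moreover have "2 * real m * K + 1 > 0" using K by (simp add: add_nonneg_pos)
    ultimately show ?thesis by (simp add: \<mu>_def field_simps)
  qed
  have sub: "cball p R \<subseteq> \<Omega>" using RR0 R0(2) subset_cball[of R R0 p] by blast
  have "cc_chart \<Omega> m X p R M \<mu> G"
    by (rule cc_chart.intro) (rule R sub M mu | (rule ind upper lower G(1) GX GX continuous_on_subset[OF contO sub]; assumption))+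
  then show ?thesis by blast
qed

context cc_chart
begin

text \<open>The bound \<open>M\<close> holds only inside the ball, so the argument runs up to the
  first exit time \<open>\<tau>\<close>. Until then the curve moves by at most \<open>M * e\<close>,
  hence at most \<open>R / 2\<close>, too little to lead from \<open>ball p (R / 2)\<close> to
  distance \<open>R\<close>.\<close>

lemma short_curve_in_ball:
  assumes cc: "controlled_curve \<Omega> m X a b \<gamma> c" and a: "\<gamma> a \<in> ball p (R / 2)"
    and len: "control_length m a b c < ennreal e" and e: "M * e \<le> R / 2"
  shows "\<gamma> ` {a..b} \<subseteq> ball p R"
proof (rule ccontr)
  assume "\<not> ?thesis"
  then obtain t1 where t1: "t1 \<in> {a..b}" "\<gamma> t1 \<notin> ball p R" by blast
  define S where "S = {t \<in> {a..b}. R \<le> dist p (\<gamma> t)}"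
  have contg: "continuous_on {a..b} \<gamma>"
    using cc by (intro abs_continuous_curve_continuous) (simp add: controlled_curve_def)
  have clS: "closed S"
    unfolding S_def by (rule continuous_on_closed_Collect_le) (auto intro!: continuous_intros contg)
  have t1S: "t1 \<in> S" using t1 by (simp add: S_def)
  have bdd: "bdd_below S" by (rule bdd_belowI[of _ a]) (simp add: S_def)
  have "Inf S \<in> S" by (rule closed_contains_Inf[OF _ bdd clS]) (use t1S in blast)
  define \<tau> where "\<tau> = Inf S"
  have \<tau>: "\<tau> \<in> {a..b}" "R \<le> dist p (\<gamma> \<tau>)" using \<open>Inf S \<in> S\<close> by (auto simp: S_def \<tau>_def)
  have before: "\<gamma> t \<in> cball p R" if "a \<le> t" "t < \<tau>" for t
  proof (rule ccontr)
    assume "\<gamma> t \<notin> cball p R"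
    then have "t \<in> S" using that \<tau>(1) by (simp add: S_def)
    then show False using cInf_lower[OF _ bdd, of t] that by (simp add: \<tau>_def)
  qed
  have "controlled_curve \<Omega> m X a \<tau> \<gamma> c"
    using \<tau>(1) by (intro controlled_curve_subinterval[OF cc]) auto
  then have "ennreal (norm (\<gamma> \<tau> - \<gamma> a)) \<le> ennreal M * control_length m a \<tau> c"
  proof (rule control_length_norm_diff_le[where T="\<lambda>v. v"])
    show "norm (\<Sum>i=1..m. c i t *\<^sub>R X i (\<gamma> t)) \<le> M * speed m c t" if "a < t" "t < \<tau>" for t
      using upper[OF before, of t "\<lambda>i. c i t"] that by (simp add: speed_def)
  qed (use M in auto)
  also have "\<dots> \<le> ennreal M * control_length m a b c"
    using \<tau>(1) unfolding control_length_def by (intro mult_left_mono nn_integral_mono) (auto simp: indicator_def)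
  also have "\<dots> \<le> ennreal M * ennreal e" using len by (intro mult_left_mono) auto
  also have "\<dots> \<le> ennreal (R / 2)" using M e R(1) by (simp add: ennreal_mult'[symmetric] ennreal_leI)
  finally have "dist (\<gamma> a) (\<gamma> \<tau>) \<le> R / 2" using R(1) by (simp add: dist_norm norm_minus_commute)
  then show False using a \<tau>(2) dist_triangle[of p "\<gamma> \<tau>" "\<gamma> a"] by simp
qed

text \<open>Stated for \<open>e\<close> strictly above the distance, since the infimum need not be
  attained. A curve of length below \<open>e\<close> stays in the chart, and there it moves by at
  most \<open>M\<close> times its length.\<close>

lemma dist_le_cc_dist:
  assumes x: "x \<in> ball p (R / 2)" and d: "cc_dist \<Omega> m X x y < ennreal e" and e: "M * e \<le> R / 2"
  shows "dist x y \<le> M * e"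
proof -
  obtain a b \<gamma> c where c: "controlled_curve \<Omega> m X a b \<gamma> c" "\<gamma> a = x" "\<gamma> b = y" "control_length m a b c < ennreal e"
    by (rule cc_dist_lessE[OF ind d])
  have im: "\<gamma> ` {a..b} \<subseteq> ball p R"
    by (rule short_curve_in_ball[OF c(1) _ c(4) e]) (use c x in simp)
  have in_ball: "\<gamma> t \<in> cball p R" if "a < t" "t < b" for t
    using that by (intro subsetD[OF ball_subset_cball] subsetD[OF im] imageI) auto
  have "ennreal (norm (\<gamma> b - \<gamma> a)) \<le> ennreal M * control_length m a b c"
  proof (rule control_length_norm_diff_le[where T="\<lambda>v. v", OF c(1)])
    show "norm (\<Sum>i=1..m. c i t *\<^sub>R X i (\<gamma> t)) \<le> M * speed m c t" if "a < t" "t < b" for t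
      using upper[OF in_ball, of t "\<lambda>i. c i t"] that by (simp add: speed_def)
  qed (use M in auto)
  also have "\<dots> \<le> ennreal M * ennreal e" using c(4) by (intro mult_left_mono) auto
  also have "\<dots> = ennreal (M * e)" using M by (simp add: ennreal_mult')
  finally have "ennreal (dist x y) \<le> ennreal (M * e)" using c by (simp add: dist_norm norm_minus_commute)
  moreover have "e > 0" using d by (cases "e > 0") (auto simp: ennreal_neg)
  ultimately show ?thesis using M by (simp add: ennreal_le_iff)
qed

text \<open>Along a short curve from \<open>x\<close> the fields stay close to their values at
  \<open>x\<close>, all orthogonal to \<open>w\<close>, so the component of the velocity along
  \<open>w\<close> is at most \<open>\<epsilon>\<close> times the speed. This later forces
  derivatives of \<open>d_cc\<close>-Lipschitz curves to be horizontal.\<close>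

lemma normal_displacement_small:
  assumes x: "x \<in> ball p (R / 2)" and w: "norm w \<le> 1" "\<And>i. i \<in> {1..m} \<Longrightarrow> w \<bullet> X i x = 0" and "\<epsilon> > 0"
  obtains \<delta> where "\<delta> > 0" "\<And>y e. e \<le> \<delta> \<Longrightarrow> cc_dist \<Omega> m X x y < ennreal e \<Longrightarrow> \<bar>w \<bullet> (y - x)\<bar> \<le> \<epsilon> * e"
proof -
  define \<eta> where "\<eta> = \<epsilon> / real (Suc m)"
  have \<eta>: "\<eta> > 0" using \<open>\<epsilon> > 0\<close> by (simp add: \<eta>_def)
  have xR: "x \<in> cball p R" "x \<in> ball p R" using x R(1) by auto
  have "\<exists>r>0. \<forall>z\<in>cball p R. dist z x < r \<longrightarrow> dist (X i z) (X i x) < \<eta>" if "i \<in> {1..m}" for i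
    using cont[OF that] xR(1) \<eta> unfolding continuous_on_iff by blast
  then obtain r where r: "\<And>i. i \<in> {1..m} \<Longrightarrow> r i > 0"
    "\<And>i z. i \<in> {1..m} \<Longrightarrow> z \<in> cball p R \<Longrightarrow> dist z x < r i \<Longrightarrow> dist (X i z) (X i x) < \<eta>" by metis
  define \<rho> where "\<rho> = Min (insert (R / 2) (r ` {1..m})) / 2"
  have \<rho>: "\<rho> > 0" using R(1) r(1) by (simp add: \<rho>_def)
  have "Min (insert (R / 2) (r ` {1..m})) \<le> R / 2" by (rule Min_le) auto
  then have \<rho>R: "\<rho> \<le> R / 2" using \<rho> unfolding \<rho>_def by linarith
  have \<rho>r: "\<rho> < r i" if "i \<in> {1..m}" for i
  proof -
    have "Min (insert (R / 2) (r ` {1..m})) \<le> r i" by (rule Min_le) (use that in auto)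
    then show ?thesis using \<rho> unfolding \<rho>_def by linarith
  qed
  \<comment> \<open>A curve shorter than \<open>\<rho> / M\<close> stays within
    \<open>\<rho>\<close> of \<open>x\<close>, by \<open>dist_le_cc_dist\<close>.\<close>
  show thesis
  proof (rule that[of "\<rho> / M"])
    fix y e assume e: "e \<le> \<rho> / M" and d: "cc_dist \<Omega> m X x y < ennreal e"
    have Me: "M * e \<le> \<rho>" using e M by (simp add: field_simps)
    have e0: "e > 0" using d by (cases "e > 0") (auto simp: ennreal_neg)
    obtain a b \<gamma> c where c: "controlled_curve \<Omega> m X a b \<gamma> c" "\<gamma> a = x" "\<gamma> b = y" "control_length m a b c < ennreal e"
      by (rule cc_dist_lessE[OF ind d])
    have near: "dist x (\<gamma> t) \<le> \<rho>" if "a \<le> t" "t \<le> b" for t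
    proof -
      have "cc_dist \<Omega> m X (\<gamma> a) (\<gamma> t) \<le> control_length m a t c"
        by (intro cc_dist_le_control_length[OF ind] controlled_curve_subinterval[OF c(1)]) (use that in auto)
      also have "\<dots> \<le> control_length m a b c"
        unfolding control_length_def using that by (intro nn_integral_mono) (auto simp: indicator_def)
      also have "\<dots> < ennreal e" by (rule c)
      finally have "dist x (\<gamma> t) \<le> M * e"
        using c(2) Me \<rho>R by (intro dist_le_cc_dist[OF x]) auto
      with Me show ?thesis by linarith
    qed
    have "ennreal (norm (w \<bullet> \<gamma> b - w \<bullet> \<gamma> a)) \<le> ennreal \<epsilon> * control_length m a b c"
    proof (rule control_length_norm_diff_le[OF c(1)])
      show "bounded_linear ((\<bullet>) w)" by (rule bounded_linear_inner_right)
      show "norm (w \<bullet> v) \<le> norm v" for v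
        using Cauchy_Schwarz_ineq2[of w v] mult_right_mono[OF w(1) norm_ge_zero[of v]] by simp
      fix t assume t: "a < t" "t < b"
      have z: "\<gamma> t \<in> cball p R" "dist (\<gamma> t) x \<le> \<rho>"
        using near[of t] t x \<rho>R dist_triangle[of p "\<gamma> t" x] by (auto simp: dist_commute)
      have "w \<bullet> (\<Sum>i=1..m. c i t *\<^sub>R X i (\<gamma> t)) = (\<Sum>i=1..m. c i t * (w \<bullet> (X i (\<gamma> t) - X i x)))"
        unfolding inner_sum_right by (intro sum.cong) (auto simp: inner_diff_right w)
      also have "\<bar>\<dots>\<bar> \<le> (\<Sum>i=1..m. speed m c t * \<eta>)"
      proof (intro order_trans[OF sum_abs] sum_mono)
        fix i assume i: "i \<in> {1..m}"
        have "\<bar>w \<bullet> (X i (\<gamma> t) - X i x)\<bar> \<le> norm (X i (\<gamma> t) - X i x)"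
          using Cauchy_Schwarz_ineq2[of w "X i (\<gamma> t) - X i x"] mult_right_mono[OF w(1) norm_ge_zero[of "X i (\<gamma> t) - X i x"]] by simp
        also have "\<dots> \<le> \<eta>"
          using r(2)[OF i z(1)] \<rho>r[OF i] z(2) by (simp add: dist_norm)
        finally show "\<bar>c i t * (w \<bullet> (X i (\<gamma> t) - X i x))\<bar> \<le> speed m c t * \<eta>"
          using abs_le_l2norm[OF i, of "\<lambda>i. c i t"] unfolding abs_mult speed_def by (intro mult_mono) (auto simp: sum_nonneg)
      qed
      also have "\<dots> = (real m * \<eta>) * speed m c t" by simp
      also have "\<dots> \<le> \<epsilon> * speed m c t"
        using \<open>\<epsilon> > 0\<close> by (intro mult_right_mono) (auto simp: \<eta>_def field_simps)
      finally show "norm (w \<bullet> (\<Sum>i=1..m. c i t *\<^sub>R X i (\<gamma> t))) \<le> \<epsilon> * speed m c t" by simp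
    qed (rule \<open>\<epsilon> > 0\<close>)
    also have "\<dots> \<le> ennreal \<epsilon> * ennreal e" using c(4) by (intro mult_left_mono) auto
    also have "\<dots> = ennreal (\<epsilon> * e)" using \<open>\<epsilon> > 0\<close> by (simp add: ennreal_mult')
    finally show "\<bar>w \<bullet> (y - x)\<bar> \<le> \<epsilon> * e"
      using c e0 \<open>\<epsilon> > 0\<close> by (simp add: inner_diff_right)
  qed (use \<rho> M in auto)
qed

end

text \<open>Once the derivative exists, a bound along some points converging to \<open>t\<close> is
  enough. This permits testing at points of a set of which \<open>t\<close> is a density
  point.\<close>

lemma norm_vector_derivative_le:
  fixes \<gamma> :: "real \<Rightarrow> 'a::real_normed_vector"
  assumes D: "(\<gamma> has_vector_derivative D) (at t)"
    and le: "\<And>\<delta>. \<delta> > 0 \<Longrightarrow> \<exists>s. s \<noteq> t \<and> \<bar>s - t\<bar> < \<delta> \<and> norm (\<gamma> s - \<gamma> t) \<le> k * \<bar>s - t\<bar>"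
  shows "norm D \<le> k"
proof (rule field_le_epsilon)
  fix e :: real assume "e > 0"
  then obtain d where d: "d > 0" "\<And>s. norm (s - t) < d \<Longrightarrow> norm (\<gamma> s - \<gamma> t - (s - t) *\<^sub>R D) \<le> e * norm (s - t)"
    using D unfolding has_vector_derivative_def has_derivative_at_alt by blast
  obtain s where s: "s \<noteq> t" "\<bar>s - t\<bar> < d" "norm (\<gamma> s - \<gamma> t) \<le> k * \<bar>s - t\<bar>"
    using le[OF d(1)] by blast
  have "\<bar>s - t\<bar> * norm D = norm ((\<gamma> s - \<gamma> t) - (\<gamma> s - \<gamma> t - (s - t) *\<^sub>R D))" by simp
  also have "\<dots> \<le> norm (\<gamma> s - \<gamma> t) + norm (\<gamma> s - \<gamma> t - (s - t) *\<^sub>R D)" by (rule norm_triangle_ineq4)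
  also have "\<dots> \<le> \<bar>s - t\<bar> * (k + e)" using s(3) d(2)[of s] s(2) by (simp add: algebra_simps)
  finally show "norm D \<le> k + e" using s(1) by simp
qed

text \<open>The iteration from \<open>u\<close> to \<open>u + (b - A u)\<close>, started at 0, for
  the linear system with coefficients \<open>G j (V i)\<close> and right side \<open>G j v\<close>.
  The iterates are the partial sums of a Neumann series.\<close>

primrec neumann :: "nat \<Rightarrow> (nat \<Rightarrow> 'v \<Rightarrow> real) \<Rightarrow> (nat \<Rightarrow> 'v) \<Rightarrow> 'v \<Rightarrow> nat \<Rightarrow> nat \<Rightarrow> real" where
  "neumann m G V v 0 j = 0"
| "neumann m G V v (Suc n) j = neumann m G V v n j + G j v - (\<Sum>i=1..m. neumann m G V v n i * G j (V i))"

section \<open>Lipschitz curves for the Carnot-Caratheodory distance are horizontal\<close>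

context cc_chart
begin

text \<open>The matrix \<open>(G j (X i q))\<close> is close to the identity, so its inverse is a Neumann series. This
  exhibits the coefficients of a horizontal vector as a limit of measurable functions.\<close>

lemma neumann_converges:
  assumes q: "q \<in> cball p R" and j: "j \<in> {1..m}" and v: "v = (\<Sum>i=1..m. a i *\<^sub>R X i q)"
  shows "(\<lambda>n. neumann m G (\<lambda>i. X i q) v n j) \<longlonglongrightarrow> a j"
proof -
  define u where "u n i = neumann m G (\<lambda>i. X i q) v n i" for n i
  have Gv: "G j v = (\<Sum>i=1..m. a i * G j (X i q))" if "j \<in> {1..m}" for j
    by (simp add: v linear_sum[OF G[OF that]] linear_scale[OF G[OF that]])
  have err: "a j - u (Suc n) j = (\<Sum>i=1..m. (a i - u n i) * ((if i = j then 1 else 0) - G j (X i q)))"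
    if j: "j \<in> {1..m}" for n j
  proof -
    have "a j - u n j = (\<Sum>i=1..m. (a i - u n i) * (if i = j then 1 else 0))"
      using j by (simp add: if_distrib sum.delta cong: if_cong)
    moreover have "G j v - (\<Sum>i=1..m. u n i * G j (X i q)) = (\<Sum>i=1..m. (a i - u n i) * G j (X i q))"
      by (simp add: Gv[OF j] left_diff_distrib sum_subtractf)
    ultimately show ?thesis by (simp add: u_def right_diff_distrib sum_subtractf)
  qed
  define S where "S n = (\<Sum>j=1..m. \<bar>a j - u n j\<bar>)" for n
  have S0: "0 \<le> S n" for n by (simp add: S_def sum_nonneg)
  have half: "S (Suc n) \<le> S n / 2" for n
  proof -
    have "\<bar>a j - u (Suc n) j\<bar> \<le> S n * (1 / (2 * real m))" if j: "j \<in> {1..m}" for j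
    proof -
      have "\<bar>a j - u (Suc n) j\<bar> \<le> (\<Sum>i=1..m. \<bar>(a i - u n i) * ((if i = j then 1 else 0) - G j (X i q))\<bar>)"
        unfolding err[OF j] by (rule sum_abs)
      also have "\<dots> \<le> (\<Sum>i=1..m. \<bar>a i - u n i\<bar> * (1 / (2 * real m)))"
        unfolding abs_mult by (intro sum_mono mult_left_mono GX[OF _ j q]) auto
      finally show ?thesis by (simp add: S_def sum_divide_distrib)
    qed
    then have "S (Suc n) \<le> (\<Sum>j=1..m. S n * (1 / (2 * real m)))"
      unfolding S_def[of "Suc n"] by (intro sum_mono) auto
    also have "\<dots> \<le> S n / 2" using S0[of n] by (cases "m = 0") auto
    finally show ?thesis .
  qed
  have Sn: "S n \<le> S 0 * (1/2) ^ n" for n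
  proof (induction n)
    case (Suc n)
    with half[of n] have "S (Suc n) \<le> (S 0 * (1/2) ^ n) / 2" by linarith
    then show ?case by simp
  qed simp
  have "(\<lambda>n. S 0 * (1/2) ^ n) \<longlonglongrightarrow> S 0 * 0"
    by (intro tendsto_intros) auto
  then have lim0: "(\<lambda>n. S 0 * (1/2) ^ n) \<longlonglongrightarrow> 0" by simp
  have le: "norm (u n j - a j) \<le> S 0 * (1/2) ^ n" for n
  proof -
    have "\<bar>a j - u n j\<bar> \<le> S n" unfolding S_def using j by (intro member_le_sum) auto
    with Sn[of n] show ?thesis by (simp add: abs_minus_commute)
  qed
  have "(\<lambda>n. u n j - a j) \<longlonglongrightarrow> 0"
    by (rule Lim_null_comparison[OF _ lim0]) (rule always_eventually, rule allI, rule le)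
  then show ?thesis by (simp add: u_def LIM_zero_iff)
qed

context
  fixes a b \<kappa> :: real and \<gamma> :: "real \<Rightarrow> real ^ 'n"
  assumes ab: "a < b" and in_ball: "\<And>t. t \<in> {a..b} \<Longrightarrow> \<gamma> t \<in> ball p (R / 2)" and l: "\<kappa> > 0"
    and lip: "\<And>s t. a \<le> s \<Longrightarrow> s \<le> t \<Longrightarrow> t \<le> b \<Longrightarrow> cc_dist \<Omega> m X (\<gamma> s) (\<gamma> t) \<le> ennreal (\<kappa> * (t - s))"
    and small: "M * (\<kappa> * (b - a)) < R / 2"
begin

lemma cc_lipschitz_curve_dist:
  assumes st: "a \<le> s" "s \<le> t" "t \<le> b"
  shows "dist (\<gamma> s) (\<gamma> t) \<le> M * \<kappa> * (t - s)"
proof (rule field_le_epsilon)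
  fix \<epsilon> :: real assume "\<epsilon> > 0"
  \<comment> \<open>Strictly above \<open>\<kappa> * (t - s)\<close>, as
    \<open>dist_le_cc_dist\<close> requires, by at most \<open>\<epsilon> / M\<close>, and within
    the slack that \<open>small\<close> leaves below \<open>R / 2\<close>.\<close>
  define e where "e = \<kappa> * (t - s) + min (\<epsilon> / M) ((R / 2 - M * (\<kappa> * (b - a))) / M)"
  have gt: "\<kappa> * (t - s) < e" using \<open>\<epsilon> > 0\<close> small M by (simp add: e_def)
  have "M * (\<kappa> * (t - s)) \<le> M * (\<kappa> * (b - a))"
    using st l M by (intro mult_left_mono) auto
  moreover have "M * min (\<epsilon> / M) ((R / 2 - M * (\<kappa> * (b - a))) / M) \<le> M * ((R / 2 - M * (\<kappa> * (b - a))) / M)"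
    using M by (intro mult_left_mono) auto
  moreover have "M * ((R / 2 - M * (\<kappa> * (b - a))) / M) = R / 2 - M * (\<kappa> * (b - a))" using M by simp
  ultimately have Me: "M * e \<le> R / 2" unfolding e_def distrib_left by linarith
  have "dist (\<gamma> s) (\<gamma> t) \<le> M * e"
  proof (rule dist_le_cc_dist[OF in_ball _ Me])
    have "0 \<le> \<kappa> * (t - s)" using st l by simp
    then have "ennreal (\<kappa> * (t - s)) < ennreal e" using gt by (intro ennreal_lessI) auto
    with lip[OF st] show "cc_dist \<Omega> m X (\<gamma> s) (\<gamma> t) < ennreal e" by (rule le_less_trans)
  qed (use st in auto)
  also have "\<dots> \<le> M * (\<kappa> * (t - s) + \<epsilon> / M)"
    using M by (intro mult_left_mono) (auto simp: e_def)
  finally show "dist (\<gamma> s) (\<gamma> t) \<le> M * \<kappa> * (t - s) + \<epsilon>" using M by (simp add: distrib_left mult.assoc)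
qed

text \<open>The component \<open>z\<close> of \<open>D\<close> normal to the fields at
  \<open>\<gamma> t\<close> vanishes: over a step \<open>h\<close> the displacement in its direction
  is an arbitrarily small multiple of \<open>\<kappa> * h\<close>, by
  \<open>normal_displacement_small\<close>.\<close>

lemma derivative_horizontal:
  assumes t: "a < t" "t < b" and D: "(\<gamma> has_vector_derivative D) (at t)"
  shows "\<exists>c. D = (\<Sum>i=1..m. c i *\<^sub>R X i (\<gamma> t))"
proof -
  let ?V = "(\<lambda>i. X i (\<gamma> t)) ` {1..m}"
  have x: "\<gamma> t \<in> ball p (R / 2)" using in_ball t by simp
  obtain y z where yz: "y \<in> span ?V" "\<And>w. w \<in> span ?V \<Longrightarrow> orthogonal z w" "D = y + z"
    using orthogonal_subspace_decomp_exists[of ?V D] by metis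
  have "\<bar>z \<bullet> D\<bar> \<le> 0"
  proof (cases "z = 0")
    case False
    define w where "w = z /\<^sub>R norm z"
    have w: "norm w \<le> 1" "\<And>i. i \<in> {1..m} \<Longrightarrow> w \<bullet> X i (\<gamma> t) = 0"
      using False yz(2) span_base[of _ ?V] by (auto simp: w_def orthogonal_def)
    have "\<bar>w \<bullet> D\<bar> \<le> 0 + e" if "e > 0" for e
    proof -
      \<comment> \<open>The normal displacement of the curve accounts for
        \<open>2 * \<kappa>\<close>, the error of differentiation for 1. The 2 arises because
        \<open>2 * \<kappa> * h\<close> serves as a strict upper bound for the distance
        \<open>\<kappa> * h\<close>.\<close>
      define \<epsilon> where "\<epsilon> = e / (2 * \<kappa> + 1)"
      have \<epsilon>: "\<epsilon> > 0" using that l by (simp add: \<epsilon>_def add_pos_pos)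
      obtain \<delta> where \<delta>: "\<delta> > 0" "\<And>y e. e \<le> \<delta> \<Longrightarrow> cc_dist \<Omega> m X (\<gamma> t) y < ennreal e \<Longrightarrow> \<bar>w \<bullet> (y - \<gamma> t)\<bar> \<le> \<epsilon> * e"
        using normal_displacement_small[OF x w \<epsilon>] by blast
      obtain d where d: "d > 0" "\<And>s. norm (s - t) < d \<Longrightarrow> norm (\<gamma> s - \<gamma> t - (s - t) *\<^sub>R D) \<le> \<epsilon> * norm (s - t)"
        using D \<epsilon> unfolding has_vector_derivative_def has_derivative_at_alt by blast
      define h where "h = min (min (d / 2) (b - t)) (\<delta> / (2 * \<kappa>))"
      have h: "h > 0" "h < d" "t + h \<le> b" "2 * \<kappa> * h \<le> \<delta>"
      proof -
        show "h > 0" using d(1) t \<delta>(1) l by (simp add: h_def)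
        show "h < d" "t + h \<le> b" using d(1) by (auto simp: h_def)
        have "h \<le> \<delta> / (2 * \<kappa>)" by (simp add: h_def)
        then show "2 * \<kappa> * h \<le> \<delta>" using l by (simp add: field_simps)
      qed
      have "cc_dist \<Omega> m X (\<gamma> t) (\<gamma> (t + h)) \<le> ennreal (\<kappa> * (t + h - t))"
        using h t by (intro lip) auto
      also have "\<dots> < ennreal (2 * \<kappa> * h)" using h l by (intro ennreal_lessI) auto
      finally have "\<bar>w \<bullet> (\<gamma> (t + h) - \<gamma> t)\<bar> \<le> \<epsilon> * (2 * \<kappa> * h)" by (rule \<delta>(2)[OF h(4)])
      moreover have "\<bar>w \<bullet> (\<gamma> (t + h) - \<gamma> t - h *\<^sub>R D)\<bar> \<le> norm w * norm (\<gamma> (t + h) - \<gamma> t - h *\<^sub>R D)"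
        by (rule Cauchy_Schwarz_ineq2)
      moreover have "norm w * norm (\<gamma> (t + h) - \<gamma> t - h *\<^sub>R D) \<le> 1 * norm (\<gamma> (t + h) - \<gamma> t - h *\<^sub>R D)"
        using w(1) by (intro mult_right_mono) auto
      moreover have "norm (\<gamma> (t + h) - \<gamma> t - h *\<^sub>R D) \<le> \<epsilon> * h"
        using d(2)[of "t + h"] h by simp
      ultimately have "\<bar>h * (w \<bullet> D)\<bar> \<le> \<epsilon> * (2 * \<kappa> * h) + \<epsilon> * h"
        unfolding inner_diff_right inner_scaleR_right by linarith
      also have "\<dots> = h * (\<epsilon> * (2 * \<kappa> + 1))" by (simp add: algebra_simps)
      also have "\<epsilon> * (2 * \<kappa> + 1) = e" using l by (simp add: \<epsilon>_def)
      finally show ?thesis using h(1) by (simp add: abs_mult)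
    qed
    then have "\<bar>w \<bullet> D\<bar> \<le> 0" by (rule field_le_epsilon)
    then show ?thesis using False by (simp add: w_def)
  qed simp
  moreover have "z \<bullet> y = 0" using yz(1,2) by (simp add: orthogonal_def)
  ultimately have "z \<bullet> z = 0" using yz(3) inner_ge_zero[of z] by (simp add: inner_add_right)
  then have "z = 0" by simp
  then have "D \<in> span ?V" using yz by simp
  then obtain u where u: "D = (\<Sum>v\<in>?V. u v *\<^sub>R v)" using span_finite[of ?V] by auto
  have "\<gamma> t \<in> \<Omega>" using x R by auto
  from lin_indep_family_dual(1)[OF ind[OF this]] have "inj_on (\<lambda>i. X i (\<gamma> t)) {1..m}" .
  from u[unfolded sum.reindex[OF this]] show ?thesis by (auto simp: o_def)
qed

text \<open>The derivative exists almost everywhere and is horizontal where it exists. What remains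
  is a measurable choice of coefficients: the derivative and its coefficients are both written as
  limits of sequences of Borel functions.\<close>

lemma cc_lipschitz_curve_controlled: "\<exists>c. controlled_curve \<Omega> m X a b \<gamma> c"
proof -
  \<comment> \<open>Constant continuation to the whole line, so that difference quotients are
    defined and continuous everywhere.\<close>
  define \<gamma>' where "\<gamma>' t = \<gamma> (max a (min t b))" for t
  have Ml: "0 \<le> M * \<kappa>" using M l by simp
  have lipU: "(M * \<kappa>)-lipschitz_on UNIV \<gamma>'"
  proof (rule lipschitz_onI)
    fix s t :: real
    have *: "dist (\<gamma>' s) (\<gamma>' t) \<le> M * \<kappa> * (t - s)" if "s \<le> t" for s t
    proof -
      have "dist (\<gamma>' s) (\<gamma>' t) \<le> M * \<kappa> * (max a (min t b) - max a (min s b))"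
        unfolding \<gamma>'_def using that ab by (intro cc_lipschitz_curve_dist) auto
      also have "\<dots> \<le> M * \<kappa> * (t - s)" using Ml that by (intro mult_left_mono) auto
      finally show ?thesis .
    qed
    show "dist (\<gamma>' s) (\<gamma>' t) \<le> M * \<kappa> * dist s t"
      using *[of s t] *[of t s] by (cases "s \<le> t") (auto simp: dist_real_def dist_commute)
  qed (rule Ml)
  have contg: "continuous_on UNIV \<gamma>'" using lipU by (rule lipschitz_on_continuous_on)
  have contg': "continuous_on UNIV (\<lambda>t. \<gamma>' (t + c))" for c
    by (rule continuous_on_compose2[OF contg]) (auto intro!: continuous_intros)
  define q where "q n t = real (Suc n) *\<^sub>R (\<gamma>' (t + inverse (real (Suc n))) - \<gamma>' t)" for n t
  have qm: "q n \<in> borel_measurable borel" for n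
    unfolding q_def[abs_def] by (intro borel_measurable_continuous_onI continuous_intros contg contg')
  \<comment> \<open>\<open>lim\<close> is total: where the quotients diverge its value is
    unspecified, yet \<open>vd\<close> is Borel measurable and equals the derivative wherever one
    exists.\<close>
  define vd where "vd t = lim (\<lambda>n. q n t)" for t
  have vdm: "vd \<in> borel_measurable borel"
    unfolding vd_def[abs_def] by (rule borel_measurable_lim_metric[OF qm])
  have vd_eq: "vd t = D" if D: "(\<gamma>' has_vector_derivative D) (at t)" for t D
  proof -
    have "(\<lambda>n. q n t) \<longlonglongrightarrow> D"
    proof (rule metric_LIMSEQ_I)
      fix e :: real assume "e > 0"
      then have "e / 2 > 0" by simp
      then obtain d where d: "d > 0" "\<And>s. norm (s - t) < d \<Longrightarrow> norm (\<gamma>' s - \<gamma>' t - (s - t) *\<^sub>R D) \<le> e / 2 * norm (s - t)"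
        using D unfolding has_vector_derivative_def has_derivative_at_alt by blast
      obtain N where N: "inverse (real (Suc N)) < d" using reals_Archimedean[OF d(1)] by blast
      have "dist (q n t) D < e" if "n \<ge> N" for n
      proof -
        let ?h = "inverse (real (Suc n))"
        have "?h \<le> inverse (real (Suc N))" using that by (intro le_imp_inverse_le) auto
        then have "?h < d" using N by linarith
        then have "norm (\<gamma>' (t + ?h) - \<gamma>' t - ?h *\<^sub>R D) \<le> e / 2 * ?h"
          using d(2)[of "t + ?h"] by (simp del: of_nat_Suc)
        moreover have "q n t - D = real (Suc n) *\<^sub>R (\<gamma>' (t + ?h) - \<gamma>' t - ?h *\<^sub>R D)"
          by (simp add: q_def scaleR_right_diff_distrib del: of_nat_Suc)
        ultimately have "norm (q n t - D) \<le> real (Suc n) * (e / 2 * ?h)"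
          by (simp del: of_nat_Suc)
        also have "\<dots> = e / 2" by (simp del: of_nat_Suc)
        finally show ?thesis using \<open>e > 0\<close> by (simp add: dist_norm)
      qed
      then show "\<exists>N. \<forall>n\<ge>N. dist (q n t) D < e" by blast
    qed
    then show ?thesis unfolding vd_def by (rule limI)
  qed
  define N where "N = {t \<in> UNIV. \<not> (\<exists>D. (\<gamma>' has_derivative D) (at t))}"
  have negN: "negligible N" unfolding N_def by (rule rademacher_within[OF lipU])
  have der: "(\<gamma> has_vector_derivative vd t) (at t)" if t: "a < t" "t < b" "t \<notin> N" for t
  proof -
    have "\<gamma>' differentiable (at t)" using t by (auto simp: N_def differentiable_def)
    then have "(\<gamma>' has_vector_derivative vector_derivative \<gamma>' (at t)) (at t)"
      using vector_derivative_works by blast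
    then have "(\<gamma>' has_vector_derivative vd t) (at t)" using vd_eq by metis
    then show ?thesis
      by (rule has_vector_derivative_transform_within_open[where S="{a<..<b}"]) (use t in \<open>auto simp: \<gamma>'_def\<close>)
  qed
  have g_in: "\<gamma>' t \<in> cball p R" for t
    using in_ball[of "max a (min t b)"] ab R(1) by (auto simp: \<gamma>'_def)
  define u where "u n j t = neumann m G (\<lambda>i. X i (\<gamma>' t)) (vd t) n j" for n j t
  have Gm: "(\<lambda>t. G j (w t)) \<in> borel_measurable borel" if "j \<in> {1..m}" "w \<in> borel_measurable borel" for j and w :: "real \<Rightarrow> real ^ 'n"
  proof (rule measurable_compose[OF that(2)])
    have "bounded_linear (G j)" using G[OF that(1)] by (simp add: linear_conv_bounded_linear)
    then show "G j \<in> borel_measurable borel"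
      by (intro borel_measurable_continuous_onI linear_continuous_on)
  qed
  have Xm: "(\<lambda>t. X i (\<gamma>' t)) \<in> borel_measurable borel" if "i \<in> {1..m}" for i
    by (intro borel_measurable_continuous_onI continuous_on_compose2[OF cont[OF that] contg]) (use g_in in auto)
  have um: "j \<in> {1..m} \<Longrightarrow> u n j \<in> borel_measurable borel" for n j
  proof (induction n arbitrary: j)
    case 0
    then show ?case by (simp add: u_def[abs_def])
  next
    case (Suc n)
    have "(\<lambda>t. u n j t + G j (vd t) - (\<Sum>i=1..m. u n i t * G j (X i (\<gamma>' t)))) \<in> borel_measurable borel"
      using Suc by (intro borel_measurable_diff borel_measurable_add borel_measurable_sum borel_measurable_times Gm vdm Xm) auto
    then show ?case by (simp add: u_def[abs_def])
  qed
  define c where "c j t = lim (\<lambda>n. u n j t)" for j t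
  have cm: "c j \<in> borel_measurable lebesgue" if "j \<in> {1..m}" for j
  proof -
    have "c j \<in> borel_measurable borel"
      unfolding c_def[abs_def] by (rule borel_measurable_lim_metric[OF um[OF that]])
    then show ?thesis by (simp add: measurable_completion)
  qed
  have neg: "negligible {t\<in>{a<..<b}. \<not> (\<gamma> has_vector_derivative (\<Sum>i=1..m. c i t *\<^sub>R X i (\<gamma> t))) (at t)}"
  proof (rule negligible_subset[OF negN], clarify, rule ccontr)
    fix t assume t: "t \<in> {a<..<b}" "t \<notin> N" and n: "\<not> (\<gamma> has_vector_derivative (\<Sum>i=1..m. c i t *\<^sub>R X i (\<gamma> t))) (at t)"
    have d: "(\<gamma> has_vector_derivative vd t) (at t)" using der t by auto
    obtain co where co: "vd t = (\<Sum>i=1..m. co i *\<^sub>R X i (\<gamma> t))"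
      using derivative_horizontal[OF _ _ d] t by auto
    have gt: "\<gamma>' t = \<gamma> t" using t by (simp add: \<gamma>'_def)
    have "c j t = co j" if "j \<in> {1..m}" for j
      unfolding c_def u_def by (rule limI, rule neumann_converges[OF g_in that]) (simp add: co gt)
    then have "(\<Sum>i=1..m. c i t *\<^sub>R X i (\<gamma> t)) = vd t" unfolding co by (intro sum.cong) auto
    with n d show False by simp
  qed
  have "abs_continuous_curve a b \<gamma>"
    by (rule abs_continuous_curve_lipschitz[OF cc_lipschitz_curve_dist Ml])
  moreover have "\<gamma> ` {a..b} \<subseteq> \<Omega>" using in_ball R by fastforce
  ultimately have "controlled_curve \<Omega> m X a b \<gamma> c"
    unfolding controlled_curve_def using ab cm neg by auto
  then show ?thesis by blast
qed

end

end

section \<open>Speed along lines\<close>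

text \<open>Writing lengths as gauge integrals makes continuity and additivity of the indefinite
  integral available for the reparametrization by arc length.\<close>

lemma control_length_eq_integral:
  assumes m: "\<forall>i\<in>{1..m}. c i \<in> borel_measurable lebesgue" and l: "control_length m a b c = ennreal l" "l \<ge> 0"
  shows "(speed m c has_integral l) {a..b}"
    and "\<And>s t. a \<le> s \<Longrightarrow> t \<le> b \<Longrightarrow> control_length m s t c = ennreal (integral {s..t} (speed m c))"
proof -
  have [measurable]: "speed m c \<in> borel_measurable lebesgue" using m by (rule speed_measurable)
  have "((\<lambda>t. speed m c t * indicator {a..b} t) has_integral l) UNIV"
  proof (subst has_integral_iff_nn_integral_lebesgue)
    have "(\<lambda>t. speed m c t * indicator {a..b} t) \<in> borel_measurable lebesgue"
      by (intro borel_measurable_times borel_measurable_indicator) auto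
    moreover have "(\<integral>\<^sup>+t. ennreal (speed m c t * indicator {a..b} t) \<partial>lebesgue) = ennreal l"
      unfolding l(1)[symmetric] control_length_def by (intro nn_integral_cong) (auto simp: indicator_def)
    ultimately show "(\<lambda>t. speed m c t * indicator {a..b} t) \<in> borel_measurable lebesgue \<and>
       (\<integral>\<^sup>+t. ennreal (speed m c t * indicator {a..b} t) \<partial>lebesgue) = ennreal l \<and> 0 \<le> l" using l by simp
  qed simp
  moreover have "(\<lambda>t. speed m c t * indicator {a..b} t) = (\<lambda>t. if t \<in> {a..b} then speed m c t else 0)"
    by (auto simp: indicator_def)
  ultimately show int: "(speed m c has_integral l) {a..b}"
    by (simp only: has_integral_restrict_UNIV)
  show "control_length m s t c = ennreal (integral {s..t} (speed m c))" if "a \<le> s" "t \<le> b" for s t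
  proof -
    have "speed m c integrable_on {s..t}"
      using int that by (intro integrable_subinterval_real[of "speed m c" a b s t]) auto
    then have "(speed m c has_integral integral {s..t} (speed m c)) {s..t}" by (rule integrable_integral)
    then show ?thesis
      unfolding control_length_def nn_integral_completion
      by (intro nn_integral_has_integral_lebesgue') auto
  qed
qed

context
  fixes \<Omega> :: "(real ^ 'n) set" and m :: nat and X :: "nat \<Rightarrow> real ^ 'n \<Rightarrow> real ^ 'n"
  assumes ind: "\<And>p. p \<in> \<Omega> \<Longrightarrow> lin_indep_family m (\<lambda>i. X i p)"
begin

text \<open>Reparametrization by the strictly increasing function \<open>h\<close>, arc length plus a multiple of \<open>t\<close>.\<close>

lemma ex_cc_lipschitz_curve:
  assumes d: "cc_dist \<Omega> m X x y < ennreal (\<kappa> * (\<beta> - \<alpha>))" and \<alpha>\<beta>: "\<alpha> < \<beta>" and l: "\<kappa> > 0"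
  shows "\<exists>\<sigma>. \<sigma> \<alpha> = x \<and> \<sigma> \<beta> = y \<and> (\<forall>s t. \<alpha> \<le> s \<longrightarrow> s \<le> t \<longrightarrow> t \<le> \<beta> \<longrightarrow>
            \<sigma> s \<in> \<Omega> \<and> \<sigma> t \<in> \<Omega> \<and> cc_dist \<Omega> m X (\<sigma> s) (\<sigma> t) \<le> ennreal (\<kappa> * (t - s)))"
proof -
  obtain a b \<gamma> c where c: "controlled_curve \<Omega> m X a b \<gamma> c" "\<gamma> a = x" "\<gamma> b = y"
    "control_length m a b c < ennreal (\<kappa> * (\<beta> - \<alpha>))"
    by (rule cc_dist_lessE[OF ind d])
  note cc = c(1)[unfolded controlled_curve_def]
  have cm: "\<forall>i\<in>{1..m}. c i \<in> borel_measurable lebesgue" using cc by blast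
  show ?thesis
  proof (cases "a = b")
    case True
    then have "x = y" "x \<in> \<Omega>" using c cc by auto
    moreover have "cc_dist \<Omega> m X x x = 0"
      by (rule cc_dist_refl) (use ind \<open>x \<in> \<Omega>\<close> in auto)
    ultimately show ?thesis by (intro exI[of _ "\<lambda>_. x"]) auto
  next
    case False
    then have ab: "a < b" using cc by auto
    obtain L where L: "control_length m a b c = ennreal L" "L \<ge> 0"
      using c(4) by (cases "control_length m a b c") auto
    have Ll: "L < \<kappa> * (\<beta> - \<alpha>)" using c(4) L by (simp add: ennreal_less_iff)
    note int = control_length_eq_integral[OF cm L]
    have intg: "speed m c integrable_on {s..t}" if "a \<le> s" "t \<le> b" for s t
      using int(1) that by (intro integrable_subinterval_real[of "speed m c" a b s t]) auto
    \<comment> \<open>The length left over, spread evenly: \<open>h\<close> becomes strictly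
      increasing even where the curve rests, and ends exactly at
      \<open>\<kappa> * (\<beta> - \<alpha>)\<close>.\<close>
    define \<delta> where "\<delta> = (\<kappa> * (\<beta> - \<alpha>) - L) / (b - a)"
    have \<delta>: "\<delta> > 0" using Ll ab by (simp add: \<delta>_def)
    define h where "h t = integral {a..t} (speed m c) + \<delta> * (t - a)" for t
    have hdiff: "h t - h s = integral {s..t} (speed m c) + \<delta> * (t - s)" if "a \<le> s" "s \<le> t" "t \<le> b" for s t
      using Henstock_Kurzweil_Integration.integral_combine[OF that(1,2) intg[OF order_refl that(3)]]
      by (simp add: h_def algebra_simps)
    have pos: "0 \<le> integral {s..t} (speed m c)" if "a \<le> s" "t \<le> b" for s t
      by (rule Henstock_Kurzweil_Integration.integral_nonneg[OF intg[OF that]]) simp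
    have strict: "h s < h t" if "a \<le> s" "s < t" "t \<le> b" for s t
      using hdiff[of s t] pos[of s t] that mult_pos_pos[OF \<delta>, of "t - s"] by simp
    have ha: "h a = 0" by (simp add: h_def)
    have hb: "h b = \<kappa> * (\<beta> - \<alpha>)"
      using int(1) ab by (simp add: h_def \<delta>_def integral_unique)
    have conth: "continuous_on {a..b} h"
      unfolding h_def by (intro continuous_intros indefinite_integral_continuous_1 intg) auto
    \<comment> \<open>\<open>\<tau>\<close> inverts \<open>h\<close> up to the scale
      \<open>\<kappa>\<close>. As arc length grows no faster than \<open>h\<close>, distances in the
      new parameter are bounded by \<open>\<kappa>\<close> times its increments.\<close>
    have "\<exists>\<tau>. a \<le> \<tau> \<and> \<tau> \<le> b \<and> h \<tau> = \<kappa> * (u - \<alpha>)" if "\<alpha> \<le> u" "u \<le> \<beta>" for u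
      using IVT'[of h a "\<kappa> * (u - \<alpha>)" b] conth ha hb ab l that by auto
    then obtain \<tau> where \<tau>: "\<And>u. \<alpha> \<le> u \<Longrightarrow> u \<le> \<beta> \<Longrightarrow> a \<le> \<tau> u \<and> \<tau> u \<le> b \<and> h (\<tau> u) = \<kappa> * (u - \<alpha>)" by metis
    have mono: "\<tau> s \<le> \<tau> t" if "\<alpha> \<le> s" "s \<le> t" "t \<le> \<beta>" for s t
    proof (rule ccontr)
      assume "\<not> ?thesis"
      then have "h (\<tau> t) < h (\<tau> s)" using \<tau>[of s] \<tau>[of t] that by (intro strict) auto
      moreover have "\<kappa> * (s - \<alpha>) \<le> \<kappa> * (t - \<alpha>)" using l that by simp
      ultimately show False using \<tau>[of s] \<tau>[of t] that by simp
    qed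
    have "\<tau> \<alpha> = a"
    proof (rule ccontr)
      assume "\<tau> \<alpha> \<noteq> a"
      then have "h a < h (\<tau> \<alpha>)" using \<tau>[of \<alpha>] \<alpha>\<beta> by (intro strict) auto
      then show False using \<tau>[of \<alpha>] \<alpha>\<beta> ha by simp
    qed
    moreover have "\<tau> \<beta> = b"
    proof (rule ccontr)
      assume "\<tau> \<beta> \<noteq> b"
      then have "h (\<tau> \<beta>) < h b" using \<tau>[of \<beta>] \<alpha>\<beta> by (intro strict) auto
      then show False using \<tau>[of \<beta>] \<alpha>\<beta> hb by simp
    qed
    moreover have "\<gamma> (\<tau> s) \<in> \<Omega> \<and> \<gamma> (\<tau> t) \<in> \<Omega> \<and> cc_dist \<Omega> m X (\<gamma> (\<tau> s)) (\<gamma> (\<tau> t)) \<le> ennreal (\<kappa> * (t - s))"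
      if st: "\<alpha> \<le> s" "s \<le> t" "t \<le> \<beta>" for s t
    proof (intro conjI)
      have s: "a \<le> \<tau> s" "\<tau> s \<le> b" and t: "a \<le> \<tau> t" "\<tau> t \<le> b" and hs: "h (\<tau> s) = \<kappa> * (s - \<alpha>)" "h (\<tau> t) = \<kappa> * (t - \<alpha>)"
        using \<tau>[of s] \<tau>[of t] st by auto
      show "\<gamma> (\<tau> s) \<in> \<Omega>" "\<gamma> (\<tau> t) \<in> \<Omega>" using cc s t by auto
      have "cc_dist \<Omega> m X (\<gamma> (\<tau> s)) (\<gamma> (\<tau> t)) \<le> control_length m (\<tau> s) (\<tau> t) c"
        by (intro cc_dist_le_control_length[OF ind] controlled_curve_subinterval[OF c(1)] s t mono st)
      also have "\<dots> = ennreal (integral {\<tau> s..\<tau> t} (speed m c))" using s t by (intro int(2))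
      also have "\<dots> \<le> ennreal (h (\<tau> t) - h (\<tau> s))"
        using hdiff[OF s(1) mono[OF st] t(2)] \<delta> mono[OF st] by (intro ennreal_leI) simp
      also have "h (\<tau> t) - h (\<tau> s) = \<kappa> * (t - s)" unfolding hs by (simp add: algebra_simps)
      finally show "cc_dist \<Omega> m X (\<gamma> (\<tau> s)) (\<gamma> (\<tau> t)) \<le> ennreal (\<kappa> * (t - s))" .
    qed
    ultimately show ?thesis using c(2,3) by (intro exI[of _ "\<lambda>u. \<gamma> (\<tau> u)"]) auto
  qed
qed

text \<open>Shortest curves need not exist, so \<open>\<kappa>\<close> is doubled to leave room for
  the strict inequality in \<open>ex_cc_lipschitz_curve\<close>. Points in different gaps are
  compared through the ends of their gaps, which belong to \<open>K\<close>.\<close>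

lemma fill_gaps:
  fixes K :: "real set" and g :: "real \<Rightarrow> real ^ 'n"
  assumes K: "compact K" "K \<noteq> {}" and g: "\<And>t. t \<in> K \<Longrightarrow> g t \<in> \<Omega>" and l: "\<kappa> > 0"
    and lip: "\<And>s t. s \<in> K \<Longrightarrow> t \<in> K \<Longrightarrow> s \<le> t \<Longrightarrow> cc_dist \<Omega> m X (g s) (g t) \<le> ennreal (\<kappa> * (t - s))"
  obtains \<gamma> where "\<And>t. t \<in> K \<Longrightarrow> \<gamma> t = g t" "\<And>t. Inf K \<le> t \<Longrightarrow> t \<le> Sup K \<Longrightarrow> \<gamma> t \<in> \<Omega>"
    "\<And>s t. Inf K \<le> s \<Longrightarrow> s \<le> t \<Longrightarrow> t \<le> Sup K \<Longrightarrow> cc_dist \<Omega> m X (\<gamma> s) (\<gamma> t) \<le> ennreal (2 * \<kappa> * (t - s))"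
proof -
  have clK: "closed K" and bddK: "bdd_above K" "bdd_below K"
    using K(1) by (auto intro: compact_imp_closed bounded_imp_bdd_above bounded_imp_bdd_below compact_imp_bounded)
  have ends: "Inf K \<in> K" "Sup K \<in> K"
    using closed_contains_Inf closed_contains_Sup K(2) clK bddK by auto
  \<comment> \<open>\<open>A t\<close> and \<open>B t\<close> are the points of \<open>K\<close>
    next to \<open>t\<close> on either side; both are \<open>t\<close> itself when \<open>t\<close>
    is in \<open>K\<close>.\<close>
  define A where "A t = Sup (K \<inter> {..t})" for t
  define B where "B t = Inf (K \<inter> {t..})" for t
  have A: "A t \<in> K" "A t \<le> t" if "Inf K \<le> t" for t
  proof -
    have "A t \<in> K \<inter> {..t}"
      unfolding A_def using ends that by (intro closed_contains_Sup closed_Int clK) (auto intro: bdd_aboveI)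
    then show "A t \<in> K" "A t \<le> t" by auto
  qed
  have B: "B t \<in> K" "t \<le> B t" if "t \<le> Sup K" for t
  proof -
    have "B t \<in> K \<inter> {t..}"
      unfolding B_def using ends that by (intro closed_contains_Inf closed_Int clK) (auto intro: bdd_belowI)
    then show "B t \<in> K" "t \<le> B t" by auto
  qed
  have Amax: "s \<le> A t" if "s \<in> K" "s \<le> t" for s t
    unfolding A_def using that by (intro cSup_upper) (auto intro: bdd_aboveI)
  have Bmin: "B t \<le> s" if "s \<in> K" "t \<le> s" for s t
    unfolding B_def using that by (intro cInf_lower) (auto intro: bdd_belowI)
  have "\<exists>\<sigma>. \<sigma> u = g u \<and> \<sigma> v = g v \<and> (\<forall>s t. u \<le> s \<longrightarrow> s \<le> t \<longrightarrow> t \<le> v \<longrightarrow>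
            \<sigma> s \<in> \<Omega> \<and> \<sigma> t \<in> \<Omega> \<and> cc_dist \<Omega> m X (\<sigma> s) (\<sigma> t) \<le> ennreal (2 * \<kappa> * (t - s)))"
    if uv: "u \<in> K" "v \<in> K" "u \<le> v" for u v
  proof (cases "u = v")
    case True
    have "cc_dist \<Omega> m X (g u) (g u) = 0"
      by (rule cc_dist_refl) (use ind g[OF uv(1)] in auto)
    then show ?thesis using True g[OF uv(1)] by (intro exI[of _ "\<lambda>_. g u"]) auto
  next
    case False
    have "cc_dist \<Omega> m X (g u) (g v) \<le> ennreal (\<kappa> * (v - u))" using uv by (rule lip)
    also have "\<dots> < ennreal (2 * \<kappa> * (v - u))" using l uv False by (intro ennreal_lessI) auto
    finally show ?thesis using False uv l by (intro ex_cc_lipschitz_curve) auto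
  qed
  then obtain \<sigma> where \<sigma>: "\<And>u v. u \<in> K \<Longrightarrow> v \<in> K \<Longrightarrow> u \<le> v \<Longrightarrow> \<sigma> u v u = g u \<and> \<sigma> u v v = g v"
    "\<And>u v s t. u \<in> K \<Longrightarrow> v \<in> K \<Longrightarrow> u \<le> v \<Longrightarrow> u \<le> s \<Longrightarrow> s \<le> t \<Longrightarrow> t \<le> v \<Longrightarrow>
            \<sigma> u v s \<in> \<Omega> \<and> \<sigma> u v t \<in> \<Omega> \<and> cc_dist \<Omega> m X (\<sigma> u v s) (\<sigma> u v t) \<le> ennreal (2 * \<kappa> * (t - s))"
    by metis
  define \<gamma> where "\<gamma> t = \<sigma> (A t) (B t) t" for t
  show thesis
  proof (rule that[of \<gamma>])
    fix t assume t: "t \<in> K"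
    have it: "Inf K \<le> t" "t \<le> Sup K" using t bddK by (auto intro: cInf_lower cSup_upper)
    have "A t = t" "B t = t" using Amax[OF t] Bmin[OF t] A[OF it(1)] B[OF it(2)] by (auto intro: antisym)
    then show "\<gamma> t = g t" using \<sigma>(1)[OF t t] by (simp add: \<gamma>_def)
  next
    fix t assume t: "Inf K \<le> t" "t \<le> Sup K"
    show "\<gamma> t \<in> \<Omega>"
      unfolding \<gamma>_def using \<sigma>(2)[of "A t" "B t" t t] A[OF t(1)] B[OF t(2)] by auto
  next
    fix s t assume st: "Inf K \<le> s" "s \<le> t" "t \<le> Sup K"
    have As: "A s \<in> K" "A s \<le> s" and At: "A t \<in> K" "A t \<le> t" and Bs: "B s \<in> K" "s \<le> B s" and Bt: "B t \<in> K" "t \<le> B t"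
      using A[OF st(1)] A[OF order_trans[OF st(1,2)]] B[OF order_trans[OF st(2,3)]] B[OF st(3)] by blast+
    \<comment> \<open>If \<open>K\<close> has a point between \<open>s\<close> and \<open>t\<close>,
      the estimate passes through \<open>B s\<close> and \<open>A t\<close>; otherwise both
      parameters lie in one gap, on the same inserted curve.\<close>
    show "cc_dist \<Omega> m X (\<gamma> s) (\<gamma> t) \<le> ennreal (2 * \<kappa> * (t - s))"
    proof (cases "B s \<le> A t")
      case True
      have 1: "cc_dist \<Omega> m X (\<gamma> s) (g (B s)) \<le> ennreal (2 * \<kappa> * (B s - s))"
        using \<sigma>(2)[of "A s" "B s" s "B s"] \<sigma>(1)[of "A s" "B s"] As Bs by (auto simp: \<gamma>_def)
      have 2: "cc_dist \<Omega> m X (g (B s)) (g (A t)) \<le> ennreal (2 * \<kappa> * (A t - B s))"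
        using l True by (intro order_trans[OF lip[OF Bs(1) At(1) True]] ennreal_leI) auto
      have 3: "cc_dist \<Omega> m X (g (A t)) (\<gamma> t) \<le> ennreal (2 * \<kappa> * (t - A t))"
        using \<sigma>(2)[of "A t" "B t" "A t" t] \<sigma>(1)[of "A t" "B t"] At Bt by (auto simp: \<gamma>_def)
      have "cc_dist \<Omega> m X (\<gamma> s) (\<gamma> t) \<le> cc_dist \<Omega> m X (\<gamma> s) (g (B s)) + cc_dist \<Omega> m X (g (B s)) (\<gamma> t)"
        by (rule cc_dist_triangle[OF ind])
      also have "\<dots> \<le> cc_dist \<Omega> m X (\<gamma> s) (g (B s)) + (cc_dist \<Omega> m X (g (B s)) (g (A t)) + cc_dist \<Omega> m X (g (A t)) (\<gamma> t))"
        by (intro add_left_mono cc_dist_triangle[OF ind])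
      also have "\<dots> \<le> ennreal (2 * \<kappa> * (B s - s)) + (ennreal (2 * \<kappa> * (A t - B s)) + ennreal (2 * \<kappa> * (t - A t)))"
        by (intro add_mono 1 2 3)
      also have "\<dots> = ennreal (2 * \<kappa> * (B s - s) + (2 * \<kappa> * (A t - B s) + 2 * \<kappa> * (t - A t)))"
        using l True Bs At by (simp add: ennreal_plus[symmetric] del: ennreal_plus)
      also have "2 * \<kappa> * (B s - s) + (2 * \<kappa> * (A t - B s) + 2 * \<kappa> * (t - A t)) = 2 * \<kappa> * (t - s)"
        by (simp add: algebra_simps)
      finally show ?thesis .
    next
      case False
      have "A t < s" using False Bmin[OF At(1), of s] by linarith
      then have "A s = A t" using Amax[OF At(1), of s] Amax[OF As(1), of t] As(2) st(2) by simp
      moreover have "t < B s" using False Amax[OF Bs(1), of t] by linarith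
      then have "B s = B t" using Bmin[OF Bs(1), of t] Bmin[OF Bt(1), of s] Bt(2) st(2) by simp
      ultimately show ?thesis
        using \<sigma>(2)[of "A s" "B s" s t] As Bs Bt st by (auto simp: \<gamma>_def)
    qed
  qed
qed

end

context cc_chart
begin

text \<open>The passage from Euclidean to \<open>d_cc\<close> slowness. With gaps filled,
  \<open>g\<close> runs on a horizontal curve. At almost every point of \<open>A\<close> its speed
  is at most \<open>\<epsilon> / \<mu>\<close>, elsewhere almost everywhere at most
  \<open>2 * \<kappa> * M / \<mu>\<close>; near a density point of \<open>A\<close> the fast part is
  so short that the mean speed between \<open>t\<close> and \<open>s\<close> is at most twice the
  first bound.\<close>

lemma cc_dist_small_along_line:
  fixes K A :: "real set" and g :: "real \<Rightarrow> real ^ 'n"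
  assumes K: "compact K" and g: "\<And>t. t \<in> K \<Longrightarrow> g t \<in> ball p (R / 4)" and k: "\<kappa> > 0"
    and lip: "\<And>s t. s \<in> K \<Longrightarrow> t \<in> K \<Longrightarrow> s \<le> t \<Longrightarrow> cc_dist \<Omega> m X (g s) (g t) \<le> ennreal (\<kappa> * (t - s))"
    and diam: "\<And>s t. s \<in> K \<Longrightarrow> t \<in> K \<Longrightarrow> M * (2 * \<kappa> * (t - s)) < R / 4"
    and A: "A \<in> sets lebesgue" "A \<subseteq> K" and e: "\<epsilon> > 0"
    and slow: "\<And>t. t \<in> A \<Longrightarrow> \<exists>\<delta>>0. \<forall>s\<in>K. \<bar>s - t\<bar> < \<delta> \<longrightarrow> dist (g s) (g t) \<le> \<epsilon> * \<bar>s - t\<bar>"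
  shows "negligible {t\<in>A. \<not> (\<exists>\<delta>>0. \<forall>s\<in>K. \<bar>s - t\<bar> < \<delta> \<longrightarrow> cc_dist \<Omega> m X (g t) (g s) \<le> ennreal (2 * \<epsilon> / \<mu> * \<bar>s - t\<bar>))}"
proof (cases "K = {} \<or> Inf K = Sup K")
  case True
  have "K \<subseteq> {Inf K}"
  proof
    fix t assume t: "t \<in> K"
    have "Inf K \<le> t" "t \<le> Sup K"
      using t K by (auto intro!: cInf_lower cSup_upper bounded_imp_bdd_above bounded_imp_bdd_below compact_imp_bounded)
    with True t show "t \<in> {Inf K}" by auto
  qed
  then have "A \<subseteq> {Inf K}" using A(2) by blast
  then have "negligible A" by (rule negligible_subset[rotated]) simp
  then show ?thesis by (rule negligible_subset) blast
next
  case False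
  define a where "a = Inf K"
  define b where "b = Sup K"
  have bddK: "bdd_above K" "bdd_below K"
    using K by (auto intro: bounded_imp_bdd_above bounded_imp_bdd_below compact_imp_bounded)
  have Kne: "K \<noteq> {}" using False by blast
  have aK: "a \<in> K"
    unfolding a_def by (rule closed_contains_Inf[OF Kne bddK(2) compact_imp_closed[OF K]])
  have bK: "b \<in> K"
    unfolding b_def by (rule closed_contains_Sup[OF Kne bddK(1) compact_imp_closed[OF K]])
  have Kab: "K \<subseteq> {a..b}" using bddK by (auto simp: a_def b_def intro: cInf_lower cSup_upper)
  have ab: "a < b" using False Kab aK bK by (auto simp: a_def b_def)
  have g\<Omega>: "g t \<in> \<Omega>" if "t \<in> K" for t
  proof -
    have "dist p (g t) \<le> R" using g[OF that] R(1) by simp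
    then show ?thesis using R(2) by auto
  qed
  obtain \<gamma> where \<gamma>: "\<And>t. t \<in> K \<Longrightarrow> \<gamma> t = g t" "\<And>t. a \<le> t \<Longrightarrow> t \<le> b \<Longrightarrow> \<gamma> t \<in> \<Omega>"
    "\<And>s t. a \<le> s \<Longrightarrow> s \<le> t \<Longrightarrow> t \<le> b \<Longrightarrow> cc_dist \<Omega> m X (\<gamma> s) (\<gamma> t) \<le> ennreal (2 * \<kappa> * (t - s))"
    using fill_gaps[OF ind K Kne g\<Omega> k lip] unfolding a_def b_def by blast
  have small: "M * (2 * \<kappa> * (b - a)) < R / 4" using diam[OF aK bK] .
  have in_ball: "\<gamma> t \<in> ball p (R / 2)" if t: "t \<in> {a..b}" for t
  proof -
    have ga: "\<gamma> a \<in> ball p (R / 4)" using \<gamma>(1)[OF aK] g[OF aK] by simp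
    have "cc_dist \<Omega> m X (\<gamma> a) (\<gamma> t) \<le> ennreal (2 * \<kappa> * (t - a))" using t by (intro \<gamma>(3)) auto
    also have "\<dots> < ennreal (R / (4 * M))"
    proof (rule ennreal_lessI)
      have "M * (2 * \<kappa> * (t - a)) \<le> M * (2 * \<kappa> * (b - a))" using t k M by (intro mult_left_mono) auto
      with small have "M * (2 * \<kappa> * (t - a)) < R / 4" by linarith
      then show "2 * \<kappa> * (t - a) < R / (4 * M)" using M by (simp add: field_simps)
    qed (use R M in auto)
    finally have "dist (\<gamma> a) (\<gamma> t) \<le> M * (R / (4 * M))"
      using ga R M by (intro dist_le_cc_dist) auto
    also have "\<dots> = R / 4" using M by simp
    finally show ?thesis using ga dist_triangle[of p "\<gamma> t" "\<gamma> a"] by simp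
  qed
  have k2: "2 * \<kappa> > 0" using k by simp
  have small2: "M * (2 * \<kappa> * (b - a)) < R / 2" using small R(1) by linarith
  obtain c where c: "controlled_curve \<Omega> m X a b \<gamma> c"
    using cc_lipschitz_curve_controlled[OF ab in_ball k2 \<gamma>(3) small2] by blast
  note elip = cc_lipschitz_curve_dist[OF ab in_ball k2 \<gamma>(3) small2]
  note cc = c[unfolded controlled_curve_def]
  define N where "N = {t\<in>{a<..<b}. \<not> (\<gamma> has_vector_derivative (\<Sum>i=1..m. c i t *\<^sub>R X i (\<gamma> t))) (at t)}"
  define ND where "ND = {t\<in>A. \<not> density_point A t}"
  have negN: "negligible N" using cc by (simp add: N_def)
  have negND: "negligible ND" unfolding ND_def by (rule negligible_not_density_point[OF A(1)])
  define B where "B = N \<union> ND \<union> {a, b}"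
  have negB: "negligible B" unfolding B_def using negN negND by (intro negligible_Un) auto
  have der: "(\<gamma> has_vector_derivative (\<Sum>i=1..m. c i t *\<^sub>R X i (\<gamma> t))) (at t)" if "a < t" "t < b" "t \<notin> B" for t
    using that by (auto simp: B_def N_def)
  have sp_le: "\<mu> * speed m c t \<le> norm (\<Sum>i=1..m. c i t *\<^sub>R X i (\<gamma> t))" if "a < t" "t < b" for t
    using lower[of "\<gamma> t" "\<lambda>i. c i t"] in_ball[of t] that R(1) by (simp add: speed_def)
  have sp1: "speed m c t \<le> 2 * \<kappa> * M / \<mu>" if t: "a < t" "t < b" "t \<notin> B" for t
  proof -
    have "norm (\<Sum>i=1..m. c i t *\<^sub>R X i (\<gamma> t)) \<le> M * (2 * \<kappa>)"
    proof (rule norm_vector_derivative_le[OF der[OF t]])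
      fix \<delta> :: real assume "\<delta> > 0"
      define s where "s = t + min (\<delta> / 2) (b - t)"
      have "s \<noteq> t" "\<bar>s - t\<bar> < \<delta>" "t \<le> s" "s \<le> b" using \<open>\<delta> > 0\<close> t by (auto simp: s_def)
      then show "\<exists>s. s \<noteq> t \<and> \<bar>s - t\<bar> < \<delta> \<and> norm (\<gamma> s - \<gamma> t) \<le> M * (2 * \<kappa>) * \<bar>s - t\<bar>"
        using elip[of t s] t by (intro exI[of _ s]) (auto simp: dist_norm norm_minus_commute)
    qed
    with sp_le[OF t(1,2)] show ?thesis using mu by (simp add: field_simps)
  qed
  \<comment> \<open>The hypothesis \<open>slow\<close> compares only points of \<open>K\<close>, so
    the derivative of the filled curve is tested at points of \<open>A\<close>, which accumulate at
    the density point \<open>t\<close>.\<close>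
  have sp2: "speed m c t \<le> \<epsilon> / \<mu>" if t: "a < t" "t < b" "t \<notin> B" "t \<in> A" for t
  proof -
    have dens: "density_point A t" using t by (auto simp: B_def ND_def)
    obtain \<delta>1 where \<delta>1: "\<delta>1 > 0" "\<And>s. s \<in> K \<Longrightarrow> \<bar>s - t\<bar> < \<delta>1 \<Longrightarrow> dist (g s) (g t) \<le> \<epsilon> * \<bar>s - t\<bar>"
      using slow[OF t(4)] by blast
    have "norm (\<Sum>i=1..m. c i t *\<^sub>R X i (\<gamma> t)) \<le> \<epsilon>"
    proof (rule norm_vector_derivative_le[OF der[OF t(1-3)]])
      fix \<delta> :: real assume "\<delta> > 0"
      obtain d where d: "d > 0" "\<And>y. dist y t < d \<Longrightarrow> y \<noteq> t \<Longrightarrow> \<exists>z\<in>A. dist z y < 1 * dist y t"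
        using density_point_near[OF A(1) dens zero_less_one order_refl] by blast
      define y where "y = t + min d (min \<delta> \<delta>1) / 2"
      have y: "dist y t < d" "y \<noteq> t" "dist y t \<le> \<delta> / 2" "dist y t \<le> \<delta>1 / 2"
        using d(1) \<open>\<delta> > 0\<close> \<delta>1(1) by (auto simp: y_def dist_real_def)
      obtain z where z: "z \<in> A" "dist z y < dist y t" using d(2)[OF y(1,2)] by auto
      have "z \<noteq> t" using z(2) by (auto simp: dist_commute)
      have "\<bar>z - t\<bar> < \<delta>" "\<bar>z - t\<bar> < \<delta>1"
        using z(2) y(3,4) dist_triangle[of z t y] by (auto simp: dist_real_def)
      moreover have "norm (\<gamma> z - \<gamma> t) \<le> \<epsilon> * \<bar>z - t\<bar>"
        using \<delta>1(2)[of z] \<open>\<bar>z - t\<bar> < \<delta>1\<close> z(1) t(4) A(2) \<gamma>(1) by (auto simp: dist_norm subset_iff)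
      ultimately show "\<exists>s. s \<noteq> t \<and> \<bar>s - t\<bar> < \<delta> \<and> norm (\<gamma> s - \<gamma> t) \<le> \<epsilon> * \<bar>s - t\<bar>"
        using \<open>z \<noteq> t\<close> by blast
    qed
    with sp_le[OF t(1,2)] show ?thesis using mu by (simp add: field_simps)
  qed
  show ?thesis
  proof (rule negligible_subset[OF negB], clarify, rule ccontr)
    fix t assume t: "t \<in> A" "t \<notin> B"
      and bad: "\<nexists>\<delta>. \<delta> > 0 \<and> (\<forall>s\<in>K. \<bar>s - t\<bar> < \<delta> \<longrightarrow> cc_dist \<Omega> m X (g t) (g s) \<le> ennreal (2 * \<epsilon> / \<mu> * \<bar>s - t\<bar>))"
    have tK: "t \<in> K" using t A by blast
    have dens: "density_point A t" using t by (auto simp: B_def ND_def)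
    \<comment> \<open>The surrounding ball has length \<open>4 * (v - u)\<close>, so the points off
      \<open>A\<close> contribute at most \<open>2 * \<kappa> * M / \<mu> * q * 4 * (v - u)\<close>,
      which equals \<open>\<epsilon> / \<mu> * (v - u)\<close>.\<close>
    define q where "q = \<epsilon> / (8 * M * \<kappa>)"
    have q: "q > 0" using e M k by (simp add: q_def)
    obtain d where d: "d > 0" "\<And>r. 0 < r \<Longrightarrow> r < d \<Longrightarrow> measure lebesgue (ball t r - A) \<le> q * measure lebesgue (ball t r)"
      using density_pointD[OF A(1) dens q] by blast
    have main: "cc_dist \<Omega> m X (g u) (g v) \<le> ennreal (2 * \<epsilon> / \<mu> * (v - u))"
      if uv: "u \<in> K" "v \<in> K" "u < v" "u = t \<or> v = t" "v - u < d / 2" for u v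
    proof -
      let ?r = "2 * (v - u)"
      define Z where "Z = ball t ?r - A"
      have uvab: "a \<le> u" "v \<le> b" using uv Kab by auto
      have Bl: "Z \<in> lmeasurable" unfolding Z_def using A by (intro fmeasurable_Diff) auto
      have mB: "measure lebesgue (Z) \<le> q * (4 * (v - u))"
        using d(2)[of ?r, folded Z_def] uv by (simp add: ball_eq_greaterThanLessThan)
      have "cc_dist \<Omega> m X (\<gamma> u) (\<gamma> v) \<le> control_length m u v c"
        by (intro cc_dist_le_control_length[OF ind] controlled_curve_subinterval[OF c]) (use uv uvab in auto)
      also have "\<dots> \<le> (\<integral>\<^sup>+x. ennreal (\<epsilon> / \<mu>) * indicator {u..v} x + ennreal (2 * \<kappa> * M / \<mu>) * indicator (Z) x \<partial>lebesgue)"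
        unfolding control_length_def
      proof (rule nn_integral_mono_AE)
        have "B \<in> null_sets lebesgue" using negB by (simp add: negligible_iff_null_sets)
        then have "AE x in lebesgue. x \<notin> B" by (rule AE_not_in)
        then show "AE x in lebesgue. ennreal (speed m c x) * indicator {u..v} x
          \<le> ennreal (\<epsilon> / \<mu>) * indicator {u..v} x + ennreal (2 * \<kappa> * M / \<mu>) * indicator (Z) x"
        proof eventually_elim
          case (elim x)
          show ?case
          proof (cases "x \<in> {u..v}")
            case True
            have x: "a < x" "x < b" using True uvab elim by (auto simp: B_def less_le)
            show ?thesis
            proof (cases "x \<in> A")
              case True
              with sp2[OF x elim] \<open>x \<in> {u..v}\<close> show ?thesis by (simp add: Z_def ennreal_leI)
            next
              case False
              have "x \<in> ball t ?r" using True uv by (auto simp: dist_real_def)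
              with False True have "x \<in> Z" by (simp add: Z_def)
              moreover have "ennreal (speed m c x) \<le> ennreal (2 * \<kappa> * M / \<mu>)" using sp1[OF x elim] by (rule ennreal_leI)
              then have "ennreal (speed m c x) \<le> ennreal (\<epsilon> / \<mu>) + ennreal (2 * \<kappa> * M / \<mu>)"
                by (rule order_trans) simp
              ultimately show ?thesis using True by simp
            qed
          qed simp
        qed
      qed
      also have "\<dots> = ennreal (\<epsilon> / \<mu>) * ennreal (v - u) + ennreal (2 * \<kappa> * M / \<mu>) * ennreal (measure lebesgue (Z))"
      proof -
        have s: "{u..v} \<in> sets lebesgue" "Z \<in> sets lebesgue" using Bl by auto
        have "emeasure lebesgue {u..v} = ennreal (v - u)" using uv by simp
        moreover have "emeasure lebesgue (Z) = ennreal (measure lebesgue (Z))"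
          by (rule emeasure_eq_measure2[OF Bl])
        ultimately show ?thesis
          by (subst nn_integral_add) (simp_all add: nn_integral_cmult_indicator s borel_measurable_indicator borel_measurable_times_ennreal)
      qed
      also have "\<dots> = ennreal (\<epsilon> / \<mu> * (v - u) + 2 * \<kappa> * M / \<mu> * measure lebesgue (Z))"
        using e mu k M uv by (simp add: ennreal_mult[symmetric] ennreal_plus[symmetric] del: ennreal_plus)
      also have "\<dots> \<le> ennreal (2 * \<epsilon> / \<mu> * (v - u))"
      proof (rule ennreal_leI)
        have "2 * \<kappa> * M / \<mu> * measure lebesgue (Z) \<le> 2 * \<kappa> * M / \<mu> * (q * (4 * (v - u)))"
          using mB k M mu by (intro mult_left_mono) auto
        also have "\<dots> = \<epsilon> / \<mu> * (v - u)" using k M mu by (simp add: q_def field_simps)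
        finally show "\<epsilon> / \<mu> * (v - u) + 2 * \<kappa> * M / \<mu> * measure lebesgue (Z) \<le> 2 * \<epsilon> / \<mu> * (v - u)"
          by simp
      qed
      finally show ?thesis using \<gamma>(1) uv by simp
    qed
    have "cc_dist \<Omega> m X (g t) (g s) \<le> ennreal (2 * \<epsilon> / \<mu> * \<bar>s - t\<bar>)" if s: "s \<in> K" "\<bar>s - t\<bar> < d / 2" for s
    proof -
      consider "s = t" | "t < s" | "s < t" by linarith
      then show ?thesis
      proof cases
        case 1
        have "cc_dist \<Omega> m X (g t) (g t) = 0" by (rule cc_dist_refl) (use ind g\<Omega>[OF tK] in auto)
        then show ?thesis using 1 by simp
      next
        case 2
        then show ?thesis using main[of t s] s tK by simp
      next
        case 3
        have "cc_dist \<Omega> m X (g t) (g s) = cc_dist \<Omega> m X (g s) (g t)" by (rule cc_dist_sym[OF ind])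
        then show ?thesis using main[of s t] s tK 3 by simp
      qed
    qed
    then show False using bad d(1) by (metis half_gt_zero)
  qed
qed

end

section \<open>Covering the image\<close>

text \<open>The pairs \<open>(x, s)\<close> violating the bound by at least \<open>1 / Suc n\<close>
  form a compact set, hence so do their first components; the set in question is \<open>K\<close>
  minus countably many of these projections.\<close>

lemma borel_directional_bound_set:
  fixes \<phi> :: "'a::euclidean_space \<Rightarrow> 'a \<Rightarrow> real"
  assumes K: "compact K" and cont: "continuous_on (K \<times> K) (\<lambda>(x, y). \<phi> x y)"
  shows "{x\<in>K. \<forall>s. \<bar>s\<bar> \<le> \<delta> \<longrightarrow> x + s *\<^sub>R v \<in> K \<longrightarrow> \<phi> x (x + s *\<^sub>R v) \<le> C * \<bar>s\<bar>} \<in> sets borel"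
proof -
  define D where "D = {z \<in> K \<times> {-\<delta>..\<delta>}. fst z + snd z *\<^sub>R v \<in> K}"
  define T where "T n = {z \<in> D. inverse (real (Suc n)) + C * \<bar>snd z\<bar> \<le> \<phi> (fst z) (fst z + snd z *\<^sub>R v)}" for n
  have clK: "closed K" using K by (rule compact_imp_closed)
  have KD: "compact (K \<times> {-\<delta>..\<delta>})" using K by (intro compact_Times) auto
  have "closed D"
  proof -
    have "D = (K \<times> {-\<delta>..\<delta>}) \<inter> ((\<lambda>z. fst z + snd z *\<^sub>R v) -` K)" by (auto simp: D_def)
    moreover have "closed ((\<lambda>z :: 'a \<times> real. fst z + snd z *\<^sub>R v) -` K)"
      by (rule closed_vimage[OF clK]) (intro continuous_intros)
    ultimately show ?thesis using compact_imp_closed[OF KD] by (simp add: closed_Int)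
  qed
  have "continuous_on D (\<lambda>z. (\<lambda>(x, y). \<phi> x y) (fst z, fst z + snd z *\<^sub>R v))"
    by (rule continuous_on_compose2[OF cont]) (auto simp: D_def intro!: continuous_intros)
  then have "closed (T n)" for n
    unfolding T_def using \<open>closed D\<close> by (intro continuous_on_closed_Collect_le continuous_intros) auto
  moreover have "T n \<subseteq> K \<times> {-\<delta>..\<delta>}" for n by (auto simp: T_def D_def)
  ultimately have "compact (T n)" for n
    using compact_Int_closed[OF KD, of "T n"] by (simp add: Int_absorb1)
  then have "compact (fst ` T n)" for n
    by (intro compact_continuous_image continuous_intros)
  then have b: "fst ` T n \<in> sets borel" for n
    by (intro borel_closed compact_imp_closed)
  have "{x\<in>K. \<forall>s. \<bar>s\<bar> \<le> \<delta> \<longrightarrow> x + s *\<^sub>R v \<in> K \<longrightarrow> \<phi> x (x + s *\<^sub>R v) \<le> C * \<bar>s\<bar>} = K - (\<Union>n. fst ` T n)"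
  proof (intro equalityI subsetI)
    fix x assume x: "x \<in> {x\<in>K. \<forall>s. \<bar>s\<bar> \<le> \<delta> \<longrightarrow> x + s *\<^sub>R v \<in> K \<longrightarrow> \<phi> x (x + s *\<^sub>R v) \<le> C * \<bar>s\<bar>}"
    have "x \<notin> fst ` T n" for n
    proof
      assume "x \<in> fst ` T n"
      then obtain s where s: "(x, s) \<in> T n" by force
      then have "\<phi> x (x + s *\<^sub>R v) \<le> C * \<bar>s\<bar>" using x by (auto simp: T_def D_def abs_le_iff)
      moreover have "inverse (real (Suc n)) + C * \<bar>s\<bar> \<le> \<phi> x (x + s *\<^sub>R v)" using s by (simp add: T_def)
      moreover have "inverse (real (Suc n)) > 0" by simp
      ultimately show False by linarith
    qed
    then show "x \<in> K - (\<Union>n. fst ` T n)" using x by blast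
  next
    fix x assume x: "x \<in> K - (\<Union>n. fst ` T n)"
    have "\<phi> x (x + s *\<^sub>R v) \<le> C * \<bar>s\<bar>" if s: "\<bar>s\<bar> \<le> \<delta>" "x + s *\<^sub>R v \<in> K" for s
    proof (rule ccontr)
      assume "\<not> ?thesis"
      then obtain n where "inverse (real (Suc n)) < \<phi> x (x + s *\<^sub>R v) - C * \<bar>s\<bar>"
        using reals_Archimedean[of "\<phi> x (x + s *\<^sub>R v) - C * \<bar>s\<bar>"] by auto
      then have "(x, s) \<in> T n" using x s by (auto simp: T_def D_def abs_le_iff)
      then have "x \<in> fst ` T n" by force
      with x show False by blast
    qed
    then show "x \<in> {x\<in>K. \<forall>s. \<bar>s\<bar> \<le> \<delta> \<longrightarrow> x + s *\<^sub>R v \<in> K \<longrightarrow> \<phi> x (x + s *\<^sub>R v) \<le> C * \<bar>s\<bar>}" using x by blast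
  qed
  also have "\<dots> \<in> sets borel"
    using b borel_closed[OF clK] by (intro sets.Diff sets.countable_UN) auto
  finally show ?thesis .
qed

lemma norm_le_card_times:
  fixes y :: "'a::euclidean_space" and h :: real
  assumes "\<And>i. i \<in> Basis \<Longrightarrow> \<bar>y \<bullet> i\<bar> \<le> h"
  shows "norm y \<le> DIM('a) * h"
  using norm_le_l1[of y] sum_mono[of "Basis :: 'a set" "\<lambda>i. \<bar>y \<bullet> i\<bar>" "\<lambda>_. h"] assms by simp

text \<open>Otherwise \<open>ball y \<rho>\<close> would be covered by its part outside
  \<open>A\<close> and the back-translated part outside \<open>A\<close> of the other ball, which
  together fill at most half of it.\<close>

lemma translate_pair_in_dense_set:
  fixes A :: "'a::euclidean_space set"
  assumes A: "A \<in> sets lebesgue" and "\<rho> > 0"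
    and 1: "measure lebesgue (ball y \<rho> - A) \<le> measure lebesgue (ball (0::'a) \<rho>) / 4"
    and 2: "measure lebesgue (ball (y + w) \<rho> - A) \<le> measure lebesgue (ball (0::'a) \<rho>) / 4"
  shows "\<exists>y'\<in>A. y' + w \<in> A \<and> dist y y' < \<rho>"
proof (rule ccontr)
  assume neg: "\<not> ?thesis"
  let ?T = "(\<lambda>z. - w + z) ` (ball (y + w) \<rho> - A)"
  have lm: "ball y \<rho> - A \<in> lmeasurable" "ball (y + w) \<rho> - A \<in> lmeasurable"
    using A by (auto intro: fmeasurable_Diff)
  then have lmT: "?T \<in> lmeasurable" by (intro measurable_translation)
  have "ball y \<rho> \<subseteq> (ball y \<rho> - A) \<union> ?T"
  proof
    fix z assume z: "z \<in> ball y \<rho>"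
    show "z \<in> (ball y \<rho> - A) \<union> ?T"
    proof (cases "z \<in> A")
      case True
      then have "z + w \<notin> A" using neg z by auto
      moreover have "z + w \<in> ball (y + w) \<rho>" using z by (simp add: dist_norm)
      ultimately have "- w + (z + w) \<in> ?T" by (intro imageI) simp
      then show ?thesis by simp
    qed (use z in simp)
  qed
  then have "measure lebesgue (ball y \<rho>) \<le> measure lebesgue ((ball y \<rho> - A) \<union> ?T)"
    using lm lmT by (intro measure_mono_fmeasurable) (auto intro: fmeasurable.Un)
  also have "\<dots> \<le> measure lebesgue (ball y \<rho> - A) + measure lebesgue ?T"
    using lm lmT by (intro measure_Un_le) (auto dest: fmeasurableD)
  also have "measure lebesgue ?T = measure lebesgue (ball (y + w) \<rho> - A)"
    by (rule measure_translation)
  finally have "measure lebesgue (ball y \<rho>) \<le> measure lebesgue (ball (0::'a) \<rho>) / 2" using 1 2 by linarith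
  moreover have "measure lebesgue (ball y \<rho>) = measure lebesgue (ball (0::'a) \<rho>)"
    using content_ball_conv_unit_ball[of \<rho> y] content_ball_conv_unit_ball[of \<rho> "0::'a"] \<open>\<rho> > 0\<close> by simp
  moreover have "measure lebesgue (ball (0::'a) \<rho>) > 0" using content_ball_pos[OF \<open>\<rho> > 0\<close>, of "0::'a"] by simp
  ultimately show False by linarith
qed

text \<open>A cube of side \<open>h\<close> is cut into about \<open>n^(k - 1)\<close> tubes of direction \<open>v\<close> and width \<open>h / n\<close>; near a density
  point of \<open>A\<close> the image of each tube has diameter of order \<open>h / n\<close>.\<close>

lemma hausdorff_content_cube_le:
  fixes d :: "'b \<Rightarrow> 'b \<Rightarrow> ennreal" and f :: "'a::euclidean_space \<Rightarrow> 'b" and v :: 'a and n :: nat and L :: real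
  assumes tri: "\<And>a b c. d a c \<le> d a b + d b c"
    and lip: "\<And>y z. y \<in> E \<Longrightarrow> z \<in> E \<Longrightarrow> d (f y) (f z) \<le> ennreal (L * dist y z)" and L: "L \<ge> 0"
    and v: "norm v = 1" and n: "n > 0" and "\<delta> > 0"
    and A: "A \<in> sets lebesgue" "A \<subseteq> E" and x: "density_point A x"
    and slow: "\<And>y s. y \<in> A \<Longrightarrow> \<bar>s\<bar> \<le> \<delta> \<Longrightarrow> y + s *\<^sub>R v \<in> E \<Longrightarrow> d (f y) (f (y + s *\<^sub>R v)) \<le> ennreal (inverse (real n) * \<bar>s\<bar>)"
  shows "\<exists>r>0. \<forall>u w h. 0 < h \<longrightarrow> (\<forall>i\<in>Basis. w \<bullet> i - u \<bullet> i = h) \<longrightarrow> x \<in> cbox u w \<longrightarrow> cbox u w \<subseteq> ball x r \<longrightarrow>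
           hausdorff_content d DIM('a) (f ` (E \<inter> cbox u w))
             \<le> ennreal ((5 * real DIM('a)) ^ (DIM('a) - 1) * ((2 + real DIM('a)) * L + real DIM('a)) ^ DIM('a) / real n * h ^ DIM('a))"
proof -
  let ?k = "DIM('a)"
  have k1: "?k \<ge> 1" by (simp add: DIM_ge_Suc0)
  \<comment> \<open>The radii \<open>3 * ?k * h\<close> and \<open>\<rho> = h / n\<close> have ratio
    \<open>3 * ?k * n\<close>. So the part of the large ball outside \<open>A\<close> measures at
    most a quarter of a small ball, as \<open>translate_pair_in_dense_set\<close> asks.\<close>
  define q where "q = 1 / (4 * (3 * real ?k * real n) ^ ?k)"
  have q: "q > 0" using n by (simp add: q_def)
  obtain d0 where d0: "d0 > 0" "\<And>r. 0 < r \<Longrightarrow> r < d0 \<Longrightarrow> measure lebesgue (ball x r - A) \<le> q * measure lebesgue (ball x r)"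
    using density_pointD[OF A(1) x q] by blast
  \<comment> \<open>A cube in \<open>ball x r\<close> has side below \<open>2 * r\<close>, which
    puts \<open>3 * ?k * h\<close> below \<open>d0\<close> and keeps the steps \<open>?k * h\<close>
    along \<open>v\<close> within \<open>\<delta>\<close>.\<close>
  define r where "r = min (d0 / (6 * real ?k)) (\<delta> / (2 * real ?k))"
  have r: "r > 0" using d0(1) \<open>\<delta> > 0\<close> by (simp add: r_def)
  \<comment> \<open>From the three hops in \<open>pair\<close>, in units of \<open>\<rho>\<close>:
    \<open>L\<close> from \<open>y\<close> into \<open>A\<close>, \<open>?k\<close> along
    \<open>v\<close>, and \<open>L * (1 + ?k)\<close> on to \<open>z\<close>.\<close>
  define D where "D = (2 + real ?k) * L + real ?k"
  have D: "D \<ge> 0" using L by (simp add: D_def)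
  have "hausdorff_content d ?k (f ` (E \<inter> cbox u w)) \<le> ennreal ((5 * real ?k) ^ (?k - 1) * D ^ ?k / real n * h ^ ?k)"
    if h: "0 < h" and side: "\<forall>i\<in>Basis. w \<bullet> i - u \<bullet> i = h" and xc: "x \<in> cbox u w" and sub: "cbox u w \<subseteq> ball x r" for u w h
  proof -
    have u_le: "u \<bullet> i \<le> w \<bullet> i" if "i \<in> Basis" for i using side h that by force
    have coord: "\<bar>(y - z) \<bullet> i\<bar> \<le> h" if "y \<in> cbox u w" "z \<in> cbox u w" "i \<in> Basis" for y z i
      using that side unfolding mem_box inner_diff_left by (smt (verit))
    have hr: "h < 2 * r"
    proof -
      obtain i where i: "i \<in> (Basis :: 'a set)" using nonempty_Basis by blast
      have "u \<in> cbox u w" "w \<in> cbox u w" using u_le by (auto simp: mem_box)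
      then have "dist x u < r" "dist x w < r" using sub by auto
      then have "dist w u < 2 * r" using dist_triangle3[of w u x] by simp
      moreover have "\<bar>(w - u) \<bullet> i\<bar> \<le> norm (w - u)" using i by (rule Basis_le_norm)
      ultimately show ?thesis using side i h by (auto simp: inner_diff_left dist_norm)
    qed
    have hd: "3 * real ?k * h < d0" and h\<delta>: "real ?k * h \<le> \<delta>"
    proof -
      have kp: "real ?k > 0" by simp
      have "r \<le> d0 / (6 * real ?k)" "r \<le> \<delta> / (2 * real ?k)" by (auto simp: r_def)
      then have "6 * real ?k * r \<le> d0" "2 * real ?k * r \<le> \<delta>" using kp by (simp_all add: field_simps)
      moreover have "real ?k * h < real ?k * (2 * r)" using hr kp by (intro mult_strict_left_mono)
      ultimately show "3 * real ?k * h < d0" "real ?k * h \<le> \<delta>" by linarith+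
    qed
    define \<rho> where "\<rho> = h / n"
    have \<rho>: "\<rho> > 0" "\<rho> \<le> h" using h n by (auto simp: \<rho>_def field_simps)
    have dense: "measure lebesgue (ball y \<rho> - A) \<le> measure lebesgue (ball (0::'a) \<rho>) / 4" if y: "dist x y \<le> 2 * real ?k * h" for y
    proof -
      have "h \<le> real ?k * h" using h k1 by simp
      have "ball y \<rho> \<subseteq> ball x (3 * real ?k * h)"
      proof
        fix z assume "z \<in> ball y \<rho>"
        then have "dist x z < 2 * real ?k * h + h"
          using y \<rho>(2) dist_triangle[of x z y] by simp
        also have "\<dots> \<le> 3 * real ?k * h" using \<open>h \<le> real ?k * h\<close> by (simp add: algebra_simps)
        finally show "z \<in> ball x (3 * real ?k * h)" by simp
      qed
      then have "measure lebesgue (ball y \<rho> - A) \<le> measure lebesgue (ball x (3 * real ?k * h) - A)"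
        using A(1) by (intro measure_mono_fmeasurable) (auto intro: fmeasurable_Diff)
      also have "\<dots> \<le> q * measure lebesgue (ball x (3 * real ?k * h))"
        using hd h by (intro d0(2)) auto
      also have "\<dots> = measure lebesgue (ball (0::'a) \<rho>) / 4"
        using content_ball_conv_unit_ball[of "3 * real ?k * h" x] content_ball_conv_unit_ball[of \<rho> "0::'a"] h n
        by (simp add: q_def \<rho>_def power_mult_distrib power_divide)
      finally show ?thesis .
    qed
    \<comment> \<open>Neither \<open>y\<close> nor its shift by \<open>s v\<close> has to lie in
      \<open>A\<close>; a pair of points of \<open>A\<close> with the same difference is found
      within \<open>\<rho>\<close>, and only this pair uses slowness.\<close>
    have pair: "d (f y) (f z) \<le> ennreal (D * \<rho>)"
      if yz: "y \<in> E" "z \<in> E" "y \<in> cbox u w" "z = y + s *\<^sub>R v + e'" and s: "\<bar>s\<bar> \<le> real ?k * h" and e': "norm e' \<le> real ?k * \<rho>" for y z s e'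
    proof -
      have xy: "dist x y \<le> real ?k * h"
        using norm_le_card_times[of "x - y" h] coord[OF xc yz(3)] by (simp add: dist_norm)
      have "norm (s *\<^sub>R v) \<le> real ?k * h" using s v by simp
      then have xsv: "dist x (y + s *\<^sub>R v) \<le> 2 * real ?k * h"
        using xy dist_triangle[of x "y + s *\<^sub>R v" y] by (simp add: dist_norm)
      have "dist x y \<le> 2 * real ?k * h" using xy zero_le_dist[of x y] by linarith
      then obtain y' where y': "y' \<in> A" "y' + s *\<^sub>R v \<in> A" "dist y y' < \<rho>"
        using translate_pair_in_dense_set[OF A(1) \<rho>(1) dense dense[OF xsv]] by blast
      have yE: "y' \<in> E" "y' + s *\<^sub>R v \<in> E" using y' A(2) by auto
      have 1: "d (f y) (f y') \<le> ennreal (L * \<rho>)"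
        using y'(3) L by (intro order_trans[OF lip[OF yz(1) yE(1)]] ennreal_leI mult_left_mono) auto
      have 2: "d (f y') (f (y' + s *\<^sub>R v)) \<le> ennreal (real ?k * \<rho>)"
      proof (rule order_trans[OF slow[OF y'(1) _ yE(2)]])
        show "\<bar>s\<bar> \<le> \<delta>" using s h\<delta> by linarith
        have "inverse (real n) * \<bar>s\<bar> \<le> inverse (real n) * (real ?k * h)" using s by (intro mult_left_mono) auto
        then show "ennreal (inverse (real n) * \<bar>s\<bar>) \<le> ennreal (real ?k * \<rho>)"
          by (intro ennreal_leI) (simp add: \<rho>_def field_simps)
      qed
      have "dist (y' + s *\<^sub>R v) z \<le> norm (y' - y) + norm e'"
      proof -
        have eq: "(y' + s *\<^sub>R v) - z = (y' - y) - e'" using yz(4) by simp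
        show ?thesis unfolding dist_norm eq by (rule norm_triangle_ineq4)
      qed
      also have "\<dots> \<le> \<rho> + real ?k * \<rho>" using y'(3) e' by (simp add: dist_norm norm_minus_commute)
      finally have "dist (y' + s *\<^sub>R v) z \<le> \<rho> + real ?k * \<rho>" .
      then have 3: "d (f (y' + s *\<^sub>R v)) (f z) \<le> ennreal (L * (\<rho> + real ?k * \<rho>))"
        using L by (intro order_trans[OF lip[OF yE(2) yz(2)]] ennreal_leI mult_left_mono) auto
      have "d (f y) (f z) \<le> d (f y) (f y') + (d (f y') (f (y' + s *\<^sub>R v)) + d (f (y' + s *\<^sub>R v)) (f z))"
        by (rule order_trans[OF tri[of _ _ "f y'"]], rule add_left_mono, rule tri)
      also have "\<dots> \<le> ennreal (L * \<rho>) + (ennreal (real ?k * \<rho>) + ennreal (L * (\<rho> + real ?k * \<rho>)))"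
        by (intro add_mono 1 2 3)
      also have "\<dots> = ennreal (L * \<rho> + (real ?k * \<rho> + L * (\<rho> + real ?k * \<rho>)))"
        using L \<rho> by (simp add: ennreal_plus[symmetric] del: ennreal_plus)
      also have "L * \<rho> + (real ?k * \<rho> + L * (\<rho> + real ?k * \<rho>)) = D * \<rho>"
        by (simp add: D_def algebra_simps)
      finally show ?thesis .
    qed
    \<comment> \<open>The coordinates of a unit vector have absolute sum at least 1, so one of them
      is at least \<open>1 / ?k\<close>. Projecting along \<open>v\<close> to a hyperplane
      orthogonal to \<open>i0\<close> is then well controlled.\<close>
    obtain i0 where i0: "i0 \<in> Basis" "1 \<le> real ?k * \<bar>v \<bullet> i0\<bar>"
    proof (rule ccontr)
      assume "\<not> thesis"
      then have lt: "\<bar>v \<bullet> i\<bar> < 1 / real ?k" if "i \<in> Basis" for i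
        using that \<open>\<And>i0. i0 \<in> Basis \<Longrightarrow> 1 \<le> real ?k * \<bar>v \<bullet> i0\<bar> \<Longrightarrow> thesis\<close> by (force simp: field_simps)
      have "norm v \<le> (\<Sum>i\<in>Basis. \<bar>v \<bullet> i\<bar>)" by (rule norm_le_l1)
      also have "\<dots> < (\<Sum>i\<in>(Basis::'a set). 1 / real ?k)" using lt by (intro sum_strict_mono) auto
      finally show False using v by simp
    qed
    \<comment> \<open>The parameter that moves \<open>y\<close> along \<open>v\<close> into the
      hyperplane through \<open>u\<close> orthogonal to \<open>i0\<close>.\<close>
    define \<tau> where "\<tau> y = ((y - u) \<bullet> i0) / (v \<bullet> i0)" for y
    have v0: "v \<bullet> i0 \<noteq> 0" using i0(2) by auto
    have uc: "u \<in> cbox u w" using u_le by (auto simp: mem_box)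
    have \<tau>_diff: "\<bar>\<tau> z - \<tau> y\<bar> \<le> real ?k * h" if "y \<in> cbox u w" "z \<in> cbox u w" for y z
    proof -
      have "\<tau> z - \<tau> y = ((z - y) \<bullet> i0) / (v \<bullet> i0)"
        by (simp add: \<tau>_def diff_divide_distrib inner_diff_left)
      also have "\<bar>\<dots>\<bar> \<le> h / \<bar>v \<bullet> i0\<bar>"
        unfolding abs_divide using coord[OF that(2,1) i0(1)] by (intro divide_right_mono) auto
      also have "\<dots> \<le> real ?k * h"
        using i0(2) v0 h mult_right_mono[OF i0(2), of h] by (simp add: field_simps)
      finally show ?thesis .
    qed
    \<comment> \<open>Projected coordinates relative to \<open>u\<close> are at most
      \<open>h + ?k * h\<close> in absolute value, hence at most \<open>2 * ?k * h\<close>, which is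
      \<open>N * \<rho>\<close>.\<close>
    define N where "N = int (2 * ?k * n)"
    \<comment> \<open>The grid cell of the projected point. The coordinate \<open>i0\<close> is left
      out, being 0 after projection; hence the exponent \<open>?k - 1\<close> in the number of
      tubes.\<close>
    define idx where "idx y = restrict (\<lambda>i. \<lfloor>((y - \<tau> y *\<^sub>R v - u) \<bullet> i) / \<rho>\<rfloor>) (Basis - {i0})" for y
    define I where "I = (PiE (Basis - {i0}) (\<lambda>_. {-N..N}) :: ('a \<Rightarrow> int) set)"
    have finI: "finite I" unfolding I_def by (intro finite_PiE) auto
    have cardI: "real (card I) \<le> (5 * real ?k * real n) ^ (?k - 1)"
    proof -
      have "card I = (\<Prod>i\<in>(Basis::'a set) - {i0}. card {-N..N})" unfolding I_def by (rule card_PiE) auto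
      also have "\<dots> = (4 * ?k * n + 1) ^ (?k - 1)"
        using i0(1) by (simp add: N_def nat_add_distrib nat_mult_distrib card_Diff_singleton ac_simps)
      finally have "real (card I) = (4 * real ?k * real n + 1) ^ (?k - 1)" by (simp add: add.commute)
      also have "\<dots> \<le> (5 * real ?k * real n) ^ (?k - 1)"
      proof (rule power_mono)
        have "1 \<le> real ?k * real n" using k1 n by (simp flip: of_nat_mult)
        then show "4 * real ?k * real n + 1 \<le> 5 * real ?k * real n" by (simp add: algebra_simps)
      qed simp
      finally show ?thesis .
    qed
    have idxI: "idx y \<in> I" if y: "y \<in> cbox u w" for y
    proof -
      have "\<lfloor>((y - \<tau> y *\<^sub>R v - u) \<bullet> i) / \<rho>\<rfloor> \<in> {-N..N}" if i: "i \<in> Basis" for i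
      proof -
        have "(y - \<tau> y *\<^sub>R v - u) \<bullet> i = (y - u) \<bullet> i - (\<tau> y - \<tau> u) * (v \<bullet> i)"
          by (simp add: inner_diff_left \<tau>_def)
        also have "\<bar>\<dots>\<bar> \<le> h + real ?k * h * 1"
        proof -
          have "\<bar>v \<bullet> i\<bar> \<le> 1" using Basis_le_norm[OF i, of v] v by simp
          then have "\<bar>(\<tau> y - \<tau> u) * (v \<bullet> i)\<bar> \<le> real ?k * h * 1"
            unfolding abs_mult using \<tau>_diff[OF uc y] h by (intro mult_mono) auto
          then show ?thesis using coord[OF y uc i] by linarith
        qed
        also have "\<dots> \<le> 2 * real ?k * h" using h k1 by simp
        also have "\<dots> = real_of_int N * \<rho>" using n by (simp add: N_def \<rho>_def)
        finally have "\<bar>((y - \<tau> y *\<^sub>R v - u) \<bullet> i) / \<rho>\<bar> \<le> real_of_int N"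
          using \<rho>(1) by (simp add: field_simps)
        then show ?thesis
          unfolding abs_le_iff atLeastAtMost_iff le_floor_iff floor_le_iff of_int_minus by linarith
      qed
      then show ?thesis by (auto simp: I_def idx_def)
    qed
    define T where "T \<iota> = {y \<in> E \<inter> cbox u w. idx y = \<iota>}" for \<iota>
    have diamT: "hausdorff_content d ?k (f ` T \<iota>) \<le> ennreal ((D * \<rho>) ^ ?k)" for \<iota>
    proof -
      have "ediameter d (f ` T \<iota>) \<le> ennreal (D * \<rho>)"
      proof (rule ediameter_leI)
        fix a b assume "a \<in> f ` T \<iota>" "b \<in> f ` T \<iota>"
        then obtain y z where yz: "a = f y" "b = f z" "y \<in> T \<iota>" "z \<in> T \<iota>" by blast
        define e' where "e' = (z - \<tau> z *\<^sub>R v - u) - (y - \<tau> y *\<^sub>R v - u)"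
        have z: "z = y + (\<tau> z - \<tau> y) *\<^sub>R v + e'" by (simp add: e'_def algebra_simps)
        have "\<bar>e' \<bullet> i\<bar> \<le> \<rho>" if i: "i \<in> Basis" for i
        proof (cases "i = i0")
          case True
          have "(z - \<tau> z *\<^sub>R v - u) \<bullet> i0 = 0" "(y - \<tau> y *\<^sub>R v - u) \<bullet> i0 = 0"
            using v0 by (simp_all add: \<tau>_def inner_diff_left)
          then show ?thesis using True \<rho> by (simp add: e'_def inner_diff_left)
        next
          case False
          have "idx y i = idx z i" using yz by (simp add: T_def)
          then have "\<lfloor>((y - \<tau> y *\<^sub>R v - u) \<bullet> i) / \<rho>\<rfloor> = \<lfloor>((z - \<tau> z *\<^sub>R v - u) \<bullet> i) / \<rho>\<rfloor>"
            using i False by (simp add: idx_def)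
          then have "\<bar>((z - \<tau> z *\<^sub>R v - u) \<bullet> i) / \<rho> - ((y - \<tau> y *\<^sub>R v - u) \<bullet> i) / \<rho>\<bar> \<le> 1" by linarith
          then have "\<bar>(e' \<bullet> i) / \<rho>\<bar> \<le> 1"
            unfolding e'_def inner_diff_left[of "z - \<tau> z *\<^sub>R v - u" "y - \<tau> y *\<^sub>R v - u"] diff_divide_distrib .
          then show ?thesis using \<rho>(1) by (simp add: field_simps)
        qed
        then have "norm e' \<le> real ?k * \<rho>" by (rule norm_le_card_times)
        then show "d a b \<le> ennreal (D * \<rho>)"
          unfolding yz(1,2) using yz(3,4) by (intro pair[OF _ _ _ z] \<tau>_diff) (auto simp: T_def)
      qed
      then have "ediameter d (f ` T \<iota>) ^ ?k \<le> ennreal (D * \<rho>) ^ ?k" by (intro power_mono) auto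
      also have "\<dots> = ennreal ((D * \<rho>) ^ ?k)" using D \<rho> by (simp add: ennreal_power)
      finally show ?thesis using hausdorff_content_le_diam[OF k1, of d "f ` T \<iota>"] by (rule order_trans[rotated])
    qed
    have "f ` (E \<inter> cbox u w) = (\<Union>\<iota>\<in>I. f ` T \<iota>)"
      using idxI by (auto simp: T_def)
    then have "hausdorff_content d ?k (f ` (E \<inter> cbox u w)) \<le> of_nat (card I) * ennreal ((D * \<rho>) ^ ?k)"
      using hausdorff_content_finite_UN_le[OF k1 finI diamT] by simp
    also have "\<dots> = ennreal (real (card I) * (D * \<rho>) ^ ?k)"
      using D \<rho> by (simp add: ennreal_mult ennreal_of_nat_eq_real_of_nat)
    also have "\<dots> \<le> ennreal ((5 * real ?k * real n) ^ (?k - 1) * (D * \<rho>) ^ ?k)"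
      using cardI D \<rho> by (intro ennreal_leI mult_right_mono) auto
    \<comment> \<open>The gain: \<open>n ^ (?k - 1)\<close> from the number of tubes against
      \<open>n ^ ?k\<close> from their diameters leaves a factor \<open>1 / n\<close>.\<close>
    also have "(5 * real ?k * real n) ^ (?k - 1) * (D * \<rho>) ^ ?k = (5 * real ?k) ^ (?k - 1) * D ^ ?k / real n * h ^ ?k"
    proof -
      obtain k' where k': "?k = Suc k'" using k1 by (cases ?k) auto
      have gen: "(c * N) ^ (?k - 1) * (D * (h / N)) ^ ?k = c ^ (?k - 1) * D ^ ?k / N * h ^ ?k" if "N > 0" for c N :: real
        using that unfolding k' by (simp add: power_mult_distrib power_divide)
      show ?thesis unfolding \<rho>_def by (rule gen) (use n in simp)
    qed
    finally show ?thesis by simp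
  qed
  then show ?thesis using r by (intro exI[of _ r]) (auto simp: D_def)
qed

lemma hausdorff_content_countable_UN_null:
  assumes "k \<ge> 1" "countable I" "\<And>i. i \<in> I \<Longrightarrow> hausdorff_content d k (A i) = 0"
  shows "hausdorff_content d k (\<Union>i\<in>I. A i) = 0"
proof (cases "I = {}")
  case True
  then show ?thesis by (simp add: hausdorff_content_empty[OF assms(1)])
next
  case False
  have "(\<Union>i\<in>I. A i) = (\<Union>n. A (from_nat_into I n))"
    using range_from_nat_into[OF False assms(2)] by (metis image_image)
  then show ?thesis
    using hausdorff_content_UN_null[OF assms(1), of d "\<lambda>n. A (from_nat_into I n)"] assms(3) from_nat_into[OF False] by simp
qed

lemma hausdorff_content_image_UN_le:
  assumes "k \<ge> 1"
  shows "hausdorff_content d k (f ` (E \<inter> (\<Union>n::nat. A n))) \<le> (\<Sum>n. hausdorff_content d k (f ` (E \<inter> A n)))"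
proof -
  have "f ` (E \<inter> (\<Union>n. A n)) = (\<Union>n. f ` (E \<inter> A n))" by blast
  then show ?thesis using hausdorff_content_UN_le[OF assms, of d "\<lambda>n. f ` (E \<inter> A n)"] by simp
qed

text \<open>\<open>cube_covering_le\<close> with a set of measure 0: a cube of side \<open>h\<close>
  has an image of diameter at most \<open>L * DIM('a) * h\<close>. Cutting \<open>N\<close> by balls
  provides the boundedness required there.\<close>

lemma hausdorff_content_lipschitz_image_negligible:
  fixes f :: "'a::euclidean_space \<Rightarrow> 'b" and d :: "'b \<Rightarrow> 'b \<Rightarrow> ennreal" and L :: real
  assumes lip: "\<And>y z. y \<in> E \<Longrightarrow> z \<in> E \<Longrightarrow> d (f y) (f z) \<le> ennreal (L * dist y z)" and L: "L \<ge> 0"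
    and N: "negligible N" "N \<subseteq> E"
  shows "hausdorff_content d DIM('a) (f ` N) = 0"
proof -
  have k1: "DIM('a) \<ge> 1" by (simp add: DIM_ge_Suc0)
  let ?\<phi> = "\<lambda>S. hausdorff_content d DIM('a) (f ` (E \<inter> S))"
  have "?\<phi> (N \<inter> ball 0 (real j)) = 0" for j :: nat
  proof -
    have neg: "negligible (N \<inter> ball 0 (real j))" by (rule negligible_subset[OF N(1)]) blast
    have "?\<phi> (N \<inter> ball 0 (real j)) \<le> ennreal ((L * real DIM('a)) ^ DIM('a)) * emeasure lebesgue (N \<inter> ball 0 (real j))"
    proof (rule cube_covering_le)
      show "?\<phi> (\<Union>n. A n) \<le> (\<Sum>n. ?\<phi> (A n))" for A :: "nat \<Rightarrow> 'a set" by (rule hausdorff_content_image_UN_le[OF k1])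
      show "?\<phi> A \<le> ?\<phi> B" if "A \<subseteq> B" for A B using that by (intro hausdorff_content_mono[OF k1]) auto
      show "?\<phi> {} = 0" by (simp add: hausdorff_content_empty[OF k1])
      show "N \<inter> ball 0 (real j) \<in> sets lebesgue" using neg by (rule negligible_imp_sets)
      show "bounded (N \<inter> ball 0 (real j))" by (simp add: bounded_Int)
      show "0 \<le> (L * real DIM('a)) ^ DIM('a)" using L by simp
      have cube: "?\<phi> (cbox u v) \<le> ennreal ((L * real DIM('a)) ^ DIM('a) * h ^ DIM('a))"
        if h: "0 < h" and side: "\<forall>i\<in>Basis. v \<bullet> i - u \<bullet> i = h" for u v h
      proof -
        have "ediameter d (f ` (E \<inter> cbox u v)) \<le> ennreal (L * (real DIM('a) * h))"
        proof (rule ediameter_leI)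
          fix a b assume "a \<in> f ` (E \<inter> cbox u v)" "b \<in> f ` (E \<inter> cbox u v)"
          then obtain y z where yz: "a = f y" "b = f z" "y \<in> E" "z \<in> E" "y \<in> cbox u v" "z \<in> cbox u v" by blast
          have "\<bar>(y - z) \<bullet> i\<bar> \<le> h" if "i \<in> Basis" for i
            using yz(5,6) side that unfolding mem_box inner_diff_left by (smt (verit))
          then have "dist y z \<le> real DIM('a) * h" unfolding dist_norm by (rule norm_le_card_times)
          then have "L * dist y z \<le> L * (real DIM('a) * h)" using L by (rule mult_left_mono)
          then show "d a b \<le> ennreal (L * (real DIM('a) * h))"
            unfolding yz(1,2) by (intro order_trans[OF lip[OF yz(3,4)]] ennreal_leI)
        qed
        then have "ediameter d (f ` (E \<inter> cbox u v)) ^ DIM('a) \<le> ennreal (L * (real DIM('a) * h)) ^ DIM('a)"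
          by (intro power_mono) auto
        also have "\<dots> = ennreal ((L * real DIM('a)) ^ DIM('a) * h ^ DIM('a))"
          using L h by (simp add: ennreal_power power_mult_distrib mult.assoc)
        finally show ?thesis by (rule order_trans[OF hausdorff_content_le_diam[OF k1]])
      qed
      show "\<exists>r>0. \<forall>u v h. 0 < h \<longrightarrow> (\<forall>i\<in>Basis. v \<bullet> i - u \<bullet> i = h) \<longrightarrow> x \<in> cbox u v \<longrightarrow>
          cbox u v \<subseteq> ball x r \<longrightarrow> ?\<phi> (cbox u v) \<le> ennreal ((L * real DIM('a)) ^ DIM('a) * h ^ DIM('a))" for x
        using cube by (intro exI[of _ 1]) simp
    qed
    also have "emeasure lebesgue (N \<inter> ball 0 (real j)) = 0"
      using neg negligible_imp_sets[OF neg] by (simp add: negligible_iff_emeasure0)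
    finally show ?thesis by simp
  qed
  then have "hausdorff_content d DIM('a) (\<Union>j::nat. f ` (E \<inter> (N \<inter> ball 0 (real j)))) = 0"
    by (intro hausdorff_content_UN_null[OF k1])
  moreover have "f ` N = (\<Union>j::nat. f ` (E \<inter> (N \<inter> ball 0 (real j))))"
  proof -
    have "N = (\<Union>j::nat. E \<inter> (N \<inter> ball 0 (real j)))"
      using N(2) reals_Archimedean2 by (auto simp: subset_iff)
    then show ?thesis by (metis image_UN)
  qed
  ultimately show ?thesis by simp
qed

section \<open>Lipschitz maps into a single chart\<close>

text \<open>The domain is so small that the filled curves along its lines, with Lipschitz constant
  \<open>2 * (L + 1)\<close>, remain in \<open>ball p (R / 2)\<close>. The constant
  \<open>L + 1\<close> is positive even when \<open>L = 0\<close>.\<close>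

locale cc_lipschitz_piece = cc_chart \<Omega> m X p R M \<mu> G
  for \<Omega> :: "(real ^ 'n) set" and m :: nat and X :: "nat \<Rightarrow> real ^ 'n \<Rightarrow> real ^ 'n"
    and p :: "real ^ 'n" and R M \<mu> :: real and G :: "nat \<Rightarrow> real ^ 'n \<Rightarrow> real" +
  fixes P :: "'a::euclidean_space set" and f :: "'a \<Rightarrow> real ^ 'n" and L :: real
  assumes L: "L \<ge> 0" and lip: "\<And>y z. y \<in> P \<Longrightarrow> z \<in> P \<Longrightarrow> cc_dist \<Omega> m X (f y) (f z) \<le> ennreal (L * dist y z)"
    and image: "\<And>y. y \<in> P \<Longrightarrow> f y \<in> ball p (R / 4)"
    and diam: "\<And>y z. y \<in> P \<Longrightarrow> z \<in> P \<Longrightarrow> M * (2 * (L + 1) * dist y z) < R / 4"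
begin

lemma image': "y \<in> P \<Longrightarrow> f y \<in> ball p (R / 2)"
  using image[of y] R(1) by simp

lemma euclidean_lipschitz: "(M * (L + 1))-lipschitz_on P f"
proof (rule lipschitz_onI)
  fix y z assume yz: "y \<in> P" "z \<in> P"
  show "dist (f y) (f z) \<le> M * (L + 1) * dist y z"
  proof (cases "y = z")
    case False
    have "0 < (L + 1) * dist y z" "L * dist y z < (L + 1) * dist y z"
      using False L by (auto intro!: mult_pos_pos)
    then have "ennreal (L * dist y z) < ennreal ((L + 1) * dist y z)" by (rule ennreal_lessI)
    with lip[OF yz] have "cc_dist \<Omega> m X (f y) (f z) < ennreal ((L + 1) * dist y z)" by (rule le_less_trans)
    moreover have "M * ((L + 1) * dist y z) \<le> R / 2"
      using diam[OF yz] R(1) by (simp add: algebra_simps)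
    ultimately show ?thesis using dist_le_cc_dist[OF image'[OF yz(1)]] by (simp add: mult.assoc)
  qed simp
qed (use M L in auto)

lemma edist_le_cc_dist:
  assumes x: "x \<in> ball p (R / 2)" and d: "cc_dist \<Omega> m X x y < ennreal (R / (2 * M))"
  shows "edist x y \<le> ennreal M * cc_dist \<Omega> m X x y"
proof -
  obtain c where c: "cc_dist \<Omega> m X x y = ennreal c" "c \<ge> 0"
    using d by (cases "cc_dist \<Omega> m X x y") auto
  have cR: "c < R / (2 * M)" using d c by (simp add: ennreal_less_iff)
  have "dist x y \<le> M * c"
  proof (rule field_le_epsilon)
    fix \<epsilon> :: real assume "\<epsilon> > 0"
    define e where "e = c + min (\<epsilon> / M) (R / (2 * M) - c)"
    have "c < e" using \<open>\<epsilon> > 0\<close> M cR by (simp add: e_def)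
    then have "cc_dist \<Omega> m X x y < ennreal e" unfolding c(1) using c(2) by (intro ennreal_lessI) auto
    moreover have "M * e \<le> M * (R / (2 * M))" using M by (intro mult_left_mono) (auto simp: e_def)
    then have "M * e \<le> R / 2" using M by simp
    ultimately have "dist x y \<le> M * e" by (rule dist_le_cc_dist[OF x])
    also have "\<dots> \<le> M * (c + \<epsilon> / M)" using M by (intro mult_left_mono) (auto simp: e_def)
    also have "\<dots> = M * c + \<epsilon>" using M by (simp add: distrib_left)
    finally show "dist x y \<le> M * c + \<epsilon>" .
  qed
  then have "edist x y \<le> ennreal (M * c)" by (rule ennreal_leI)
  then show ?thesis using M c by (simp add: ennreal_mult')
qed

text \<open>In a covering with small sum every set has small \<open>d_cc\<close>-diameter, so the
  metrics can be compared within it, after intersection with the image, which lies in the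
  chart.\<close>

lemma euclidean_null_if_cc_null:
  assumes k: "k \<ge> 1" and null: "hausdorff_content (cc_dist \<Omega> m X) k (f ` P) = 0"
  shows "hausdorff_content edist k (f ` P) = 0"
proof -
  define e0 where "e0 = R / (4 * M)"
  have e0: "e0 > 0" using R M by (simp add: e0_def)
  have "hausdorff_content edist k (f ` P) \<le> 0 + ennreal \<epsilon>" if "\<epsilon> > 0" for \<epsilon>
  proof -
    \<comment> \<open>The first bound keeps diameters below \<open>R / (2 * M)\<close>, the range of
      the comparison; the second pays for the factor \<open>M ^ k\<close>.\<close>
    define e where "e = min (e0 ^ k) (\<epsilon> / M ^ k)"
    have e: "e > 0" using that e0 M by (simp add: e_def)
    obtain C where C: "f ` P \<subseteq> (\<Union>i::nat. C i)" "(\<Sum>i. ediameter (cc_dist \<Omega> m X) (C i) ^ k) < ennreal e"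
      using hausdorff_content_approx[OF k, of "cc_dist \<Omega> m X" "f ` P" "ennreal e"] null e by auto
    have diamC: "ediameter (cc_dist \<Omega> m X) (C i) < ennreal (R / (2 * M))" for i
    proof (rule ccontr)
      assume "\<not> ?thesis"
      moreover have "ennreal e0 \<le> ennreal (R / (2 * M))"
        using R M by (intro ennreal_leI) (simp add: e0_def field_simps)
      ultimately have "ennreal e0 \<le> ediameter (cc_dist \<Omega> m X) (C i)" by (meson not_le order_trans)
      then have "ennreal e0 ^ k \<le> ediameter (cc_dist \<Omega> m X) (C i) ^ k" by (intro power_mono) auto
      also have "\<dots> \<le> (\<Sum>i. ediameter (cc_dist \<Omega> m X) (C i) ^ k)"
        using sum_le_suminf[of "\<lambda>i. ediameter (cc_dist \<Omega> m X) (C i) ^ k" "{i}"] by simp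
      also have "\<dots> < ennreal e" by (rule C(2))
      also have "\<dots> \<le> ennreal e0 ^ k" using e0 by (simp add: e_def ennreal_power ennreal_leI)
      finally show False by simp
    qed
    have le: "ediameter edist (C i \<inter> f ` P) ^ k \<le> ennreal (M ^ k) * ediameter (cc_dist \<Omega> m X) (C i) ^ k" for i
    proof -
      have "ediameter edist (C i \<inter> f ` P) \<le> ennreal M * ediameter (cc_dist \<Omega> m X) (C i)"
      proof (rule ediameter_leI)
        fix x y assume xy: "x \<in> C i \<inter> f ` P" "y \<in> C i \<inter> f ` P"
        have up: "cc_dist \<Omega> m X x y \<le> ediameter (cc_dist \<Omega> m X) (C i)" using xy by (intro ediameter_upper) auto
        have "edist x y \<le> ennreal M * cc_dist \<Omega> m X x y"
        proof (rule edist_le_cc_dist)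
          show "x \<in> ball p (R / 2)" using xy image' by auto
          show "cc_dist \<Omega> m X x y < ennreal (R / (2 * M))" using up diamC[of i] by (rule le_less_trans)
        qed
        also have "\<dots> \<le> ennreal M * ediameter (cc_dist \<Omega> m X) (C i)" using up by (intro mult_left_mono) auto
        finally show "edist x y \<le> ennreal M * ediameter (cc_dist \<Omega> m X) (C i)" .
      qed
      then have "ediameter edist (C i \<inter> f ` P) ^ k \<le> (ennreal M * ediameter (cc_dist \<Omega> m X) (C i)) ^ k" by (intro power_mono) auto
      then show ?thesis using M by (simp add: power_mult_distrib ennreal_power)
    qed
    have "hausdorff_content edist k (f ` P) \<le> (\<Sum>i. ediameter edist (C i \<inter> f ` P) ^ k)"
      using C(1) by (intro hausdorff_content_le[OF k]) blast
    also have "\<dots> \<le> (\<Sum>i. ennreal (M ^ k) * ediameter (cc_dist \<Omega> m X) (C i) ^ k)"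
      by (intro suminf_le le) auto
    also have "\<dots> = ennreal (M ^ k) * (\<Sum>i. ediameter (cc_dist \<Omega> m X) (C i) ^ k)" by simp
    also have "\<dots> \<le> ennreal (M ^ k) * ennreal e" using C(2) by (intro mult_left_mono) auto
    also have "\<dots> = ennreal (M ^ k * e)" using M by (simp add: ennreal_mult')
    also have "\<dots> \<le> ennreal \<epsilon>"
    proof (rule ennreal_leI)
      have "M ^ k * e \<le> M ^ k * (\<epsilon> / M ^ k)" using M by (intro mult_left_mono) (auto simp: e_def)
      then show "M ^ k * e \<le> \<epsilon>" using M by simp
    qed
    finally show ?thesis by simp
  qed
  then have "hausdorff_content edist k (f ` P) \<le> 0" by (rule ennreal_le_epsilon)
  then show ?thesis by simp
qed

text \<open>For fixed \<open>n\<close>, \<open>Z v j\<close> collects points where \<open>f\<close>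
  moves along \<open>v\<close> at Euclidean rate at most \<open>\<epsilon>\<close>, and
  \<open>A v i\<close> those with \<open>d_cc\<close> rate at most \<open>1 / n\<close>, at uniform
  scales. By \<open>cc_dist_small_along_line\<close> on the lines parallel to \<open>v\<close>, the
  former lies in the union of the latter up to a null set. At density points of some
  \<open>A v i\<close> the tube estimate bounds the content by \<open>C / n\<close> times volume.
  Compactness of \<open>K\<close> makes these sets Borel and the sections by lines compact.\<close>

lemma cc_null_if_rank_deficient:
  assumes K: "compact K" "K \<subseteq> P"
    and deg: "negligible {x\<in>K. \<not> (\<exists>D v. (f has_derivative D) (at x within K) \<and> v \<noteq> 0 \<and> D v = 0)}" (is "negligible ?N0")
  shows "hausdorff_content (cc_dist \<Omega> m X) DIM('a) (f ` K) = 0"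
proof -
  let ?k = "DIM('a)" and ?d = "cc_dist \<Omega> m X"
  have k1: "?k \<ge> 1" by (simp add: DIM_ge_Suc0)
  have lipK: "?d (f y) (f z) \<le> ennreal (L * dist y z)" if "y \<in> K" "z \<in> K" for y z
    using lip that K(2) by blast
  have tri: "?d a c \<le> ?d a b + ?d b c" for a b c by (rule cc_dist_triangle[OF ind])
  have fin: "?d (f y) (f z) = ennreal (enn2real (?d (f y) (f z)))" if "y \<in> K" "z \<in> K" for y z
  proof -
    have "?d (f y) (f z) < top" using lipK[OF that] by (rule le_less_trans) simp
    then show ?thesis by simp
  qed
  \<comment> \<open>Independent of \<open>n\<close>, so that letting \<open>n\<close> tend to
    infinity at the end gives 0.\<close>
  define C where "C = (5 * real ?k) ^ (?k - 1) * ((2 + real ?k) * L + real ?k) ^ ?k"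
  have C: "C \<ge> 0" using L by (simp add: C_def)
  \<comment> \<open>Kernel directions differ from point to point, while only countably many null
    sets may be discarded; hence a countable dense set of directions.\<close>
  obtain V where V: "countable V" "V \<subseteq> sphere (0::'a) 1" "sphere 0 1 \<subseteq> closure V"
    by (rule separable)
  have contf: "continuous_on K f"
    using euclidean_lipschitz K(2) lipschitz_on_continuous_on lipschitz_on_subset by blast
  have contE: "continuous_on (K \<times> K) (\<lambda>(x, y). dist (f x) (f y))"
    unfolding case_prod_unfold
    by (intro continuous_intros continuous_on_compose2[OF contf continuous_on_fst] continuous_on_compose2[OF contf continuous_on_snd]) auto
  have contC: "continuous_on (K \<times> K) (\<lambda>(x, y). enn2real (?d (f x) (f y)))"
    unfolding continuous_on_iff
  proof (intro ballI allI impI)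
    fix w :: "'a \<times> 'a" and e :: real assume w: "w \<in> K \<times> K" and e: "0 < e"
    obtain x y where xy: "w = (x, y)" "x \<in> K" "y \<in> K" using w by auto
    have lt: "enn2real (?d (f x) (f y)) \<le> enn2real (?d (f x') (f y')) + L * (dist x x' + dist y y')"
      if "x \<in> K" "y \<in> K" "x' \<in> K" "y' \<in> K" for x y x' y'
    proof -
      have "?d (f x) (f y) \<le> ?d (f x) (f x') + (?d (f x') (f y') + ?d (f y') (f y))"
        by (rule order_trans[OF tri[of _ _ "f x'"]], rule add_left_mono, rule tri)
      also have "\<dots> \<le> ennreal (L * dist x x') + (ennreal (enn2real (?d (f x') (f y'))) + ennreal (L * dist y' y))"
        using that by (intro add_mono lipK order_eq_refl fin)
      also have "\<dots> = ennreal (L * dist x x' + (enn2real (?d (f x') (f y')) + L * dist y' y))"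
        using L by (simp add: ennreal_plus[symmetric] del: ennreal_plus)
      finally have "ennreal (enn2real (?d (f x) (f y))) \<le> ennreal (L * dist x x' + (enn2real (?d (f x') (f y')) + L * dist y' y))"
        using fin[OF that(1,2)] by simp
      then have "enn2real (?d (f x) (f y)) \<le> L * dist x x' + (enn2real (?d (f x') (f y')) + L * dist y' y)"
        using L by (subst (asm) ennreal_le_iff) auto
      then show ?thesis by (simp add: distrib_left dist_commute)
    qed
    have "dist (enn2real (?d (f x') (f y'))) (enn2real (?d (f x) (f y))) < e"
      if x': "x' \<in> K" "y' \<in> K" and near: "dist (x', y') (x, y) < e / (2 * (L + 1))" for x' y'
    proof -
      have "dist x' x \<le> dist (x', y') (x, y)" "dist y' y \<le> dist (x', y') (x, y)"
        using dist_fst_le[of "(x', y')" "(x, y)"] dist_snd_le[of "(x', y')" "(x, y)"] by auto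
      with near have "dist x' x < e / (2 * (L + 1))" "dist y' y < e / (2 * (L + 1))" by simp_all
      then have "dist x' x + dist y' y \<le> e / (2 * (L + 1)) + e / (2 * (L + 1))" by simp
      also have "e / (2 * (L + 1)) = e / (L + 1) / 2" by simp
      also have "e / (L + 1) / 2 + e / (L + 1) / 2 = e / (L + 1)" by (rule field_sum_of_halves)
      finally have "dist x' x + dist y' y \<le> e / (L + 1)" .
      then have "L * (dist x' x + dist y' y) \<le> L * (e / (L + 1))" using L by (rule mult_left_mono)
      also have "\<dots> < e" using L e by (simp add: field_simps)
      finally have "L * (dist x' x + dist y' y) < e" .
      then show ?thesis
        using lt[OF xy(2,3) x'] lt[OF x' xy(2,3)] by (simp add: dist_real_def dist_commute abs_less_iff)
    qed
    then show "\<exists>\<delta>>0. \<forall>w'\<in>K \<times> K. dist w' w < \<delta> \<longrightarrow>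
        dist (case w' of (x, y) \<Rightarrow> enn2real (?d (f x) (f y))) (case w of (x, y) \<Rightarrow> enn2real (?d (f x) (f y))) < e"
      using e L xy(1) by (intro exI[of _ "e / (2 * (L + 1))"]) auto
  qed
  have main: "hausdorff_content ?d ?k (f ` K) \<le> ennreal (C / real n) * emeasure lebesgue K" if n: "n > 0" for n :: nat
  proof -
    \<comment> \<open>Makes the rate \<open>2 * \<epsilon> / \<mu>\<close> of
      \<open>cc_dist_small_along_line\<close> equal to \<open>1 / n\<close>.\<close>
    define \<epsilon> where "\<epsilon> = \<mu> / (2 * real n)"
    have \<epsilon>: "\<epsilon> > 0" "2 * \<epsilon> / \<mu> = inverse (real n)" using mu n by (auto simp: \<epsilon>_def field_simps)
    define Z where "Z v j = {x\<in>K. \<forall>s. \<bar>s\<bar> \<le> inverse (real (Suc j)) \<longrightarrow> x + s *\<^sub>R v \<in> K \<longrightarrow> dist (f x) (f (x + s *\<^sub>R v)) \<le> \<epsilon> * \<bar>s\<bar>}" for v j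
    define A where "A v i = {x\<in>K. \<forall>s. \<bar>s\<bar> \<le> inverse (real (Suc i)) \<longrightarrow> x + s *\<^sub>R v \<in> K \<longrightarrow>
        enn2real (?d (f x) (f (x + s *\<^sub>R v))) \<le> inverse (real n) * \<bar>s\<bar>}" for v i
    have Zb: "Z v j \<in> sets borel" for v j
      unfolding Z_def by (rule borel_directional_bound_set[OF K(1) contE])
    have Ab: "A v i \<in> sets borel" for v i
      unfolding A_def by (rule borel_directional_bound_set[OF K(1) contC])
    have Al: "A v i \<in> sets lebesgue" for v i using Ab by simp
    have ZA: "negligible (Z v j - (\<Union>i. A v i))" if v: "norm v = 1" for v j
    proof (rule negligible_if_negligible_on_lines[where v=v])
      have "Z v j - (\<Union>i. A v i) \<in> sets borel" using Zb Ab by (intro sets.Diff sets.countable_UN) auto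
      then show "Z v j - (\<Union>i. A v i) \<in> sets lebesgue" by simp
      fix x0
      define K1 where "K1 = {t. x0 + t *\<^sub>R v \<in> K}"
      define g where "g t = f (x0 + t *\<^sub>R v)" for t
      define A1 where "A1 = {t. x0 + t *\<^sub>R v \<in> Z v j}"
      have distl: "dist (x0 + s *\<^sub>R v) (x0 + t *\<^sub>R v) = \<bar>s - t\<bar>" for s t
        using v by (simp add: dist_norm scaleR_left_diff_distrib[symmetric])
      have "closed K1"
        unfolding K1_def using closed_vimage[OF compact_imp_closed[OF K(1)], of "\<lambda>t. x0 + t *\<^sub>R v"]
        by (simp add: vimage_def continuous_intros)
      moreover have "bounded K1"
      proof -
        obtain B where B: "\<And>x. x \<in> K \<Longrightarrow> norm x \<le> B" using compact_imp_bounded[OF K(1)] by (auto simp: bounded_iff)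
        have "\<bar>t\<bar> \<le> B + norm x0" if "t \<in> K1" for t
          using B[of "x0 + t *\<^sub>R v"] that v norm_triangle_ineq4[of "x0 + t *\<^sub>R v" x0] by (simp add: K1_def)
        then show ?thesis by (auto simp: bounded_iff)
      qed
      ultimately have K1: "compact K1" by (simp add: compact_eq_bounded_closed)
      have A1m: "A1 \<in> sets lebesgue"
      proof -
        have "(\<lambda>t. x0 + t *\<^sub>R v) \<in> borel_measurable borel" by measurable
        from measurable_sets[OF this Zb[of v j]] show ?thesis by (simp add: A1_def vimage_def)
      qed
      have "negligible {t\<in>A1. \<not> (\<exists>\<delta>>0. \<forall>s\<in>K1. \<bar>s - t\<bar> < \<delta> \<longrightarrow> ?d (g t) (g s) \<le> ennreal (2 * \<epsilon> / \<mu> * \<bar>s - t\<bar>))}"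
      proof (rule cc_dist_small_along_line[OF K1 _ _ _ _ A1m _ \<epsilon>(1), where \<kappa>="L + 1"])
        show "g t \<in> ball p (R / 4)" if "t \<in> K1" for t using that K(2) image by (auto simp: K1_def g_def)
        show "L + 1 > 0" using L by simp
        show "?d (g s) (g t) \<le> ennreal ((L + 1) * (t - s))" if "s \<in> K1" "t \<in> K1" "s \<le> t" for s t
        proof -
          have "?d (g s) (g t) \<le> ennreal (L * dist (x0 + s *\<^sub>R v) (x0 + t *\<^sub>R v))"
            unfolding g_def using that by (intro lipK) (auto simp: K1_def)
          also have "\<dots> \<le> ennreal ((L + 1) * (t - s))"
            unfolding distl using that by (intro ennreal_leI) (auto simp: distrib_right)
          finally show ?thesis .
        qed
        show "M * (2 * (L + 1) * (t - s)) < R / 4" if "s \<in> K1" "t \<in> K1" for s t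
        proof -
          have "M * (2 * (L + 1) * \<bar>t - s\<bar>) < R / 4"
            using diam[of "x0 + t *\<^sub>R v" "x0 + s *\<^sub>R v"] that K(2) unfolding distl by (auto simp: K1_def)
          moreover have "M * (2 * (L + 1) * (t - s)) \<le> M * (2 * (L + 1) * \<bar>t - s\<bar>)"
            using M L by (intro mult_left_mono) auto
          ultimately show ?thesis by linarith
        qed
        show "A1 \<subseteq> K1" by (auto simp: A1_def K1_def Z_def)
        fix t assume t: "t \<in> A1"
        have "dist (g s) (g t) \<le> \<epsilon> * \<bar>s - t\<bar>" if s: "s \<in> K1" "\<bar>s - t\<bar> < inverse (real (Suc j))" for s
        proof -
          have eq: "x0 + t *\<^sub>R v + (s - t) *\<^sub>R v = x0 + s *\<^sub>R v" by (simp add: algebra_simps)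
          have "dist (f (x0 + t *\<^sub>R v)) (f (x0 + t *\<^sub>R v + (s - t) *\<^sub>R v)) \<le> \<epsilon> * \<bar>s - t\<bar>"
          proof -
            have "\<forall>r. \<bar>r\<bar> \<le> inverse (real (Suc j)) \<longrightarrow> x0 + t *\<^sub>R v + r *\<^sub>R v \<in> K \<longrightarrow>
                dist (f (x0 + t *\<^sub>R v)) (f (x0 + t *\<^sub>R v + r *\<^sub>R v)) \<le> \<epsilon> * \<bar>r\<bar>"
              using t unfolding A1_def Z_def by blast
            moreover have "\<bar>s - t\<bar> \<le> inverse (real (Suc j))" using s(2) by (rule less_imp_le)
            moreover have "x0 + t *\<^sub>R v + (s - t) *\<^sub>R v \<in> K" unfolding eq using s(1) by (simp add: K1_def)
            ultimately show ?thesis by blast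
          qed
          then show ?thesis by (simp add: eq g_def dist_commute)
        qed
        then show "\<exists>\<delta>>0. \<forall>s\<in>K1. \<bar>s - t\<bar> < \<delta> \<longrightarrow> dist (g s) (g t) \<le> \<epsilon> * \<bar>s - t\<bar>"
          by (intro exI[of _ "inverse (real (Suc j))"]) (auto simp del: of_nat_Suc)
      qed
      then show "negligible {t. x0 + t *\<^sub>R v \<in> Z v j - (\<Union>i. A v i)}"
      proof (rule negligible_subset, intro subsetI CollectI conjI notI)
        fix t assume t: "t \<in> {t. x0 + t *\<^sub>R v \<in> Z v j - (\<Union>i. A v i)}"
        then show "t \<in> A1" by (simp add: A1_def)
        assume "\<exists>\<delta>>0. \<forall>s\<in>K1. \<bar>s - t\<bar> < \<delta> \<longrightarrow> ?d (g t) (g s) \<le> ennreal (2 * \<epsilon> / \<mu> * \<bar>s - t\<bar>)"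
        then obtain \<delta> where \<delta>: "\<delta> > 0" "\<And>s. s \<in> K1 \<Longrightarrow> \<bar>s - t\<bar> < \<delta> \<Longrightarrow> ?d (g t) (g s) \<le> ennreal (2 * \<epsilon> / \<mu> * \<bar>s - t\<bar>)"
          by blast
        obtain i where i: "inverse (real (Suc i)) < \<delta>" using reals_Archimedean[OF \<delta>(1)] by blast
        have tK: "x0 + t *\<^sub>R v \<in> K" using t by (auto simp: Z_def)
        have "x0 + t *\<^sub>R v \<in> A v i"
          unfolding A_def
        proof (intro CollectI conjI allI impI tK)
          fix s assume s: "\<bar>s\<bar> \<le> inverse (real (Suc i))" "x0 + t *\<^sub>R v + s *\<^sub>R v \<in> K"
          have eq: "x0 + t *\<^sub>R v + s *\<^sub>R v = x0 + (t + s) *\<^sub>R v" by (simp add: algebra_simps)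
          have "?d (g t) (g (t + s)) \<le> ennreal (2 * \<epsilon> / \<mu> * \<bar>t + s - t\<bar>)"
            using s i by (intro \<delta>(2)) (auto simp: K1_def eq)
          then have "?d (g t) (g (t + s)) \<le> ennreal (inverse (real n) * \<bar>s\<bar>)" unfolding \<epsilon>(2) by simp
          then have "enn2real (?d (g t) (g (t + s))) \<le> inverse (real n) * \<bar>s\<bar>"
            by (intro enn2real_leI) auto
          then show "enn2real (?d (f (x0 + t *\<^sub>R v)) (f (x0 + t *\<^sub>R v + s *\<^sub>R v))) \<le> inverse (real n) * \<bar>s\<bar>"
            unfolding eq g_def .
        qed
        then show False using t by blast
      qed
    qed
    \<comment> \<open>A unit kernel vector \<open>w\<close> has some \<open>v\<close> in
      \<open>V\<close> within \<open>\<epsilon> / (2 * B)\<close>, so \<open>D v\<close> has norm at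
      most \<open>\<epsilon> / 2\<close>; the error of differentiation takes the other half of
      \<open>\<epsilon>\<close>.\<close>
    have cover: "K \<subseteq> ?N0 \<union> (\<Union>v\<in>V. \<Union>j. Z v j)"
    proof (intro subsetI, rule ccontr)
      fix x assume x: "x \<in> K" and nx: "x \<notin> ?N0 \<union> (\<Union>v\<in>V. \<Union>j. Z v j)"
      then obtain D v0 where D: "(f has_derivative D) (at x within K)" "v0 \<noteq> 0" "D v0 = 0" by blast
      have lin: "linear D" using D(1) by (rule has_derivative_linear)
      obtain B where B: "B > 0" "\<And>v. norm (D v) \<le> norm v * B"
        using bounded_linear.pos_bounded[OF has_derivative_bounded_linear[OF D(1)]] by blast
      define w where "w = v0 /\<^sub>R norm v0"
      have w: "w \<in> sphere 0 1" "D w = 0" using D(2,3) by (auto simp: w_def linear_scale[OF lin])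
      have "\<epsilon> / (2 * B) > 0" using \<epsilon>(1) B(1) by simp
      then obtain v where v: "v \<in> V" "dist v w < \<epsilon> / (2 * B)"
        using V(3) w(1) closure_approachable by blast
      have nv: "norm v = 1" using v(1) V(2) by auto
      have "D v = D (v - w)" using w(2) by (simp add: linear_diff[OF lin])
      then have "norm (D v) \<le> norm (v - w) * B" using B(2) by metis
      also have "\<dots> \<le> \<epsilon> / (2 * B) * B" using v(2) B(1) by (intro mult_right_mono) (auto simp: dist_norm)
      finally have Dv: "norm (D v) \<le> \<epsilon> / 2" using B(1) by simp
      have "\<epsilon> / 2 > 0" using \<epsilon>(1) by simp
      then obtain \<delta> where \<delta>: "\<delta> > 0" "\<And>y. y \<in> K \<Longrightarrow> norm (y - x) < \<delta> \<Longrightarrow> norm (f y - f x - D (y - x)) \<le> \<epsilon> / 2 * norm (y - x)"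
        using D(1) unfolding has_derivative_within_alt by blast
      obtain j where j: "inverse (real (Suc j)) < \<delta>" using reals_Archimedean[OF \<delta>(1)] by blast
      have "x \<in> Z v j"
        unfolding Z_def
      proof (intro CollectI conjI allI impI x)
        fix s assume s: "\<bar>s\<bar> \<le> inverse (real (Suc j))" "x + s *\<^sub>R v \<in> K"
        have "norm (f (x + s *\<^sub>R v) - f x - D (s *\<^sub>R v)) \<le> \<epsilon> / 2 * \<bar>s\<bar>"
          using \<delta>(2)[OF s(2)] s(1) j nv by simp
        moreover have "norm (D (s *\<^sub>R v)) \<le> \<bar>s\<bar> * (\<epsilon> / 2)"
          unfolding linear_scale[OF lin] norm_scaleR using Dv by (intro mult_left_mono) auto
        moreover have "norm (f (x + s *\<^sub>R v) - f x) \<le> norm (f (x + s *\<^sub>R v) - f x - D (s *\<^sub>R v)) + norm (D (s *\<^sub>R v))"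
          using norm_triangle_ineq[of "f (x + s *\<^sub>R v) - f x - D (s *\<^sub>R v)" "D (s *\<^sub>R v)"] by simp
        ultimately have "norm (f (x + s *\<^sub>R v) - f x) \<le> \<epsilon> * \<bar>s\<bar>" by (simp add: mult.commute)
        then show "dist (f x) (f (x + s *\<^sub>R v)) \<le> \<epsilon> * \<bar>s\<bar>" by (simp add: dist_norm norm_minus_commute)
      qed
      then show False using nx v(1) by blast
    qed
    \<comment> \<open>The points where the tube estimate applies: all of \<open>K\<close> up to a
      null set, whose image is null by Lipschitz continuity.\<close>
    define H where "H = (\<Union>v\<in>V. \<Union>i. {x\<in>A v i. density_point (A v i) x})"
    have negH: "negligible (K - H)"
    proof (rule negligible_subset)
      show "negligible (?N0 \<union> ((\<Union>v\<in>V. \<Union>j. Z v j - (\<Union>i. A v i)) \<union> (\<Union>v\<in>V. \<Union>i. {x\<in>A v i. \<not> density_point (A v i) x})))"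
      proof (intro negligible_Un deg negligible_countable_Union countable_image V(1))
        fix T assume "T \<in> (\<lambda>v. \<Union>j. Z v j - (\<Union>i. A v i)) ` V"
        then obtain v where v: "v \<in> V" "T = (\<Union>j. Z v j - (\<Union>i. A v i))" by blast
        have "norm v = 1" using v(1) V(2) by auto
        then show "negligible T" unfolding v(2) by (intro negligible_Union_nat ZA)
      next
        fix T assume "T \<in> (\<lambda>v. \<Union>i. {x\<in>A v i. \<not> density_point (A v i) x}) ` V"
        then show "negligible T" by (auto intro!: negligible_Union_nat negligible_not_density_point Al)
      qed
      show "K - H \<subseteq> ?N0 \<union> ((\<Union>v\<in>V. \<Union>j. Z v j - (\<Union>i. A v i)) \<union> (\<Union>v\<in>V. \<Union>i. {x\<in>A v i. \<not> density_point (A v i) x}))"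
      proof
        fix x assume x: "x \<in> K - H"
        show "x \<in> ?N0 \<union> ((\<Union>v\<in>V. \<Union>j. Z v j - (\<Union>i. A v i)) \<union> (\<Union>v\<in>V. \<Union>i. {x\<in>A v i. \<not> density_point (A v i) x}))"
        proof (cases "x \<in> ?N0")
          case False
          then obtain v j where vj: "v \<in> V" "x \<in> Z v j" using cover x by blast
          show ?thesis
          proof (cases "x \<in> (\<Union>i. A v i)")
            case True
            then obtain i where "x \<in> A v i" by blast
            moreover from this have "\<not> density_point (A v i) x" using x vj(1) unfolding H_def by blast
            ultimately show ?thesis using vj(1) by blast
          qed (use vj in blast)
        qed blast
      qed
    qed
    have HK: "H \<subseteq> K" by (auto simp: H_def A_def)
    have "H = K - (K - H)" using HK by blast
    moreover have "K - (K - H) \<in> sets lebesgue"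
      by (rule sets.Diff[OF fmeasurableD[OF lmeasurable_compact[OF K(1)]] negligible_imp_sets[OF negH]])
    ultimately have Hl: "H \<in> sets lebesgue" by simp
    let ?\<phi> = "\<lambda>S. hausdorff_content ?d ?k (f ` (K \<inter> S))"
    have "?\<phi> H \<le> ennreal (C / real n) * emeasure lebesgue H"
    proof (rule cube_covering_le[OF _ _ _ Hl])
      show "?\<phi> (\<Union>n. A n) \<le> (\<Sum>n. ?\<phi> (A n))" for A :: "nat \<Rightarrow> 'a set" by (rule hausdorff_content_image_UN_le[OF k1])
      show "?\<phi> A \<le> ?\<phi> B" if "A \<subseteq> B" for A B using that by (intro hausdorff_content_mono[OF k1]) auto
      show "?\<phi> {} = 0" by (simp add: hausdorff_content_empty[OF k1])
      show "bounded H" using HK compact_imp_bounded[OF K(1)] bounded_subset by blast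
      show "0 \<le> C / real n" using C by simp
      fix x assume "x \<in> H"
      then obtain v i where vi: "v \<in> V" "density_point (A v i) x" by (auto simp: H_def)
      have nv: "norm v = 1" using vi(1) V(2) by auto
      have A_K: "A v i \<subseteq> K" by (auto simp: A_def)
      have "\<exists>r>0. \<forall>u w h. 0 < h \<longrightarrow> (\<forall>i\<in>Basis. w \<bullet> i - u \<bullet> i = h) \<longrightarrow> x \<in> cbox u w \<longrightarrow> cbox u w \<subseteq> ball x r \<longrightarrow>
           hausdorff_content ?d DIM('a) (f ` (K \<inter> cbox u w))
             \<le> ennreal ((5 * real DIM('a)) ^ (DIM('a) - 1) * ((2 + real DIM('a)) * L + real DIM('a)) ^ DIM('a) / real n * h ^ DIM('a))"
      proof (rule hausdorff_content_cube_le[where A="A v i" and \<delta>="inverse (real (Suc i))"])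
        show "?d a c \<le> ?d a b + ?d b c" for a b c by (rule tri)
        show "?d (f y) (f z) \<le> ennreal (L * dist y z)" if "y \<in> K" "z \<in> K" for y z using that by (rule lipK)
        show "A v i \<in> sets lebesgue" by (rule Al)
        fix y s assume y: "y \<in> A v i" and s: "\<bar>s\<bar> \<le> inverse (real (Suc i))" "y + s *\<^sub>R v \<in> K"
        have yK: "y \<in> K" using y A_K by blast
        have "enn2real (?d (f y) (f (y + s *\<^sub>R v))) \<le> inverse (real n) * \<bar>s\<bar>"
          using y s unfolding A_def by blast
        then show "?d (f y) (f (y + s *\<^sub>R v)) \<le> ennreal (inverse (real n) * \<bar>s\<bar>)"
          by (subst fin[OF yK s(2)]) (rule ennreal_leI)
      qed (simp_all add: L nv n A_K vi(2))
      then show "\<exists>r>0. \<forall>u v h. 0 < h \<longrightarrow> (\<forall>i\<in>Basis. v \<bullet> i - u \<bullet> i = h) \<longrightarrow> x \<in> cbox u v \<longrightarrow> cbox u v \<subseteq> ball x r \<longrightarrow>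
          ?\<phi> (cbox u v) \<le> ennreal (C / real n * h ^ ?k)"
        unfolding C_def .
    qed
    also have "\<dots> \<le> ennreal (C / real n) * emeasure lebesgue K"
      using HK fmeasurableD[OF lmeasurable_compact[OF K(1)]] by (intro mult_left_mono emeasure_mono) auto
    finally have 1: "hausdorff_content ?d ?k (f ` H) \<le> ennreal (C / real n) * emeasure lebesgue K"
      using HK by (simp add: Int_absorb1)
    have 2: "hausdorff_content ?d ?k (f ` (K - H)) = 0"
      by (rule hausdorff_content_lipschitz_image_negligible[where E=K and L=L]) (use L negH lipK in auto)
    define W where "W i = (if i = 0 then f ` H else if i = 1 then f ` (K - H) else {})" for i :: nat
    have "f ` K = (\<Union>i. W i)" using HK by (auto simp: W_def split: if_splits)
    then have "hausdorff_content ?d ?k (f ` K) \<le> (\<Sum>i. hausdorff_content ?d ?k (W i))"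
      by (simp only: hausdorff_content_UN_le[OF k1])
    also have "\<dots> = (\<Sum>i\<in>{0}. hausdorff_content ?d ?k (W i))"
      by (rule suminf_finite) (use 2 hausdorff_content_empty[OF k1] in \<open>auto simp: W_def\<close>)
    also have "\<dots> = hausdorff_content ?d ?k (f ` H)" by (simp add: W_def)
    finally show ?thesis using 1 by simp
  qed
  have "emeasure lebesgue K < top" using emeasure_compact_finite[OF K(1)] by (simp add: compact_imp_closed[OF K(1)] less_top)
  then obtain c0 where c0: "emeasure lebesgue K = ennreal c0" "c0 \<ge> 0" by (cases "emeasure lebesgue K") auto
  have "hausdorff_content ?d ?k (f ` K) \<le> 0 + ennreal e" if "e > 0" for e
  proof -
    obtain n :: nat where n: "C * c0 / e < real n" using reals_Archimedean2 by blast
    have "n > 0" using n C c0(2) that by (cases "n = 0") (auto simp: divide_less_0_iff mult_less_0_iff not_less)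
    have "hausdorff_content ?d ?k (f ` K) \<le> ennreal (C / real n) * ennreal c0" using main[OF \<open>n > 0\<close>] c0 by simp
    also have "\<dots> = ennreal (C / real n * c0)" by (rule ennreal_mult'[symmetric]) (use C in simp)
    also have "\<dots> \<le> ennreal e" using n \<open>n > 0\<close> that by (intro ennreal_leI) (simp add: field_simps)
    finally show ?thesis by simp
  qed
  then have "hausdorff_content ?d ?k (f ` K) \<le> 0" by (rule ennreal_le_epsilon)
  then show ?thesis by simp
qed

text \<open>Inner regularity leaves compact pieces and a null set, whose image is null. A derivative
  within \<open>P\<close> is also one within each compact piece, with the same kernel.\<close>

lemma cc_null_if_rank_deficient_measurable:
  assumes P: "P \<in> sets lebesgue"
    and deg: "negligible {x\<in>P. \<not> (\<exists>D v. (f has_derivative D) (at x within P) \<and> v \<noteq> 0 \<and> D v = 0)}"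
  shows "hausdorff_content (cc_dist \<Omega> m X) DIM('a) (f ` P) = 0"
proof -
  have k1: "DIM('a) \<ge> 1" by (simp add: DIM_ge_Suc0)
  obtain N C where N: "negligible N" and C: "\<And>n::nat. compact (C n)" and P_eq: "P = (\<Union>n. C n) \<union> N"
    using lebesgue_regular_inner[OF P] by metis
  have "hausdorff_content (cc_dist \<Omega> m X) DIM('a) (f ` C n) = 0" for n
  proof (rule cc_null_if_rank_deficient[OF C])
    show sub: "C n \<subseteq> P" using P_eq by blast
    show "negligible {x\<in>C n. \<not> (\<exists>D v. (f has_derivative D) (at x within C n) \<and> v \<noteq> 0 \<and> D v = 0)}"
    proof (rule negligible_subset[OF deg], rule subsetI)
      fix x assume x: "x \<in> {x\<in>C n. \<not> (\<exists>D v. (f has_derivative D) (at x within C n) \<and> v \<noteq> 0 \<and> D v = 0)}"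
      then have "\<not> (\<exists>D v. (f has_derivative D) (at x within P) \<and> v \<noteq> 0 \<and> D v = 0)"
        using has_derivative_subset[OF _ sub] by blast
      then show "x \<in> {x\<in>P. \<not> (\<exists>D v. (f has_derivative D) (at x within P) \<and> v \<noteq> 0 \<and> D v = 0)}"
        using x sub by blast
    qed
  qed
  then have "hausdorff_content (cc_dist \<Omega> m X) DIM('a) (\<Union>n. f ` C n) = 0"
    by (intro hausdorff_content_UN_null[OF k1])
  moreover have "hausdorff_content (cc_dist \<Omega> m X) DIM('a) (f ` N) = 0"
    by (rule hausdorff_content_lipschitz_image_negligible[where E=P and L=L]) (use L N lip P_eq in auto)
  moreover have "f ` P = (\<Union>i\<in>UNIV. if i then (\<Union>n. f ` C n) else f ` N)"
    unfolding P_eq by auto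
  ultimately show ?thesis
    by (simp only:) (rule hausdorff_content_countable_UN_null[OF k1], auto)
qed

end

section \<open>Globalization\<close>

locale cc_lipschitz_map =
  fixes \<Omega> :: "(real ^ 'n) set" and m :: nat and X :: "nat \<Rightarrow> real ^ 'n \<Rightarrow> real ^ 'n"
    and E :: "'a::euclidean_space set" and f :: "'a \<Rightarrow> real ^ 'n" and L :: real
  assumes open_domain: "open \<Omega>" and loc_lip: "\<And>i. i \<in> {1..m} \<Longrightarrow> locally_lipschitz_on \<Omega> (X i)"
    and ind: "\<And>q. q \<in> \<Omega> \<Longrightarrow> lin_indep_family m (\<lambda>i. X i q)"
    and E: "E \<in> sets lebesgue" and image: "f ` E \<subseteq> \<Omega>" and L: "L \<ge> 0"
    and lip: "\<And>y z. y \<in> E \<Longrightarrow> z \<in> E \<Longrightarrow> cc_dist \<Omega> m X (f y) (f z) \<le> ennreal (L * dist y z)"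
begin

definition good_ball :: "'a set \<Rightarrow> bool" where
  "good_ball B \<longleftrightarrow> open B \<and> (\<exists>p R M \<mu> G. cc_lipschitz_piece \<Omega> m X p R M \<mu> G (E \<inter> B) f L)"

lemma ex_good_ball:
  assumes x: "x \<in> E"
  shows "\<exists>\<rho>>0. good_ball (ball x \<rho>)"
proof -
  have "f x \<in> \<Omega>" using x image by blast
  then obtain R M \<mu> G where "cc_chart \<Omega> m X (f x) R M \<mu> G"
    using ex_cc_chart[OF open_domain loc_lip ind] by blast
  then interpret cc_chart \<Omega> m X "f x" R M \<mu> G .
  \<comment> \<open>Gives \<open>M * (L + 1) * \<rho> = R / 32\<close>. Points of the ball are less
    than \<open>2 * \<rho>\<close> apart, so the diameter condition of a piece reduces to
    \<open>4 * R / 32 < R / 4\<close>.\<close>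
  define \<rho> where "\<rho> = R / (32 * M * (L + 1))"
  have \<rho>: "\<rho> > 0" using R(1) M L by (simp add: \<rho>_def)
  have M\<rho>: "M * ((L + 1) * \<rho>) = R / 32" using M L by (simp add: \<rho>_def)
  have "cc_lipschitz_piece_axioms \<Omega> m X (f x) R M (E \<inter> ball x \<rho>) f L"
  proof
    show "0 \<le> L" by (rule L)
  next
    fix y z assume yz: "y \<in> E \<inter> ball x \<rho>" "z \<in> E \<inter> ball x \<rho>"
    then show "cc_dist \<Omega> m X (f y) (f z) \<le> ennreal (L * dist y z)" by (intro lip) auto
    have "dist y z < 2 * \<rho>" using yz dist_triangle[of y z x] by (simp add: dist_commute)
    then have "M * (2 * (L + 1) * dist y z) \<le> M * (2 * (L + 1) * (2 * \<rho>))"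
      using M L by (intro mult_left_mono) auto
    also have "\<dots> = 4 * (M * ((L + 1) * \<rho>))" by simp
    also have "\<dots> < R / 4" unfolding M\<rho> using R(1) by simp
    finally show "M * (2 * (L + 1) * dist y z) < R / 4" .
  next
    fix y assume y: "y \<in> E \<inter> ball x \<rho>"
    have "cc_dist \<Omega> m X (f x) (f y) \<le> ennreal (L * dist x y)" using x y by (intro lip) auto
    also have "\<dots> < ennreal ((L + 1) * \<rho>)"
    proof (rule ennreal_lessI)
      show "0 < (L + 1) * \<rho>" using L \<rho> by simp
      have "L * dist x y \<le> L * \<rho>" using L y by (intro mult_left_mono) auto
      also have "\<dots> < (L + 1) * \<rho>" using \<rho> by simp
      finally show "L * dist x y < (L + 1) * \<rho>" .
    qed
    finally have "cc_dist \<Omega> m X (f x) (f y) < ennreal ((L + 1) * \<rho>)" .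
    then have "dist (f x) (f y) \<le> M * ((L + 1) * \<rho>)"
      by (rule dist_le_cc_dist[rotated]) (use R(1) M\<rho> in auto)
    then show "f y \<in> ball (f x) (R / 4)" unfolding M\<rho> using R(1) by simp
  qed
  then have "cc_lipschitz_piece \<Omega> m X (f x) R M \<mu> G (E \<inter> ball x \<rho>) f L"
    by (intro cc_lipschitz_piece.intro cc_chart_axioms)
  then show ?thesis using \<rho> unfolding good_ball_def by blast
qed

text \<open>Lindelof's theorem. Local results become global because null sets, for contents and for
  Lebesgue measure alike, are stable under countable unions.\<close>

lemma countable_good_cover:
  obtains \<B> where "countable \<B>" "E \<subseteq> \<Union>\<B>" "\<And>B. B \<in> \<B> \<Longrightarrow> good_ball B"
proof -
  obtain \<B> where B: "\<B> \<subseteq> {B. good_ball B}" "countable \<B>" "\<Union>\<B> = \<Union>{B. good_ball B}"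
    by (rule Lindelof[of "{B. good_ball B}"]) (auto simp: good_ball_def)
  have "E \<subseteq> \<Union>\<B>"
  proof
    fix x assume "x \<in> E"
    then obtain \<rho> where "\<rho> > 0" "good_ball (ball x \<rho>)" using ex_good_ball by blast
    then have "x \<in> ball x \<rho>" "ball x \<rho> \<in> {B. good_ball B}" by simp_all
    then show "x \<in> \<Union>\<B>" unfolding B(3) by blast
  qed
  then show ?thesis using B(1,2) by (intro that[of \<B>]) auto
qed

lemma hausdorff_content_null_if_good_balls:
  assumes "\<And>B. good_ball B \<Longrightarrow> hausdorff_content d DIM('a) (f ` (E \<inter> B)) = 0"
  shows "hausdorff_content d DIM('a) (f ` E) = 0"
proof -
  obtain \<B> where B: "countable \<B>" "E \<subseteq> \<Union>\<B>" "\<And>B. B \<in> \<B> \<Longrightarrow> good_ball B" by (rule countable_good_cover) blast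
  have "f ` E = (\<Union>B\<in>\<B>. f ` (E \<inter> B))" using B(2) by blast
  moreover have "hausdorff_content d DIM('a) (\<Union>B\<in>\<B>. f ` (E \<inter> B)) = 0"
    by (rule hausdorff_content_countable_UN_null[OF _ B(1)]) (use assms B(3) in \<open>auto simp: DIM_ge_Suc0\<close>)
  ultimately show ?thesis by simp
qed

lemma negligible_if_good_balls:
  assumes "\<And>B. good_ball B \<Longrightarrow> negligible (S \<inter> B)" and "S \<subseteq> E"
  shows "negligible S"
proof -
  obtain \<B> where B: "countable \<B>" "E \<subseteq> \<Union>\<B>" "\<And>B. B \<in> \<B> \<Longrightarrow> good_ball B" by (rule countable_good_cover) blast
  have "negligible (\<Union>B\<in>\<B>. S \<inter> B)"
    using B(1,3) assms(1) by (intro negligible_countable_Union countable_image) auto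
  then show ?thesis by (rule negligible_subset) (use B(2) assms(2) in blast)
qed

lemma at_within_good_ball: "good_ball B \<Longrightarrow> x \<in> B \<Longrightarrow> at x within (E \<inter> B) = at x within E"
  by (rule at_within_nhd[of _ B]) (auto simp: good_ball_def)

lemma edist_null_if_cc_null:
  assumes "hausdorff_content (cc_dist \<Omega> m X) DIM('a) (f ` E) = 0"
  shows "hausdorff_content edist DIM('a) (f ` E) = 0"
proof (rule hausdorff_content_null_if_good_balls)
  fix B assume "good_ball B"
  then obtain p R M \<mu> G where "cc_lipschitz_piece \<Omega> m X p R M \<mu> G (E \<inter> B) f L" unfolding good_ball_def by blast
  then interpret piece: cc_lipschitz_piece \<Omega> m X p R M \<mu> G "E \<inter> B" f L .
  have k1: "DIM('a) \<ge> 1" by (simp add: DIM_ge_Suc0)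
  have "hausdorff_content (cc_dist \<Omega> m X) DIM('a) (f ` (E \<inter> B)) \<le> hausdorff_content (cc_dist \<Omega> m X) DIM('a) (f ` E)"
    by (rule hausdorff_content_mono[OF k1]) blast
  then show "hausdorff_content edist DIM('a) (f ` (E \<inter> B)) = 0"
    using assms by (intro piece.euclidean_null_if_cc_null[OF k1]) simp
qed

text \<open>The implication from (3) to (1): a linear map that is not injective supplies the kernel
  vector for each piece.\<close>

lemma cc_null_if_not_inj:
  assumes neg: "negligible {x\<in>E. \<not> (\<exists>D. (f has_derivative D) (at x within E) \<and> \<not> inj D)}"
  shows "hausdorff_content (cc_dist \<Omega> m X) DIM('a) (f ` E) = 0"
proof (rule hausdorff_content_null_if_good_balls)
  fix B assume B: "good_ball B"
  then obtain p R M \<mu> G where "cc_lipschitz_piece \<Omega> m X p R M \<mu> G (E \<inter> B) f L" unfolding good_ball_def by blast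
  then interpret piece: cc_lipschitz_piece \<Omega> m X p R M \<mu> G "E \<inter> B" f L .
  show "hausdorff_content (cc_dist \<Omega> m X) DIM('a) (f ` (E \<inter> B)) = 0"
  proof (rule piece.cc_null_if_rank_deficient_measurable)
    show "E \<inter> B \<in> sets lebesgue" using E B by (auto simp: good_ball_def intro!: sets.Int)
    show "negligible {x\<in>E \<inter> B. \<not> (\<exists>D v. (f has_derivative D) (at x within E \<inter> B) \<and> v \<noteq> 0 \<and> D v = 0)}"
    proof (rule negligible_subset[OF neg], rule subsetI, rule CollectI, intro conjI notI)
      fix x assume x: "x \<in> {x\<in>E \<inter> B. \<not> (\<exists>D v. (f has_derivative D) (at x within E \<inter> B) \<and> v \<noteq> 0 \<and> D v = 0)}"
      then show "x \<in> E" by blast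
      assume "\<exists>D. (f has_derivative D) (at x within E) \<and> \<not> inj D"
      then obtain D where D: "(f has_derivative D) (at x within E)" "\<not> inj D" by blast
      have "linear D" using D(1) by (rule has_derivative_linear)
      then obtain v where "v \<noteq> 0" "D v = 0" using D(2) linear_injective_0 by blast
      moreover have "(f has_derivative D) (at x within E \<inter> B)"
        using D(1) x at_within_good_ball[OF B, of x] by simp
      ultimately show False using x by blast
    qed
  qed
qed

text \<open>The implication from (2) to (3). An exceptional point either has no derivative within
  \<open>E\<close>, which Rademacher's theorem excludes almost everywhere, or has an injective one
  and falls under \<open>negligible_full_rank_points\<close>.\<close>

lemma not_inj_if_edist_null:
  assumes null: "hausdorff_content edist DIM('a) (f ` E) = 0"
  shows "negligible {x\<in>E. \<not> (\<exists>D. (f has_derivative D) (at x within E) \<and> \<not> inj D)}" (is "negligible ?S")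
proof -
  have "negligible {x\<in>E. \<not> (\<exists>D. (f has_derivative D) (at x within E))}" (is "negligible ?T")
  proof (rule negligible_if_good_balls)
    fix B assume B: "good_ball B"
    then obtain p R M \<mu> G where "cc_lipschitz_piece \<Omega> m X p R M \<mu> G (E \<inter> B) f L" unfolding good_ball_def by blast
    then interpret piece: cc_lipschitz_piece \<Omega> m X p R M \<mu> G "E \<inter> B" f L .
    show "negligible (?T \<inter> B)"
      by (rule negligible_subset[OF rademacher_within[OF piece.euclidean_lipschitz]])
        (use at_within_good_ball[OF B] in auto)
  qed blast
  moreover have "negligible {x\<in>E. \<exists>D. (f has_derivative D) (at x within E) \<and> inj D}"
    by (rule negligible_full_rank_points[OF null])
  ultimately have "negligible (?T \<union> {x\<in>E. \<exists>D. (f has_derivative D) (at x within E) \<and> inj D})"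
    by (rule negligible_Un)
  then show ?thesis by (rule negligible_subset) blast
qed

lemma locally_euclidean_lipschitz:
  assumes "x \<in> E"
  obtains \<rho> K where "\<rho> > 0" "K-lipschitz_on (E \<inter> ball x \<rho>) f"
proof -
  obtain \<rho> where \<rho>: "\<rho> > 0" "good_ball (ball x \<rho>)" using ex_good_ball[OF assms] by blast
  then obtain p R M \<mu> G where "cc_lipschitz_piece \<Omega> m X p R M \<mu> G (E \<inter> ball x \<rho>) f L" unfolding good_ball_def by blast
  then interpret piece: cc_lipschitz_piece \<Omega> m X p R M \<mu> G "E \<inter> ball x \<rho>" f L .
  show ?thesis using \<rho>(1) piece.euclidean_lipschitz by (rule that)
qed

end

section \<open>Translation into ranks and almost everywhere statements\<close>

lemma rank_less_iff_not_inj: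
  fixes D :: "real ^ 'k \<Rightarrow> real ^ 'n"
  assumes "linear D"
  shows "rank (matrix D) < CARD('k) \<longleftrightarrow> \<not> inj D"
proof -
  have "(*v) (matrix D) = D" using matrix_works[OF assms[unfolded linear_matrix_vector_mul_eq[symmetric]]] by auto
  then have "rank (matrix D) = CARD('k) \<longleftrightarrow> inj D" using full_rank_injective[of "matrix D"] by simp
  moreover have "rank (matrix D) \<le> CARD('k)" using rank_bound[of "matrix D"] by simp
  ultimately show ?thesis by linarith
qed

lemma AE_lebesgue_on_iff_negligible:
  fixes E :: "'a::euclidean_space set"
  assumes "E \<in> sets lebesgue"
  shows "(AE x in lebesgue_on E. Q x) \<longleftrightarrow> negligible {x\<in>E. \<not> Q x}"
proof -
  have "(AE x in lebesgue_on E. Q x) \<longleftrightarrow> (AE x in lebesgue. x \<in> E \<longrightarrow> Q x)"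
    using assms by (subst AE_restrict_space_iff) auto
  also have "\<dots> \<longleftrightarrow> (\<exists>N. negligible N \<and> {x\<in>E. \<not> Q x} \<subseteq> N)"
    unfolding eventually_ae_filter_negligible by (simp add: Collect_conj_eq[symmetric])
  also have "\<dots> \<longleftrightarrow> negligible {x\<in>E. \<not> Q x}" using negligible_subset by blast
  finally show ?thesis .
qed

theorem theorem5p3:
  fixes \<Omega> :: "(real ^ 'n) set"
    and m :: nat
    and X :: "nat \<Rightarrow> real ^ 'n \<Rightarrow> real ^ 'n"
    and E :: "(real ^ 'k) set"
    and f :: "real ^ 'k \<Rightarrow> real ^ 'n"
  assumes "open \<Omega>" and "connected \<Omega>"
    and "\<And>i. i \<in> {1..m} \<Longrightarrow> locally_lipschitz_on \<Omega> (X i)"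
    and "\<And>p. p \<in> \<Omega> \<Longrightarrow> lin_indep_family m (\<lambda>i. X i p)"
    and "\<And>K. compact K \<Longrightarrow> K \<subseteq> \<Omega> \<Longrightarrow> (INF p\<in>K. INF i\<in>{1..m}. ennreal (norm (X i p))) > 0"
    and "\<And>x y. x \<in> \<Omega> \<Longrightarrow> y \<in> \<Omega> \<Longrightarrow>
           \<exists>a b \<gamma>. horizontal_curve \<Omega> m X a b \<gamma> \<and> \<gamma> a = x \<and> \<gamma> b = y"
    and "E \<in> sets lebesgue"
    and "f ` E \<subseteq> \<Omega>"
    and "\<exists>L\<ge>0. \<forall>x\<in>E. \<forall>y\<in>E. cc_dist \<Omega> m X (f x) (f y) \<le> ennreal (L * dist x y)"
  shows "(hausdorff_measure \<Omega> (cc_dist \<Omega> m X) CARD('k) (f ` E) = 0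
            \<longleftrightarrow> hausdorff_measure \<Omega> (\<lambda>x y. ennreal (dist x y)) CARD('k) (f ` E) = 0)
       \<and> (hausdorff_measure \<Omega> (\<lambda>x y. ennreal (dist x y)) CARD('k) (f ` E) = 0
            \<longleftrightarrow> (AE x in lebesgue_on E.
                   ap_differentiable f E x \<and> rank (matrix (ap_D f E x)) < CARD('k)))"
proof -
  obtain L where L: "L \<ge> 0" "\<And>y z. y \<in> E \<Longrightarrow> z \<in> E \<Longrightarrow> cc_dist \<Omega> m X (f y) (f z) \<le> ennreal (L * dist y z)"
    using assms(9) by blast
  interpret cc_lipschitz_map \<Omega> m X E f L
    by (rule cc_lipschitz_map.intro) (fact assms L)+
  have k: "CARD('k) \<ge> 1" "DIM(real ^ 'k) = CARD('k)" by (simp_all add: Suc_leI)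
  \<comment> \<open>The working form of (3). It is existential because derivatives within
    \<open>E\<close> are known to be unique only at density points of \<open>E\<close>; there it is
    equivalent to (3), and the other points of \<open>E\<close> form a null set.\<close>
  let ?Q = "\<lambda>x. \<exists>D. (f has_derivative D) (at x within E) \<and> \<not> inj D"
  have Q: "(ap_differentiable f E x \<and> rank (matrix (ap_D f E x)) < CARD('k)) \<longleftrightarrow> ?Q x"
    if x: "x \<in> E" "density_point E x" for x
  proof -
    obtain \<rho> K where \<rho>: "\<rho> > 0" "K-lipschitz_on (E \<inter> ball x \<rho>) f" by (rule locally_euclidean_lipschitz[OF x(1)])
    show ?thesis
    proof
      assume *: "ap_differentiable f E x \<and> rank (matrix (ap_D f E x)) < CARD('k)"
      then obtain D where D: "(f has_derivative D) (at x within E)"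
        unfolding ap_differentiable_iff[OF E x \<rho>(2,1)] by blast
      then show "?Q x"
        using * rank_less_iff_not_inj[OF has_derivative_linear[OF D]] ap_D_eq[OF E x \<rho>(2,1) D] by auto
    next
      assume "?Q x"
      then obtain D where D: "(f has_derivative D) (at x within E)" "\<not> inj D" by blast
      then show "ap_differentiable f E x \<and> rank (matrix (ap_D f E x)) < CARD('k)"
        using rank_less_iff_not_inj[OF has_derivative_linear[OF D(1)]] ap_D_eq[OF E x \<rho>(2,1) D(1)]
          ap_differentiable_iff[OF E x \<rho>(2,1)] by auto
    qed
  qed
  have nd: "negligible {x\<in>E. \<not> density_point E x}" using E by (rule negligible_not_density_point)
  have "(AE x in lebesgue_on E. ap_differentiable f E x \<and> rank (matrix (ap_D f E x)) < CARD('k))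
      \<longleftrightarrow> negligible {x\<in>E. \<not> ?Q x}"
    unfolding AE_lebesgue_on_iff_negligible[OF E]
  proof
    assume "negligible {x\<in>E. \<not> (ap_differentiable f E x \<and> rank (matrix (ap_D f E x)) < CARD('k))}"
    from negligible_Un[OF this nd] show "negligible {x\<in>E. \<not> ?Q x}"
      by (rule negligible_subset) (use Q in blast)
  next
    assume "negligible {x\<in>E. \<not> ?Q x}"
    from negligible_Un[OF this nd]
    show "negligible {x\<in>E. \<not> (ap_differentiable f E x \<and> rank (matrix (ap_D f E x)) < CARD('k))}"
      by (rule negligible_subset) (use Q in blast)
  qed
  \<comment> \<open>In terms of contents, (1) implies (2), (2) implies (3) and (3) implies (1),
    which closes the circle.\<close>
  then show ?thesis
    unfolding hausdorff_measure_eq_0_iff[OF k(1) assms(8)]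
    using edist_null_if_cc_null cc_null_if_not_inj not_inj_if_edist_null unfolding k(2) by argo
qed

end
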